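(* Assume $d\in\{1,2\}$ and $V=0$. Then $\mathcal{T}(W_0)=r(W_0)$ for every nonzero initial condition $W_0=(w_0,\dot w_0)$ satisfying one of the following: (i) $w_0=0$, $\dot w_0\in L^2(\mathbb{T}^d)$ and $\dot w_0\ge0$ a.e. on $\mathbb{T}^d$ (or $\dot w_0\le0$ a.e.); (ii) $W_0\in H^1\times L^2(\mathbb{T}^d)$ and $Z(w_0)=Z(W_0)$; (iii) $W_0\in H^1\times H^1(\mathbb{T}^d)$.
   Context: Setting: $d\ge 1$ is an integer, $\mathbb{T}^d=\mathbb{R}^d/2\pi\mathbb{Z}^d$; all functions are real-valued. Control potentials: $V_0(x)=1$, $V_{2j-1}(x)=\sin(x_j)$, $V_{2j}(x)=\cos(x_j)$ for $j=1,\dots,d$. On $H^1\times L^2(\mathbb{T}^d)$, equipped with the norm $\|(w_1,w_2)\|^2=\int_{\mathbb{T}^d}(|\nabla w_1|^2+|w_1|^2+|w_2|^2)$, consider $A=\begin{pmatrix}0&1\\ \Delta-1&0\end{pmatrix}$ (domain $H^2\times H^1$), generating a group $(e^{tA})$ of isometries, and $B=\begin{pmatrix}0&0\\1&0\end{pmatrix}$. For a bounded operator $L$ on $H^1\times L^2$, $\exp(t(A+L))W_0$ is the unique $W\in C^0(\mathbb{R},H^1\times L^2)$ with $W(t)=e^{tA}W_0+\int_0^te^{(t-s)A}LW(s)\,ds$. The control system is $\frac{dW}{dt}=\big(A+VB+\sum_{j=0}^{2d}u_j(t)V_jB\big)W$ (here with $V=0$); for piecewise constant $u:[0,T]\to\mathbb{R}^{2d+1}$,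 $W(t;u,W_0)$ is the solution with $W(0)=W_0$. A target $W_f$ is approximately reachable in time $T^+$ from $W_0$ if for every $\epsilon>0$ there exist $T_1\in[T,T+\epsilon]$ and piecewise constant $u:[0,T_1]\to\mathbb{R}^{2d+1}$ with $\|W(T_1;u,W_0)-W_f\|<\epsilon$; the system is approximately controllable in time $T^+$ from $W_0$ if every target in $H^1\times L^2$ is so; $\mathcal{T}(W_0)$ is the infimum of such $T\ge0$. For $f\in L^2(\mathbb{T}^d,\mathbb{R}^n)$, $Z(f)=f^{-1}(\{0\})$ (up to null sets) and $r(f)=\sup\{\tilde r\ge0: f=0\text{ a.e. on some ball of radius }\tilde r\}$; $Z(W_0)$, $r(W_0)$ refer to $W_0$ viewed as $\mathbb{R}^2$-valued. *)

theory Defs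
  imports "HOL-Analysis.Analysis"
begin

text \<open>Functions on the torus T^d = R^d / 2 pi Z^d are represented as 2 pi-periodic
  functions on R^d (points are of type real^'d). Integrals over the torus are
  integrals over the fundamental cube [0, 2 pi]^d.\<close>

definition tcube :: "(real^'d) set" where
  "tcube = cbox 0 (\<chi> i. 2 * pi)"

definition tmeas :: "(real^'d) measure" where
  "tmeas = lebesgue_on tcube"

definition periodic_fun :: "(real^'d \<Rightarrow> 'b) \<Rightarrow> bool" where
  "periodic_fun f \<longleftrightarrow> (\<forall>x i. f (x + (2 * pi) *\<^sub>R axis i 1) = f x)"

definition L2 :: "(real^'d \<Rightarrow> real) \<Rightarrow> bool" where
  "L2 f \<longleftrightarrow> periodic_fun f \<and> f \<in> borel_measurable tmeas
     \<and> integrable tmeas (\<lambda>x. (f x)^2)"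

definition weak_partial :: "'d \<Rightarrow> (real^'d \<Rightarrow> real) \<Rightarrow> (real^'d \<Rightarrow> real) \<Rightarrow> bool" where
  "weak_partial j f g \<longleftrightarrow> L2 g \<and>
     (\<forall>\<phi> D\<phi>. periodic_fun \<phi> \<and> (\<forall>x. (\<phi> has_derivative (\<lambda>h. D\<phi> x \<bullet> h)) (at x))
        \<and> continuous_on UNIV D\<phi> \<longrightarrow>
        (\<integral>x. f x * (D\<phi> x $ j) \<partial>tmeas) = - (\<integral>x. g x * \<phi> x \<partial>tmeas))"

definition H1 :: "(real^'d \<Rightarrow> real) \<Rightarrow> bool" where
  "H1 f \<longleftrightarrow> L2 f \<and> (\<forall>j. \<exists>g. weak_partial j f g)"

definition wgrad :: "(real^'d \<Rightarrow> real) \<Rightarrow> 'd \<Rightarrow> real^'d \<Rightarrow> real" where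
  "wgrad f j = (SOME g. weak_partial j f g)"

type_synonym 'd state = "(real^('d::finite) \<Rightarrow> real) \<times> (real^'d \<Rightarrow> real)"

definition Hsp :: "('d::finite) state set" where
  "Hsp = {W. H1 (fst W) \<and> L2 (snd W)}"

definition Hnorm :: "('d::finite) state \<Rightarrow> real" where
  "Hnorm W = sqrt (\<integral>x. (\<Sum>j\<in>UNIV. (wgrad (fst W) j x)^2) + (fst W x)^2 + (snd W x)^2 \<partial>tmeas)"

definition Hdiff :: "('d::finite) state \<Rightarrow> 'd state \<Rightarrow> 'd state" where
  "Hdiff W V = ((\<lambda>x. fst W x - fst V x), (\<lambda>x. snd W x - snd V x))"

text \<open>Fourier coefficients with respect to cos(k.x) and sin(k.x), k in Z^d.\<close>
definition lattice :: "real^'d \<Rightarrow> bool" where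
  "lattice k \<longleftrightarrow> (\<forall>i. k $ i \<in> \<int>)"

definition fco :: "(real \<Rightarrow> real) \<Rightarrow> (real^'d \<Rightarrow> real) \<Rightarrow> real^'d \<Rightarrow> real" where
  "fco e f k = (\<integral>x. f x * e (k \<bullet> x) \<partial>tmeas)"

definition freq :: "real^'d \<Rightarrow> real" where
  "freq k = sqrt (1 + (norm k)^2)"

text \<open>The isometry group e^{tA}, A = (0 1; Delta-1 0), computed mode by mode
  (each Fourier mode solves w'' = -(1+|k|^2) w).\<close>
definition egroup :: "real \<Rightarrow> ('d::finite) state \<Rightarrow> 'd state" where
  "egroup t W = (SOME W'. W' \<in> Hsp \<and>
     (\<forall>k e. lattice k \<and> e \<in> {cos, sin} \<longrightarrow>
        fco e (fst W') k = cos (freq k * t) * fco e (fst W) k + sin (freq k * t) / freq k * fco e (snd W) k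
      \<and> fco e (snd W') k = - freq k * sin (freq k * t) * fco e (fst W) k + cos (freq k * t) * fco e (snd W) k))"

definition Lop :: "(real^('d::finite) \<Rightarrow> real) \<Rightarrow> 'd state \<Rightarrow> 'd state" where
  "Lop p W = ((\<lambda>x. 0), (\<lambda>x. p x * fst W x))"

definition Hcont :: "(real \<Rightarrow> ('d::finite) state) \<Rightarrow> bool" where
  "Hcont W \<longleftrightarrow> (\<forall>t. ((\<lambda>s. Hnorm (Hdiff (W s) (W t))) \<longlongrightarrow> 0) (at t))"

text \<open>Mild solution W in C^0(R, H^1 x L^2) of W(t) = e^{tA} W0 + int_0^t e^{(t-s)A} L W(s) ds,
  the H-valued identity being expressed through all Fourier coefficients (which are
  continuous linear functionals separating points of H).\<close>
definition mild :: "(real^('d::finite) \<Rightarrow> real) \<Rightarrow> 'd state \<Rightarrow> (real \<Rightarrow> ('d::finite) state) \<Rightarrow> bool" where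
  "mild p W0 W \<longleftrightarrow> (\<forall>t. W t \<in> Hsp) \<and> Hcont W \<and>
     (\<forall>t k e. lattice k \<and> e \<in> {cos, sin} \<longrightarrow>
        fco e (fst (W t)) k = fco e (fst (egroup t W0)) k
           + (LBINT s=0..ereal t. fco e (fst (egroup (t - s) (Lop p (W s)))) k)
      \<and> fco e (snd (W t)) k = fco e (snd (egroup t W0)) k
           + (LBINT s=0..ereal t. fco e (snd (egroup (t - s) (Lop p (W s)))) k))"

definition expAL :: "real \<Rightarrow> (real^('d::finite) \<Rightarrow> real) \<Rightarrow> 'd state \<Rightarrow> 'd state" where
  "expAL t p W0 = (SOME W. mild p W0 W) t"

text \<open>Control values (u_0, (u_{2j-1})_j, (u_{2j})_j) and the corresponding potential
  sum_j u_j V_j with V_0 = 1, V_{2j-1} = sin x_j, V_{2j} = cos x_j.\<close>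
type_synonym 'd ctrl = "real \<times> (real^('d::finite)) \<times> (real^'d)"

definition potential :: "('d::finite) ctrl \<Rightarrow> real^'d \<Rightarrow> real" where
  "potential u x = fst u + (\<Sum>j\<in>UNIV. fst (snd u) $ j * sin (x $ j) + snd (snd u) $ j * cos (x $ j))"

text \<open>A piecewise constant control on [0, T1] is a finite list of pieces
  (duration, constant value), applied in order; the durations sum to T1.\<close>
fun flow :: "(real \<times> ('d::finite) ctrl) list \<Rightarrow> 'd state \<Rightarrow> 'd state" where
  "flow [] W = W"
| "flow (pc # ps) W = flow ps (expAL (fst pc) (potential (snd pc)) W)"

definition approx_reachable :: "('d::finite) state \<Rightarrow> real \<Rightarrow> 'd state \<Rightarrow> bool" where
  "approx_reachable W0 T Wf \<longleftrightarrow> (\<forall>\<epsilon>>0. \<exists>T1 ps. T \<le> T1 \<and> T1 \<le> T + \<epsilon>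
      \<and> (\<forall>pc\<in>set ps. fst pc \<ge> 0) \<and> sum_list (map fst ps) = T1
      \<and> Hnorm (Hdiff (flow ps W0) Wf) < \<epsilon>)"

definition approx_controllable :: "('d::finite) state \<Rightarrow> real \<Rightarrow> bool" where
  "approx_controllable W0 T \<longleftrightarrow> (\<forall>Wf\<in>Hsp. approx_reachable W0 T Wf)"

text \<open>Minimal time (infimum; +infinity if the system is never controllable).\<close>
definition Tmin :: "('d::finite) state \<Rightarrow> ereal" where
  "Tmin W0 = Inf {ereal T | T. T \<ge> 0 \<and> approx_controllable W0 T}"

definition Zset :: "(real^'d \<Rightarrow> bool) \<Rightarrow> (real^'d) set" where
  "Zset P = {x. P x}"

definition ae_eq_set :: "(real^'d) set \<Rightarrow> (real^'d) set \<Rightarrow> bool" where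
  "ae_eq_set A B \<longleftrightarrow> (AE x in lebesgue. x \<in> A \<longleftrightarrow> x \<in> B)"

definition rW :: "('d::finite) state \<Rightarrow> ereal" where
  "rW W = Sup {ereal \<rho> | \<rho>. \<rho> \<ge> 0 \<and>
     (\<exists>c. AE x in lebesgue. x \<in> ball c \<rho> \<longrightarrow> fst W x = 0 \<and> snd W x = 0)}"

end

(*
  With the constant control equal to 1 the mass is cancelled, so the free evolution is the wave group.

  Lower bound: in dimensions 1 and 2 the kernel of sin(t sqrt(-Delta))/sqrt(-Delta) is a nonnegative
  function supported in the ball of radius t, and multiplication by a potential does not enlarge supports;
  hence zeros on a ball of radius rho survive up to time rho.

  Upper bound: a control of size 1/h during time h acts as an impulse (w, y) -> (w, y + q w). Free
  evolution between the impulses f/sqrt h and -f/sqrt h produces the impulse -f^2, so trigonometric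
  identities saturate all trigonometric polynomials, and by density every velocity is reachable in time 0 as
  long as it is changed only off the zeros of w. If w is nonzero almost everywhere, a velocity of
  size 1/h and free evolution during time h then give every state. Such a w is obtained at time
  t > r because the kernel is strictly positive in the ball of radius t: the velocity c on {w \<noteq> 0} evolves
  into something positive, and for all but countably many c it does not cancel the contribution of w.
  In case (iii) a shear w -> w + b y with generic b first makes the zeros of w common zeros.
*)
theory Submission
  imports Defs "HOL-Analysis.Analysis"
begin

text \<open>The obstacle is the velocity on the zero set of the position: impulses change it by q w,
  hence not at all where w = 0, and what is left there with arbitrary sign could cancel under the
  wave kernel. Each hypothesis removes this remainder: it has one sign (with w = 0), or it is zero,
  or its H^1 regularity allows it to be added to w in time 0, after which it is zero on the new zero
  set. The radius enters because t > r forbids common zeros on a ball of radius t, so the kernel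
  finds positive mass around every point. Positivity of the kernel as a function ties the argument
  to d = 1, 2. The analysis takes place in coordinates (v, y) with w = (1 - Laplacian)^(-1/2) v,
  where the energy space is a product of two copies of L^2 and the propagators are bounded
  multipliers depending only on |k|^2. The solution concepts of the statement are given by Fourier
  coefficients and choice, so they are matched with these coordinates mode by mode. Reachability
  becomes a relation closed under composition and limits, which hides the blow-up of the
  controls.\<close>

section \<open>Spectral calculus for an orthogonal resolution of the identity\<close>

definition bdd_fun :: "(nat \<Rightarrow> real) \<Rightarrow> bool" where
  "bdd_fun c \<longleftrightarrow> (\<exists>K. \<forall>n. \<bar>c n\<bar> \<le> K)"

lemma bdd_funI: "(\<And>n. \<bar>c n\<bar> \<le> K) \<Longrightarrow> bdd_fun c"
  by (auto simp: bdd_fun_def)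

lemma bdd_fun_mult: "bdd_fun c \<Longrightarrow> bdd_fun d \<Longrightarrow> bdd_fun (\<lambda>n. c n * d n)"
proof -
  assume "bdd_fun c" "bdd_fun d"
  then obtain K L where *: "\<And>n. \<bar>c n\<bar> \<le> K" "\<And>n. \<bar>d n\<bar> \<le> L" by (auto simp: bdd_fun_def)
  have "\<bar>c n * d n\<bar> \<le> K * L" for n
    unfolding abs_mult using *(1)[of n] *(2)[of n] by (intro mult_mono) auto
  then show ?thesis by (rule bdd_funI)
qed

lemma bdd_fun_diff: "bdd_fun c \<Longrightarrow> bdd_fun d \<Longrightarrow> bdd_fun (\<lambda>n. c n - d n)"
proof -
  assume "bdd_fun c" "bdd_fun d"
  then obtain K L where *: "\<And>n. \<bar>c n\<bar> \<le> K" "\<And>n. \<bar>d n\<bar> \<le> L" by (auto simp: bdd_fun_def)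
  have "\<bar>c n - d n\<bar> \<le> K + L" for n using *(1)[of n] *(2)[of n] by linarith
  then show ?thesis by (rule bdd_funI)
qed

text \<open>Models the eigenspace projections of the Laplacian: symmetric, mutually orthogonal
  idempotents with trivial common kernel. Bounded functions of the Laplacian become bounded real
  sequences.\<close>

locale spectral =
  fixes E :: "nat \<Rightarrow> 'a::{real_inner,banach} \<Rightarrow> 'a"
  assumes lin: "linear (E n)"
    and sym: "inner (E n x) y = inner x (E n y)"
    and proj: "E n (E m x) = (if n = m then E n x else 0)"
    and total: "(\<And>n. E n x = 0) \<Longrightarrow> x = 0"
begin

lemma E_idem [simp]: "E n (E n x) = E n x"
  by (simp add: proj)

lemma inner_E: "inner (E n x) y = inner (E n x) (E n y)"
  by (metis E_idem sym)

lemma norm_E_le: "norm (E n x) \<le> norm x"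
proof -
  have "norm (E n x) * norm (E n x) = inner (E n x) x"
    by (metis inner_E power2_eq_square power2_norm_eq_inner)
  also have "\<dots> \<le> norm (E n x) * norm x"
    by (rule norm_cauchy_schwarz)
  finally show ?thesis
    by (cases "E n x = 0") auto
qed

lemma bounded_linear_E: "bounded_linear (E n)"
  using lin norm_E_le by (intro bounded_linear_intro[where K=1]) (auto simp: linear_add linear_scale)

lemma E_orth: "n \<noteq> m \<Longrightarrow> inner (E n x) (E m y) = 0"
  by (metis inner_zero_right proj sym)

lemma E_0 [simp]: "E n 0 = 0" using lin by (simp add: linear_0)
lemma E_add: "E n (x + y) = E n x + E n y" using lin by (simp add: linear_add)
lemma E_diff: "E n (x - y) = E n x - E n y" using lin by (simp add: linear_diff)
lemma E_scale: "E n (r *\<^sub>R x) = r *\<^sub>R E n x" using lin by (simp add: linear_scale)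

lemma E_eqI: "(\<And>n. E n x = E n y) \<Longrightarrow> x = y"
  using total[of "x - y"] by (simp add: E_diff)

lemma norm_sum_E:
  assumes "finite A"
  shows "(norm (\<Sum>n\<in>A. E n (a n)))\<^sup>2 = (\<Sum>n\<in>A. (norm (E n (a n)))\<^sup>2)"
  using assms
proof (induction A rule: finite_induct)
  case (insert m A)
  have "inner (E m (a m)) (\<Sum>n\<in>A. E n (a n)) = 0"
    using insert.hyps by (auto simp: inner_sum_right intro!: sum.neutral E_orth)
  then show ?case
    using insert by (simp add: power2_norm_eq_inner inner_add_left inner_add_right inner_commute)
qed simp

lemma bessel: "(\<Sum>n<N. (norm (E n x))\<^sup>2) \<le> (norm x)\<^sup>2"
proof -
  let ?s = "\<Sum>n<N. E n x"
  have s: "(norm ?s)\<^sup>2 = (\<Sum>n<N. (norm (E n x))\<^sup>2)"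
    by (rule norm_sum_E) simp
  have "inner ?s x = (\<Sum>n<N. inner (E n x) (E n x))"
    by (simp add: inner_sum_left) (meson inner_E)
  then have i: "inner ?s x = (norm ?s)\<^sup>2"
    by (simp add: s dot_square_norm)
  have "0 \<le> (norm (x - ?s))\<^sup>2" by simp
  also have "\<dots> = (norm x)\<^sup>2 - 2 * inner ?s x + (norm ?s)\<^sup>2"
    by (simp add: power2_norm_eq_inner inner_diff_left inner_diff_right inner_commute)
  finally show ?thesis using i s by simp
qed

lemma summable_E: "summable (\<lambda>n. (norm (E n x))\<^sup>2)"
  by (rule summableI_nonneg_bounded[where x="(norm x)\<^sup>2"]) (auto simp: bessel)

text \<open>Riesz-Fischer: orthogonality turns the Cauchy criterion for the series into the one for
  the squared norms, and the continuous \<open>E m\<close> annihilates every term of the series but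
  one.\<close>

lemma riesz:
  assumes "summable (\<lambda>n. (norm (E n (a n)))\<^sup>2)"
  shows riesz_summable: "summable (\<lambda>n. E n (a n))"
    and riesz_E: "E m (\<Sum>n. E n (a n)) = E m (a m)"
proof -
  show s: "summable (\<lambda>n. E n (a n))"
    unfolding summable_Cauchy
  proof (intro allI impI)
    fix e :: real assume "e > 0"
    then obtain N where N: "\<And>m n. m \<ge> N \<Longrightarrow> norm (\<Sum>n\<in>{m..<n}. (norm (E n (a n)))\<^sup>2) < e\<^sup>2"
      using assms unfolding summable_Cauchy by (meson zero_less_power)
    have "norm (\<Sum>n\<in>{m..<n}. E n (a n)) < e" if "m \<ge> N" for m n
    proof -
      have "(norm (\<Sum>n\<in>{m..<n}. E n (a n)))\<^sup>2 < e\<^sup>2"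
        using N[OF that, of n] by (simp add: norm_sum_E sum_nonneg)
      then show ?thesis using \<open>e > 0\<close> by (simp add: power2_less_imp_less)
    qed
    then show "\<exists>N. \<forall>m\<ge>N. \<forall>n. norm (\<Sum>n\<in>{m..<n}. E n (a n)) < e" by blast
  qed
  have "E m (\<Sum>n. E n (a n)) = (\<Sum>n. E m (E n (a n)))"
    using bounded_linear.suminf[OF bounded_linear_E s] by simp
  also have "\<dots> = (\<Sum>n. if n = m then E m (a m) else 0)"
    by (rule arg_cong[where f=suminf]) (auto simp: proj)
  also have "\<dots> = E m (a m)"
    using suminf_finite[of "{m}" "\<lambda>n. if n = m then E m (a m) else 0"] by auto
  finally show "E m (\<Sum>n. E n (a n)) = E m (a m)" .
qed

lemma E_sums: "(\<lambda>n. E n x) sums x"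
proof -
  have "(\<Sum>n. E n x) = x"
    by (rule E_eqI) (rule riesz_E[OF summable_E])
  then show ?thesis
    using riesz_summable[OF summable_E, of x] by (simp add: summable_sums_iff)
qed

lemma inner_sums: "(\<lambda>n. inner (E n x) y) sums inner x y"
  using bounded_linear.sums[OF bounded_linear_inner_left E_sums] .

lemma parseval: "(\<lambda>n. (norm (E n x))\<^sup>2) sums (norm x)\<^sup>2"
  using inner_sums[of x x] inner_E[of _ x x] by (simp add: power2_norm_eq_inner)

text \<open>Functional calculus: \<open>c n\<close> is the multiplier on the range of
  \<open>E n\<close>. The scalar stands inside \<open>E n\<close> so that \<open>riesz\<close>
  applies directly.\<close>

definition cal :: "(nat \<Rightarrow> real) \<Rightarrow> 'a \<Rightarrow> 'a" where
  "cal c x = (\<Sum>n. E n (c n *\<^sub>R x))"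

lemma E_cal:
  assumes "bdd_fun c" shows "E n (cal c x) = c n *\<^sub>R E n x"
proof -
  obtain K where K: "\<And>n. \<bar>c n\<bar> \<le> K" using assms by (auto simp: bdd_fun_def)
  have "(c n)\<^sup>2 \<le> K\<^sup>2" for n
    using K[of n] by (metis abs_ge_zero power2_abs power_mono)
  then have "summable (\<lambda>n. (norm (E n (c n *\<^sub>R x)))\<^sup>2)"
    by (intro summable_comparison_test[OF _ summable_mult[OF summable_E[of x], of "K\<^sup>2"]] exI[of _ 0])
       (auto simp: E_scale power_mult_distrib intro!: mult_right_mono)
  from riesz_E[OF this, of n] show ?thesis unfolding cal_def by (simp add: E_scale)
qed

lemma cal_eqI: "bdd_fun c \<Longrightarrow> (\<And>n. E n y = c n *\<^sub>R E n x) \<Longrightarrow> cal c x = y"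
  by (rule E_eqI) (simp add: E_cal)

lemma cal_norm_le:
  assumes "\<And>n. \<bar>c n\<bar> \<le> K" shows "norm (cal c x) \<le> K * norm x"
proof -
  have K: "K \<ge> 0" using assms[of 0] by linarith
  have "(norm (cal c x))\<^sup>2 \<le> K\<^sup>2 * (norm x)\<^sup>2"
  proof (rule sums_le[OF _ parseval sums_mult[OF parseval]])
    fix n
    have "(c n)\<^sup>2 \<le> K\<^sup>2" using assms[of n] by (metis abs_ge_zero power2_abs power_mono)
    then show "(norm (E n (cal c x)))\<^sup>2 \<le> K\<^sup>2 * (norm (E n x))\<^sup>2"
      using E_cal[OF bdd_funI[of c K], of n x] assms
      by (metis mult_right_mono norm_scaleR power2_abs power_mult_distrib zero_le_power2)
  qed
  then have "(norm (cal c x))\<^sup>2 \<le> (K * norm x)\<^sup>2"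
    by (simp only: power_mult_distrib)
  then show ?thesis
    by (rule power2_le_imp_le) (simp add: K)
qed

lemma linear_cal: "bdd_fun c \<Longrightarrow> linear (cal c)"
  by (rule linearI; rule cal_eqI) (auto simp: E_cal E_add E_scale scaleR_add_right)

lemma bounded_linear_cal: "bdd_fun c \<Longrightarrow> bounded_linear (cal c)"
proof -
  assume c: "bdd_fun c"
  then obtain K where "\<And>n. \<bar>c n\<bar> \<le> K" by (auto simp: bdd_fun_def)
  with c show ?thesis
    by (intro bounded_linear_intro[where K=K])
       (auto simp: linear_add[OF linear_cal] linear_scale[OF linear_cal] mult.commute intro!: cal_norm_le)
qed

lemma cal_add: "bdd_fun c \<Longrightarrow> cal c (x + y) = cal c x + cal c y"
  by (simp add: linear_add linear_cal)
lemma cal_diff: "bdd_fun c \<Longrightarrow> cal c (x - y) = cal c x - cal c y"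
  by (simp add: linear_diff linear_cal)
lemma cal_scale: "bdd_fun c \<Longrightarrow> cal c (r *\<^sub>R x) = r *\<^sub>R cal c x"
  by (simp add: linear_scale linear_cal)
lemma cal_0 [simp]: "cal c 0 = 0"
  by (simp add: cal_def)

lemma cal_cal: "bdd_fun c \<Longrightarrow> bdd_fun d \<Longrightarrow> cal c (cal d x) = cal (\<lambda>n. c n * d n) x"
  by (rule cal_eqI) (auto simp: E_cal bdd_fun_mult)

lemma cal_fun_diff: "bdd_fun c \<Longrightarrow> bdd_fun d \<Longrightarrow> cal (\<lambda>n. c n - d n) x = cal c x - cal d x"
  by (rule cal_eqI) (auto simp: E_cal bdd_fun_diff E_diff scaleR_diff_left)

lemma cal_const [simp]: "cal (\<lambda>n. r) x = r *\<^sub>R x"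
  by (rule cal_eqI) (auto simp: E_scale bdd_fun_def)

text \<open>Dominated convergence: pointwise convergence of uniformly bounded symbols gives strong
  convergence of the operators.\<close>
lemma cal_tendsto:
  assumes bnd: "\<forall>\<^sub>F t in F. \<forall>n. \<bar>c t n\<bar> \<le> K"
    and c0: "bdd_fun c0" and lim: "\<And>n. ((\<lambda>t. c t n) \<longlongrightarrow> c0 n) F"
  shows "((\<lambda>t. cal (c t) x) \<longlongrightarrow> cal c0 x) F"
proof -
  obtain K0 where K0: "\<And>n. \<bar>c0 n\<bar> \<le> K0" using c0 by (auto simp: bdd_fun_def)
  have eq: "(\<Sum>n. (c t n - c0 n)\<^sup>2 * (norm (E n x))\<^sup>2) = (norm (cal (c t) x - cal c0 x))\<^sup>2"
    if "\<forall>n. \<bar>c t n\<bar> \<le> K" for t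
  proof -
    have b: "bdd_fun (c t)" using that by (auto simp: bdd_fun_def)
    have "(\<lambda>n. (c t n - c0 n)\<^sup>2 * (norm (E n x))\<^sup>2) sums (norm (cal (c t) x - cal c0 x))\<^sup>2"
      using parseval[of "cal (c t) x - cal c0 x"] b c0
      by (simp add: E_diff E_cal scaleR_diff_left[symmetric] power_mult_distrib)
    then show ?thesis by (simp add: sums_iff)
  qed
  have "((\<lambda>t. \<Sum>n. (c t n - c0 n)\<^sup>2 * (norm (E n x))\<^sup>2) \<longlongrightarrow> (\<Sum>n. 0)) F"
  \<comment> \<open>Tannery's theorem asks for a proper filter; along \<open>bot\<close> convergence
    is vacuous.\<close>
  proof (cases "F = bot")
    case False
    have "(\<forall>\<^sub>F t in F. summable (\<lambda>k. norm ((c t k - c0 k)\<^sup>2 * (norm (E k x))\<^sup>2))) \<and> summable (\<lambda>n. norm (0::real)) \<and>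
      ((\<lambda>t. \<Sum>n. (c t n - c0 n)\<^sup>2 * (norm (E n x))\<^sup>2) \<longlongrightarrow> (\<Sum>n. 0)) F"
    proof (rule tannerys_theorem)
      show "((\<lambda>t. (c t n - c0 n)\<^sup>2 * (norm (E n x))\<^sup>2) \<longlongrightarrow> 0) F" for n
        by (rule tendsto_eq_intros lim refl | simp)+
      show "\<forall>\<^sub>F (k, t) in at_top \<times>\<^sub>F F. norm ((c t k - c0 k)\<^sup>2 * (norm (E k x))\<^sup>2) \<le> (K + K0)\<^sup>2 * (norm (E k x))\<^sup>2"
        unfolding eventually_prod_filter
      proof (intro exI conjI allI impI)
        show "\<forall>\<^sub>F t in F. \<forall>n. \<bar>c t n\<bar> \<le> K" by (rule bnd)
        show "\<forall>\<^sub>F k in at_top. True" by simp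
        fix k :: nat and t assume "\<forall>n. \<bar>c t n\<bar> \<le> K"
        then have "\<bar>c t k\<bar> \<le> K" by blast
        then have "\<bar>c t k - c0 k\<bar> \<le> K + K0" using K0[of k] by linarith
        then have "(c t k - c0 k)\<^sup>2 \<le> (K + K0)\<^sup>2"
          by (metis abs_ge_zero power2_abs power_mono)
        then show "case (k, t) of (k, t) \<Rightarrow> norm ((c t k - c0 k)\<^sup>2 * (norm (E k x))\<^sup>2) \<le> (K + K0)\<^sup>2 * (norm (E k x))\<^sup>2"
          by (simp add: mult_right_mono)
      qed
      show "summable (\<lambda>n. (K + K0)\<^sup>2 * (norm (E n x))\<^sup>2)" by (intro summable_mult summable_E)
      show "F \<noteq> bot" by fact
    qed
    then show ?thesis by blast
  qed simp
  then have "((\<lambda>t. \<Sum>n. (c t n - c0 n)\<^sup>2 * (norm (E n x))\<^sup>2) \<longlongrightarrow> 0) F" by simp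
  moreover have "\<forall>\<^sub>F t in F. (\<Sum>n. (c t n - c0 n)\<^sup>2 * (norm (E n x))\<^sup>2) = (norm (cal (c t) x - cal c0 x))\<^sup>2"
    using bnd by (rule eventually_mono) (rule eq)
  ultimately have "((\<lambda>t. (norm (cal (c t) x - cal c0 x))\<^sup>2) \<longlongrightarrow> 0) F"
    by (rule Lim_transform_eventually)
  then have "((\<lambda>t. sqrt ((norm (cal (c t) x - cal c0 x))\<^sup>2)) \<longlongrightarrow> sqrt 0) F"
    by (rule tendsto_real_sqrt)
  then show ?thesis
    by (simp add: tendsto_norm_zero_iff LIM_zero_iff)
qed

end

section \<open>Integration of periodic functions\<close>

definition tlat :: "int^'d \<Rightarrow> real^'d::finite" where
  "tlat m = (\<chi> i. 2 * pi * of_int (m $ i))"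

text \<open>Half-open fundamental domain: its lattice translates tile R^d without overlap, whereas
  those of \<open>tcube\<close> meet along faces.\<close>

definition qcube :: "(real^'d::finite) set" where
  "qcube = {x. \<forall>i. 0 \<le> x $ i \<and> x $ i < 2 * pi}"

lemma periodic_fun_step:
  assumes "periodic_fun f"
  shows "f (x + (2 * pi * of_int n) *\<^sub>R axis i 1) = f x"
proof (induction n arbitrary: x rule: int_induct[where k=0])
  case (step1 n)
  have "f (x + (2 * pi * of_int (n + 1)) *\<^sub>R axis i 1) = f ((x + (2 * pi * of_int n) *\<^sub>R axis i 1) + (2 * pi) *\<^sub>R axis i 1)"
    by (rule arg_cong[where f=f]) (simp add: algebra_simps)
  then show ?case using assms step1 by (simp add: periodic_fun_def)
next
  case (step2 n)
  have "f (x + (2 * pi * of_int (n - 1)) *\<^sub>R axis i 1) = f ((x + (2 * pi * of_int (n - 1)) *\<^sub>R axis i 1) + (2 * pi) *\<^sub>R axis i 1)"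
    using assms by (simp add: periodic_fun_def)
  also have "\<dots> = f (x + (2 * pi * of_int n) *\<^sub>R axis i 1)"
    by (rule arg_cong[where f=f]) (simp add: algebra_simps)
  finally show ?case using step2 by simp
qed simp

lemma periodic_fun_tlat:
  fixes f :: "real^'d::finite \<Rightarrow> 'b"
  assumes "periodic_fun f"
  shows "f (x + tlat m) = f x"
proof -
  have "f (x + (\<Sum>i\<in>A. (2 * pi * of_int (m $ i)) *\<^sub>R axis i 1)) = f x" if "finite A" for A
    using that
  proof (induction A rule: finite_induct)
    case (insert i A)
    have "f (x + (\<Sum>i\<in>insert i A. (2 * pi * of_int (m $ i)) *\<^sub>R axis i 1)) =
       f ((x + (\<Sum>i\<in>A. (2 * pi * of_int (m $ i)) *\<^sub>R axis i 1)) + (2 * pi * of_int (m $ i)) *\<^sub>R axis i 1)"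
      using insert.hyps by (simp add: algebra_simps)
    then show ?case using insert.IH periodic_fun_step[OF assms] by metis
  qed simp
  moreover have "tlat m = (\<Sum>i\<in>UNIV. (2 * pi * of_int (m $ i)) *\<^sub>R axis i 1)"
    by (simp add: vec_eq_iff tlat_def axis_def if_distrib cong: if_cong)
  ultimately show ?thesis by (metis finite)
qed

lemma periodic_fun_tlat_diff:
  fixes f :: "real^'d::finite \<Rightarrow> 'b"
  assumes "periodic_fun f"
  shows "f (x - tlat m) = f x"
  using periodic_fun_tlat[OF assms, of "x - tlat m" m] by simp

lemma ex1_qcube: "\<exists>!m. x - tlat m \<in> qcube"
proof
  let ?m = "\<chi> i. \<lfloor>x $ i / (2 * pi)\<rfloor>"
  have "0 \<le> x $ i - 2 * pi * of_int \<lfloor>x $ i / (2 * pi)\<rfloor> \<and> x $ i - 2 * pi * of_int \<lfloor>x $ i / (2 * pi)\<rfloor> < 2 * pi" for i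
  proof -
    have 1: "of_int \<lfloor>x $ i / (2 * pi)\<rfloor> \<le> x $ i / (2 * pi)" and 2: "x $ i / (2 * pi) < of_int \<lfloor>x $ i / (2 * pi)\<rfloor> + 1"
      by linarith+
    have "of_int \<lfloor>x $ i / (2 * pi)\<rfloor> * (2 * pi) \<le> x $ i"
      using 1 by (subst (asm) pos_le_divide_eq) auto
    moreover have "x $ i < (of_int \<lfloor>x $ i / (2 * pi)\<rfloor> + 1) * (2 * pi)"
      using 2 by (subst (asm) pos_divide_less_eq) auto
    ultimately show ?thesis by (simp add: algebra_simps)
  qed
  then show "x - tlat ?m \<in> qcube"
    by (simp add: qcube_def tlat_def)
  fix m assume m: "x - tlat m \<in> qcube"
  show "m = ?m"
  proof (rule vec_eq_iff[THEN iffD2], rule allI)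
    fix i
    have "0 \<le> x $ i - 2 * pi * of_int (m $ i)" "x $ i - 2 * pi * of_int (m $ i) < 2 * pi"
      using m by (auto simp: qcube_def tlat_def)
    then have "\<lfloor>x $ i / (2 * pi)\<rfloor> = m $ i"
      by (intro floor_unique) (auto simp: field_simps)
    then show "m $ i = ?m $ i" by simp
  qed
qed

lemma qcube_subset: "qcube \<subseteq> tcube"
  by (auto simp: qcube_def tcube_def mem_box_cart less_imp_le)

lemma negligible_tcube_qcube: "negligible (tcube - qcube :: (real^'d::finite) set)"
proof -
  have "tcube - qcube \<subseteq> (\<Union>i. {x::real^'d. axis i 1 \<bullet> x = 2 * pi})"
    by (auto simp: qcube_def tcube_def mem_box_cart inner_axis' not_less) (meson antisym not_le)
  moreover have "negligible (\<Union>i. {x::real^'d. axis i 1 \<bullet> x = 2 * pi})"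
    by (intro negligible_Union) (auto intro!: negligible_hyperplane)
  ultimately show ?thesis using negligible_subset by blast
qed

lemma qcube_borel [measurable]: "qcube \<in> sets borel"
proof -
  have "qcube = (\<Inter>i. {x::real^'d. 0 \<le> x $ i} \<inter> {x. x $ i < 2 * pi})"
    by (auto simp: qcube_def)
  also have "\<dots> \<in> sets borel"
    by (intro sets.finite_INT sets.Int borel_closed borel_open closed_Collect_le open_Collect_less continuous_intros) auto
  finally show ?thesis .
qed

lemma tcube_borel [measurable]: "tcube \<in> sets borel"
  by (simp add: tcube_def)

lemma tcube_lebesgue [measurable]: "tcube \<in> sets lebesgue"
  by (simp add: tcube_def)

lemma space_tmeas [simp]: "space tmeas = tcube"
  by (simp add: tmeas_def)

lemma finite_measure_tmeas: "finite_measure (tmeas :: (real^'d::finite) measure)"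
  by (rule finite_measureI) (simp add: tmeas_def emeasure_restrict_space tcube_def emeasure_lborel_cbox_eq)

lemma AE_tmeas: "(AE x in tmeas. P x) \<longleftrightarrow> (AE x in lebesgue. x \<in> tcube \<longrightarrow> P x)"
  unfolding tmeas_def by (rule AE_restrict_space_iff) simp

lemma AE_lebesgue_iff: "(AE x in lebesgue. P x) \<longleftrightarrow> negligible {x::'a::euclidean_space. \<not> P x}"
  by (simp add: AE_iff_null_sets[OF _ ] negligible_iff_null_sets eventually_ae_filter completion.complete2)
     (metis (mono_tags, lifting) completion.complete2 mem_Collect_eq order_refl)

text \<open>The exceptional set is covered by the lattice translates of its part in the cube, and
  there are only countably many of them.\<close>

lemma AE_periodic:
  fixes P :: "real^'d::finite \<Rightarrow> bool"
  assumes "AE x in tmeas. P x" "periodic_fun P"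
  shows "AE x in lebesgue. P x"
proof -
  have N: "negligible {x. \<not> (x \<in> tcube \<longrightarrow> P x)}"
    using assms(1) unfolding AE_tmeas AE_lebesgue_iff .
  have "{x. \<not> P x} \<subseteq> (\<Union>m. (+) (tlat m) ` {x. \<not> (x \<in> tcube \<longrightarrow> P x)})"
  proof
    fix x assume "x \<in> {x. \<not> P x}"
    moreover obtain m where "x - tlat m \<in> qcube" using ex1_qcube by blast
    ultimately have "x - tlat m \<in> {x. \<not> (x \<in> tcube \<longrightarrow> P x)}"
      using qcube_subset periodic_fun_tlat_diff[OF assms(2), of x m] by auto
    then show "x \<in> (\<Union>m. (+) (tlat m) ` {x. \<not> (x \<in> tcube \<longrightarrow> P x)})"
      by (force simp: image_iff)
  qed
  moreover have "negligible (\<Union>m. (+) (tlat m) ` {x. \<not> (x \<in> tcube \<longrightarrow> P x)})"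
    by (rule negligible_countable_Union) (use negligible_translation[OF N] in auto)
  ultimately show ?thesis unfolding AE_lebesgue_iff by (rule negligible_subset[rotated])
qed

lemma AE_tmeas_lebesgue: "AE x in lebesgue. P x \<Longrightarrow> AE x in tmeas. P x"
  unfolding AE_tmeas by auto

lemma AE_periodic_iff:
  fixes P :: "real^'d::finite \<Rightarrow> bool"
  shows "periodic_fun P \<Longrightarrow> (AE x in tmeas. P x) \<longleftrightarrow> (AE x in lebesgue. P x)"
  using AE_periodic AE_tmeas_lebesgue by blast

lemma lebesgue_translation:
  fixes a :: "'a::euclidean_space"
  shows "lebesgue = distr lebesgue lebesgue (\<lambda>x. a + x)" and "(\<lambda>x. a + x) \<in> lebesgue \<rightarrow>\<^sub>M lebesgue"
proof -
  have T: "(\<lambda>x. a + (\<Sum>j\<in>Basis. (1 * (x \<bullet> j)) *\<^sub>R j)) = (\<lambda>x. a + x)"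
    by (simp add: euclidean_representation)
  show "lebesgue = distr lebesgue lebesgue (\<lambda>x. a + x)"
    using lebesgue_affine_euclidean[of "\<lambda>_. 1" a] unfolding T by (simp add: density_1)
  show "(\<lambda>x. a + x) \<in> lebesgue \<rightarrow>\<^sub>M lebesgue"
    using lebesgue_affine_measurable[of "\<lambda>_. 1" a] unfolding T by simp
qed

lemma nn_integral_lebesgue_translation:
  fixes f :: "'a::euclidean_space \<Rightarrow> ennreal"
  assumes "f \<in> borel_measurable lebesgue"
  shows "(\<integral>\<^sup>+x. f (a + x) \<partial>lebesgue) = (\<integral>\<^sup>+x. f x \<partial>lebesgue)"
proof -
  have "(\<integral>\<^sup>+x. f x \<partial>lebesgue) = (\<integral>\<^sup>+x. f x \<partial>distr lebesgue lebesgue (\<lambda>x. a + x))"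
    by (rule arg_cong[where f="\<lambda>M. integral\<^sup>N M f"]) (rule lebesgue_translation(1))
  also have "\<dots> = (\<integral>\<^sup>+x. f (a + x) \<partial>lebesgue)"
    by (rule nn_integral_distr) (use lebesgue_translation assms in auto)
  finally show ?thesis by simp
qed

lemma measurable_lebesgue_translation:
  fixes f :: "'a::euclidean_space \<Rightarrow> 'b::topological_space"
  shows "f \<in> borel_measurable lebesgue \<Longrightarrow> (\<lambda>x. f (a + x)) \<in> borel_measurable lebesgue"
  using measurable_compose[OF lebesgue_translation(2)] by blast

lemma sum_qcube: "(\<integral>\<^sup>+m. indicator qcube (x - tlat m) \<partial>count_space UNIV) = (1::ennreal)"
proof -
  obtain m0 where m0: "x - tlat m0 \<in> qcube" "\<And>m. x - tlat m \<in> qcube \<Longrightarrow> m = m0"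
    using ex1_qcube[of x] by blast
  have "(\<lambda>m. indicator qcube (x - tlat m) :: ennreal) = indicator {m0}"
  proof
    fix m show "indicator qcube (x - tlat m) = (indicator {m0} m :: ennreal)"
      using m0(1) m0(2)[of m] by (cases "m = m0") (auto simp: indicator_def)
  qed
  then show ?thesis by simp
qed

lemma tlat_uminus: "tlat (- m) = - tlat m"
  by (simp add: tlat_def vec_eq_iff)

lemma sum_qcube_plus: "(\<integral>\<^sup>+m. indicator qcube (x + tlat m) \<partial>count_space UNIV) = (1::ennreal)"
proof -
  have "(\<integral>\<^sup>+m. indicator qcube (x + tlat m) \<partial>count_space UNIV) = (\<integral>\<^sup>+m. indicator qcube (x + tlat (- m)) \<partial>count_space UNIV :: ennreal)"
    by (rule nn_integral_bij_count_space[symmetric]) (auto intro!: bij_betwI[where g=uminus])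
  then show ?thesis using sum_qcube[of x] by (simp add: tlat_uminus)
qed

text \<open>Unfolding argument: the tiling identity \<open>sum_qcube\<close> is inserted as a factor
  1, each summand is translated by its lattice vector, and the other indicator is summed away with
  \<open>sum_qcube_plus\<close>.\<close>

lemma nn_integral_qcube_translation:
  fixes f :: "real^'d::finite \<Rightarrow> ennreal"
  assumes per: "periodic_fun f" and [measurable]: "f \<in> borel_measurable lebesgue"
  shows "(\<integral>\<^sup>+x. f (x + a) * indicator qcube x \<partial>lebesgue) = (\<integral>\<^sup>+x. f x * indicator qcube x \<partial>lebesgue)"
proof -
  have i[measurable]: "(\<lambda>x. indicator qcube (b + x) :: ennreal) \<in> borel_measurable lebesgue" for b :: "real^'d"
    using measurable_lebesgue_translation[of "indicator qcube :: real^'d \<Rightarrow> ennreal" b]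
    by (simp add: measurable_completion)
  have i1[measurable]: "(\<lambda>x. indicator qcube (x + b) :: ennreal) \<in> borel_measurable lebesgue" for b :: "real^'d"
    using i[of b] by (simp add: add.commute)
  have i2[measurable]: "(\<lambda>x. indicator qcube (x - b) :: ennreal) \<in> borel_measurable lebesgue" for b :: "real^'d"
    using i1[of "-b"] by simp
  have fxq: "(\<lambda>x. f x * indicator qcube x) \<in> borel_measurable lebesgue"
    using i[of 0] by simp
  have "(\<integral>\<^sup>+x. f (x + a) * indicator qcube x \<partial>lebesgue) = (\<integral>\<^sup>+x. f x * indicator qcube (x - a) \<partial>lebesgue)"
    using nn_integral_lebesgue_translation[of "\<lambda>x. f x * indicator qcube (x - a)" a] by (simp add: add.commute)
  also have "\<dots> = (\<integral>\<^sup>+x. (\<integral>\<^sup>+m. f x * indicator qcube (x - a) * indicator qcube (x - tlat m) \<partial>count_space UNIV) \<partial>lebesgue)"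
    by (simp add: nn_integral_cmult sum_qcube)
  also have "\<dots> = (\<integral>\<^sup>+m. (\<integral>\<^sup>+x. f x * indicator qcube (x - a) * indicator qcube (x - tlat m) \<partial>lebesgue) \<partial>count_space UNIV)"
    by (rule nn_integral_count_space_nn_integral) auto
  also have "\<dots> = (\<integral>\<^sup>+m. (\<integral>\<^sup>+x. f x * indicator qcube x * indicator qcube (x - a + tlat m) \<partial>lebesgue) \<partial>count_space UNIV)"
  proof (rule nn_integral_cong)
    fix m :: "int^'d"
    show "(\<integral>\<^sup>+x. f x * indicator qcube (x - a) * indicator qcube (x - tlat m) \<partial>lebesgue) =
       (\<integral>\<^sup>+x. f x * indicator qcube x * indicator qcube (x - a + tlat m) \<partial>lebesgue)"
      using nn_integral_lebesgue_translation[of "\<lambda>x. f x * indicator qcube (x - a) * indicator qcube (x - tlat m)" "tlat m"]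
        periodic_fun_tlat[OF per, of _ m] by (simp add: add.commute algebra_simps)
  qed
  also have "\<dots> = (\<integral>\<^sup>+x. (\<integral>\<^sup>+m. f x * indicator qcube x * indicator qcube (x - a + tlat m) \<partial>count_space UNIV) \<partial>lebesgue)"
  proof (rule nn_integral_count_space_nn_integral[symmetric])
    fix m :: "int^'d"
    have e: "x - a + tlat m = x - (a - tlat m)" for x
      by simp
    show "(\<lambda>x. f x * indicator qcube x * indicator qcube (x - a + tlat m)) \<in> borel_measurable lebesgue"
      unfolding e by (intro borel_measurable_times_ennreal fxq i2)
  qed auto
  also have "\<dots> = (\<integral>\<^sup>+x. f x * indicator qcube x \<partial>lebesgue)"
    by (simp add: nn_integral_cmult sum_qcube_plus)
  finally show ?thesis .
qed

lemma nn_integral_tmeas: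
  "(\<integral>\<^sup>+x. f x \<partial>tmeas) = (\<integral>\<^sup>+x. f x * indicator qcube x \<partial>lebesgue)"
proof -
  have "(\<integral>\<^sup>+x. f x \<partial>tmeas) = (\<integral>\<^sup>+x. f x * indicator tcube x \<partial>lebesgue)"
    unfolding tmeas_def by (rule nn_integral_restrict_space) simp
  also have "\<dots> = (\<integral>\<^sup>+x. f x * indicator qcube x \<partial>lebesgue)"
  proof (rule nn_integral_cong_AE)
    have "AE x in lebesgue. \<not> (x \<in> tcube - qcube)"
      unfolding AE_lebesgue_iff using negligible_tcube_qcube by (simp add: set_diff_eq)
    then show "AE x in lebesgue. f x * indicator tcube x = f x * indicator qcube x"
      by eventually_elim (use qcube_subset in \<open>auto simp: indicator_def\<close>)
  qed
  finally show ?thesis .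
qed

text \<open>A preimage is a countable union of translates of its part in \<open>qcube\<close>, where
  measurability is known from \<open>tmeas\<close>.\<close>

lemma measurable_tmeas_lebesgue:
  fixes f :: "real^'d::finite \<Rightarrow> 'b::topological_space"
  assumes per: "periodic_fun f" and f: "f \<in> borel_measurable tmeas"
  shows "f \<in> borel_measurable lebesgue"
proof (rule measurableI)
  fix A :: "'b set" assume A: "A \<in> sets borel"
  have "f -` A \<inter> space tmeas \<in> sets tmeas" using f A by (rule measurable_sets)
  then have "f -` A \<inter> tcube \<in> sets lebesgue"
    by (simp add: tmeas_def sets_restrict_space_iff)
  then have "(f -` A \<inter> tcube) \<inter> qcube \<in> sets lebesgue"
    by (rule sets.Int) (simp add: sets_completionI_sets)
  moreover have "(f -` A \<inter> tcube) \<inter> qcube = f -` A \<inter> qcube" using qcube_subset by blast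
  ultimately have B: "f -` A \<inter> qcube \<in> sets lebesgue" (is "?B \<in> _") by simp
  have "f -` A = (\<Union>m. (\<lambda>x. - tlat m + x) -` ?B)"
  proof (intro set_eqI iffI)
    fix x assume "x \<in> f -` A"
    moreover obtain m where "x - tlat m \<in> qcube" using ex1_qcube by blast
    ultimately show "x \<in> (\<Union>m. (\<lambda>x. - tlat m + x) -` ?B)"
      using periodic_fun_tlat_diff[OF per, of x m] by (auto intro!: exI[of _ m])
  next
    fix x assume "x \<in> (\<Union>m. (\<lambda>x. - tlat m + x) -` ?B)"
    then show "x \<in> f -` A" using periodic_fun_tlat_diff[OF per, of x] by auto
  qed
  also have "\<dots> \<in> sets lebesgue"
  proof (rule sets.countable_UN')
    have "(\<lambda>x. - tlat m + x) -` ?B \<in> sets lebesgue" for m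
      using measurable_sets[OF lebesgue_translation(2) B, of "- tlat m"] by (simp only: space_completion space_lborel space_borel Int_UNIV_right)
    then show "range (\<lambda>m. (\<lambda>x. - tlat m + x) -` ?B) \<subseteq> sets lebesgue" by blast
  qed simp
  finally show "f -` A \<inter> space lebesgue \<in> sets lebesgue" by simp
qed simp

lemma measurable_lebesgue_tmeas:
  "f \<in> borel_measurable lebesgue \<Longrightarrow> f \<in> borel_measurable tmeas"
  unfolding tmeas_def by (rule measurable_restrict_space1)

lemma periodic_comp: "periodic_fun f \<Longrightarrow> periodic_fun (\<lambda>x. g (f x))"
  by (simp add: periodic_fun_def)

lemma periodic_comp2: "periodic_fun f \<Longrightarrow> periodic_fun h \<Longrightarrow> periodic_fun (\<lambda>x. g (f x) (h x))"
  by (simp add: periodic_fun_def)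

lemma periodic_translation: "periodic_fun f \<Longrightarrow> periodic_fun (\<lambda>x. f (x + a))"
  by (simp add: periodic_fun_def add.assoc add.commute[of _ a]) (simp add: add.assoc[symmetric])

lemma measurable_periodic_translation:
  fixes f :: "real^'d::finite \<Rightarrow> 'b::topological_space"
  assumes "periodic_fun f" and "f \<in> borel_measurable tmeas"
  shows "(\<lambda>x. f (x + a)) \<in> borel_measurable tmeas"
  using measurable_lebesgue_translation[OF measurable_tmeas_lebesgue[OF assms], of a]
  by (intro measurable_lebesgue_tmeas) (simp add: add.commute)

lemma nn_integral_periodic_translation:
  fixes f :: "real^'d::finite \<Rightarrow> ennreal"
  assumes "periodic_fun f" "f \<in> borel_measurable tmeas"
  shows "(\<integral>\<^sup>+x. f (x + a) \<partial>tmeas) = (\<integral>\<^sup>+x. f x \<partial>tmeas)"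
  unfolding nn_integral_tmeas
  by (rule nn_integral_qcube_translation[OF assms(1) measurable_tmeas_lebesgue[OF assms]])

lemma integrable_periodic_translation:
  fixes f :: "real^'d::finite \<Rightarrow> real"
  assumes per: "periodic_fun f" and f: "integrable tmeas f"
  shows "integrable tmeas (\<lambda>x. f (x + a))"
proof -
  have m: "f \<in> borel_measurable tmeas" using f by auto
  have "(\<integral>\<^sup>+x. ennreal (norm (f (x + a))) \<partial>tmeas) = (\<integral>\<^sup>+x. ennreal (norm (f x)) \<partial>tmeas)"
    by (rule nn_integral_periodic_translation[of "\<lambda>x. ennreal (norm (f x))"])
       (use m per in \<open>auto intro: periodic_comp\<close>)
  then show ?thesis
    using f measurable_periodic_translation[OF per m] by (simp add: integrable_iff_bounded)
qed

lemma integral_periodic_translation: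
  fixes f :: "real^'d::finite \<Rightarrow> real"
  assumes per: "periodic_fun f" and f: "integrable tmeas f"
  shows "(\<integral>x. f (x + a) \<partial>tmeas) = (\<integral>x. f x \<partial>tmeas)"
proof -
  have [measurable]: "f \<in> borel_measurable tmeas" using f by auto
  have "(\<integral>\<^sup>+x. ennreal (f (x + a)) \<partial>tmeas) = (\<integral>\<^sup>+x. ennreal (f x) \<partial>tmeas)"
    by (rule nn_integral_periodic_translation[of "\<lambda>x. ennreal (f x)"])
       (use per in \<open>auto intro: periodic_comp\<close>)
  moreover have "(\<integral>\<^sup>+x. ennreal (- f (x + a)) \<partial>tmeas) = (\<integral>\<^sup>+x. ennreal (- f x) \<partial>tmeas)"
    by (rule nn_integral_periodic_translation[of "\<lambda>x. ennreal (- f x)"])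
       (use per in \<open>auto intro: periodic_comp\<close>)
  ultimately show ?thesis
    using f integrable_periodic_translation[OF assms, of a] by (simp add: real_lebesgue_integral_def)
qed

section \<open>Trigonometric polynomials\<close>

inductive trigpoly :: "(real^'d::finite \<Rightarrow> real) \<Rightarrow> bool" where
  cos: "lattice k \<Longrightarrow> trigpoly (\<lambda>x. cos (k \<bullet> x))"
| sin: "lattice k \<Longrightarrow> trigpoly (\<lambda>x. sin (k \<bullet> x))"
| add: "trigpoly f \<Longrightarrow> trigpoly g \<Longrightarrow> trigpoly (\<lambda>x. f x + g x)"
| scale: "trigpoly f \<Longrightarrow> trigpoly (\<lambda>x. c * f x)"

lemma lattice_0 [simp]: "lattice 0"
  by (simp add: lattice_def)
lemma lattice_add: "lattice k \<Longrightarrow> lattice l \<Longrightarrow> lattice (k + l)"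
  by (simp add: lattice_def)
lemma lattice_diff: "lattice k \<Longrightarrow> lattice l \<Longrightarrow> lattice (k - l)"
  by (simp add: lattice_def)
lemma lattice_uminus: "lattice k \<Longrightarrow> lattice (- k)"
  by (simp add: lattice_def)
lemma lattice_axis: "lattice (axis i 1 :: real^'d::finite)"
  by (simp add: lattice_def axis_def)

lemma trigpoly_const: "trigpoly (\<lambda>x::real^'d::finite. c)"
proof -
  have "trigpoly (\<lambda>x::real^'d. c * cos (0 \<bullet> x))"
    by (intro trigpoly.scale trigpoly.cos) simp
  then show ?thesis by simp
qed

lemma trigpoly_sum: "finite A \<Longrightarrow> (\<And>i. i \<in> A \<Longrightarrow> trigpoly (f i)) \<Longrightarrow> trigpoly (\<lambda>x. \<Sum>i\<in>A. f i x)"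
proof (induction A rule: finite_induct)
  case empty
  then show ?case by (simp add: trigpoly_const)
next
  case (insert a A)
  then have "trigpoly (\<lambda>x. f a x + (\<Sum>i\<in>A. f i x))" by (intro trigpoly.add) auto
  with insert show ?case by simp
qed

lemma trigpoly_lincomb: "trigpoly f \<Longrightarrow> trigpoly g \<Longrightarrow> trigpoly (\<lambda>x. a * f x + b * g x)"
  by (intro trigpoly.add trigpoly.scale)

lemma trigpoly_mult_cos:
  fixes f :: "real^'d::finite \<Rightarrow> real"
  assumes "trigpoly f" "lattice k"
  shows "trigpoly (\<lambda>x. f x * cos (k \<bullet> x))" "trigpoly (\<lambda>x. f x * sin (k \<bullet> x))"
proof -
  have "trigpoly (\<lambda>x. f x * cos (k \<bullet> x)) \<and> trigpoly (\<lambda>x. f x * sin (k \<bullet> x))"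
    using assms
  proof (induction rule: trigpoly.induct)
    case (cos l)
    note C1 = trigpoly.cos[OF lattice_diff[OF cos]] and C2 = trigpoly.cos[OF lattice_add[OF cos]]
      and S1 = trigpoly.sin[OF lattice_diff[OF cos]] and S2 = trigpoly.sin[OF lattice_add[OF cos]]
    have "trigpoly (\<lambda>x::real^'d. 1/2 * cos ((l - k) \<bullet> x) + 1/2 * cos ((l + k) \<bullet> x))"
      "trigpoly (\<lambda>x::real^'d. 1/2 * sin ((l + k) \<bullet> x) + (-1/2) * sin ((l - k) \<bullet> x))"
      by (rule trigpoly_lincomb[OF C1 C2], rule trigpoly_lincomb[OF S2 S1])
    moreover have "(\<lambda>x::real^'d. 1/2 * cos ((l - k) \<bullet> x) + 1/2 * cos ((l + k) \<bullet> x)) = (\<lambda>x. cos (l \<bullet> x) * cos (k \<bullet> x))"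
      "(\<lambda>x::real^'d. 1/2 * sin ((l + k) \<bullet> x) + (-1/2) * sin ((l - k) \<bullet> x)) = (\<lambda>x. cos (l \<bullet> x) * sin (k \<bullet> x))"
      by (auto simp: inner_diff_left inner_add_left cos_diff cos_add sin_add sin_diff field_simps)
    ultimately show ?case by simp
  next
    case (sin l)
    note C1 = trigpoly.cos[OF lattice_diff[OF sin]] and C2 = trigpoly.cos[OF lattice_add[OF sin]]
      and S1 = trigpoly.sin[OF lattice_diff[OF sin]] and S2 = trigpoly.sin[OF lattice_add[OF sin]]
    have "trigpoly (\<lambda>x::real^'d. 1/2 * sin ((l + k) \<bullet> x) + 1/2 * sin ((l - k) \<bullet> x))"
      "trigpoly (\<lambda>x::real^'d. 1/2 * cos ((l - k) \<bullet> x) + (-1/2) * cos ((l + k) \<bullet> x))"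
      by (rule trigpoly_lincomb[OF S2 S1], rule trigpoly_lincomb[OF C1 C2])
    moreover have "(\<lambda>x::real^'d. 1/2 * sin ((l + k) \<bullet> x) + 1/2 * sin ((l - k) \<bullet> x)) = (\<lambda>x. sin (l \<bullet> x) * cos (k \<bullet> x))"
      "(\<lambda>x::real^'d. 1/2 * cos ((l - k) \<bullet> x) + (-1/2) * cos ((l + k) \<bullet> x)) = (\<lambda>x. sin (l \<bullet> x) * sin (k \<bullet> x))"
      by (auto simp: inner_diff_left inner_add_left cos_diff cos_add sin_add sin_diff field_simps)
    ultimately show ?case by simp
  next
    case (add f g)
    then show ?case by (auto simp: distrib_right intro: trigpoly.add)
  next
    case (scale f c)
    then show ?case by (auto simp: mult.assoc intro: trigpoly.scale)
  qed
  then show "trigpoly (\<lambda>x. f x * cos (k \<bullet> x))" "trigpoly (\<lambda>x. f x * sin (k \<bullet> x))" by auto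
qed

lemma trigpoly_mult: "trigpoly f \<Longrightarrow> trigpoly g \<Longrightarrow> trigpoly (\<lambda>x. f x * g x)"
proof (rotate_tac, induction rule: trigpoly.induct)
  case (add g h)
  then show ?case by (auto simp: distrib_left intro: trigpoly.add)
next
  case (scale g c)
  then have "trigpoly (\<lambda>x. c * (f x * g x))" by (auto intro: trigpoly.scale)
  then show ?case by (simp add: mult_ac)
qed (auto intro: trigpoly_mult_cos)

lemma lattice_inner_tlat:
  assumes "lattice k" obtains n where "k \<bullet> (2 * pi) *\<^sub>R axis i 1 = 2 * pi * of_int n"
  using assms unfolding lattice_def by (metis Ints_cases inner_axis inner_real_def inner_scaleR_right mult.right_neutral)

lemma cos_add_period: "cos (x + 2 * pi * of_int n) = cos x" "sin (x + 2 * pi * of_int n) = sin x"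
  using cos_int_2pin[of n] sin_int_2pin[of n] by (simp_all add: cos_add sin_add)

lemma trigpoly_periodic: "trigpoly f \<Longrightarrow> periodic_fun f"
proof (induction rule: trigpoly.induct)
  case (cos k)
  then show ?case
    by (auto simp: periodic_fun_def inner_add_right) (metis cos_add_period(1) lattice_inner_tlat inner_scaleR_right)
next
  case (sin k)
  then show ?case
    by (auto simp: periodic_fun_def inner_add_right) (metis cos_add_period(2) lattice_inner_tlat inner_scaleR_right)
qed (auto simp: periodic_fun_def)

lemma trigpoly_continuous: "trigpoly f \<Longrightarrow> continuous_on UNIV f"
  by (induction rule: trigpoly.induct) (auto intro!: continuous_intros)

lemma trigpoly_bounded: "trigpoly f \<Longrightarrow> \<exists>K. \<forall>x. \<bar>f x\<bar> \<le> K"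
proof (induction rule: trigpoly.induct)
  case (cos k)
  show ?case by (auto intro!: exI[of _ 1])
next
  case (sin k)
  show ?case by (auto intro!: exI[of _ 1])
next
  case (add f g)
  then obtain K L where *: "\<And>x. \<bar>f x\<bar> \<le> K" "\<And>x. \<bar>g x\<bar> \<le> L" by blast
  have "\<bar>f x + g x\<bar> \<le> K + L" for x using *(1)[of x] *(2)[of x] by linarith
  then show ?case by blast
next
  case (scale f c)
  then obtain K where "\<And>x. \<bar>f x\<bar> \<le> K" by blast
  then have "\<bar>c * f x\<bar> \<le> \<bar>c\<bar> * K" for x by (simp add: abs_mult mult_left_mono)
  then show ?case by blast
qed

section \<open>Density of trigonometric polynomials\<close>

definition circ :: "real^'d \<Rightarrow> (real^'d) \<times> (real^'d::finite)" where
  "circ x = ((\<chi> i. cos (x $ i)), (\<chi> i. sin (x $ i)))"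

lemma trigpoly_polynomial_circ: "real_polynomial_function g \<Longrightarrow> trigpoly (\<lambda>x::real^'d::finite. g (circ x))"
proof (induction rule: real_polynomial_function.induct)
  case (linear h)
  have *: "h (circ x) = (\<Sum>i\<in>UNIV. h (axis i 1, 0) * cos (axis i 1 \<bullet> x)) + (\<Sum>i\<in>UNIV. h (0, axis i 1) * sin (axis i 1 \<bullet> x))" for x :: "real^'d"
  proof -
    have e1: "(\<chi> i. cos (x $ i)) = (\<Sum>i\<in>UNIV. cos (x $ i) *\<^sub>R axis i 1 :: real^'d)"
      and e2: "(\<chi> i. sin (x $ i)) = (\<Sum>i\<in>UNIV. sin (x $ i) *\<^sub>R axis i 1 :: real^'d)"
      by (simp_all add: vec_eq_iff axis_def if_distrib cong: if_cong)
    have c: "circ x = (\<Sum>i\<in>UNIV. cos (x $ i) *\<^sub>R (axis i 1, 0)) + (\<Sum>i\<in>UNIV. sin (x $ i) *\<^sub>R (0, axis i 1))"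
      unfolding circ_def e1 e2 by (simp add: prod_eq_iff fst_sum snd_sum)
    have l: "linear h" using linear by (rule bounded_linear.linear)
    show ?thesis
      unfolding c linear_add[OF l] linear_sum[OF l] linear_scale[OF l] by (simp add: inner_axis' mult.commute)
  qed
  show ?case unfolding * by (intro trigpoly.add trigpoly_sum trigpoly.scale trigpoly.cos trigpoly.sin lattice_axis) auto
qed (auto intro: trigpoly_const trigpoly.add trigpoly_mult)

text \<open>Equal cosine and sine leave a difference of at most one period in each coordinate;
  inside the closed cube a full period joins two opposite faces.\<close>

lemma circ_eq:
  assumes "circ x = circ y" "x \<in> tcube" "y \<in> tcube"
  shows "x = y \<or> ((\<exists>i. x $ i \<in> {0, 2 * pi}) \<and> (\<exists>i. y $ i \<in> {0, 2 * pi}))"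
proof (cases "x = y")
  case False
  then obtain i where i: "x $ i \<noteq> y $ i" by (auto simp: vec_eq_iff)
  have "cos (x $ i) = cos (y $ i)" "sin (x $ i) = sin (y $ i)"
    using assms(1) by (auto simp: circ_def vec_eq_iff)
  then obtain n where n: "x $ i = y $ i + 2 * pi * of_int n"
    using sin_cos_eq_iff[of "x $ i" "y $ i"] by (auto simp: mult.commute)
  have b: "0 \<le> x $ i" "x $ i \<le> 2 * pi" "0 \<le> y $ i" "y $ i \<le> 2 * pi"
    using assms by (auto simp: tcube_def mem_box_cart)
  then have "\<bar>2 * pi * of_int n\<bar> \<le> 2 * pi" using n by linarith
  then have "\<bar>n\<bar> \<le> 1" by (simp add: abs_mult)
  moreover have "n \<noteq> 0" using n i by auto
  ultimately have "n = 1 \<or> n = - 1" by linarith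
  then have "x $ i \<in> {0, 2 * pi} \<and> y $ i \<in> {0, 2 * pi}" using n b by auto
  then show ?thesis by blast
qed simp

text \<open>A function vanishing on the boundary of the cube descends to the torus, which is embedded
  by (cos, sin) in Euclidean space.\<close>
lemma trigpoly_approx:
  fixes f :: "real^'d::finite \<Rightarrow> real"
  assumes f: "continuous_on tcube f" and bd: "\<And>x i. x \<in> tcube \<Longrightarrow> x $ i \<in> {0, 2 * pi} \<Longrightarrow> f x = 0"
    and e: "e > 0"
  obtains p where "trigpoly p" "\<And>x. x \<in> tcube \<Longrightarrow> \<bar>f x - p x\<bar> < e"
proof -
  have K: "compact (tcube :: (real^'d) set)" by (simp add: tcube_def)
  have cc: "continuous_on A circ" for A :: "(real^'d) set"
    unfolding circ_def by (intro continuous_intros continuous_on_vec_lambda)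
  \<comment> \<open>\<open>f\<close> transported to the embedded torus. The choice of preimage is
    harmless: two preimages in the cube coincide or are both boundary points, where \<open>f\<close>
    vanishes.\<close>
  define g where "g z = f (SOME x. x \<in> tcube \<and> circ x = z)" for z
  have g: "g (circ x) = f x" if xt: "x \<in> tcube" for x
  proof -
    define y where "y = (SOME y. y \<in> tcube \<and> circ y = circ x)"
    have y: "y \<in> tcube \<and> circ y = circ x"
      unfolding y_def by (rule someI[where x=x]) (simp add: that)
    have "f y = f x"
    proof (cases "y = x")
      case False
      then obtain i j where "y $ i \<in> {0, 2 * pi}" "x $ j \<in> {0, 2 * pi}"
        using circ_eq[of y x] y xt by auto
      then show ?thesis using bd y xt by metis
    qed simp
    then show ?thesis unfolding g_def y_def .
  qed
  \<comment> \<open>A continuous map on a compact set is closed, so preimages of closed sets under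
    \<open>g\<close> are images of compact sets under \<open>circ\<close>.\<close>
  have "continuous_on (circ ` tcube) g"
  proof (rule continuous_on_closed_vimage[THEN iffD2, rule_format])
    show "closed (circ ` (tcube :: (real^'d) set))"
      by (intro compact_imp_closed compact_continuous_image cc K)
    fix B :: "real set" assume B: "closed B"
    have "g -` B \<inter> circ ` tcube = circ ` (f -` B \<inter> tcube)" using g by auto
    moreover have "closed (f -` B \<inter> tcube)"
      using f B K by (simp add: continuous_on_closed_vimage compact_imp_closed)
    then have "compact (tcube \<inter> (f -` B \<inter> tcube))" by (rule compact_Int_closed[OF K])
    then have "compact (f -` B \<inter> tcube)" by (simp add: Int_ac)
    ultimately show "closed (g -` B \<inter> circ ` tcube)"
      by (metis cc compact_continuous_image compact_imp_closed)
  qed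
  then obtain h where h: "real_polynomial_function h" "\<And>z. z \<in> circ ` tcube \<Longrightarrow> \<bar>g z - h z\<bar> < e"
    using Stone_Weierstrass_real_polynomial_function[of "circ ` tcube" g e] e cc K
    by (metis compact_continuous_image)
  show ?thesis
  proof (rule that)
    show "trigpoly (\<lambda>x. h (circ x))" by (rule trigpoly_polynomial_circ[OF h(1)])
    show "\<bar>f x - h (circ x)\<bar> < e" if "x \<in> tcube" for x using h(2)[of "circ x"] g that by auto
  qed
qed

text \<open>The function is an a.e. limit of continuous ones. Truncation keeps the bound
  \<open>M\<close>; the factor \<open>min 1 (real n * pr x)\<close> forces zero on the faces, as
  \<open>trigpoly_approx\<close> requires, and tends to 1 inside. The additional 1 in the bound
  absorbs the approximation error.\<close>

lemma trigpoly_approx_bounded_measurable: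
  fixes q :: "real^'d::finite \<Rightarrow> real"
  assumes q: "q \<in> borel_measurable tmeas" and M: "\<And>x. \<bar>q x\<bar> \<le> M"
  obtains p where "\<And>n::nat. trigpoly (p n)" "\<And>n x. x \<in> tcube \<Longrightarrow> \<bar>p n x\<bar> \<le> M + 1"
    "AE x in tmeas. (\<lambda>n. p n x) \<longlonglongrightarrow> q x"
proof -
  have M0: "M \<ge> 0" using M[of 0] by linarith
  let ?q = "\<lambda>x. if x \<in> tcube then q x else 0"
  have "?q \<in> borel_measurable lebesgue"
    using q unfolding tmeas_def by (simp add: borel_measurable_if)
  from lebesgue_measurable_imp_measurable_on_real[OF this, of UNIV]
  obtain N g where N: "negligible N" and g: "\<And>n. continuous_on UNIV (g n)"
    and lim: "\<And>x. x \<notin> N \<Longrightarrow> (\<lambda>n. g n x) \<longlonglongrightarrow> ?q x"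
    unfolding measurable_on_def by auto
  define pr where "pr x = (\<Prod>i\<in>UNIV. x $ i * (2 * pi - x $ i))" for x :: "real^'d"
  have pr0: "pr x \<ge> 0" if "x \<in> tcube" for x
    using that unfolding pr_def by (intro prod_nonneg) (auto simp: tcube_def mem_box_cart)
  define h where "h n x = max (- M) (min M (g n x)) * min 1 (real n * pr x)" for n x
  have cpr: "continuous_on A pr" for A unfolding pr_def by (intro continuous_intros)
  have "continuous_on tcube (h n)" for n
    unfolding h_def by (intro continuous_intros cpr continuous_on_subset[OF g]) auto
  moreover have "h n x = 0" if "x \<in> tcube" "x $ i \<in> {0, 2 * pi}" for n x i
  proof -
    have "pr x = 0" unfolding pr_def using that(2) by (intro prod_zero bexI[of _ i]) auto
    then show ?thesis by (simp add: h_def)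
  qed
  ultimately have "\<exists>p. trigpoly p \<and> (\<forall>x\<in>tcube. \<bar>h n x - p x\<bar> < 1 / (real n + 1))" for n
    by (metis trigpoly_approx[of "h n" "1 / (real n + 1)"] of_nat_0_le_iff add_nonneg_pos zero_less_one zero_less_divide_1_iff)
  then obtain p where p: "\<And>n. trigpoly (p n)" "\<And>n x. x \<in> tcube \<Longrightarrow> \<bar>h n x - p n x\<bar> < 1 / (real n + 1)"
    by metis
  have hM: "\<bar>h n x\<bar> \<le> M" if "x \<in> tcube" for n x
  proof -
    have "\<bar>max (- M) (min M (g n x))\<bar> \<le> M" using M0 by auto
    moreover have "\<bar>min 1 (real n * pr x)\<bar> \<le> 1" using pr0[OF that] by (simp add: min_def abs_le_iff)
    ultimately show ?thesis unfolding h_def abs_mult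
      by (metis M0 abs_ge_zero mult.right_neutral mult_mono)
  qed
  show ?thesis
  proof (rule that[of p])
    show "\<bar>p n x\<bar> \<le> M + 1" if "x \<in> tcube" for n x
    proof -
      have "1 / (real n + 1) \<le> 1" by simp
      then show ?thesis using hM[OF that, of n] p(2)[OF that, of n] by linarith
    qed
    have "AE x in lebesgue. x \<notin> N" "AE x :: real^'d in lebesgue. x \<notin> tcube - box 0 (\<chi> i. 2 * pi)"
      unfolding AE_lebesgue_iff using N negligible_frontier_interval[of 0 "(\<chi> i. 2 * pi) :: real^'d"] by (simp_all add: tcube_def set_diff_eq)
    then have "AE x in lebesgue. x \<in> tcube \<longrightarrow> (\<lambda>n. p n x) \<longlonglongrightarrow> q x"
    proof (eventually_elim, intro impI)
      fix x assume x: "x \<notin> N" "x \<notin> tcube - box 0 (\<chi> i. 2 * pi)" "x \<in> tcube"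
      then have "pr x > 0" unfolding pr_def by (intro prod_pos) (auto simp: mem_box_cart)
      have "\<forall>\<^sub>F n in sequentially. real n \<ge> 1 / pr x"
        using eventually_ge_at_top[of "nat \<lceil>1 / pr x\<rceil>"] by eventually_elim linarith
      then have "\<forall>\<^sub>F n in sequentially. min 1 (real n * pr x) = 1"
        by eventually_elim (use \<open>pr x > 0\<close> in \<open>simp add: field_simps min_def\<close>)
      then have "(\<lambda>n. min 1 (real n * pr x)) \<longlonglongrightarrow> 1" by (rule tendsto_eventually)
      moreover have "(\<lambda>n. max (- M) (min M (g n x))) \<longlonglongrightarrow> max (- M) (min M (q x))"
        using lim[OF x(1)] x(3) by (intro tendsto_intros) auto
      moreover have "max (- M) (min M (q x)) = q x" using M[of x] by auto
      ultimately have "(\<lambda>n. h n x) \<longlonglongrightarrow> q x * 1" unfolding h_def by (metis tendsto_mult)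
      moreover have "(\<lambda>n. p n x - h n x) \<longlonglongrightarrow> 0"
      proof (rule Lim_null_comparison)
        show "\<forall>\<^sub>F n in sequentially. norm (p n x - h n x) \<le> 1 / (real n + 1)"
          using p(2)[OF x(3)] by (intro always_eventually) (simp add: abs_minus_commute less_imp_le)
        show "(\<lambda>n. 1 / (real n + 1)) \<longlonglongrightarrow> 0" using lim_1_over_n LIMSEQ_Suc[of "\<lambda>n. 1 / real n"] lim_const_over_n[of 1] by (simp add: add.commute)
      qed
      ultimately have "(\<lambda>n. p n x - h n x + h n x) \<longlonglongrightarrow> 0 + q x * 1" by (intro tendsto_add)
      then show "(\<lambda>n. p n x) \<longlonglongrightarrow> q x" by simp
    qed
    then show "AE x in tmeas. (\<lambda>n. p n x) \<longlonglongrightarrow> q x" by (simp add: AE_tmeas)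
  qed (rule p(1))
qed

lemma trigpoly_measurable: "trigpoly f \<Longrightarrow> f \<in> borel_measurable tmeas"
  by (intro measurable_lebesgue_tmeas measurable_completion) (simp add: borel_measurable_continuous_onI trigpoly_continuous)

lemma integrable_mult_bounded:
  fixes f g :: "'a \<Rightarrow> real"
  assumes "integrable M f" "g \<in> borel_measurable M" "AE x in M. \<bar>g x\<bar> \<le> K"
  shows "integrable M (\<lambda>x. f x * g x)"
proof (rule Bochner_Integration.integrable_bound)
  show "integrable M (\<lambda>x. K * f x)" using assms by simp
  show "AE x in M. norm (f x * g x) \<le> norm (K * f x)"
    using assms(3)
  proof eventually_elim
    fix x assume "\<bar>g x\<bar> \<le> K"
    then have "\<bar>g x\<bar> \<le> \<bar>K\<bar>" by linarith
    then show "norm (f x * g x) \<le> norm (K * f x)"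
      by (simp add: abs_mult mult.commute[of "\<bar>f x\<bar>"] mult_right_mono)
  qed
  show "(\<lambda>x. f x * g x) \<in> borel_measurable M" using assms by measurable
qed

lemma integrable_trigpoly:
  assumes "integrable tmeas f" "trigpoly p" shows "integrable tmeas (\<lambda>x. f x * p x)"
  using trigpoly_bounded[OF assms(2)] integrable_mult_bounded[OF assms(1) trigpoly_measurable[OF assms(2)]] by auto

text \<open>Trigonometric polynomials approximating \<open>sgn h\<close> boundedly a.e. turn the
  vanishing coefficients into a vanishing integral of the absolute value. Stated for integrable
  \<open>h\<close> because the kernel convolutions below are only known to be integrable.\<close>

theorem fourier_unique:
  fixes h :: "real^'d::finite \<Rightarrow> real"
  assumes h: "integrable tmeas h"
    and z: "\<And>k. lattice k \<Longrightarrow> fco cos h k = 0" "\<And>k. lattice k \<Longrightarrow> fco sin h k = 0"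
  shows "AE x in tmeas. h x = 0"
proof -
  have trig: "(\<integral>x. h x * p x \<partial>tmeas) = 0" if "trigpoly p" for p
    using that
  proof (induction rule: trigpoly.induct)
    case (add f g)
    then show ?case by (simp add: distrib_left integrable_trigpoly[OF h])
  next
    case (scale f c)
    have "(\<integral>x. h x * (c * f x) \<partial>tmeas) = (\<integral>x. c * (h x * f x) \<partial>tmeas)" by (simp add: mult_ac)
    then show ?case using scale by simp
  qed (use z in \<open>auto simp: fco_def\<close>)
  have hm [measurable]: "h \<in> borel_measurable tmeas" using h by auto
  have "(\<lambda>x. sgn (h x)) \<in> borel_measurable tmeas" by measurable
  moreover have "\<bar>sgn (h x)\<bar> \<le> 1" for x by (simp add: abs_sgn_eq)
  ultimately obtain p where p: "\<And>n::nat. trigpoly (p n)" "\<And>n x. x \<in> tcube \<Longrightarrow> \<bar>p n x\<bar> \<le> 1 + 1"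
    "AE x in tmeas. (\<lambda>n. p n x) \<longlonglongrightarrow> sgn (h x)"
    by (rule trigpoly_approx_bounded_measurable) blast
  have "(\<lambda>n. \<integral>x. h x * p n x \<partial>tmeas) \<longlonglongrightarrow> (\<integral>x. h x * sgn (h x) \<partial>tmeas)"
  proof (rule integral_dominated_convergence[where w="\<lambda>x. 2 * \<bar>h x\<bar>"])
    show "AE x in tmeas. (\<lambda>n. h x * p n x) \<longlonglongrightarrow> h x * sgn (h x)"
      using p(3) by eventually_elim (intro tendsto_intros)
    show "AE x in tmeas. norm (h x * p n x) \<le> 2 * \<bar>h x\<bar>" for n
      using p(2) by (intro AE_I2) (auto simp: abs_mult mult.commute intro!: mult_left_mono)
    show "integrable tmeas (\<lambda>x. 2 * \<bar>h x\<bar>)" using h by simp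
    show "(\<lambda>x. h x * p n x) \<in> borel_measurable tmeas" for n using trigpoly_measurable[OF p(1)[of n]] by measurable
  qed measurable
  then have "(\<integral>x. h x * sgn (h x) \<partial>tmeas) = 0" using trig[OF p(1)] by (simp add: LIMSEQ_const_iff)
  then have "(\<integral>x. \<bar>h x\<bar> \<partial>tmeas) = 0" by (simp add: abs_sgn)
  then show ?thesis using integral_nonneg_eq_0_iff_AE[of tmeas "\<lambda>x. \<bar>h x\<bar>"] h by simp
qed

definition tvol :: "'d::finite itself \<Rightarrow> real" where
  "tvol _ = measure lebesgue (tcube :: (real^'d) set)"

lemma tvol_pos: "tvol TYPE('d::finite) > 0"
proof -
  have "0 < Henstock_Kurzweil_Integration.content (cbox 0 (\<chi> i. 2 * pi) :: (real^'d) set)"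
    by (rule content_pos_lt) (auto simp: Basis_vec_def inner_axis)
  then show ?thesis unfolding tvol_def tcube_def by simp
qed

lemma integral_tmeas_const: "(\<integral>x. c \<partial>(tmeas :: (real^'d::finite) measure)) = c * tvol TYPE('d)"
  by (simp add: tmeas_def tvol_def measure_restrict_space)

lemma integrable_tmeas_const: "integrable (tmeas :: (real^'d::finite) measure) (\<lambda>x. c::real)"
  using finite_measure.integrable_const[OF finite_measure_tmeas] .

lemma integrable_tmeas_trigpoly: "trigpoly p \<Longrightarrow> integrable tmeas p"
  using integrable_trigpoly[OF integrable_tmeas_const[of 1]] by simp

text \<open>Translation by half a wavelength along \<open>k\<close> reverses the sign of both
  functions but preserves their integrals.\<close>

lemma integral_cos_sin:
  fixes k :: "real^'d::finite"
  assumes k: "lattice k" "k \<noteq> 0"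
  shows "(\<integral>x. cos (k \<bullet> x) \<partial>tmeas) = 0" "(\<integral>x. sin (k \<bullet> x) \<partial>tmeas) = 0"
proof -
  let ?a = "(pi / (k \<bullet> k)) *\<^sub>R k"
  have a: "k \<bullet> (x + ?a) = k \<bullet> x + pi" for x using k by (simp add: inner_add_right)
  have "(\<integral>x. cos (k \<bullet> (x + ?a)) \<partial>tmeas) = (\<integral>x. cos (k \<bullet> x) \<partial>tmeas)"
    "(\<integral>x. sin (k \<bullet> (x + ?a)) \<partial>tmeas) = (\<integral>x. sin (k \<bullet> x) \<partial>tmeas)"
    by (rule integral_periodic_translation; intro trigpoly_periodic integrable_tmeas_trigpoly trigpoly.intros k)+
  then show "(\<integral>x. cos (k \<bullet> x) \<partial>tmeas) = 0" "(\<integral>x. sin (k \<bullet> x) \<partial>tmeas) = 0"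
    unfolding a by simp_all
qed

section \<open>The Hilbert space of square integrable functions on the torus\<close>

lemma L2_measurable: "L2 f \<Longrightarrow> f \<in> borel_measurable tmeas"
  and L2_periodic: "L2 f \<Longrightarrow> periodic_fun f"
  and L2_square_integrable: "L2 f \<Longrightarrow> integrable tmeas (\<lambda>x. (f x)\<^sup>2)"
  by (auto simp: L2_def)

lemma L2_mult_integrable:
  assumes "L2 f" "L2 g" shows "integrable tmeas (\<lambda>x. f x * g x)"
proof (rule Bochner_Integration.integrable_bound)
  show "integrable tmeas (\<lambda>x. (f x)\<^sup>2 + (g x)\<^sup>2)" using assms by (simp add: L2_def)
  show "(\<lambda>x. f x * g x) \<in> borel_measurable tmeas"
    using assms L2_measurable by (intro borel_measurable_times) auto
  have "\<bar>a * b\<bar> \<le> a\<^sup>2 + b\<^sup>2" for a b :: real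
  proof -
    have "2 * \<bar>a * b\<bar> \<le> a\<^sup>2 + b\<^sup>2"
      using sum_squares_bound[of "\<bar>a\<bar>" "\<bar>b\<bar>"] by (simp add: abs_mult)
    then show ?thesis using abs_ge_zero[of "a * b"] by linarith
  qed
  then show "AE x in tmeas. norm (f x * g x) \<le> norm ((f x)\<^sup>2 + (g x)\<^sup>2)" by simp
qed

lemma L2_add: "L2 f \<Longrightarrow> L2 g \<Longrightarrow> L2 (\<lambda>x. f x + g x)"
  using L2_mult_integrable[of f g]
  by (auto simp: L2_def power2_sum mult.assoc intro: periodic_comp2 borel_measurable_add)

lemma L2_scale: "L2 f \<Longrightarrow> L2 (\<lambda>x. c * f x)"
  by (auto simp: L2_def power_mult_distrib intro: periodic_comp)

lemma L2_diff: "L2 f \<Longrightarrow> L2 g \<Longrightarrow> L2 (\<lambda>x. f x - g x)"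
  using L2_add[of f "\<lambda>x. (-1) * g x"] L2_scale[of g "-1"] by simp

lemma L2_uminus: "L2 f \<Longrightarrow> L2 (\<lambda>x. - f x)"
  using L2_scale[of f "-1"] by simp

lemma L2_bounded:
  assumes "periodic_fun f" "f \<in> borel_measurable tmeas" "\<And>x. \<bar>f x\<bar> \<le> K"
  shows "L2 f"
proof -
  have "integrable tmeas (\<lambda>x. 1 * (f x)\<^sup>2)"
  proof (rule integrable_mult_bounded[where K="K\<^sup>2"])
    have "(f x)\<^sup>2 \<le> K\<^sup>2" for x using assms(3)[of x] by (metis abs_ge_zero power2_abs power_mono)
    then show "AE x in tmeas. \<bar>(f x)\<^sup>2\<bar> \<le> K\<^sup>2" by simp
  qed (use assms integrable_tmeas_const in auto)
  with assms show ?thesis by (simp add: L2_def)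
qed

lemma L2_const: "L2 (\<lambda>x. c)"
  by (rule L2_bounded[where K="\<bar>c\<bar>"]) (auto simp: periodic_fun_def)

lemma L2_trigpoly: "trigpoly p \<Longrightarrow> L2 p"
  using trigpoly_bounded[of p] trigpoly_periodic[of p] trigpoly_measurable[of p] L2_bounded by blast

lemma L2_integrable: "L2 f \<Longrightarrow> integrable tmeas f"
  using L2_mult_integrable[OF _ L2_const[of 1]] by simp

lemma L2_abs: "L2 f \<Longrightarrow> L2 (\<lambda>x. \<bar>f x\<bar>)"
  by (auto simp: L2_def intro: periodic_comp)

section \<open>Passage to classes modulo null sets\<close>

definition l2rel :: "(real^'d::finite \<Rightarrow> real) \<Rightarrow> (real^'d \<Rightarrow> real) \<Rightarrow> bool" where
  "l2rel f g \<longleftrightarrow> L2 f \<and> L2 g \<and> (AE x in tmeas. f x = g x)"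

lemma part_equivp_l2rel: "part_equivp (l2rel :: (real^'d::finite \<Rightarrow> real) \<Rightarrow> _)"
proof (rule part_equivpI)
  show "\<exists>f. l2rel f (f :: real^'d \<Rightarrow> real)" using L2_const by (auto simp: l2rel_def)
  show "symp (l2rel :: (real^'d \<Rightarrow> real) \<Rightarrow> _)" by (auto simp: symp_def l2rel_def eq_commute)
  show "transp (l2rel :: (real^'d \<Rightarrow> real) \<Rightarrow> _)" by (auto simp: transp_def l2rel_def)
qed

quotient_type (overloaded) 'd l2 = "real^'d::finite \<Rightarrow> real" / partial: l2rel
  by (rule part_equivp_l2rel)

definition cls :: "(real^'d::finite \<Rightarrow> real) \<Rightarrow> 'd l2" where "cls = abs_l2"
definition rep :: "'d::finite l2 \<Rightarrow> real^'d \<Rightarrow> real" where "rep = rep_l2"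

lemma L2_rep: "L2 (rep x)"
  using Quotient_rep_reflp[OF Quotient_l2, of x] by (simp add: rep_def l2rel_def)

lemma cls_rep [simp]: "cls (rep x) = x"
  using Quotient_abs_rep[OF Quotient_l2] by (simp add: cls_def rep_def)

lemma cls_eq_iff: "L2 f \<Longrightarrow> L2 g \<Longrightarrow> cls f = cls g \<longleftrightarrow> (AE x in tmeas. f x = g x)"
  using Quotient_rel[OF Quotient_l2, of f g] by (auto simp: cls_def l2rel_def)

lemma rep_cls: "L2 f \<Longrightarrow> AE x in tmeas. rep (cls f) x = f x"
  using cls_eq_iff[OF L2_rep, of f "cls f"] by simp

lemma l2_cases: obtains f where "L2 f" "x = cls f"
  using L2_rep cls_rep by metis

definition l2add :: "'d::finite l2 \<Rightarrow> 'd l2 \<Rightarrow> 'd l2" where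
  "l2add x y = cls (\<lambda>z. rep x z + rep y z)"
definition l2scale :: "real \<Rightarrow> 'd::finite l2 \<Rightarrow> 'd l2" where
  "l2scale r x = cls (\<lambda>z. r * rep x z)"
definition l2inner :: "'d::finite l2 \<Rightarrow> 'd l2 \<Rightarrow> real" where
  "l2inner x y = (\<integral>z. rep x z * rep y z \<partial>tmeas)"

lemma l2add_cls: "L2 f \<Longrightarrow> L2 g \<Longrightarrow> l2add (cls f) (cls g) = cls (\<lambda>x. f x + g x)"
  unfolding l2add_def
  by (subst cls_eq_iff) (use rep_cls[of f] rep_cls[of g] in \<open>auto intro: L2_add L2_rep\<close>)

lemma l2scale_cls: "L2 f \<Longrightarrow> l2scale r (cls f) = cls (\<lambda>x. r * f x)"
  unfolding l2scale_def
  by (subst cls_eq_iff) (use rep_cls[of f] in \<open>auto intro: L2_scale L2_rep\<close>)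

lemma l2inner_cls:
  assumes "L2 f" "L2 g" shows "l2inner (cls f) (cls g) = (\<integral>x. f x * g x \<partial>tmeas)"
  unfolding l2inner_def
proof (rule integral_cong_AE)
  show "AE x in tmeas. rep (cls f) x * rep (cls g) x = f x * g x"
    using rep_cls[OF assms(1)] rep_cls[OF assms(2)] by eventually_elim simp
qed (use assms L2_measurable L2_rep in \<open>auto intro!: borel_measurable_times\<close>)

instantiation l2 :: (finite) real_vector
begin
definition zero_l2 :: "'a l2" where "0 = cls (\<lambda>x. 0)"
definition plus_l2 :: "'a l2 \<Rightarrow> 'a l2 \<Rightarrow> 'a l2" where "x + y = l2add x y"
definition minus_l2 :: "'a l2 \<Rightarrow> 'a l2 \<Rightarrow> 'a l2" where "x - y = l2add x (l2scale (- 1) y)"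
definition uminus_l2 :: "'a l2 \<Rightarrow> 'a l2" where "- x = l2scale (- 1) x"
definition scaleR_l2 :: "real \<Rightarrow> 'a l2 \<Rightarrow> 'a l2" where "r *\<^sub>R x = l2scale r x"

instance
proof
  fix x y z :: "'a l2" and r s :: real
  obtain f g h where f: "L2 f" "x = cls f" and g: "L2 g" "y = cls g" and h: "L2 h" "z = cls h"
    by (metis l2_cases)
  note L = f(1) g(1) h(1) L2_add L2_scale L2_uminus L2_const
  note C = f(2) g(2) h(2) l2add_cls l2scale_cls zero_l2_def plus_l2_def minus_l2_def uminus_l2_def scaleR_l2_def
  show "x + y + z = x + (y + z)" by (simp add: C L add.assoc)
  show "x + y = y + x" by (simp add: C L add.commute)
  show "0 + x = x" by (simp add: C L)
  show "- x + x = 0" by (simp add: C L)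
  show "x - y = x + - y" by (simp add: C L)
  show "r *\<^sub>R (x + y) = r *\<^sub>R x + r *\<^sub>R y" by (simp add: C L distrib_left)
  show "(r + s) *\<^sub>R x = r *\<^sub>R x + s *\<^sub>R x" by (simp add: C L distrib_right)
  show "r *\<^sub>R s *\<^sub>R x = (r * s) *\<^sub>R x" by (simp add: C L mult.assoc)
  show "1 *\<^sub>R x = x" by (simp add: C L)
qed
end

lemma cls_zero [simp]: "cls (\<lambda>x. 0) = 0" by (simp add: zero_l2_def)
lemma cls_add: "L2 f \<Longrightarrow> L2 g \<Longrightarrow> cls (\<lambda>x. f x + g x) = cls f + cls g"
  by (simp add: plus_l2_def l2add_cls)
lemma cls_scaleR: "L2 f \<Longrightarrow> cls (\<lambda>x. r * f x) = r *\<^sub>R cls f"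
  by (simp add: scaleR_l2_def l2scale_cls)
lemma cls_diff: "L2 f \<Longrightarrow> L2 g \<Longrightarrow> cls (\<lambda>x. f x - g x) = cls f - cls g"
  by (simp add: minus_l2_def l2add_cls l2scale_cls L2_uminus)

instantiation l2 :: (finite) real_inner
begin
definition inner_l2 :: "'a l2 \<Rightarrow> 'a l2 \<Rightarrow> real" where "inner x y = l2inner x y"
definition norm_l2 :: "'a l2 \<Rightarrow> real" where "norm x = sqrt (l2inner x x)"
definition sgn_l2 :: "'a l2 \<Rightarrow> 'a l2" where "sgn x = x /\<^sub>R sqrt (l2inner x x)"
definition dist_l2 :: "'a l2 \<Rightarrow> 'a l2 \<Rightarrow> real" where "dist x y = sqrt (l2inner (x - y) (x - y))"
definition uniformity_l2 :: "('a l2 \<times> 'a l2) filter" where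
  "uniformity = (INF e\<in>{0 <..}. principal {(x :: 'a l2, y). sqrt (l2inner (x - y) (x - y)) < e})"
definition open_l2 :: "'a l2 set \<Rightarrow> bool" where
  "open U \<longleftrightarrow> (\<forall>x\<in>U. \<forall>\<^sub>F (x', y) in (INF e\<in>{0 <..}. principal {(x :: 'a l2, y). sqrt (l2inner (x - y) (x - y)) < e}). x' = x \<longrightarrow> y \<in> U)"

instance
proof
  fix x y z :: "'a l2" and r s :: real
  obtain f g h where f: "L2 f" "x = cls f" and g: "L2 g" "y = cls g" and h: "L2 h" "z = cls h"
    by (metis l2_cases)
  note L = f(1) g(1) h(1) L2_add L2_scale
  note C = f(2) g(2) h(2) cls_add[symmetric] cls_scaleR[symmetric] inner_l2_def l2inner_cls
  show "dist x y = norm (x - y)" by (simp add: dist_l2_def norm_l2_def)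
  show "sgn x = x /\<^sub>R norm x" by (simp add: sgn_l2_def norm_l2_def)
  show "uniformity = (INF e\<in>{0 <..}. principal {(x :: 'a l2, y). dist x y < e})"
    by (simp add: uniformity_l2_def dist_l2_def)
  show "open U \<longleftrightarrow> (\<forall>x\<in>U. \<forall>\<^sub>F (x', y) in uniformity. x' = x \<longrightarrow> y \<in> U)" for U :: "'a l2 set"
    by (simp add: open_l2_def uniformity_l2_def)
  show "inner x y = inner y x" by (simp add: C L mult.commute)
  show "inner (x + y) z = inner x z + inner y z"
    by (simp add: C L distrib_right L2_mult_integrable)
  show "inner (r *\<^sub>R x) y = r * inner x y" by (simp add: C L mult.assoc)
  show "0 \<le> inner x x" by (simp add: C L)
  show "inner x x = 0 \<longleftrightarrow> x = 0"
    using integral_nonneg_eq_0_iff_AE[OF L2_square_integrable[OF f(1)]]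
    by (simp add: f(2) inner_l2_def l2inner_cls f(1) zero_l2_def cls_eq_iff L2_const power2_eq_square del: cls_zero)
  show "norm x = sqrt (inner x x)" by (simp add: norm_l2_def inner_l2_def)
qed

end

lemma inner_cls: "L2 f \<Longrightarrow> L2 g \<Longrightarrow> inner (cls f) (cls g) = (\<integral>x. f x * g x \<partial>tmeas)" by (simp add: inner_l2_def l2inner_cls)
lemma norm_cls: "L2 f \<Longrightarrow> (norm (cls f))\<^sup>2 = (\<integral>x. (f x)\<^sup>2 \<partial>tmeas)"
  by (simp only: power2_norm_eq_inner inner_cls) (simp add: power2_eq_square)

lemma cls_eq_0_iff: "L2 f \<Longrightarrow> cls f = 0 \<longleftrightarrow> (AE x in tmeas. f x = 0)"
  unfolding zero_l2_def by (rule cls_eq_iff) (auto intro: L2_const)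

lemma rep_add: "AE z in tmeas. rep (x + y) z = rep x z + rep y z"
  unfolding plus_l2_def l2add_def by (intro rep_cls L2_add L2_rep)
lemma rep_scaleR: "AE z in tmeas. rep (r *\<^sub>R x) z = r * rep x z"
  unfolding scaleR_l2_def l2scale_def by (intro rep_cls L2_scale L2_rep)

lemma measure_tmeas [simp]: "measure (tmeas :: (real^'d::finite) measure) tcube = tvol TYPE('d)"
  by (simp add: tmeas_def tvol_def measure_restrict_space)

lemma integral_abs_le_norm:
  assumes "L2 (f :: real^'d::finite \<Rightarrow> real)"
  shows "(\<integral>x. \<bar>f x\<bar> \<partial>tmeas) \<le> norm (cls f) * sqrt (tvol TYPE('d))"
proof -
  have "(\<integral>x. \<bar>f x\<bar> \<partial>tmeas) = inner (cls (\<lambda>x. \<bar>f x\<bar>)) (cls (\<lambda>x. 1))"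
    using assms by (simp add: inner_cls L2_abs L2_const)
  also have "\<dots> \<le> norm (cls (\<lambda>x. \<bar>f x\<bar>)) * norm (cls (\<lambda>x::real^'d. 1))" by (rule norm_cauchy_schwarz)
  also have "norm (cls (\<lambda>x. \<bar>f x\<bar>)) = norm (cls f)"
    using norm_cls[OF L2_abs[OF assms]] norm_cls[OF assms]
    by (intro power2_eq_imp_eq[OF _ norm_ge_zero norm_ge_zero]) simp
  also have "norm (cls (\<lambda>x::real^'d. 1)) = sqrt (tvol TYPE('d))"
    by (rule real_sqrt_unique[symmetric]) (simp_all add: norm_cls L2_const integral_tmeas_const)
  finally show ?thesis .
qed

text \<open>On a finite measure space Cauchy-Schwarz makes the sequence Cauchy in L^1, so a
  subsequence converges a.e.; Fatou's lemma then bounds the L^2 distance of its limit to the terms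
  of the sequence.\<close>

instance l2 :: (finite) banach
proof
  fix X :: "nat \<Rightarrow> 'a l2" assume X: "Cauchy X"
  define f where "f n = rep (X n)" for n
  have Lf: "L2 (f n)" for n by (simp add: f_def L2_rep)
  have cf: "cls (f n) = X n" for n by (simp add: f_def)
  have Ld: "L2 (\<lambda>x. f i x - f j x)" for i j by (intro L2_diff Lf)
  have cd: "cls (\<lambda>x. f i x - f j x) = X i - X j" for i j by (simp add: cls_diff Lf cf)
  define V where "V = sqrt (tvol TYPE('a))"
  have V: "V > 0" using tvol_pos by (simp add: V_def)
  have cau: "\<exists>N. \<forall>i\<ge>N. \<forall>j\<ge>N. (\<integral>x. norm (f i x - f j x) \<partial>tmeas) < e" if e: "e > 0" for e
  proof -
    obtain N where N: "\<And>i j. i \<ge> N \<Longrightarrow> j \<ge> N \<Longrightarrow> norm (X i - X j) < e / V"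
      using X e V unfolding Cauchy_def dist_norm by (meson divide_pos_pos)
    have "(\<integral>x. norm (f i x - f j x) \<partial>tmeas) < e" if "i \<ge> N" "j \<ge> N" for i j
      using integral_abs_le_norm[OF Ld, of i j] N[OF that] V unfolding cd V_def[symmetric]
      by (simp add: pos_less_divide_eq)
    then show ?thesis by blast
  qed
  obtain r where r: "strict_mono r" and ae: "AE x in tmeas. Cauchy (\<lambda>i. f (r i) x)"
    by (rule cauchy_L1_AE_cauchy_subseq[of tmeas f, OF L2_integrable[OF Lf] cau])
  \<comment> \<open>\<open>lim\<close> has a value at every point and depends only on the sequence
    there, so \<open>g\<close> is periodic everywhere, including outside the set of
    convergence.\<close>
  define g where "g x = lim (\<lambda>i. f (r i) x)" for x
  have gper: "periodic_fun g"
    using L2_periodic[OF Lf] by (simp add: g_def periodic_fun_def)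
  have fm [measurable]: "f n \<in> borel_measurable tmeas" for n by (rule L2_measurable[OF Lf])
  have gm [measurable]: "g \<in> borel_measurable tmeas" unfolding g_def by measurable
  have lim: "AE x in tmeas. (\<lambda>i. f (r i) x) \<longlonglongrightarrow> g x"
    using ae unfolding g_def by eventually_elim (simp add: Cauchy_convergent_iff convergent_LIMSEQ_iff)
  have key: "(\<integral>\<^sup>+x. ennreal ((g x - f n x)\<^sup>2) \<partial>tmeas) \<le> ennreal (e\<^sup>2)"
    if N: "\<And>i. i \<ge> N \<Longrightarrow> norm (X i - X n) \<le> e" for n N e
  proof -
    have "(\<integral>\<^sup>+x. ennreal ((g x - f n x)\<^sup>2) \<partial>tmeas) = (\<integral>\<^sup>+x. liminf (\<lambda>i. ennreal ((f (r i) x - f n x)\<^sup>2)) \<partial>tmeas)"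
    proof (rule nn_integral_cong_AE)
      show "AE x in tmeas. ennreal ((g x - f n x)\<^sup>2) = liminf (\<lambda>i. ennreal ((f (r i) x - f n x)\<^sup>2))"
        using lim
      proof eventually_elim
        case (elim x)
        have "(\<lambda>i. ennreal ((f (r i) x - f n x)\<^sup>2)) \<longlonglongrightarrow> ennreal ((g x - f n x)\<^sup>2)"
          by (intro tendsto_ennrealI tendsto_intros elim)
        then show ?case by (intro lim_imp_Liminf[symmetric]) auto
      qed
    qed
    also have "\<dots> \<le> liminf (\<lambda>i. \<integral>\<^sup>+x. ennreal ((f (r i) x - f n x)\<^sup>2) \<partial>tmeas)"
      by (rule nn_integral_liminf) measurable
    also have "\<dots> \<le> limsup (\<lambda>i. \<integral>\<^sup>+x. ennreal ((f (r i) x - f n x)\<^sup>2) \<partial>tmeas)"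
      by (rule Liminf_le_Limsup) simp
    also have "\<dots> \<le> ennreal (e\<^sup>2)"
    proof (rule Limsup_bounded)
      have "(\<integral>\<^sup>+x. ennreal ((f (r i) x - f n x)\<^sup>2) \<partial>tmeas) \<le> ennreal (e\<^sup>2)" if "i \<ge> N" for i
      proof -
        have "(\<integral>\<^sup>+x. ennreal ((f (r i) x - f n x)\<^sup>2) \<partial>tmeas) = ennreal ((norm (X (r i) - X n))\<^sup>2)"
          using norm_cls[OF Ld, of "r i" n] L2_square_integrable[OF Ld, of "r i" n]
          by (simp add: cd nn_integral_eq_integral)
        moreover have "norm (X (r i) - X n) \<le> e" using N[of "r i"] that seq_suble[OF r, of i] by simp
        ultimately show ?thesis by (simp add: ennreal_leI power_mono)
      qed
      then show "\<forall>\<^sub>F i in sequentially. (\<integral>\<^sup>+x. ennreal ((f (r i) x - f n x)\<^sup>2) \<partial>tmeas) \<le> ennreal (e\<^sup>2)"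
        by (auto simp: eventually_sequentially)
    qed
    finally show ?thesis .
  qed
  have Lgf: "L2 (\<lambda>x. g x - f n x)" and ngf: "norm (cls (\<lambda>x. g x - f n x)) \<le> e"
    if e: "\<And>i. i \<ge> N \<Longrightarrow> norm (X i - X n) \<le> e" for n N e
  proof -
    have e0: "e \<ge> 0" using e[of N] norm_ge_zero order_trans by blast
    have k: "(\<integral>\<^sup>+x. ennreal ((g x - f n x)\<^sup>2) \<partial>tmeas) \<le> ennreal (e\<^sup>2)" by (rule key[OF e])
    then have "(\<integral>\<^sup>+x. ennreal (norm ((g x - f n x)\<^sup>2)) \<partial>tmeas) < \<infinity>"
      using le_less_trans ennreal_less_top by fastforce
    then have "integrable tmeas (\<lambda>x. (g x - f n x)\<^sup>2)" by (simp add: integrable_iff_bounded)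
    then show L: "L2 (\<lambda>x. g x - f n x)" using gper L2_periodic[OF Lf, of n]
      by (simp add: L2_def periodic_comp2[of g "f n" "(-)"])
    have "ennreal ((norm (cls (\<lambda>x. g x - f n x)))\<^sup>2) \<le> ennreal (e\<^sup>2)"
      using k L2_square_integrable[OF L] by (simp add: norm_cls[OF L] nn_integral_eq_integral)
    then have "(norm (cls (\<lambda>x. g x - f n x)))\<^sup>2 \<le> e\<^sup>2" by (simp add: ennreal_le_iff)
    then show "norm (cls (\<lambda>x. g x - f n x)) \<le> e" using e0 by (rule power2_le_imp_le)
  qed
  obtain N0 where "\<And>i. i \<ge> N0 \<Longrightarrow> norm (X i - X N0) \<le> 1"
    using X unfolding Cauchy_def dist_norm by (meson le_refl less_imp_le zero_less_one)
  from L2_add[OF Lgf[OF this] Lf[of N0]] have Lg: "L2 g" by simp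
  have "X \<longlonglongrightarrow> cls g"
  proof (rule LIMSEQ_I)
    fix e :: real assume "e > 0"
    then obtain N where N: "\<And>i j. i \<ge> N \<Longrightarrow> j \<ge> N \<Longrightarrow> norm (X i - X j) < e / 2"
      using X unfolding Cauchy_def dist_norm by (meson half_gt_zero)
    have "norm (X n - cls g) < e" if "n \<ge> N" for n
    proof -
      have "norm (cls (\<lambda>x. g x - f n x)) \<le> e / 2"
        by (rule ngf[of N]) (use N that in \<open>auto intro: less_imp_le\<close>)
      then show ?thesis using \<open>e > 0\<close> by (simp add: cls_diff Lg Lf cf norm_minus_commute)
    qed
    then show "\<exists>N. \<forall>n\<ge>N. norm (X n - cls g) < e" by blast
  qed
  then show "convergent X" by (auto simp: convergent_def)
qed

subsection \<open>Multiplication operators\<close>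

definition bmp :: "(real^'d::finite \<Rightarrow> real) \<Rightarrow> bool" where
  "bmp q \<longleftrightarrow> periodic_fun q \<and> q \<in> borel_measurable tmeas \<and> (\<exists>K. \<forall>x. \<bar>q x\<bar> \<le> K)"

definition mult :: "(real^'d::finite \<Rightarrow> real) \<Rightarrow> 'd l2 \<Rightarrow> 'd l2" where
  "mult q x = cls (\<lambda>z. q z * rep x z)"

lemma L2_mult_bmp: assumes "bmp q" "L2 f" shows "L2 (\<lambda>x. q x * f x)"
proof -
  obtain K where K: "\<And>x. \<bar>q x\<bar> \<le> K" using assms by (auto simp: bmp_def)
  have qm: "q \<in> borel_measurable tmeas" using assms by (auto simp: bmp_def)
  have "integrable tmeas (\<lambda>x. (f x)\<^sup>2 * (q x)\<^sup>2)"
  proof (rule integrable_mult_bounded[where K="K\<^sup>2"])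
    have "(q x)\<^sup>2 \<le> K\<^sup>2" for x using K[of x] by (metis abs_ge_zero power2_abs power_mono)
    then show "AE x in tmeas. \<bar>(q x)\<^sup>2\<bar> \<le> K\<^sup>2" by simp
  qed (use assms qm L2_square_integrable in auto)
  then show ?thesis
    using assms qm by (auto simp: L2_def bmp_def power_mult_distrib mult.commute intro: periodic_comp2)
qed

lemma mult_cls: assumes "bmp q" "L2 f" shows "mult q (cls f) = cls (\<lambda>x. q x * f x)"
  unfolding mult_def
  by (subst cls_eq_iff) (use rep_cls[OF assms(2)] assms in \<open>auto intro: L2_mult_bmp L2_rep\<close>)

lemma mult_add: "bmp q \<Longrightarrow> mult q (x + y) = mult q x + mult q y"
  by (cases x rule: l2_cases, cases y rule: l2_cases)
     (simp add: cls_add[symmetric] mult_cls L2_mult_bmp L2_add distrib_left)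

lemma mult_scaleR: "bmp q \<Longrightarrow> mult q (r *\<^sub>R x) = r *\<^sub>R mult q x"
  by (cases x rule: l2_cases)
     (simp add: cls_scaleR[symmetric] mult_cls L2_mult_bmp L2_scale mult.left_commute)

lemma linear_mult: "bmp q \<Longrightarrow> linear (mult q)"
  by (rule linearI) (simp_all add: mult_add mult_scaleR)

lemma mult_norm_le:
  assumes "bmp q" "\<And>z. \<bar>q z\<bar> \<le> K" shows "norm (mult q x) \<le> K * norm x"
proof -
  have K: "K \<ge> 0" using assms(2)[of 0] by linarith
  obtain f where f: "L2 f" "x = cls f" by (rule l2_cases)
  have "(norm (mult q x))\<^sup>2 = (\<integral>z. (q z * f z)\<^sup>2 \<partial>tmeas)"
    using f assms by (simp add: mult_cls norm_cls L2_mult_bmp)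
  also have "\<dots> \<le> (\<integral>z. K\<^sup>2 * (f z)\<^sup>2 \<partial>tmeas)"
  proof (rule integral_mono)
    show "integrable tmeas (\<lambda>z. (q z * f z)\<^sup>2)" by (rule L2_square_integrable[OF L2_mult_bmp[OF assms(1) f(1)]])
    show "integrable tmeas (\<lambda>z. K\<^sup>2 * (f z)\<^sup>2)" using L2_square_integrable[OF f(1)] by simp
    fix z have "(q z)\<^sup>2 \<le> K\<^sup>2" using assms(2)[of z] by (metis abs_ge_zero power2_abs power_mono)
    then show "(q z * f z)\<^sup>2 \<le> K\<^sup>2 * (f z)\<^sup>2" by (simp add: power_mult_distrib mult_right_mono)
  qed
  also have "\<dots> = (K * norm x)\<^sup>2" using f by (simp add: norm_cls power_mult_distrib)
  finally show ?thesis by (rule power2_le_imp_le) (simp add: K)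
qed

lemma bounded_linear_mult: "bmp q \<Longrightarrow> bounded_linear (mult q)"
proof -
  assume q: "bmp q"
  then obtain K where K: "\<And>z. \<bar>q z\<bar> \<le> K" by (auto simp: bmp_def)
  show ?thesis
    by (rule bounded_linear_intro[where K=K]) (simp_all add: mult_add mult_scaleR mult_norm_le q K mult.commute)
qed

lemma bmp_mult: assumes "bmp p" "bmp q" shows "bmp (\<lambda>x. p x * q x)"
proof -
  obtain K L where *: "\<And>x. \<bar>p x\<bar> \<le> K" "\<And>x. \<bar>q x\<bar> \<le> L" using assms by (auto simp: bmp_def)
  have "\<bar>p x * q x\<bar> \<le> K * L" for x
    unfolding abs_mult using *(1)[of x] *(2)[of x] by (intro mult_mono) auto
  then show ?thesis using assms by (auto simp: bmp_def intro: periodic_comp2)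
qed

lemma mult_mult: "bmp p \<Longrightarrow> bmp q \<Longrightarrow> mult p (mult q x) = mult (\<lambda>z. p z * q z) x"
  by (cases x rule: l2_cases) (simp add: mult_cls bmp_mult L2_mult_bmp mult.assoc)

lemma mult_commute: "bmp p \<Longrightarrow> bmp q \<Longrightarrow> mult p (mult q x) = mult q (mult p x)"
  by (simp add: mult_mult mult.commute)

lemma bmp_trigpoly: "trigpoly p \<Longrightarrow> bmp p"
  by (simp add: bmp_def trigpoly_periodic trigpoly_measurable trigpoly_bounded)

lemma bmp_const: "bmp (\<lambda>x. c)"
  by (rule bmp_trigpoly[OF trigpoly_const])

lemma mult_const [simp]: "mult (\<lambda>x. c) x = c *\<^sub>R x"
  by (cases x rule: l2_cases) (simp add: mult_cls bmp_const cls_scaleR)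

lemma mult_fun_add: "bmp p \<Longrightarrow> bmp q \<Longrightarrow> bmp (\<lambda>z. p z + q z) \<Longrightarrow> mult (\<lambda>z. p z + q z) x = mult p x + mult q x"
  by (cases x rule: l2_cases) (simp add: mult_cls cls_add[symmetric] L2_mult_bmp distrib_right)

lemma mult_fun_diff: "bmp p \<Longrightarrow> bmp q \<Longrightarrow> bmp (\<lambda>z. p z - q z) \<Longrightarrow> mult (\<lambda>z. p z - q z) x = mult p x - mult q x"
  by (cases x rule: l2_cases) (simp add: mult_cls cls_diff[symmetric] L2_mult_bmp left_diff_distrib)

lemma mult_fun_scale: "bmp p \<Longrightarrow> mult (\<lambda>z. c * p z) x = c *\<^sub>R mult p x"
  using mult_mult[OF bmp_const, of p c x] by simp

subsection \<open>Fourier modes and the spectral projections of the Laplacian\<close>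

definition cosk :: "real^'d::finite \<Rightarrow> 'd l2" where "cosk k = cls (\<lambda>x. cos (k \<bullet> x))"
definition sink :: "real^'d::finite \<Rightarrow> 'd l2" where "sink k = cls (\<lambda>x. sin (k \<bullet> x))"

lemma fco_cos: "lattice k \<Longrightarrow> L2 f \<Longrightarrow> fco cos f k = inner (cls f) (cosk k)"
  unfolding fco_def cosk_def by (simp add: inner_cls L2_trigpoly trigpoly.cos)
lemma fco_sin: "lattice k \<Longrightarrow> L2 f \<Longrightarrow> fco sin f k = inner (cls f) (sink k)"
  unfolding fco_def sink_def by (simp add: inner_cls L2_trigpoly trigpoly.sin)

lemma cosk_uminus [simp]: "cosk (- k) = cosk k" by (simp add: cosk_def)
lemma sink_uminus: "lattice k \<Longrightarrow> sink (- k) = - sink k"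
  using cls_scaleR[OF L2_trigpoly[OF trigpoly.sin], of k "-1"] by (simp add: sink_def)

text \<open>Both k and -k index the same pair of modes up to sign, which explains the second
  indicator and the factor 1/2; at k = 0 the two indicators add up or cancel.\<close>

lemma inner_modes:
  fixes k l :: "real^'d::finite"
  assumes k: "lattice k" and l: "lattice l"
  shows "inner (cosk k) (cosk l) = tvol TYPE('d) / 2 * (of_bool (k = l) + of_bool (k = - l))"
    and "inner (sink k) (sink l) = tvol TYPE('d) / 2 * (of_bool (k = l) - of_bool (k = - l))"
    and "inner (cosk k) (sink l) = 0"
    and "inner (sink l) (cosk k) = 0"
proof -
  have c: "(\<integral>x. cos (m \<bullet> x) \<partial>tmeas) = tvol TYPE('d) * of_bool (m = 0)" if "lattice m" for m :: "real^'d"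
    using integral_cos_sin(1)[OF that] integral_tmeas_const[where 'd='d, of 1] by (cases "m = 0") auto
  have s: "(\<integral>x. sin (m \<bullet> x) \<partial>tmeas) = 0" if "lattice m" for m :: "real^'d"
    using integral_cos_sin(2)[OF that] by (cases "m = 0") auto
  have ic: "integrable tmeas (\<lambda>x. cos (m \<bullet> x))" and isn: "integrable tmeas (\<lambda>x. sin (m \<bullet> x))" if "lattice m" for m :: "real^'d"
    using that by (auto intro: integrable_tmeas_trigpoly trigpoly.intros)
  note L = lattice_add[OF k l] lattice_diff[OF k l]
  have "inner (cosk k) (cosk l) = (\<integral>x. cos (k \<bullet> x) * cos (l \<bullet> x) \<partial>tmeas)"
    unfolding cosk_def by (intro inner_cls L2_trigpoly trigpoly.cos k l)
  also have "\<dots> = (\<integral>x. cos ((k - l) \<bullet> x) / 2 + cos ((k + l) \<bullet> x) / 2 \<partial>tmeas)"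
    by (rule arg_cong[where f="integral\<^sup>L tmeas"]) (auto simp: inner_diff_left inner_add_left cos_diff cos_add field_simps)
  also have "\<dots> = tvol TYPE('d) / 2 * (of_bool (k = l) + of_bool (k = - l))"
    using L by (simp add: ic c eq_neg_iff_add_eq_0 distrib_left)
  finally show "inner (cosk k) (cosk l) = tvol TYPE('d) / 2 * (of_bool (k = l) + of_bool (k = - l))" .
  have "inner (sink k) (sink l) = (\<integral>x. sin (k \<bullet> x) * sin (l \<bullet> x) \<partial>tmeas)"
    unfolding sink_def by (intro inner_cls L2_trigpoly trigpoly.sin k l)
  also have "\<dots> = (\<integral>x. cos ((k - l) \<bullet> x) / 2 - cos ((k + l) \<bullet> x) / 2 \<partial>tmeas)"
    by (rule arg_cong[where f="integral\<^sup>L tmeas"]) (auto simp: inner_diff_left inner_add_left cos_diff cos_add field_simps)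
  also have "\<dots> = tvol TYPE('d) / 2 * (of_bool (k = l) - of_bool (k = - l))"
    using L by (simp add: ic c eq_neg_iff_add_eq_0 right_diff_distrib)
  finally show "inner (sink k) (sink l) = tvol TYPE('d) / 2 * (of_bool (k = l) - of_bool (k = - l))" .
  have "inner (cosk k) (sink l) = (\<integral>x. cos (k \<bullet> x) * sin (l \<bullet> x) \<partial>tmeas)"
    unfolding cosk_def sink_def by (intro inner_cls L2_trigpoly trigpoly.cos trigpoly.sin k l)
  also have "\<dots> = (\<integral>x. sin ((k + l) \<bullet> x) / 2 - sin ((k - l) \<bullet> x) / 2 \<partial>tmeas)"
    by (rule arg_cong[where f="integral\<^sup>L tmeas"]) (auto simp: inner_diff_left inner_add_left sin_diff sin_add field_simps)
  also have "\<dots> = 0" using L by (simp add: isn s)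
  finally show "inner (cosk k) (sink l) = 0" .
  then show "inner (sink l) (cosk k) = 0" by (simp add: inner_commute)
qed

lemma lattice_of_int:
  assumes "lattice k" obtains f where "\<And>i. k $ i = of_int (f i)"
proof -
  have "\<forall>i. \<exists>m::int. k $ i = of_int m"
    using assms by (auto simp: lattice_def elim!: Ints_cases)
  then obtain f where "\<forall>i. k $ i = of_int (f i)" by (rule choice[THEN exE])
  then show ?thesis using that by blast
qed

text \<open>The lattice frequencies of Laplace eigenvalue -n. If n is not a sum of d squares, the
  shell is empty and \<open>eigproj n\<close> is zero.\<close>

definition shell :: "nat \<Rightarrow> (real^'d::finite) set" where
  "shell n = {k. lattice k \<and> k \<bullet> k = real n}"

lemma finite_shell: "finite (shell n :: (real^'d::finite) set)"
proof -
  let ?S = "{m::int. \<bar>m\<bar> \<le> int n + 1}"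
  have "(shell n :: (real^'d) set) \<subseteq> (\<lambda>f. \<chi> i. of_int (f i)) ` (PiE UNIV (\<lambda>_. ?S))"
  proof
    fix k :: "real^'d" assume k: "k \<in> shell n"
    then obtain f where f: "\<And>i. k $ i = of_int (f i)"
      using lattice_of_int[of k] by (auto simp: shell_def)
    have "\<bar>f i\<bar> \<le> int n + 1" for i
    proof -
      have "(k $ i)\<^sup>2 \<le> k \<bullet> k" unfolding inner_vec_def
        by (simp add: power2_eq_square) (rule member_le_sum, auto)
      then have "(of_int (f i))\<^sup>2 \<le> (of_int (int n) :: real)" using k f by (simp add: shell_def)
      then have "(f i)\<^sup>2 \<le> int n" by (simp only: of_int_power[symmetric] of_int_le_iff)
      moreover have "\<bar>f i\<bar> \<le> (f i)\<^sup>2" 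
        using mult_left_mono[of 1 "\<bar>f i\<bar>" "\<bar>f i\<bar>"] by (cases "f i = 0") (auto simp: power2_eq_square)
      ultimately show ?thesis by linarith
    qed
    moreover have "k = (\<chi> i. of_int (f i))" using f by (simp add: vec_eq_iff)
    ultimately show "k \<in> (\<lambda>f. \<chi> i. of_int (f i)) ` (PiE UNIV (\<lambda>_. ?S))" by auto
  qed
  moreover have "finite ?S" by (rule finite_subset[of _ "{-(int n + 1)..int n + 1}"]) auto
  then have "finite (PiE (UNIV :: 'd set) (\<lambda>_. ?S))" by (intro finite_PiE) auto
  then have "finite ((\<lambda>f. (\<chi> i. of_int (f i)) :: real^'d) ` (PiE UNIV (\<lambda>_. ?S)))" by (rule finite_imageI)
  ultimately show ?thesis by (rule finite_subset)
qed

lemma lattice_shell: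
  assumes "lattice k" obtains n where "k \<in> shell n"
proof -
  obtain f where f: "\<And>i. k $ i = of_int (f i)"
    using lattice_of_int[OF assms] by blast
  have "k \<bullet> k = of_int (\<Sum>i\<in>UNIV. f i * f i)" by (simp add: inner_vec_def f)
  moreover have "(\<Sum>i\<in>UNIV. f i * f i) \<ge> 0" by (intro sum_nonneg) simp
  ultimately have "k \<bullet> k = real (nat (\<Sum>i\<in>UNIV. f i * f i))" by simp
  then show ?thesis using assms that by (auto simp: shell_def)
qed

lemma shell_uminus: "k \<in> shell n \<Longrightarrow> - k \<in> shell n"
  by (simp add: shell_def lattice_uminus)

lemma shell_unique: "k \<in> shell n \<Longrightarrow> k \<in> shell m \<Longrightarrow> n = m"
  by (simp add: shell_def)

text \<open>Orthogonal projection onto an eigenspace: for k nonzero the modes have squared norm V/2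
  and occur twice in the shell, through k and -k, so the normalisation is 1/V.\<close>

definition eigproj :: "nat \<Rightarrow> 'd::finite l2 \<Rightarrow> 'd l2" where
  "eigproj n x = (1 / tvol TYPE('d)) *\<^sub>R (\<Sum>k\<in>shell n. inner x (cosk k) *\<^sub>R cosk k + inner x (sink k) *\<^sub>R sink k)"

lemma inner_eigproj:
  "inner (eigproj n x) (y :: 'd::finite l2) = (1 / tvol TYPE('d)) *
     (\<Sum>k\<in>shell n. inner x (cosk k) * inner y (cosk k) + inner x (sink k) * inner y (sink k))"
  unfolding eigproj_def inner_scaleR_left inner_sum_left inner_add_left by (simp add: inner_commute[of y])

lemma sum_shell_pm:
  fixes l :: "real^'d::finite" and g :: "real^'d \<Rightarrow> real"
  assumes l: "l \<in> shell m"
  shows "(\<Sum>k\<in>shell n. g k * of_bool (k = l)) = of_bool (n = m) * g l"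
    and "(\<Sum>k\<in>shell n. g k * of_bool (k = - l)) = of_bool (n = m) * g (- l)"
proof -
  have *: "(\<Sum>k\<in>shell n. g k * of_bool (k = a)) = of_bool (n = m) * g a" if "a \<in> shell m" for a
  proof -
    have "(\<Sum>k\<in>shell n. g k * of_bool (k = a)) = (\<Sum>k\<in>shell n. if k = a then g k else 0)"
      by (rule sum.cong) auto
    also have "\<dots> = (if a \<in> shell n then g a else 0)" by (simp add: finite_shell)
    also have "\<dots> = of_bool (n = m) * g a" using that shell_unique by auto
    finally show ?thesis .
  qed
  show "(\<Sum>k\<in>shell n. g k * of_bool (k = l)) = of_bool (n = m) * g l" by (rule *[OF l])
  show "(\<Sum>k\<in>shell n. g k * of_bool (k = - l)) = of_bool (n = m) * g (- l)" by (rule *[OF shell_uminus[OF l]])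
qed

lemma inner_eigproj_modes:
  fixes l :: "real^'d::finite"
  assumes l: "l \<in> shell m"
  shows "inner (eigproj n x) (cosk l) = of_bool (n = m) * inner x (cosk l)"
    and "inner (eigproj n x) (sink l) = of_bool (n = m) * inner x (sink l)"
proof -
  let ?V = "tvol TYPE('d)"
  have V: "?V \<noteq> 0" using tvol_pos[where 'd='d] by simp
  have ll: "lattice l" using l by (simp add: shell_def)
  have "inner (eigproj n x) (cosk l) = (1 / ?V) * (\<Sum>k\<in>shell n. inner x (cosk k) * (?V / 2 * (of_bool (k = l) + of_bool (k = - l))))"
    unfolding inner_eigproj
    by (intro arg_cong2[where f=times] sum.cong refl)
       (auto simp: shell_def inner_modes ll eq_commute[of l] minus_equation_iff[of l])
  also have "\<dots> = (1 / ?V) * (?V / 2) * ((\<Sum>k\<in>shell n. inner x (cosk k) * of_bool (k = l)) + (\<Sum>k\<in>shell n. inner x (cosk k) * of_bool (k = - l)))"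
    by (simp add: sum_distrib_left sum.distrib[symmetric] distrib_left mult_ac)
  also have "\<dots> = of_bool (n = m) * inner x (cosk l)"
    unfolding sum_shell_pm[OF l] using V by simp
  finally show "inner (eigproj n x) (cosk l) = of_bool (n = m) * inner x (cosk l)" .
  have "inner (eigproj n x) (sink l) = (1 / ?V) * (\<Sum>k\<in>shell n. inner x (sink k) * (?V / 2 * (of_bool (k = l) - of_bool (k = - l))))"
    unfolding inner_eigproj
    by (intro arg_cong2[where f=times] sum.cong refl)
       (auto simp: shell_def inner_modes ll eq_commute[of l] minus_equation_iff[of l])
  also have "\<dots> = (1 / ?V) * (?V / 2) * ((\<Sum>k\<in>shell n. inner x (sink k) * of_bool (k = l)) - (\<Sum>k\<in>shell n. inner x (sink k) * of_bool (k = - l)))"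
    by (simp add: sum_distrib_left sum_subtractf[symmetric] right_diff_distrib mult_ac)
  also have "\<dots> = of_bool (n = m) * inner x (sink l)"
    unfolding sum_shell_pm[OF l] using V by (simp add: sink_uminus[OF ll])
  finally show "inner (eigproj n x) (sink l) = of_bool (n = m) * inner x (sink l)" .
qed

lemma modes_total:
  assumes "\<And>k. lattice k \<Longrightarrow> inner x (cosk k) = 0" "\<And>k. lattice k \<Longrightarrow> inner x (sink k) = 0"
  shows "x = 0"
proof -
  have "AE z in tmeas. rep x z = 0"
    by (rule fourier_unique) (use assms in \<open>auto simp: fco_cos fco_sin L2_rep intro: L2_integrable L2_rep\<close>)
  then show ?thesis using cls_eq_0_iff[OF L2_rep, of x] by simp
qed

global_interpretation sp: spectral "eigproj :: nat \<Rightarrow> 'd::finite l2 \<Rightarrow> 'd l2"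
  defines cal = sp.cal
proof (rule spectral.intro)
  show "linear (eigproj n :: 'd l2 \<Rightarrow> 'd l2)" for n
    unfolding eigproj_def
    by (rule linearI) (simp_all add: inner_add_left scaleR_add_left scaleR_add_right sum.distrib[symmetric] scaleR_sum_right add_ac)
  show "inner (eigproj n x) y = inner x (eigproj n y)" for n and x y :: "'d l2"
    unfolding inner_commute[of x] inner_eigproj by (simp add: mult.commute)
  show "eigproj n (eigproj m x) = (if n = m then eigproj n x else 0)" for n m and x :: "'d l2"
  proof -
    have "eigproj n (eigproj m x) = (1 / tvol TYPE('d)) *\<^sub>R (\<Sum>k\<in>shell n. (of_bool (m = n) * inner x (cosk k)) *\<^sub>R cosk k + (of_bool (m = n) * inner x (sink k)) *\<^sub>R sink k)"
      unfolding eigproj_def[of n "eigproj m x"]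
      by (intro arg_cong2[where f=scaleR] sum.cong refl) (simp add: inner_eigproj_modes)
    also have "\<dots> = (if n = m then eigproj n x else 0)"
      by (cases "n = m") (simp_all add: eigproj_def)
    finally show ?thesis .
  qed
  show "x = 0" if z: "\<And>n. eigproj n x = 0" for x :: "'d l2"
  proof (rule modes_total)
    fix k :: "real^'d" assume "lattice k"
    then obtain n where n: "k \<in> shell n" by (rule lattice_shell)
    show "inner x (cosk k) = 0" "inner x (sink k) = 0"
      using inner_eigproj_modes[OF n, of n x] z by simp_all
  qed
qed

lemma norm_eigproj:
  "(norm (eigproj n (x :: 'd::finite l2)))\<^sup>2 = (1 / tvol TYPE('d)) * (\<Sum>k\<in>shell n. (inner x (cosk k))\<^sup>2 + (inner x (sink k))\<^sup>2)"
proof -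
  have "(norm (eigproj n x))\<^sup>2 = inner (eigproj n x) x"
    by (simp only: power2_norm_eq_inner sp.inner_E[of n x x])
  then show ?thesis by (simp add: inner_eigproj power2_eq_square)
qed

lemma cal_modes:
  assumes "bdd_fun c" "k \<in> shell n"
  shows "inner (cal c x) (cosk k) = c n * inner x (cosk k)"
    and "inner (cal c x) (sink k) = c n * inner x (sink k)"
  using inner_eigproj_modes[OF assms(2), of n "cal c x"] inner_eigproj_modes[OF assms(2), of n x] sp.E_cal[OF assms(1), of n x]
  by simp_all

section \<open>Sobolev regularity in terms of Fourier modes\<close>

text \<open>Difference quotients of a periodic function have integral zero by translation
  invariance; the mean value theorem bounds them for dominated convergence.\<close>

lemma integral_partial_eq_0:
  fixes F :: "real^'d::finite \<Rightarrow> real"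
  assumes per: "periodic_fun F" and D: "\<And>x. (F has_derivative (\<lambda>h. DF x \<bullet> h)) (at x)"
    and cont: "continuous_on UNIV DF"
  shows "(\<integral>x. DF x $ j \<partial>tmeas) = 0"
proof -
  let ?e = "axis j 1 :: real^'d"
  define q where "q n x = (F (x + (1 / (real n + 1)) *\<^sub>R ?e) - F x) * (real n + 1)" for n x
  have Fc: "continuous_on UNIV F"
    using D has_derivative_continuous by (simp add: continuous_on_eq_continuous_at) blast
  have Fi: "integrable tmeas F"
  proof -
    have "bounded (F ` tcube)"
      by (intro compact_imp_bounded compact_continuous_image continuous_on_subset[OF Fc]) (auto simp: tcube_def)
    then obtain K where K: "\<And>x. x \<in> tcube \<Longrightarrow> \<bar>F x\<bar> \<le> K" by (auto simp: bounded_iff)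
    have "F \<in> borel_measurable tmeas"
      by (intro measurable_lebesgue_tmeas measurable_completion) (simp add: borel_measurable_continuous_onI Fc)
    then have "integrable tmeas (\<lambda>x. 1 * F x)"
      by (rule integrable_mult_bounded[OF integrable_tmeas_const]) (use K in \<open>auto intro!: AE_I2\<close>)
    then show ?thesis by simp
  qed
  have dline: "((\<lambda>t. F (x + t *\<^sub>R ?e)) has_real_derivative DF (x + t *\<^sub>R ?e) $ j) (at t)" for x t
  proof -
    have "((\<lambda>t. x + t *\<^sub>R ?e) has_derivative (\<lambda>h. h *\<^sub>R ?e)) (at t)" by (auto intro!: derivative_eq_intros)
    from has_derivative_compose[OF this D[of "x + t *\<^sub>R ?e"]]
    show ?thesis
      unfolding has_field_derivative_def by (rule has_derivative_eq_rhs) (simp add: fun_eq_iff inner_axis mult.commute)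
  qed
  have int0: "(\<integral>x. q n x \<partial>tmeas) = 0" for n
    using integral_periodic_translation[OF per Fi] integrable_periodic_translation[OF per Fi] Fi by (simp add: q_def)
  \<comment> \<open>The cube enlarged by 1 contains the shifted points, since the increments
    \<open>1 / (real n + 1)\<close> are at most 1.\<close>
  define B where "B = cbox (\<chi> i. -1) (\<chi> i. 2 * pi + 1 :: real^'d)"
  have B: "x + t *\<^sub>R ?e \<in> B" if "x \<in> tcube" "0 \<le> t" "t \<le> 1" for x t
    using that by (auto simp: B_def tcube_def mem_box_cart axis_def add_increasing2 intro: add_mono order_trans[of _ 0])
  have "bounded (DF ` B)"
    by (intro compact_imp_bounded compact_continuous_image continuous_on_subset[OF cont]) (auto simp: B_def)
  then obtain K where K: "\<And>x. x \<in> B \<Longrightarrow> norm (DF x) \<le> K" by (auto simp: bounded_iff)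
  have qK: "\<bar>q n x\<bar> \<le> K" if x: "x \<in> tcube" for n x
  proof -
    let ?h = "1 / (real n + 1)"
    have "\<exists>z. 0 < z \<and> z < ?h \<and> F (x + ?h *\<^sub>R ?e) - F (x + 0 *\<^sub>R ?e) = (?h - 0) * (DF (x + z *\<^sub>R ?e) $ j)"
      by (rule MVT2) (auto intro: dline)
    then obtain z where z: "0 < z" "z < ?h" "F (x + ?h *\<^sub>R ?e) - F x = ?h * (DF (x + z *\<^sub>R ?e) $ j)" by auto
    have "?h \<le> 1" by simp
    then have "x + z *\<^sub>R ?e \<in> B" using z x by (intro B) linarith+
    then have "\<bar>DF (x + z *\<^sub>R ?e) $ j\<bar> \<le> K" using K component_le_norm_cart order_trans by blast
    moreover have "q n x = DF (x + z *\<^sub>R ?e) $ j" unfolding q_def z(3) by simp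
    ultimately show ?thesis by simp
  qed
  have "(\<lambda>n. \<integral>x. q n x \<partial>tmeas) \<longlonglongrightarrow> (\<integral>x. DF x $ j \<partial>tmeas)"
  proof (rule integral_dominated_convergence[where w="\<lambda>x. K"])
    show "(\<lambda>x. DF x $ j) \<in> borel_measurable tmeas"
      by (intro measurable_lebesgue_tmeas measurable_completion)
         (simp add: borel_measurable_continuous_onI continuous_on_component cont)
    show "q n \<in> borel_measurable tmeas" for n
    proof -
      have "continuous_on UNIV (q n)"
        unfolding q_def by (intro continuous_intros continuous_on_compose2[OF Fc]) auto
      then show ?thesis
        by (intro measurable_lebesgue_tmeas measurable_completion) (simp add: borel_measurable_continuous_onI)
    qed
    show "integrable tmeas (\<lambda>x::real^'d. K)" by (rule integrable_tmeas_const)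
    show "AE x in tmeas. norm (q n x) \<le> K" for n by (rule AE_I2) (simp add: qK)
    have lim: "(\<lambda>n. q n x) \<longlonglongrightarrow> DF x $ j" for x
    proof -
      have "((\<lambda>t. F (x + t *\<^sub>R ?e)) has_real_derivative DF x $ j) (at 0)" using dline[of x 0] by simp
      then have *: "((\<lambda>h. (F (x + h *\<^sub>R ?e) - F x) / h) \<longlongrightarrow> DF x $ j) (at 0)"
        by (simp add: DERIV_def)
      have "filterlim (\<lambda>n. 1 / (real n + 1)) (at 0) sequentially"
        using LIMSEQ_inverse_real_of_nat by (auto simp: filterlim_at inverse_eq_divide add.commute)
      from filterlim_compose[OF * this] show ?thesis by (simp add: q_def)
    qed
    show "AE x in tmeas. (\<lambda>n. q n x) \<longlonglongrightarrow> DF x $ j" using lim by simp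
  qed
  then show ?thesis unfolding int0 by (simp add: LIMSEQ_const_iff)
qed

lemma trigpoly_has_derivative:
  "trigpoly p \<Longrightarrow> \<exists>D. (\<forall>x. (p has_derivative (\<lambda>h. D x \<bullet> h)) (at x)) \<and> continuous_on UNIV D \<and> (\<forall>j. trigpoly (\<lambda>x. D x $ j))"
proof (induction rule: trigpoly.induct)
  case (cos k)
  show ?case
  proof (intro exI[of _ "\<lambda>x. (- sin (k \<bullet> x)) *\<^sub>R k"] conjI allI)
    show "((\<lambda>x. cos (k \<bullet> x)) has_derivative (\<lambda>h. ((- sin (k \<bullet> x)) *\<^sub>R k) \<bullet> h)) (at x)" for x
      by (auto intro!: derivative_eq_intros)
    show "continuous_on UNIV (\<lambda>x. (- sin (k \<bullet> x)) *\<^sub>R k)" by (intro continuous_intros)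
    show "trigpoly (\<lambda>x. ((- sin (k \<bullet> x)) *\<^sub>R k) $ j)" for j
      using trigpoly.scale[OF trigpoly.sin[OF cos], of "- k $ j"] by (simp add: mult.commute)
  qed
next
  case (sin k)
  show ?case
  proof (intro exI[of _ "\<lambda>x. cos (k \<bullet> x) *\<^sub>R k"] conjI allI)
    show "((\<lambda>x. sin (k \<bullet> x)) has_derivative (\<lambda>h. (cos (k \<bullet> x) *\<^sub>R k) \<bullet> h)) (at x)" for x
      by (auto intro!: derivative_eq_intros)
    show "continuous_on UNIV (\<lambda>x. cos (k \<bullet> x) *\<^sub>R k)" by (intro continuous_intros)
    show "trigpoly (\<lambda>x. (cos (k \<bullet> x) *\<^sub>R k) $ j)" for j
      using trigpoly.scale[OF trigpoly.cos[OF sin], of "k $ j"] by (simp add: mult.commute)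
  qed
next
  case (add f g)
  then obtain D E where D: "\<And>x. (f has_derivative (\<lambda>h. D x \<bullet> h)) (at x)" "continuous_on UNIV D" "\<And>j. trigpoly (\<lambda>x. D x $ j)"
    and E: "\<And>x. (g has_derivative (\<lambda>h. E x \<bullet> h)) (at x)" "continuous_on UNIV E" "\<And>j. trigpoly (\<lambda>x. E x $ j)" by blast
  show ?case
  proof (intro exI[of _ "\<lambda>x. D x + E x"] conjI allI)
    show "((\<lambda>x. f x + g x) has_derivative (\<lambda>h. (D x + E x) \<bullet> h)) (at x)" for x
      using has_derivative_add[OF D(1) E(1), of x] by (simp add: inner_add_left)
    show "continuous_on UNIV (\<lambda>x. D x + E x)" by (intro continuous_intros D E)
    show "trigpoly (\<lambda>x. (D x + E x) $ j)" for j
      using trigpoly.add[OF D(3) E(3)] by simp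
  qed
next
  case (scale f c)
  then obtain D where D: "\<And>x. (f has_derivative (\<lambda>h. D x \<bullet> h)) (at x)" "continuous_on UNIV D" "\<And>j. trigpoly (\<lambda>x. D x $ j)"
    by blast
  show ?case
  proof (intro exI[of _ "\<lambda>x. c *\<^sub>R D x"] conjI allI)
    show "((\<lambda>x. c * f x) has_derivative (\<lambda>h. (c *\<^sub>R D x) \<bullet> h)) (at x)" for x
      using has_derivative_mult_right[OF D(1), of c x] by simp
    show "continuous_on UNIV (\<lambda>x. c *\<^sub>R D x)" by (intro continuous_intros D)
    show "trigpoly (\<lambda>x. (c *\<^sub>R D x) $ j)" for j
      using trigpoly.scale[OF D(3)] by simp
  qed
qed

definition C1_test :: "(real^'d::finite \<Rightarrow> real) \<Rightarrow> (real^'d \<Rightarrow> real^'d) \<Rightarrow> bool" where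
  "C1_test \<phi> D \<longleftrightarrow> periodic_fun \<phi> \<and> (\<forall>x. (\<phi> has_derivative (\<lambda>h. D x \<bullet> h)) (at x)) \<and> continuous_on UNIV D"

lemma weak_partial_alt:
  "weak_partial j f g \<longleftrightarrow> L2 g \<and> (\<forall>\<phi> D. C1_test \<phi> D \<longrightarrow> (\<integral>x. f x * (D x $ j) \<partial>tmeas) = - (\<integral>x. g x * \<phi> x \<partial>tmeas))"
  unfolding weak_partial_def C1_test_def by blast

lemma C1_test_mult:
  assumes "C1_test \<phi> D" "C1_test \<psi> E"
  shows "C1_test (\<lambda>x. \<phi> x * \<psi> x) (\<lambda>x. \<phi> x *\<^sub>R E x + \<psi> x *\<^sub>R D x)"
  unfolding C1_test_def
proof (intro conjI allI)
  have d: "(\<phi> has_derivative (\<lambda>h. D x \<bullet> h)) (at x)" "(\<psi> has_derivative (\<lambda>h. E x \<bullet> h)) (at x)" for x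
    using assms by (auto simp: C1_test_def)
  show "periodic_fun (\<lambda>x. \<phi> x * \<psi> x)"
    by (rule periodic_comp2) (use assms in \<open>simp_all add: C1_test_def\<close>)
  show "((\<lambda>x. \<phi> x * \<psi> x) has_derivative (\<lambda>h. (\<phi> x *\<^sub>R E x + \<psi> x *\<^sub>R D x) \<bullet> h)) (at x)" for x
    by (rule has_derivative_eq_rhs[OF has_derivative_mult[OF d]]) (auto simp: inner_add_left algebra_simps)
  have "continuous_on UNIV \<phi>" "continuous_on UNIV \<psi>"
    using d has_derivative_continuous by (simp_all add: continuous_on_eq_continuous_at) blast+
  then show "continuous_on UNIV (\<lambda>x. \<phi> x *\<^sub>R E x + \<psi> x *\<^sub>R D x)"
    using assms by (auto simp: C1_test_def intro!: continuous_intros)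
qed

lemma periodic_derivative:
  fixes \<phi> :: "real^'d::finite \<Rightarrow> real"
  assumes "C1_test \<phi> D" shows "periodic_fun D"
  unfolding periodic_fun_def
proof (intro allI)
  fix x :: "real^'d" and i
  let ?p = "(2 * pi) *\<^sub>R axis i 1 :: real^'d"
  have "(\<phi> has_derivative (\<lambda>h. D (x + ?p) \<bullet> h)) (at (x + ?p))" using assms by (auto simp: C1_test_def)
  moreover have "((\<lambda>y. y + ?p) has_derivative (\<lambda>h. h)) (at x)" by (auto intro!: derivative_eq_intros)
  ultimately have "((\<lambda>y. \<phi> (y + ?p)) has_derivative (\<lambda>h. D (x + ?p) \<bullet> h)) (at x)"
    using has_derivative_compose by fastforce
  moreover have "(\<lambda>y. \<phi> (y + ?p)) = \<phi>" using assms by (auto simp: C1_test_def periodic_fun_def)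
  ultimately have "(\<phi> has_derivative (\<lambda>h. D (x + ?p) \<bullet> h)) (at x)" by simp
  moreover have "(\<phi> has_derivative (\<lambda>h. D x \<bullet> h)) (at x)" using assms by (auto simp: C1_test_def)
  ultimately have "(\<lambda>h. D (x + ?p) \<bullet> h) = (\<lambda>h. D x \<bullet> h)" by (rule has_derivative_unique)
  then have "\<forall>h. D (x + ?p) \<bullet> h = D x \<bullet> h" by meson
  then show "D (x + ?p) = D x" by (simp only: vector_eq_rdot)
qed

lemma continuous_periodic_L2:
  fixes f :: "real^'d::finite \<Rightarrow> real"
  assumes "periodic_fun f" "continuous_on UNIV f"
  shows "L2 f"
proof (rule ccontr, erule notE)
  have "bounded (f ` tcube)"
    by (intro compact_imp_bounded compact_continuous_image continuous_on_subset[OF assms(2)]) (auto simp: tcube_def)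
  then obtain K where K: "\<And>x. x \<in> tcube \<Longrightarrow> \<bar>f x\<bar> \<le> K" by (auto simp: bounded_iff)
  have "\<bar>f x\<bar> \<le> K" for x
  proof -
    obtain m where "x - tlat m \<in> qcube" using ex1_qcube by blast
    then show ?thesis using K[of "x - tlat m"] qcube_subset periodic_fun_tlat_diff[OF assms(1), of x m] by auto
  qed
  moreover have "f \<in> borel_measurable tmeas"
    by (intro measurable_lebesgue_tmeas measurable_completion) (simp add: borel_measurable_continuous_onI assms)
  ultimately show "L2 f" by (intro L2_bounded assms)
qed

lemma C1_test_L2:
  assumes "C1_test \<phi> D" shows "L2 \<phi>" and "L2 (\<lambda>x. D x $ j)"
proof -
  have d: "(\<phi> has_derivative (\<lambda>h. D x \<bullet> h)) (at x)" for x using assms by (auto simp: C1_test_def)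
  have "continuous_on UNIV \<phi>"
    using d has_derivative_continuous by (simp add: continuous_on_eq_continuous_at) blast
  then show "L2 \<phi>" by (rule continuous_periodic_L2[rotated]) (use assms in \<open>simp add: C1_test_def\<close>)
  show "L2 (\<lambda>x. D x $ j)"
  proof (rule continuous_periodic_L2)
    show "periodic_fun (\<lambda>x. D x $ j)"
      by (rule periodic_comp[OF periodic_derivative[OF assms]])
    show "continuous_on UNIV (\<lambda>x. D x $ j)"
      using assms by (simp add: C1_test_def continuous_on_component)
  qed
qed

text \<open>Integration by parts: the derivative of the product with a test function has integral
  zero.\<close>

lemma weak_partial_classical:
  fixes \<phi> :: "real^'d::finite \<Rightarrow> real"
  assumes D: "C1_test \<phi> D" shows "weak_partial j \<phi> (\<lambda>x. D x $ j)"
  unfolding weak_partial_alt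
proof (intro conjI allI impI)
  show "L2 (\<lambda>x. D x $ j)" by (rule C1_test_L2[OF D])
  fix \<psi> :: "real^'d \<Rightarrow> real" and E assume E: "C1_test \<psi> E"
  have "(\<integral>x. (\<phi> x *\<^sub>R E x + \<psi> x *\<^sub>R D x) $ j \<partial>tmeas) = 0"
    by (rule integral_partial_eq_0[where F="\<lambda>x. \<phi> x * \<psi> x"])
       (use C1_test_mult[OF D E] in \<open>simp_all add: C1_test_def\<close>)
  then have "0 = (\<integral>x. (\<phi> x *\<^sub>R E x + \<psi> x *\<^sub>R D x) $ j \<partial>tmeas)" by simp
  also have "\<dots> = (\<integral>x. \<phi> x * (E x $ j) \<partial>tmeas) + (\<integral>x. (D x $ j) * \<psi> x \<partial>tmeas)"
    using L2_mult_integrable[OF C1_test_L2(1)[OF D] C1_test_L2(2)[OF E, of j]]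
      L2_mult_integrable[OF C1_test_L2(2)[OF D, of j] C1_test_L2(1)[OF E]]
    by (simp add: mult.commute[of "\<psi> _"])
  finally show "(\<integral>x. \<phi> x * (E x $ j) \<partial>tmeas) = - (\<integral>x. (D x $ j) * \<psi> x \<partial>tmeas)" by linarith
qed

definition mode_deriv :: "'d \<Rightarrow> 'd::finite l2 \<Rightarrow> 'd l2 \<Rightarrow> bool" where
  "mode_deriv j x g \<longleftrightarrow> (\<forall>k. lattice k \<longrightarrow>
     inner g (cosk k) = k $ j * inner x (sink k) \<and> inner g (sink k) = - (k $ j) * inner x (cosk k))"

text \<open>Parseval over the shells; within a shell the two bilinear expressions agree term by term
  up to the sign.\<close>

lemma mode_deriv_adjoint:
  assumes "mode_deriv j x g" "mode_deriv j p q" shows "inner x q = - inner g p"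
proof -
  have "inner (eigproj n x) q = - inner (eigproj n g) p" for n
    unfolding inner_eigproj mult_minus_right[symmetric] sum_negf[symmetric]
    by (intro arg_cong2[where f=times] sum.cong refl)
       (use assms in \<open>auto simp: mode_deriv_def shell_def algebra_simps\<close>)
  then have "(\<lambda>n. - inner (eigproj n g) p) sums inner x q"
    using sp.inner_sums[of x q] by simp
  moreover have "(\<lambda>n. - inner (eigproj n g) p) sums (- inner g p)"
    by (intro sums_minus sp.inner_sums)
  ultimately show ?thesis by (rule sums_unique2)
qed

lemma C1_test_trig:
  assumes "lattice k"
  shows "C1_test (\<lambda>x. cos (k \<bullet> x)) (\<lambda>x. (- sin (k \<bullet> x)) *\<^sub>R k)"
    and "C1_test (\<lambda>x. sin (k \<bullet> x)) (\<lambda>x. cos (k \<bullet> x) *\<^sub>R k)"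
  unfolding C1_test_def using assms
  by (auto intro!: derivative_eq_intros continuous_intros trigpoly_periodic trigpoly.intros)

text \<open>Cosines and sines are admissible test functions. Conversely, a test function and its
  classical derivative obey the same mode relations, so \<open>mode_deriv_adjoint\<close> yields the
  integral identity for every test function.\<close>

lemma weak_partial_mode_deriv:
  fixes f :: "real^'d::finite \<Rightarrow> real"
  assumes f: "L2 f" shows "weak_partial j f g \<longleftrightarrow> L2 g \<and> mode_deriv j (cls f) (cls g)"
proof (intro iffI conjI)
  assume w: "weak_partial j f g"
  then show g: "L2 g" by (simp add: weak_partial_alt)
  show "mode_deriv j (cls f) (cls g)"
    unfolding mode_deriv_def
  proof (intro allI impI)
    fix k :: "real^'d" assume k: "lattice k"
    have "(\<integral>x. f x * ((- sin (k \<bullet> x)) *\<^sub>R k) $ j \<partial>tmeas) = - (\<integral>x. g x * cos (k \<bullet> x) \<partial>tmeas)"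
      "(\<integral>x. f x * (cos (k \<bullet> x) *\<^sub>R k) $ j \<partial>tmeas) = - (\<integral>x. g x * sin (k \<bullet> x) \<partial>tmeas)"
      using w C1_test_trig[OF k] unfolding weak_partial_alt by blast+
    moreover have "(\<integral>x. f x * ((- sin (k \<bullet> x)) *\<^sub>R k) $ j \<partial>tmeas) = - (k $ j) * (\<integral>x. f x * sin (k \<bullet> x) \<partial>tmeas)"
      "(\<integral>x. f x * (cos (k \<bullet> x) *\<^sub>R k) $ j \<partial>tmeas) = k $ j * (\<integral>x. f x * cos (k \<bullet> x) \<partial>tmeas)"
      by (simp_all flip: integral_mult_right_zero integral_minus add: mult_ac)
    ultimately show "inner (cls g) (cosk k) = k $ j * inner (cls f) (sink k) \<and> inner (cls g) (sink k) = - (k $ j) * inner (cls f) (cosk k)"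
      using fco_cos[OF k f] fco_sin[OF k f] fco_cos[OF k g] fco_sin[OF k g] by (simp add: fco_def)
  qed
next
  assume *: "L2 g \<and> mode_deriv j (cls f) (cls g)"
  show "weak_partial j f g"
    unfolding weak_partial_alt
  proof (intro conjI allI impI)
    show g: "L2 g" using * by blast
    fix \<phi> :: "real^'d \<Rightarrow> real" and D assume C: "C1_test \<phi> D"
    have "mode_deriv j (cls \<phi>) (cls (\<lambda>x. D x $ j))"
    proof -
      have L: "L2 \<phi>" "L2 (\<lambda>x. D x $ j)" by (rule C1_test_L2[OF C])+
      show ?thesis
        unfolding mode_deriv_def
      proof (intro allI impI)
        fix k :: "real^'d" assume k: "lattice k"
        have "(\<integral>x. \<phi> x * ((- sin (k \<bullet> x)) *\<^sub>R k) $ j \<partial>tmeas) = - (\<integral>x. D x $ j * cos (k \<bullet> x) \<partial>tmeas)"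
          "(\<integral>x. \<phi> x * (cos (k \<bullet> x) *\<^sub>R k) $ j \<partial>tmeas) = - (\<integral>x. D x $ j * sin (k \<bullet> x) \<partial>tmeas)"
          using weak_partial_classical[OF C, of j] C1_test_trig[OF k] unfolding weak_partial_alt by blast+
        moreover have "(\<integral>x. \<phi> x * ((- sin (k \<bullet> x)) *\<^sub>R k) $ j \<partial>tmeas) = - (k $ j) * (\<integral>x. \<phi> x * sin (k \<bullet> x) \<partial>tmeas)"
          "(\<integral>x. \<phi> x * (cos (k \<bullet> x) *\<^sub>R k) $ j \<partial>tmeas) = k $ j * (\<integral>x. \<phi> x * cos (k \<bullet> x) \<partial>tmeas)"
          by (simp_all flip: integral_mult_right_zero integral_minus add: mult_ac)
        ultimately show "inner (cls (\<lambda>x. D x $ j)) (cosk k) = k $ j * inner (cls \<phi>) (sink k) \<and> inner (cls (\<lambda>x. D x $ j)) (sink k) = - (k $ j) * inner (cls \<phi>) (cosk k)"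
          using fco_cos[OF k L(1)] fco_sin[OF k L(1)] fco_cos[OF k L(2)] fco_sin[OF k L(2)] by (simp add: fco_def)
      qed
    qed
    with * have "inner (cls f) (cls (\<lambda>x. D x $ j)) = - inner (cls g) (cls \<phi>)" using mode_deriv_adjoint by blast
    then show "(\<integral>x. f x * (D x $ j) \<partial>tmeas) = - (\<integral>x. g x * \<phi> x \<partial>tmeas)"
      by (simp add: inner_cls f g C1_test_L2[OF C])
  qed
qed

subsection \<open>The operator J = (1 - Laplacian)^(-1/2)\<close>

definition jsym :: "nat \<Rightarrow> real" where "jsym n = 1 / sqrt (1 + real n)"
definition J :: "'d::finite l2 \<Rightarrow> 'd l2" where "J = cal jsym"

lemma jsym_pos: "jsym n > 0" and jsym_le_1: "jsym n \<le> 1"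
  by (auto simp: jsym_def)

lemma bdd_jsym [simp]: "bdd_fun jsym"
  using jsym_pos jsym_le_1 by (intro bdd_funI[where K=1]) (simp add: abs_of_pos)

lemma E_J [simp]: "eigproj n (J x) = jsym n *\<^sub>R eigproj n x"
  by (simp add: J_def sp.E_cal)

lemma J_inj: "J x = J y \<Longrightarrow> x = y"
proof (rule sp.E_eqI)
  fix n assume "J x = J y"
  then have "jsym n *\<^sub>R eigproj n x = jsym n *\<^sub>R eigproj n y" by (metis E_J)
  then show "eigproj n x = eigproj n y" using jsym_pos[of n] by simp
qed

lemma bounded_linear_J: "bounded_linear J" unfolding J_def by (rule sp.bounded_linear_cal) simp
lemma J_add: "J (x + y) = J x + J y" by (simp add: J_def sp.cal_add)
lemma J_diff: "J (x - y) = J x - J y" by (simp add: J_def sp.cal_diff)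
lemma J_scale: "J (r *\<^sub>R x) = r *\<^sub>R J x" by (simp add: J_def sp.cal_scale)
lemma J_0 [simp]: "J 0 = 0" by (simp add: J_def)
lemma J_norm_le: "norm (J x) \<le> norm x"
  using sp.cal_norm_le[of jsym 1 x] jsym_pos jsym_le_1 by (simp add: J_def abs_of_pos)

text \<open>The squares of the components of k add up to |k|^2 = n on the shell.\<close>

lemma norm_mode_deriv:
  fixes x :: "'d::finite l2"
  assumes "\<And>j. mode_deriv j x (g j)"
  shows "(\<Sum>j\<in>UNIV. (norm (eigproj n (g j)))\<^sup>2) = real n * (norm (eigproj n x))\<^sup>2"
proof -
  have "(\<Sum>j\<in>UNIV. (norm (eigproj n (g j)))\<^sup>2) =
     (1 / tvol TYPE('d)) * (\<Sum>j\<in>UNIV. \<Sum>k\<in>shell n. (inner (g j) (cosk k))\<^sup>2 + (inner (g j) (sink k))\<^sup>2)"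
    by (simp add: norm_eigproj sum_distrib_left)
  also have "(\<Sum>j\<in>UNIV. \<Sum>k\<in>shell n. (inner (g j) (cosk k))\<^sup>2 + (inner (g j) (sink k))\<^sup>2) =
     (\<Sum>k\<in>shell n. \<Sum>j\<in>UNIV. (inner (g j) (cosk k))\<^sup>2 + (inner (g j) (sink k))\<^sup>2)"
    by (rule sum.swap)
  also have "\<dots> = (\<Sum>k\<in>shell n. real n * ((inner x (cosk k))\<^sup>2 + (inner x (sink k))\<^sup>2))"
  proof (rule sum.cong[OF refl])
    fix k :: "real^'d" assume k: "k \<in> shell n"
    have "(\<Sum>j\<in>UNIV. (inner (g j) (cosk k))\<^sup>2 + (inner (g j) (sink k))\<^sup>2) =
       (\<Sum>j\<in>UNIV. (k $ j * k $ j) * ((inner x (cosk k))\<^sup>2 + (inner x (sink k))\<^sup>2))"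
      using assms k by (intro sum.cong refl) (auto simp: mode_deriv_def shell_def power2_eq_square algebra_simps)
    also have "\<dots> = (k \<bullet> k) * ((inner x (cosk k))\<^sup>2 + (inner x (sink k))\<^sup>2)"
      by (simp add: inner_vec_def sum_distrib_right)
    finally show "(\<Sum>j\<in>UNIV. (inner (g j) (cosk k))\<^sup>2 + (inner (g j) (sink k))\<^sup>2) = real n * ((inner x (cosk k))\<^sup>2 + (inner x (sink k))\<^sup>2)"
      using k by (simp add: shell_def)
  qed
  finally show ?thesis by (simp add: norm_eigproj sum_distrib_left mult.left_commute)
qed

text \<open>The preimage \<open>v\<close> must have projections sqrt(1 + n) E_n x. They are square
  summable because (1 + n) |E_n x|^2 is |E_n x|^2 plus the contributions of the derivatives; the
  same identity computes the norm of \<open>v\<close>.\<close>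

lemma mode_deriv_imp_J:
  fixes x :: "'d::finite l2"
  assumes g: "\<And>j. mode_deriv j x (g j)"
  obtains v where "x = J v" "(norm v)\<^sup>2 = (norm x)\<^sup>2 + (\<Sum>j\<in>UNIV. (norm (g j))\<^sup>2)"
proof -
  let ?a = "\<lambda>n. sqrt (1 + real n) *\<^sub>R x"
  have *: "(norm (eigproj n (?a n)))\<^sup>2 = (norm (eigproj n x))\<^sup>2 + (\<Sum>j\<in>UNIV. (norm (eigproj n (g j)))\<^sup>2)" for n
    by (simp add: norm_mode_deriv[OF g] sp.E_scale power_mult_distrib algebra_simps)
  have s: "(\<lambda>n. (norm (eigproj n (?a n)))\<^sup>2) sums ((norm x)\<^sup>2 + (\<Sum>j\<in>UNIV. (norm (g j))\<^sup>2))"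
    unfolding * by (intro sums_add sums_sum sp.parseval)
  define v where "v = (\<Sum>n. eigproj n (?a n))"
  have Ev: "eigproj n v = eigproj n (?a n)" for n
    unfolding v_def by (rule sp.riesz_E[OF sums_summable[OF s]])
  show ?thesis
  proof (rule that[of v])
    show "x = J v" by (rule sp.E_eqI) (simp add: Ev sp.E_scale jsym_def)
    show "(norm v)\<^sup>2 = (norm x)\<^sup>2 + (\<Sum>j\<in>UNIV. (norm (g j))\<^sup>2)"
      using sp.parseval[of v] s unfolding Ev by (rule sums_unique2)
  qed
qed

text \<open>The candidate \<open>D n\<close> for the derivative on shell n is no larger than the
  projection of \<open>v\<close>, since n / (1 + n) is at most 1; so the candidates sum to an
  element of L^2.\<close>

lemma J_imp_mode_deriv:
  fixes v :: "'d::finite l2"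
  obtains g where "mode_deriv j (J v) g"
proof -
  let ?V = "tvol TYPE('d)"
  have V: "?V > 0" by (rule tvol_pos)
  define x where "x = J v"
  define D where "D n = (1 / ?V) *\<^sub>R (\<Sum>k\<in>shell n. (k $ j * inner x (sink k)) *\<^sub>R cosk k - (k $ j * inner x (cosk k)) *\<^sub>R sink k)" for n
  have modes: "inner (D n) (cosk l) = of_bool (n = m) * (l $ j * inner x (sink l))"
    "inner (D n) (sink l) = of_bool (n = m) * (- (l $ j) * inner x (cosk l))" if l: "l \<in> shell m" for n m and l :: "real^'d"
  proof -
    have ll: "lattice l" using l by (simp add: shell_def)
    have "inner (D n) (cosk l) = (1 / ?V) * (\<Sum>k\<in>shell n. (k $ j * inner x (sink k)) * (?V / 2 * (of_bool (k = l) + of_bool (k = - l))))"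
      unfolding D_def inner_scaleR_left inner_sum_left inner_diff_left
      by (intro arg_cong2[where f=times] sum.cong refl) (simp add: shell_def inner_modes ll)
    also have "\<dots> = (1 / ?V) * (?V / 2) * ((\<Sum>k\<in>shell n. (k $ j * inner x (sink k)) * of_bool (k = l)) + (\<Sum>k\<in>shell n. (k $ j * inner x (sink k)) * of_bool (k = - l)))"
      by (simp add: sum_distrib_left sum.distrib[symmetric] distrib_left mult_ac)
    also have "\<dots> = of_bool (n = m) * (l $ j * inner x (sink l))"
      unfolding sum_shell_pm[OF l] using V by (simp add: sink_uminus[OF ll])
    finally show "inner (D n) (cosk l) = of_bool (n = m) * (l $ j * inner x (sink l))" .
    have "inner (D n) (sink l) = (1 / ?V) * (\<Sum>k\<in>shell n. - (k $ j * inner x (cosk k)) * (?V / 2 * (of_bool (k = l) - of_bool (k = - l))))"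
      unfolding D_def inner_scaleR_left inner_sum_left inner_diff_left
      by (intro arg_cong2[where f=times] sum.cong refl) (simp add: shell_def inner_modes ll)
    also have "\<dots> = (1 / ?V) * (?V / 2) * ((\<Sum>k\<in>shell n. (- (k $ j * inner x (cosk k))) * of_bool (k = l)) - (\<Sum>k\<in>shell n. (- (k $ j * inner x (cosk k))) * of_bool (k = - l)))"
      by (simp add: sum_distrib_left sum_subtractf[symmetric] right_diff_distrib mult_ac)
    also have "\<dots> = of_bool (n = m) * (- (l $ j) * inner x (cosk l))"
      unfolding sum_shell_pm[OF l] using V by simp
    finally show "inner (D n) (sink l) = of_bool (n = m) * (- (l $ j) * inner x (cosk l))" .
  qed
  have ED: "eigproj n (D n) = D n" for n
  proof -
    have "eigproj n (D n) - D n = 0"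
    proof (rule modes_total)
      fix l :: "real^'d" assume "lattice l"
      then obtain m where m: "l \<in> shell m" by (rule lattice_shell)
      show "inner (eigproj n (D n) - D n) (cosk l) = 0" "inner (eigproj n (D n) - D n) (sink l) = 0"
        unfolding inner_diff_left inner_eigproj_modes[OF m] modes[OF m] by simp_all
    qed
    then show ?thesis by simp
  qed
  have nD: "(norm (eigproj n (D n)))\<^sup>2 \<le> (norm (eigproj n v))\<^sup>2" for n
  proof -
    have "(norm (eigproj n (D n)))\<^sup>2 = (1 / ?V) * (\<Sum>k\<in>shell n. (k $ j)\<^sup>2 * ((inner x (cosk k))\<^sup>2 + (inner x (sink k))\<^sup>2))"
      unfolding norm_eigproj
      by (intro arg_cong2[where f=times] sum.cong refl) (simp add: modes power_mult_distrib algebra_simps)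
    also have "\<dots> \<le> (1 / ?V) * (\<Sum>k\<in>shell n. real n * ((inner x (cosk k))\<^sup>2 + (inner x (sink k))\<^sup>2))"
    proof (intro mult_left_mono sum_mono mult_right_mono)
      fix k :: "real^'d" assume k: "k \<in> shell n"
      have "(k $ j)\<^sup>2 \<le> k \<bullet> k" unfolding inner_vec_def
        by (simp add: power2_eq_square) (rule member_le_sum, auto)
      then show "(k $ j)\<^sup>2 \<le> real n" using k by (simp add: shell_def)
    qed (use V in auto)
    also have "\<dots> = real n * (norm (eigproj n x))\<^sup>2"
      by (simp add: norm_eigproj sum_distrib_left mult.left_commute)
    also have "\<dots> = (real n / (1 + real n)) * (norm (eigproj n v))\<^sup>2"
      unfolding x_def by (simp add: jsym_def power_mult_distrib power_divide)
    also have "\<dots> \<le> 1 * (norm (eigproj n v))\<^sup>2"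
      by (intro mult_right_mono) auto
    finally show ?thesis by simp
  qed
  have s: "summable (\<lambda>n. (norm (eigproj n (D n)))\<^sup>2)"
    by (rule summable_comparison_test[OF _ sp.summable_E[of v]]) (use nD in auto)
  define g where "g = (\<Sum>n. eigproj n (D n))"
  have Eg: "eigproj m g = D m" for m unfolding g_def sp.riesz_E[OF s] by (rule ED)
  have "mode_deriv j x g"
    unfolding mode_deriv_def
  proof (intro allI impI)
    fix l :: "real^'d" assume "lattice l"
    then obtain m where m: "l \<in> shell m" by (rule lattice_shell)
    show "inner g (cosk l) = l $ j * inner x (sink l) \<and> inner g (sink l) = - (l $ j) * inner x (cosk l)"
      using inner_eigproj_modes[OF m, of m g] modes[OF m, of m] unfolding Eg by simp
  qed
  then show ?thesis using that unfolding x_def by blast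
qed

lemma H1_iff: "H1 f \<longleftrightarrow> L2 f \<and> (\<exists>v. cls f = J v)"
proof
  assume h: "H1 f"
  then have f: "L2 f" by (simp add: H1_def)
  obtain g where "\<And>j. weak_partial j f (g j)" using h unfolding H1_def by metis
  then have m: "\<And>j. mode_deriv j (cls f) (cls (g j))" using weak_partial_mode_deriv[OF f] by blast
  obtain v where "cls f = J v" by (rule mode_deriv_imp_J[OF m])
  then show "L2 f \<and> (\<exists>v. cls f = J v)" using f by blast
next
  assume "L2 f \<and> (\<exists>v. cls f = J v)"
  then obtain v where f: "L2 f" and v: "cls f = J v" by blast
  have "\<exists>g. weak_partial j f g" for j
  proof -
    obtain g where "mode_deriv j (J v) g" by (rule J_imp_mode_deriv)
    then have "weak_partial j f (rep g)" using weak_partial_mode_deriv[OF f] v L2_rep by simp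
    then show ?thesis by blast
  qed
  then show "H1 f" using f by (simp add: H1_def)
qed

text \<open>Product rule: H^1, the range of \<open>J\<close>, is stable under trigonometric
  multipliers. Hence the velocity produced by such an impulse can itself become a displacement of
  the coordinate \<open>v\<close>.\<close>

lemma mult_trigpoly_J:
  fixes p :: "real^'d::finite \<Rightarrow> real"
  assumes p: "trigpoly p" obtains v' where "mult p (J v) = J v'"
proof -
  obtain D where D: "C1_test p D" "\<And>j. trigpoly (\<lambda>x. D x $ j)"
    using trigpoly_has_derivative[OF p] trigpoly_periodic[OF p] unfolding C1_test_def by blast
  let ?f = "rep (J v)"
  have f: "L2 ?f" by (rule L2_rep)
  have "H1 ?f" unfolding H1_iff using f by auto
  then obtain g where g: "\<And>j. weak_partial j ?f (g j)" unfolding H1_def by metis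
  then have gL: "\<And>j. L2 (g j)" by (simp add: weak_partial_alt)
  have "weak_partial j (\<lambda>x. p x * ?f x) (\<lambda>x. p x * g j x + D x $ j * ?f x)" for j
    unfolding weak_partial_alt
  proof (intro conjI allI impI)
    have L: "L2 (\<lambda>x. p x * g j x)" "L2 (\<lambda>x. D x $ j * ?f x)"
      by (intro L2_mult_bmp bmp_trigpoly p D gL f)+
    then show "L2 (\<lambda>x. p x * g j x + D x $ j * ?f x)" by (rule L2_add)
    fix \<phi> :: "real^'d \<Rightarrow> real" and E assume E: "C1_test \<phi> E"
    have "(\<integral>x. ?f x * ((p x *\<^sub>R E x + \<phi> x *\<^sub>R D x) $ j) \<partial>tmeas) = - (\<integral>x. g j x * (p x * \<phi> x) \<partial>tmeas)"
      using g[of j] C1_test_mult[OF D(1) E] unfolding weak_partial_alt by blast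
    moreover have "(\<integral>x. ?f x * ((p x *\<^sub>R E x + \<phi> x *\<^sub>R D x) $ j) \<partial>tmeas) =
       (\<integral>x. (p x * ?f x) * (E x $ j) \<partial>tmeas) + (\<integral>x. (D x $ j * ?f x) * \<phi> x \<partial>tmeas)"
      using L2_mult_integrable[OF L2_mult_bmp[OF bmp_trigpoly[OF p] f] C1_test_L2(2)[OF E, of j]]
        L2_mult_integrable[OF L(2) C1_test_L2(1)[OF E]]
      by (subst Bochner_Integration.integral_add[symmetric]) (auto simp: algebra_simps)
    moreover have "(\<integral>x. (p x * g j x + D x $ j * ?f x) * \<phi> x \<partial>tmeas) =
       (\<integral>x. g j x * (p x * \<phi> x) \<partial>tmeas) + (\<integral>x. (D x $ j * ?f x) * \<phi> x \<partial>tmeas)"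
      using L2_mult_integrable[OF L(1) C1_test_L2(1)[OF E]] L2_mult_integrable[OF L(2) C1_test_L2(1)[OF E]]
      by (subst Bochner_Integration.integral_add[symmetric]) (auto simp: algebra_simps)
    ultimately show "(\<integral>x. p x * ?f x * (E x $ j) \<partial>tmeas) = - (\<integral>x. (p x * g j x + D x $ j * ?f x) * \<phi> x \<partial>tmeas)"
      by linarith
  qed
  then have "H1 (\<lambda>x. p x * ?f x)" unfolding H1_def using L2_mult_bmp[OF bmp_trigpoly[OF p] f] by blast
  then obtain v' where "cls (\<lambda>x. p x * ?f x) = J v'" unfolding H1_iff by blast
  then show ?thesis using that by (simp add: mult_def)
qed

subsection \<open>Coordinates on the energy space\<close>

text \<open>A state (w, w') is represented by (v, y) with w = J v and y = w', so that the energy norm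
  becomes the Hilbert norm of a product of two copies of L2.\<close>
definition st :: "'d::finite state \<Rightarrow> 'd l2 \<times> 'd l2 \<Rightarrow> bool" where
  "st W z \<longleftrightarrow> L2 (fst W) \<and> L2 (snd W) \<and> cls (fst W) = J (fst z) \<and> cls (snd W) = snd z"

lemma st_Hsp: "st W z \<Longrightarrow> W \<in> Hsp"
  by (auto simp: st_def Hsp_def H1_iff)

lemma Hsp_st: assumes "W \<in> Hsp" obtains z where "st W z"
proof -
  have 1: "L2 (fst W)" "L2 (snd W)" using assms by (simp_all add: Hsp_def H1_def)
  obtain v where "cls (fst W) = J v" using assms H1_iff[of "fst W"] by (auto simp: Hsp_def)
  with 1 have "st W (v, cls (snd W))" by (simp add: st_def)
  then show ?thesis by (rule that)
qed

lemma st_rep: "st (rep (J (fst z)), rep (snd z)) z"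
  by (simp add: st_def L2_rep)

lemma st_Hdiff: "st W z \<Longrightarrow> st V y \<Longrightarrow> st (Hdiff W V) (z - y)"
  by (simp add: st_def Hdiff_def L2_diff cls_diff J_diff)

text \<open>\<open>wgrad\<close> is an arbitrary choice of weak derivatives, but the identity of
  \<open>mode_deriv_imp_J\<close> holds for every choice, and injectivity of \<open>J\<close>
  identifies the resulting vector with \<open>fst z\<close>.\<close>

lemma Hnorm_st:
  assumes "st W z" shows "Hnorm W = norm z"
proof -
  have L: "L2 (fst W)" "L2 (snd W)" using assms by (simp_all add: st_def)
  have h: "H1 (fst W)" using st_Hsp[OF assms] by (simp add: Hsp_def)
  have w: "weak_partial j (fst W) (wgrad (fst W) j)" for j
  proof -
    have "\<exists>g. weak_partial j (fst W) g" using h by (simp add: H1_def)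
    then show ?thesis unfolding wgrad_def by (rule someI_ex)
  qed
  then have gL: "L2 (wgrad (fst W) j)" for j by (simp add: weak_partial_alt)
  have m: "\<And>j. mode_deriv j (cls (fst W)) (cls (wgrad (fst W) j))"
    using w weak_partial_mode_deriv[OF L(1)] by blast
  obtain v where v: "cls (fst W) = J v" "(norm v)\<^sup>2 = (norm (cls (fst W)))\<^sup>2 + (\<Sum>j\<in>UNIV. (norm (cls (wgrad (fst W) j)))\<^sup>2)"
    by (rule mode_deriv_imp_J[OF m])
  have vz: "v = fst z" using v(1) assms J_inj[of v "fst z"] by (simp add: st_def)
  have "(\<integral>x. (\<Sum>j\<in>UNIV. (wgrad (fst W) j x)\<^sup>2) + (fst W x)\<^sup>2 + (snd W x)\<^sup>2 \<partial>tmeas) =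
     (\<Sum>j\<in>UNIV. (norm (cls (wgrad (fst W) j)))\<^sup>2) + (norm (cls (fst W)))\<^sup>2 + (norm (cls (snd W)))\<^sup>2"
    using L2_square_integrable[OF L(1)] L2_square_integrable[OF L(2)] L2_square_integrable[OF gL]
    by (simp add: norm_cls L gL)
  also have "\<dots> = (norm (fst z))\<^sup>2 + (norm (snd z))\<^sup>2" using v(2) assms unfolding vz by (simp add: st_def)
  finally show ?thesis by (simp add: Hnorm_def norm_prod_def)
qed

section \<open>Mild solutions under bounded perturbations\<close>

text \<open>Two-sided Duhamel integral of L U from 0 to t, rescaled to the unit interval so that one formula
  covers both signs of t.\<close>
definition duh :: "(real \<Rightarrow> 'a \<Rightarrow> 'a::banach) \<Rightarrow> ('a \<Rightarrow> 'a) \<Rightarrow> (real \<Rightarrow> 'a) \<Rightarrow> real \<Rightarrow> 'a" where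
  "duh G L U t = t *\<^sub>R integral {0..1} (\<lambda>\<sigma>. G (t * (1 - \<sigma>)) (L (U (t * \<sigma>))))"

lemma exp_kernel_integral:
  "((\<lambda>\<sigma>. c * exp (- (c * (1 - \<sigma>)))) has_integral (1 - exp (- c))) {0..1::real}"
proof -
  have "((\<lambda>\<sigma>. c * exp (- (c * (1 - \<sigma>)))) has_integral (exp (- (c * (1 - 1))) - exp (- (c * (1 - 0))))) {0..1::real}"
    by (rule fundamental_theorem_of_calculus)
       (auto intro!: derivative_eq_intros simp: has_real_derivative_iff_has_vector_derivative[symmetric])
  then show ?thesis by simp
qed

locale evo =
  fixes G :: "real \<Rightarrow> 'a::banach \<Rightarrow> 'a" and Kg :: real
  assumes G_bl: "bounded_linear (G t)"
    and G_cont1: "continuous_on UNIV (\<lambda>t. G t x)"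
    and G_bound: "norm (G t x) \<le> Kg * exp \<bar>t\<bar> * norm x"
    and G_0: "G 0 x = x"
begin

lemma G_cont:
  assumes f: "continuous_on S f" and U: "continuous_on S U"
  shows "continuous_on S (\<lambda>p. G (f p) (U p))"
  unfolding continuous_on_def
proof
  fix p0 assume p0: "p0 \<in> S"
  have ft: "(f \<longlongrightarrow> f p0) (at p0 within S)" and Ut: "(U \<longlongrightarrow> U p0) (at p0 within S)"
    using f U p0 by (auto simp: continuous_on_def)
  have a: "((\<lambda>p. G (f p) (U p - U p0)) \<longlongrightarrow> 0) (at p0 within S)"
  proof (rule Lim_null_comparison)
    show "\<forall>\<^sub>F p in at p0 within S. norm (G (f p) (U p - U p0)) \<le> Kg * exp \<bar>f p\<bar> * norm (U p - U p0)"
      by (intro always_eventually allI G_bound)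
    have "((\<lambda>p. Kg * exp \<bar>f p\<bar> * norm (U p - U p0)) \<longlongrightarrow> Kg * exp \<bar>f p0\<bar> * norm (U p0 - U p0)) (at p0 within S)"
      by (intro tendsto_intros ft Ut)
    then show "((\<lambda>p. Kg * exp \<bar>f p\<bar> * norm (U p - U p0)) \<longlongrightarrow> 0) (at p0 within S)" by simp
  qed
  have "isCont (\<lambda>t. G t (U p0)) (f p0)"
    using G_cont1 by (simp add: continuous_on_eq_continuous_at)
  then have b: "((\<lambda>p. G (f p) (U p0)) \<longlongrightarrow> G (f p0) (U p0)) (at p0 within S)"
    using ft by (rule isCont_tendsto_compose)
  have "G (f p) (U p - U p0) + G (f p) (U p0) = G (f p) (U p)" for p
    using G_bl by (simp add: bounded_linear.linear linear_diff)
  then show "((\<lambda>p. G (f p) (U p)) \<longlongrightarrow> G (f p0) (U p0)) (at p0 within S)"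
    using tendsto_add[OF a b] by simp
qed

end

locale evo_pert = evo G Kg for G :: "real \<Rightarrow> 'a::banach \<Rightarrow> 'a" and Kg +
  fixes L :: "'a \<Rightarrow> 'a" and B :: real
  assumes L_bl: "bounded_linear L" and L_bound: "norm (L x) \<le> B * norm x" and B0: "B \<ge> 0" and Kg0: "Kg \<ge> 0"
begin

text \<open>Chosen so that Kg B / (M - 1) is at most 1/2: the Duhamel map halves norms weighted by
  exp(- M |t|).\<close>

definition M where "M = 1 + 2 * (Kg * B + 1)"

lemma M_gt_1: "M > 1" using mult_nonneg_nonneg[OF Kg0 B0] unfolding M_def by simp

lemma integrand_cont:
  assumes U: "continuous_on UNIV U"
  shows "continuous_on S (\<lambda>(t, \<sigma>). G (t * (1 - \<sigma>)) (L (U (t * \<sigma>))))"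
  unfolding case_prod_beta
  by (intro G_cont continuous_intros continuous_on_compose2[OF linear_continuous_on[OF L_bl, of UNIV]]
        continuous_on_compose2[OF U]) auto

lemma integrand_integrable:
  assumes U: "continuous_on UNIV U"
  shows "(\<lambda>\<sigma>. G (t * (1 - \<sigma>)) (L (U (t * \<sigma>)))) integrable_on {0..1}"
proof (rule integrable_continuous_real)
  show "continuous_on {0..1} (\<lambda>\<sigma>. G (t * (1 - \<sigma>)) (L (U (t * \<sigma>))))"
    by (intro G_cont continuous_intros continuous_on_compose2[OF linear_continuous_on[OF L_bl, of UNIV]]
        continuous_on_compose2[OF U]) auto
qed

lemma duh_cont:
  assumes U: "continuous_on UNIV U" shows "continuous_on UNIV (duh G L U)"
proof -
  have "continuous_on UNIV (\<lambda>t. integral (cbox 0 1) (\<lambda>\<sigma>. G (t * (1 - \<sigma>)) (L (U (t * \<sigma>)))))"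
    by (rule integral_continuous_on_param) (rule integrand_cont[OF U])
  then show ?thesis unfolding duh_def[abs_def] by (intro continuous_intros) auto
qed

text \<open>The family \<open>G\<close> contributes exp(|t| (1 - s)) and the weight exp(M |t| s), so
  relative to exp(M |t|) the integrand decays like exp(- c (1 - s)) with c = (M - 1) |t|.
  Integration leaves the factor Kg B / (M - 1).\<close>

lemma duh_bound:
  assumes U: "continuous_on UNIV U" and D: "\<And>s. \<bar>s\<bar> \<le> \<bar>t\<bar> \<Longrightarrow> norm (U s) \<le> D * exp (M * \<bar>s\<bar>)" and D0: "D \<ge> 0"
  shows "norm (duh G L U t) \<le> D / 2 * exp (M * \<bar>t\<bar>)"
proof -
  define c where "c = (M - 1) * \<bar>t\<bar>"
  define A where "A = Kg * B * D * exp (M * \<bar>t\<bar>)"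
  have KB: "Kg * B \<ge> 0" using B0 Kg0 by simp
  have A0: "A \<ge> 0" unfolding A_def using KB D0 by simp
  have pt: "norm (G (t * (1 - \<sigma>)) (L (U (t * \<sigma>)))) \<le> A * exp (- (c * (1 - \<sigma>)))" if s: "\<sigma> \<in> {0..1}" for \<sigma>
  proof -
    have s': "\<bar>t * (1 - \<sigma>)\<bar> = \<bar>t\<bar> * (1 - \<sigma>)" "\<bar>t * \<sigma>\<bar> = \<bar>t\<bar> * \<sigma>" using s by (auto simp: abs_mult)
    have "\<bar>t\<bar> * \<sigma> \<le> \<bar>t\<bar>" using s by (simp add: mult_left_le)
    then have u: "norm (U (t * \<sigma>)) \<le> D * exp (M * (\<bar>t\<bar> * \<sigma>))" using D[of "t * \<sigma>"] s' by simp
    have "norm (G (t * (1 - \<sigma>)) (L (U (t * \<sigma>)))) \<le> Kg * exp (\<bar>t\<bar> * (1 - \<sigma>)) * norm (L (U (t * \<sigma>)))"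
      using G_bound[of "t * (1 - \<sigma>)" "L (U (t * \<sigma>))"] s' by simp
    also have "\<dots> \<le> Kg * exp (\<bar>t\<bar> * (1 - \<sigma>)) * (B * (D * exp (M * (\<bar>t\<bar> * \<sigma>))))"
      using Kg0 B0 u L_bound[of "U (t * \<sigma>)"] by (intro mult_left_mono order_trans[OF L_bound]) auto
    also have "\<dots> = A * exp (- (c * (1 - \<sigma>)))"
      unfolding A_def c_def by (simp add: exp_add[symmetric] algebra_simps mult_exp_exp)
    finally show ?thesis .
  qed
  have i: "((\<lambda>\<sigma>. A / (M - 1) * (c * exp (- (c * (1 - \<sigma>))))) has_integral (A / (M - 1) * (1 - exp (- c)))) {0..1}"
    by (intro has_integral_mult_right exp_kernel_integral)
  have "norm (duh G L U t) = norm (integral {0..1} (\<lambda>\<sigma>. t *\<^sub>R G (t * (1 - \<sigma>)) (L (U (t * \<sigma>)))))"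
    unfolding duh_def by simp
  also have "\<dots> \<le> integral {0..1} (\<lambda>\<sigma>. A / (M - 1) * (c * exp (- (c * (1 - \<sigma>)))))"
  proof (rule Henstock_Kurzweil_Integration.integral_norm_bound_integral)
    show "(\<lambda>\<sigma>. t *\<^sub>R G (t * (1 - \<sigma>)) (L (U (t * \<sigma>)))) integrable_on {0..1}"
      by (intro integrable_cmul integrand_integrable U)
    show "(\<lambda>\<sigma>. A / (M - 1) * (c * exp (- (c * (1 - \<sigma>))))) integrable_on {0..1}"
      using i by (rule has_integral_integrable)
    fix \<sigma> :: real assume s: "\<sigma> \<in> {0..1}"
    have "norm (t *\<^sub>R G (t * (1 - \<sigma>)) (L (U (t * \<sigma>)))) \<le> \<bar>t\<bar> * (A * exp (- (c * (1 - \<sigma>))))"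
      using pt[OF s] by (simp add: mult_left_mono)
    also have "\<dots> = A / (M - 1) * (c * exp (- (c * (1 - \<sigma>))))"
      using M_gt_1 unfolding c_def by (simp add: field_simps)
    finally show "norm (t *\<^sub>R G (t * (1 - \<sigma>)) (L (U (t * \<sigma>)))) \<le> A / (M - 1) * (c * exp (- (c * (1 - \<sigma>))))" .
  qed
  also have "\<dots> = A / (M - 1) * (1 - exp (- c))" using i by (rule integral_unique)
  also have "\<dots> \<le> A / (M - 1) * 1" using A0 M_gt_1 by (intro mult_left_mono) auto
  also have "\<dots> \<le> D / 2 * exp (M * \<bar>t\<bar>)"
  proof -
    have "Kg * B / (M - 1) \<le> 1 / 2" using KB unfolding M_def by (simp add: field_simps)
    then have "Kg * B / (M - 1) * (D * exp (M * \<bar>t\<bar>)) \<le> 1 / 2 * (D * exp (M * \<bar>t\<bar>))"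
      using D0 by (intro mult_right_mono) auto
    then show ?thesis unfolding A_def by simp
  qed
  finally show ?thesis .
qed

text \<open>Gronwall in weighted form: at a maximum point of the weighted norm the Duhamel term is
  at most half of the maximum, so the maximum is at most twice \<eta>.\<close>

lemma volterra_bound:
  assumes U: "continuous_on UNIV U" and e0: "\<eta> \<ge> 0"
    and est: "\<And>s. \<bar>s\<bar> \<le> \<bar>T\<bar> \<Longrightarrow> s * T \<ge> 0 \<Longrightarrow> norm (U s) \<le> \<eta> * exp (M * \<bar>s\<bar>) + norm (duh G L U s)"
  shows "norm (U T) \<le> 2 * \<eta> * exp (M * \<bar>T\<bar>)"
proof -
  text \<open>The solution is only controlled on the segment from 0 to T; freezing it at the endpoints of that
    segment gives a function to which the global bound applies.\<close>
  define cl where "cl s = (if T \<ge> 0 then max 0 (min T s) else min 0 (max T s))" for s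
  have clc: "continuous_on S cl" for S unfolding cl_def by (cases "T \<ge> 0") (auto intro!: continuous_intros)
  have cl1: "\<bar>cl s\<bar> \<le> \<bar>T\<bar>" "cl s * T \<ge> 0" for s
    unfolding cl_def by (auto simp: mult_nonpos_nonpos)
  have cl2: "cl s = s" if "\<bar>s\<bar> \<le> \<bar>T\<bar>" "s * T \<ge> 0" for s
    using that unfolding cl_def by (cases "T = 0") (auto simp: zero_le_mult_iff)
  define h where "h s = exp (- M * \<bar>cl s\<bar>) * norm (U (cl s))" for s
  have "continuous_on {- \<bar>T\<bar>..\<bar>T\<bar>} h"
    unfolding h_def by (intro continuous_intros clc continuous_on_compose2[OF U]) auto
  then obtain s0 where s0: "s0 \<in> {- \<bar>T\<bar>..\<bar>T\<bar>}" "\<And>s. s \<in> {- \<bar>T\<bar>..\<bar>T\<bar>} \<Longrightarrow> h s \<le> h s0"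
    using continuous_attains_sup[of "{- \<bar>T\<bar>..\<bar>T\<bar>}" h] by auto
  define t where "t = cl s0"
  define m where "m = h s0"
  have m0: "m \<ge> 0" by (simp add: m_def h_def)
  have bound: "norm (U s) \<le> m * exp (M * \<bar>s\<bar>)" if s: "\<bar>s\<bar> \<le> \<bar>T\<bar>" "s * T \<ge> 0" for s
  proof -
    have "h s \<le> m" unfolding m_def using s by (intro s0(2)) auto
    then show ?thesis unfolding h_def cl2[OF s] by (simp add: exp_minus field_simps)
  qed
  have t: "\<bar>t\<bar> \<le> \<bar>T\<bar>" "t * T \<ge> 0" using cl1 by (auto simp: t_def)
  define V where "V s = U (cl s)" for s
  have Vc: "continuous_on UNIV V" unfolding V_def by (intro continuous_on_compose2[OF U] clc) auto
  have "duh G L U t = duh G L V t"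
    unfolding duh_def
  proof (intro arg_cong2[where f=scaleR] refl Henstock_Kurzweil_Integration.integral_cong)
    fix \<sigma> :: real assume s: "\<sigma> \<in> {0..1}"
    have "\<bar>t * \<sigma>\<bar> \<le> \<bar>T\<bar>" using t s by (auto simp: abs_mult intro: order_trans[OF mult_left_le])
    moreover have "t * \<sigma> * T \<ge> 0" using mult_nonneg_nonneg[OF t(2), of \<sigma>] s by (simp add: mult_ac)
    ultimately show "G (t * (1 - \<sigma>)) (L (U (t * \<sigma>))) = G (t * (1 - \<sigma>)) (L (V (t * \<sigma>)))"
      by (simp add: V_def cl2)
  qed
  moreover have "norm (duh G L V t) \<le> m / 2 * exp (M * \<bar>t\<bar>)"
  proof (rule duh_bound[OF Vc _ m0])
    fix s
    have "norm (V s) \<le> m * exp (M * \<bar>cl s\<bar>)" unfolding V_def by (rule bound[OF cl1])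
    also have "\<dots> \<le> m * exp (M * \<bar>s\<bar>)"
      using M_gt_1 m0 by (intro mult_left_mono) (auto simp: cl_def)
    finally show "norm (V s) \<le> m * exp (M * \<bar>s\<bar>)" .
  qed
  ultimately have "norm (U t) \<le> (\<eta> + m / 2) * exp (M * \<bar>t\<bar>)"
    using est[OF t] by (simp add: algebra_simps)
  then have "m \<le> \<eta> + m / 2"
    unfolding m_def[unfolded h_def] t_def[symmetric] h_def by (simp add: m_def h_def t_def exp_minus field_simps)
  then have "m \<le> 2 * \<eta>" by simp
  moreover have "norm (U T) \<le> m * exp (M * \<bar>T\<bar>)" by (rule bound) auto
  ultimately show ?thesis by (meson exp_ge_zero mult_right_mono order_trans)
qed

lemma duh_diff:
  assumes "continuous_on UNIV U" "continuous_on UNIV V"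
  shows "duh G L (\<lambda>s. U s - V s) t = duh G L U t - duh G L V t"
proof -
  have "G r (L (x - y)) = G r (L x) - G r (L y)" for r x y
    using G_bl L_bl by (simp add: bounded_linear.linear linear_diff)
  then show ?thesis unfolding duh_def
    by (simp add: Henstock_Kurzweil_Integration.integral_diff[OF integrand_integrable[OF assms(1)] integrand_integrable[OF assms(2)]] scaleR_diff_right)
qed

section \<open>Mild solutions and their propagator\<close>

definition mildsol :: "'a \<Rightarrow> (real \<Rightarrow> 'a) \<Rightarrow> bool" where
  "mildsol x U \<longleftrightarrow> continuous_on UNIV U \<and> (\<forall>t. U t = G t x + duh G L U t)"

lemma mildsol_diff:
  assumes "mildsol x U" "mildsol y V" shows "mildsol (x - y) (\<lambda>t. U t - V t)"
proof -
  have cU: "continuous_on UNIV U" "continuous_on UNIV V" using assms by (auto simp: mildsol_def)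
  have Gd: "G t (x - y) = G t x - G t y" for t using G_bl by (simp add: bounded_linear.linear linear_diff)
  show ?thesis
    unfolding mildsol_def
  proof (intro conjI allI)
    show "continuous_on UNIV (\<lambda>t. U t - V t)" by (intro continuous_intros cU)
    fix t
    have "U t = G t x + duh G L U t" "V t = G t y + duh G L V t" using assms by (simp_all add: mildsol_def)
    then have "U t - V t = (G t x + duh G L U t) - (G t y + duh G L V t)" by (rule arg_cong2)
    also have "\<dots> = G t (x - y) + duh G L (\<lambda>t. U t - V t) t"
      unfolding duh_diff[OF cU] Gd by (rule add_diff_add)
    finally show "U t - V t = G t (x - y) + duh G L (\<lambda>t. U t - V t) t" .
  qed
qed

lemma mildsol_bound:
  assumes "mildsol x U" shows "norm (U t) \<le> 2 * (Kg * norm x) * exp (M * \<bar>t\<bar>)"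
proof (rule volterra_bound)
  show "continuous_on UNIV U" using assms unfolding mildsol_def by blast
  show "Kg * norm x \<ge> 0" using Kg0 by simp
  fix s
  have "U s = G s x + duh G L U s" using assms unfolding mildsol_def by blast
  then have "norm (U s) \<le> norm (G s x) + norm (duh G L U s)"
    by (rule ssubst) (rule norm_triangle_ineq)
  moreover have "norm (G s x) \<le> Kg * norm x * exp (M * \<bar>s\<bar>)"
  proof -
    have "norm (G s x) \<le> Kg * norm x * exp \<bar>s\<bar>" using G_bound[of s x] by (simp add: mult_ac)
    also have "\<dots> \<le> Kg * norm x * exp (M * \<bar>s\<bar>)"
      using Kg0 M_gt_1 mult_right_mono[of 1 M "\<bar>s\<bar>"] by (intro mult_left_mono) auto
    finally show ?thesis .
  qed
  ultimately show "norm (U s) \<le> Kg * norm x * exp (M * \<bar>s\<bar>) + norm (duh G L U s)" by linarith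
qed

lemma mildsol_unique:
  assumes "mildsol x U" "mildsol x V" shows "U = V"
proof
  fix t
  have "mildsol (x - x) (\<lambda>t. U t - V t)" using assms by (rule mildsol_diff)
  from mildsol_bound[OF this, of t] show "U t = V t" by simp
qed

text \<open>Picard iteration in the space of functions with weight exp (- M |t|); an invariant family of
  closed subspaces, given as kernels of P t, is preserved.\<close>
lemma mildsol_exists:
  fixes P :: "real \<Rightarrow> 'a \<Rightarrow> 'b::banach"
  assumes P: "\<And>t. bounded_linear (P t)"
    and P0: "\<And>t. P t (G t x) = 0"
    and PG: "\<And>t \<sigma> y. \<sigma> \<in> {0..1} \<Longrightarrow> P (t * \<sigma>) y = 0 \<Longrightarrow> P t (G (t * (1 - \<sigma>)) (L y)) = 0"
  obtains U where "mildsol x U" "\<And>t. P t (U t) = 0"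
proof -
  \<comment> \<open>The fixed point is sought among bounded continuous functions; \<open>ex\<close>
    removes the weight exp(- M |t|) again.\<close>
  define ex where "ex V = (\<lambda>s. exp (M * \<bar>s\<bar>) *\<^sub>R apply_bcontfun V s)" for V :: "real \<Rightarrow>\<^sub>C 'a"
  define F where "F V t = exp (- (M * \<bar>t\<bar>)) *\<^sub>R (G t x + duh G L (ex V) t)" for V t
  have exc: "continuous_on UNIV (ex V)" for V
    unfolding ex_def by (intro continuous_intros continuous_on_apply_bcontfun)
  have exb: "norm (ex V s) \<le> norm V * exp (M * \<bar>s\<bar>)" for V s
    unfolding ex_def using norm_bounded[of V s] by (simp add: mult.commute mult_left_mono)
  have Fc: "continuous_on UNIV (F V)" for V
    unfolding F_def by (intro continuous_intros G_cont1 duh_cont exc)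
  have wb: "norm (exp (- (M * \<bar>t\<bar>)) *\<^sub>R y) \<le> C" if "norm y \<le> C * exp (M * \<bar>t\<bar>)" for t y C
    using that by (simp add: exp_minus field_simps)
  have Fb: "norm (F V t) \<le> Kg * norm x + norm V / 2" for V t
    unfolding F_def
  proof (rule wb)
    have "norm (G t x) \<le> Kg * norm x * exp \<bar>t\<bar>" using G_bound[of t x] by (simp add: mult_ac)
    also have "\<dots> \<le> Kg * norm x * exp (M * \<bar>t\<bar>)"
      using Kg0 M_gt_1 mult_right_mono[of 1 M "\<bar>t\<bar>"] by (intro mult_left_mono) auto
    finally have "norm (G t x) \<le> Kg * norm x * exp (M * \<bar>t\<bar>)" .
    moreover have "norm (duh G L (ex V) t) \<le> norm V / 2 * exp (M * \<bar>t\<bar>)"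
      by (rule duh_bound[OF exc exb]) simp
    ultimately show "norm (G t x + duh G L (ex V) t) \<le> (Kg * norm x + norm V / 2) * exp (M * \<bar>t\<bar>)"
      using norm_triangle_ineq[of "G t x" "duh G L (ex V) t"] by (simp add: algebra_simps)
  qed
  have Fin: "F V \<in> bcontfun" for V by (rule bcontfun_normI[OF Fc Fb])
  define \<Psi> where "\<Psi> V = Bcontfun (F V)" for V
  have app: "apply_bcontfun (\<Psi> V) = F V" for V unfolding \<Psi>_def by (rule Bcontfun_inverse[OF Fin])
  define S where "S = {V :: real \<Rightarrow>\<^sub>C 'a. \<forall>t. P t (apply_bcontfun V t) = 0}"
  have Scl: "closed S"
  proof -
    have "S = PiC UNIV (\<lambda>t. {y. P t y = 0})" by (auto simp: S_def mem_PiC_iff Pi_iff)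
    moreover have "closed {y. P t y = 0}" for t
      using closed_Collect_eq[of "P t" "\<lambda>_. 0"] linear_continuous_on[OF P, of UNIV t] by simp
    ultimately show ?thesis using closed_PiC[of UNIV "\<lambda>t. {y. P t y = 0}"] by auto
  qed
  have Plin: "linear (P t)" for t using P by (rule bounded_linear.linear)
  have "\<exists>!V. V \<in> S \<and> \<Psi> V = V"
  proof (rule Banach_fix[where c="1/2"])
    show "complete S" using Scl by (simp add: complete_eq_closed)
    show "S \<noteq> {}" using Plin by (auto simp: S_def linear_0 intro!: exI[of _ 0])
    show "\<Psi> ` S \<subseteq> S"
    proof clarsimp
      fix V assume V: "V \<in> S"
      have "P t (F V t) = 0" for t
      proof -
        have z: "P t (G (t * (1 - \<sigma>)) (L (ex V (t * \<sigma>)))) = 0" if "\<sigma> \<in> {0..1}" for \<sigma>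
          by (rule PG[OF that]) (use V in \<open>simp add: S_def ex_def linear_scale[OF Plin]\<close>)
        have "P t (integral {0..1} (\<lambda>\<sigma>. G (t * (1 - \<sigma>)) (L (ex V (t * \<sigma>))))) =
            integral {0..1} (P t \<circ> (\<lambda>\<sigma>. G (t * (1 - \<sigma>)) (L (ex V (t * \<sigma>)))))"
          by (rule integral_linear[symmetric, OF integrand_integrable[OF exc] P])
        also have "\<dots> = integral {0..1} (\<lambda>\<sigma>::real. 0)"
          by (rule Henstock_Kurzweil_Integration.integral_cong) (simp add: z)
        finally show ?thesis
          unfolding F_def duh_def linear_scale[OF Plin] linear_add[OF Plin] P0 by simp
      qed
      then show "\<Psi> V \<in> S" by (simp add: S_def app)
    qed
    show "dist (\<Psi> V) (\<Psi> W) \<le> 1 / 2 * dist V W" for V W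
      proof (rule dist_bound)
        fix t
        have e: "ex V s - ex W s = ex (V - W) s" for s unfolding ex_def by (simp add: scaleR_diff_right)
        have "F V t - F W t = exp (- (M * \<bar>t\<bar>)) *\<^sub>R duh G L (ex (V - W)) t"
          unfolding F_def e[symmetric] duh_diff[OF exc exc] by (simp add: scaleR_diff_right[symmetric])
        moreover have "norm (exp (- (M * \<bar>t\<bar>)) *\<^sub>R duh G L (ex (V - W)) t) \<le> norm (V - W) / 2"
          by (rule wb, rule duh_bound[OF exc exb]) simp
        ultimately show "dist (apply_bcontfun (\<Psi> V) t) (apply_bcontfun (\<Psi> W) t) \<le> 1 / 2 * dist V W"
          by (simp add: app dist_norm)
      qed
  qed auto
  then obtain V where V: "V \<in> S" "\<Psi> V = V" by blast
  have eq: "ex V t = G t x + duh G L (ex V) t" for t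
  proof -
    have "apply_bcontfun V t = F V t" using app[of V] V(2) by simp
    then show ?thesis unfolding ex_def[of V] F_def by (simp add: exp_minus)
  qed
  show ?thesis
  proof (rule that)
    show "mildsol x (ex V)" unfolding mildsol_def using exc eq by blast
    show "P t (ex V t) = 0" for t using V(1) by (simp add: S_def ex_def linear_scale[OF Plin])
  qed
qed

definition propg :: "real \<Rightarrow> 'a \<Rightarrow> 'a" where "propg t x = (SOME U. mildsol x U) t"

lemma mildsol_propg: "mildsol x (\<lambda>t. propg t x)"
proof -
  \<comment> \<open>The zero family of maps imposes no constraint on the solution.\<close>
  obtain U where "mildsol x U"
    by (rule mildsol_exists[where P="\<lambda>_ _. 0 :: 'a" and x=x]) auto
  then show ?thesis unfolding propg_def by (rule someI[of "mildsol x"])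
qed

lemma propg_eqI: "mildsol x U \<Longrightarrow> U t = propg t x"
  using mildsol_unique[OF _ mildsol_propg] by metis

text \<open>Linearity passes from the equation to the propagator by uniqueness: differences and
  multiples of solutions solve the equation with the corresponding data.\<close>

lemma bounded_linear_propg: "bounded_linear (propg t)"
proof (rule bounded_linear_intro)
  have diff: "propg t (x - y) = propg t x - propg t y" for x y
    using propg_eqI[OF mildsol_diff[OF mildsol_propg[of x] mildsol_propg[of y]], of t] by simp
  have z: "propg t 0 = 0" using diff[of 0 0] by simp
  show "propg t (x + y) = propg t x + propg t y" for x y
    using diff[of x "- y"] diff[of 0 y] z by simp
  show "propg t (r *\<^sub>R x) = r *\<^sub>R propg t x" for r x
  proof -
    have sc: "G s (L (r *\<^sub>R y)) = r *\<^sub>R G s (L y)" "G s (r *\<^sub>R y) = r *\<^sub>R G s y" for s y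
      using G_bl L_bl by (simp_all add: bounded_linear.linear linear_scale)
    have m: "continuous_on UNIV (\<lambda>t. propg t x)" "\<And>t. propg t x = G t x + duh G L (\<lambda>t. propg t x) t"
      using mildsol_propg[of x] unfolding mildsol_def by blast+
    have d: "duh G L (\<lambda>t. r *\<^sub>R propg t x) s = r *\<^sub>R duh G L (\<lambda>t. propg t x) s" for s
      unfolding duh_def sc by (simp only: integral_cmul scaleR_scaleR mult.commute)
    have "mildsol (r *\<^sub>R x) (\<lambda>t. r *\<^sub>R propg t x)"
      unfolding mildsol_def
    proof (intro conjI allI)
      show "continuous_on UNIV (\<lambda>t. r *\<^sub>R propg t x)" by (intro continuous_intros m)
      show "r *\<^sub>R propg s x = G s (r *\<^sub>R x) + duh G L (\<lambda>t. r *\<^sub>R propg t x) s" for s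
        unfolding d sc using m(2)[of s] by (simp only: scaleR_add_right[symmetric])
    qed
    then show ?thesis using propg_eqI[of "r *\<^sub>R x" "\<lambda>t. r *\<^sub>R propg t x" t] by simp
  qed
  show "norm (propg t x) \<le> norm x * (2 * Kg * exp (M * \<bar>t\<bar>))" for x
  proof -
    have "norm x * (2 * Kg * exp (M * \<bar>t\<bar>)) = 2 * (Kg * norm x) * exp (M * \<bar>t\<bar>)"
      by (simp only: mult_ac)
    then show ?thesis using mildsol_bound[OF mildsol_propg[of x], of t] by linarith
  qed
qed

end

section \<open>The scalar oscillator\<close>

definition csn :: "real \<Rightarrow> real \<Rightarrow> real" where "csn \<omega> t = cos (\<omega> * t)"
text \<open>The function sin(\<omega> t) / \<omega>, continued to \<omega> = 0 by its limit t; the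
  zero Fourier mode of the massless wave equation grows linearly.\<close>

definition snn :: "real \<Rightarrow> real \<Rightarrow> real" where "snn \<omega> t = (if \<omega> = 0 then t else sin (\<omega> * t) / \<omega>)"

lemma csn_0 [simp]: "csn \<omega> 0 = 1" and snn_0 [simp]: "snn \<omega> 0 = 0"
  by (auto simp: csn_def snn_def)

lemma snn_deriv: "(snn \<omega> has_real_derivative csn \<omega> t) (at t)"
  by (cases "\<omega> = 0") (auto simp: snn_def[abs_def] csn_def intro!: derivative_eq_intros)

lemma csn_deriv: "(csn \<omega> has_real_derivative (- (\<omega>\<^sup>2) * snn \<omega> t)) (at t)"
  by (cases "\<omega> = 0") (auto simp: snn_def csn_def[abs_def] power2_eq_square intro!: derivative_eq_intros)

lemma csn_cont:
  fixes f :: "'a::topological_space \<Rightarrow> real"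
  assumes "continuous_on S f" shows "continuous_on S (\<lambda>x. csn \<omega> (f x))"
  unfolding csn_def by (intro continuous_on_compose2[OF continuous_on_cos[OF continuous_on_id, of UNIV]] continuous_intros assms) auto

lemma snn_cont:
  fixes f :: "'a::topological_space \<Rightarrow> real"
  assumes "continuous_on S f" shows "continuous_on S (\<lambda>x. snn \<omega> (f x))"
proof -
  have "continuous_on S (\<lambda>x. sin (\<omega> * f x))"
    by (intro continuous_on_compose2[OF continuous_on_sin[OF continuous_on_id, of UNIV]] continuous_intros assms) auto
  then show ?thesis unfolding snn_def using assms by (cases "\<omega> = 0") (auto intro!: continuous_intros)
qed

lemma csn_abs_le: "\<bar>csn \<omega> t\<bar> \<le> 1" by (simp add: csn_def)

lemma snn_abs_le: "\<bar>snn \<omega> t\<bar> \<le> \<bar>t\<bar>"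
  using abs_sin_x_le_abs_x[of "\<omega> * t"] by (auto simp: snn_def abs_mult field_simps)

lemma omega_snn: "\<omega> * snn \<omega> t = sin (\<omega> * t)"
  by (simp add: snn_def)

lemma omega_snn_le: "\<bar>\<omega> * snn \<omega> t\<bar> \<le> 1"
  by (simp add: omega_snn)

lemma csn_snn_square: "(csn \<omega> t)\<^sup>2 + \<omega>\<^sup>2 * (snn \<omega> t)\<^sup>2 = 1"
  by (simp add: power_mult_distrib[symmetric] omega_snn) (simp add: csn_def)

lemma snn_diff: "snn \<omega> (t - s) = snn \<omega> t * csn \<omega> s - csn \<omega> t * snn \<omega> s"
  by (simp add: snn_def csn_def right_diff_distrib sin_diff diff_divide_distrib)

lemma csn_diff: "csn \<omega> (t - s) = csn \<omega> t * csn \<omega> s + \<omega>\<^sup>2 * (snn \<omega> t * snn \<omega> s)"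
  by (simp add: snn_def csn_def right_diff_distrib cos_diff power2_eq_square)

text \<open>Integral from 0 to t for both signs of t, in the same rescaled form as
  \<open>duh\<close>.\<close>

definition lint :: "(real \<Rightarrow> real) \<Rightarrow> real \<Rightarrow> real" where
  "lint f t = t * integral {0..1} (\<lambda>\<sigma>. f (t * \<sigma>))"

lemma lint_antiderivative:
  assumes f: "continuous_on UNIV f"
    and F: "\<And>x. x \<in> {min 0 t..max 0 t} \<Longrightarrow> (F has_vector_derivative f x) (at x within {min 0 t..max 0 t})"
  shows "lint f t = F t - F 0" and "(LBINT s=0..ereal t. f s) = F t - F 0"
proof -
  have "((\<lambda>\<sigma>. t *\<^sub>R f (t * \<sigma>)) has_integral (F (t * 1) - F (t * 0))) {0..1}"
  proof (rule fundamental_theorem_of_calculus)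
    fix \<sigma> :: real assume s: "\<sigma> \<in> {0..1}"
    have im: "(\<lambda>\<sigma>. t * \<sigma>) ` {0..1} \<subseteq> {min 0 t..max 0 t}"
      by (cases "t \<ge> 0") (auto simp: mult_left_le mult_nonpos_nonneg mult_le_cancel_left min_def max_def
        intro: order_trans[OF mult_left_le])
    have "((\<lambda>\<sigma>. t * \<sigma>) has_vector_derivative t) (at \<sigma> within {0..1})"
      by (auto intro!: derivative_eq_intros simp: has_real_derivative_iff_has_vector_derivative[symmetric])
    moreover have "(F has_vector_derivative f (t * \<sigma>)) (at (t * \<sigma>) within (\<lambda>\<sigma>. t * \<sigma>) ` {0..1})"
      using F[of "t * \<sigma>"] im s by (blast intro: has_vector_derivative_within_subset)
    ultimately show "((\<lambda>\<sigma>. F (t * \<sigma>)) has_vector_derivative t *\<^sub>R f (t * \<sigma>)) (at \<sigma> within {0..1})"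
      using vector_diff_chain_within by (fastforce simp: o_def)
  qed simp
  from integral_unique[OF this] show "lint f t = F t - F 0"
    unfolding lint_def integral_cmul by simp
  have "(LBINT s=ereal 0..ereal t. f s) = F t - F 0"
    by (rule interval_integral_FTC_finite) (use F continuous_on_subset[OF f] in auto)
  then show "(LBINT s=0..ereal t. f s) = F t - F 0" by (simp add: zero_ereal_def)
qed

lemma lint_eq_LBINT: "continuous_on UNIV f \<Longrightarrow> (LBINT s=0..ereal t. f s) = lint f t"
proof -
  assume f: "continuous_on UNIV f"
  obtain F where "\<And>x. x \<in> {min 0 t..max 0 t} \<Longrightarrow> (F has_vector_derivative f x) (at x within {min 0 t..max 0 t})"
    using antiderivative_continuous[OF continuous_on_subset[OF f subset_UNIV, of "{min 0 t..max 0 t}"]] by blast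
  from lint_antiderivative[OF f this] show ?thesis by simp
qed

lemma lint_deriv:
  assumes f: "continuous_on UNIV f" shows "(lint f has_real_derivative f t) (at t)"
proof -
  define N where "N = \<bar>t\<bar> + 1"
  obtain F where F: "\<And>x. x \<in> {-N..N} \<Longrightarrow> (F has_vector_derivative f x) (at x within {-N..N})"
    using antiderivative_continuous[OF continuous_on_subset[OF f subset_UNIV, of "{-N..N}"]] by blast
  have eq: "F s - F 0 = lint f s" if "s \<in> {-N<..<N}" for s
    by (rule lint_antiderivative(1)[OF f, symmetric])
       (use that in \<open>auto intro!: has_vector_derivative_within_subset[OF F]\<close>)
  have "t \<in> {-N<..<N}" by (auto simp: N_def)
  then have "(F has_real_derivative f t) (at t)"
    using F[of t] at_within_interior[of t "{-N..N}"] by (simp add: has_real_derivative_iff_has_vector_derivative)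
  then have "((\<lambda>s. F s - F 0) has_real_derivative f t) (at t)" by (auto intro!: derivative_eq_intros)
  then show ?thesis
    by (rule has_field_derivative_transform_within_open[of _ _ _ "{-N<..<N}"]) (use eq \<open>t \<in> {-N<..<N}\<close> in auto)
qed

lemma lint_lincomb:
  assumes "continuous_on UNIV f" "continuous_on UNIV g"
  shows "lint (\<lambda>s. a * f s + b * g s) t = a * lint f t + b * lint g t"
proof -
  have i: "(\<lambda>\<sigma>. f (t * \<sigma>)) integrable_on {0..1}" "(\<lambda>\<sigma>. g (t * \<sigma>)) integrable_on {0..1}"
    by (intro integrable_continuous_real continuous_on_compose2[OF assms(1)] continuous_on_compose2[OF assms(2)] continuous_intros; simp)+
  have "integral {0..1} (\<lambda>\<sigma>. a * f (t * \<sigma>) + b * g (t * \<sigma>)) = a * integral {0..1} (\<lambda>\<sigma>. f (t * \<sigma>)) + b * integral {0..1} (\<lambda>\<sigma>. g (t * \<sigma>))"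
    using integrable_cmul[OF i(1), of a] integrable_cmul[OF i(2), of b]
    by (subst Henstock_Kurzweil_Integration.integral_add) simp_all
  then show ?thesis by (simp add: lint_def algebra_simps)
qed

definition duhform :: "real \<Rightarrow> real \<Rightarrow> real \<Rightarrow> (real \<Rightarrow> real) \<Rightarrow> (real \<Rightarrow> real) \<Rightarrow> (real \<Rightarrow> real) \<Rightarrow> bool" where
  "duhform \<omega> x0 y0 q x y \<longleftrightarrow> (\<forall>t.
     x t = csn \<omega> t * x0 + snn \<omega> t * y0 + lint (\<lambda>s. snn \<omega> (t - s) * q s) t \<and>
     y t = - (\<omega>\<^sup>2) * snn \<omega> t * x0 + csn \<omega> t * y0 + lint (\<lambda>s. csn \<omega> (t - s) * q s) t)"

text \<open>Forwards, the addition formulas separate t from s, and the remaining integrals are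
  differentiated. Backwards, let the state at time s evolve freely up to time t: its derivative in s
  contains the forcing term alone, and integrating it gives the formula.\<close>

lemma duhform_iff_ode:
  assumes q: "continuous_on UNIV q"
  shows "duhform \<omega> x0 y0 q x y \<longleftrightarrow> x 0 = x0 \<and> y 0 = y0 \<and>
    (\<forall>t. (x has_real_derivative y t) (at t) \<and> (y has_real_derivative (- (\<omega>\<^sup>2) * x t + q t)) (at t))"
proof
  assume d: "duhform \<omega> x0 y0 q x y"
  have c1: "continuous_on UNIV (\<lambda>s. csn \<omega> s * q s)" and c2: "continuous_on UNIV (\<lambda>s. snn \<omega> s * q s)"
    by (intro continuous_intros csn_cont snn_cont q)+
  let ?A = "lint (\<lambda>s. csn \<omega> s * q s)" and ?C = "lint (\<lambda>s. snn \<omega> s * q s)"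
  have i1: "lint (\<lambda>s. snn \<omega> (t - s) * q s) t = snn \<omega> t * ?A t + (- csn \<omega> t) * ?C t" for t
    unfolding lint_lincomb[OF c1 c2, symmetric]
    by (rule arg_cong[where f="\<lambda>f. lint f t"]) (simp add: fun_eq_iff snn_diff algebra_simps)
  have i2: "lint (\<lambda>s. csn \<omega> (t - s) * q s) t = csn \<omega> t * ?A t + (\<omega>\<^sup>2 * snn \<omega> t) * ?C t" for t
    unfolding lint_lincomb[OF c1 c2, symmetric]
    by (rule arg_cong[where f="\<lambda>f. lint f t"]) (simp add: fun_eq_iff csn_diff algebra_simps)
  have x: "x = (\<lambda>t. csn \<omega> t * x0 + snn \<omega> t * y0 + (snn \<omega> t * ?A t + (- csn \<omega> t) * ?C t))"
    using d unfolding duhform_def i1 by blast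
  have y: "y = (\<lambda>t. - (\<omega>\<^sup>2) * snn \<omega> t * x0 + csn \<omega> t * y0 + (csn \<omega> t * ?A t + (\<omega>\<^sup>2 * snn \<omega> t) * ?C t))"
    using d unfolding duhform_def i2 by blast
  have z: "lint f 0 = 0" for f by (simp add: lint_def)
  note D = csn_deriv snn_deriv lint_deriv[OF c1] lint_deriv[OF c2]
  have "(x has_real_derivative y t) (at t)" for t
    unfolding x y by (rule derivative_eq_intros D refl | simp)+
  moreover have "(y has_real_derivative (- (\<omega>\<^sup>2) * x t + q t)) (at t)" for t
  proof -
    define Z where "Z = - (\<omega>\<^sup>2) * csn \<omega> t * x0 + (- (\<omega>\<^sup>2) * snn \<omega> t) * y0
      + (((- (\<omega>\<^sup>2) * snn \<omega> t) * ?A t + csn \<omega> t * (csn \<omega> t * q t))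
      + ((\<omega>\<^sup>2 * csn \<omega> t) * ?C t + (\<omega>\<^sup>2 * snn \<omega> t) * (snn \<omega> t * q t)))"
    have "(y has_real_derivative Z) (at t)"
      unfolding y Z_def by ((rule derivative_eq_intros D refl | simp)+, (simp add: algebra_simps)?)
    moreover have e: "csn \<omega> t * (csn \<omega> t * q t) + (\<omega>\<^sup>2 * snn \<omega> t) * (snn \<omega> t * q t) = q t"
    proof -
      have "csn \<omega> t * (csn \<omega> t * q t) + (\<omega>\<^sup>2 * snn \<omega> t) * (snn \<omega> t * q t) = ((csn \<omega> t)\<^sup>2 + \<omega>\<^sup>2 * (snn \<omega> t)\<^sup>2) * q t"
        by (simp add: power2_eq_square algebra_simps)
      then show ?thesis by (simp add: csn_snn_square)
    qed
    have "Z = - (\<omega>\<^sup>2) * (csn \<omega> t * x0 + snn \<omega> t * y0 + (snn \<omega> t * ?A t + (- csn \<omega> t) * ?C t))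
      + (csn \<omega> t * (csn \<omega> t * q t) + (\<omega>\<^sup>2 * snn \<omega> t) * (snn \<omega> t * q t))"
      unfolding Z_def by (simp add: algebra_simps)
    then have "Z = - (\<omega>\<^sup>2) * x t + q t" unfolding e x .
    ultimately show ?thesis by simp
  qed
  ultimately show "x 0 = x0 \<and> y 0 = y0 \<and> (\<forall>t. (x has_real_derivative y t) (at t) \<and> (y has_real_derivative (- (\<omega>\<^sup>2) * x t + q t)) (at t))"
    by (simp add: x y z)
next
  assume ode: "x 0 = x0 \<and> y 0 = y0 \<and> (\<forall>t. (x has_real_derivative y t) (at t) \<and> (y has_real_derivative (- (\<omega>\<^sup>2) * x t + q t)) (at t))"
  then have dx: "(x has_real_derivative y t) (at t)" and dy: "(y has_real_derivative (- (\<omega>\<^sup>2) * x t + q t)) (at t)" for t by auto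
  have ds: "((\<lambda>s. snn \<omega> (t - s)) has_real_derivative - csn \<omega> (t - s)) (at s)" for t s
    by (rule DERIV_cong[OF DERIV_chain2[OF snn_deriv]]) (auto intro!: derivative_eq_intros)
  have dc: "((\<lambda>s. csn \<omega> (t - s)) has_real_derivative \<omega>\<^sup>2 * snn \<omega> (t - s)) (at s)" for t s
    by (rule DERIV_cong[OF DERIV_chain2[OF csn_deriv]]) (auto intro!: derivative_eq_intros)
  show "duhform \<omega> x0 y0 q x y"
    unfolding duhform_def
  proof (intro allI conjI)
    fix t
    have "lint (\<lambda>s. snn \<omega> (t - s) * q s) t = (snn \<omega> (t - t) * y t + csn \<omega> (t - t) * x t) - (snn \<omega> (t - 0) * y 0 + csn \<omega> (t - 0) * x 0)"
    proof (rule lint_antiderivative(1)[where F="\<lambda>s. snn \<omega> (t - s) * y s + csn \<omega> (t - s) * x s"])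
      show "continuous_on UNIV (\<lambda>s. snn \<omega> (t - s) * q s)" by (intro continuous_intros snn_cont q)
      fix s
      have "((\<lambda>s. snn \<omega> (t - s) * y s + csn \<omega> (t - s) * x s) has_real_derivative snn \<omega> (t - s) * q s) (at s)"
        by (rule derivative_eq_intros ds dc dx dy refl | simp)+ (simp add: algebra_simps)
      then show "((\<lambda>s. snn \<omega> (t - s) * y s + csn \<omega> (t - s) * x s) has_vector_derivative snn \<omega> (t - s) * q s) (at s within {min 0 t..max 0 t})"
        by (simp add: has_real_derivative_iff_has_vector_derivative has_vector_derivative_at_within)
    qed
    then show "x t = csn \<omega> t * x0 + snn \<omega> t * y0 + lint (\<lambda>s. snn \<omega> (t - s) * q s) t" using ode by simp
    have "lint (\<lambda>s. csn \<omega> (t - s) * q s) t = (csn \<omega> (t - t) * y t - \<omega>\<^sup>2 * snn \<omega> (t - t) * x t) - (csn \<omega> (t - 0) * y 0 - \<omega>\<^sup>2 * snn \<omega> (t - 0) * x 0)"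
    proof (rule lint_antiderivative(1)[where F="\<lambda>s. csn \<omega> (t - s) * y s - \<omega>\<^sup>2 * snn \<omega> (t - s) * x s"])
      show "continuous_on UNIV (\<lambda>s. csn \<omega> (t - s) * q s)" by (intro continuous_intros csn_cont q)
      fix s
      have "((\<lambda>s. csn \<omega> (t - s) * y s - \<omega>\<^sup>2 * snn \<omega> (t - s) * x s) has_real_derivative csn \<omega> (t - s) * q s) (at s)"
        by (rule derivative_eq_intros ds dc dx dy refl | simp)+ (simp add: algebra_simps)
      then show "((\<lambda>s. csn \<omega> (t - s) * y s - \<omega>\<^sup>2 * snn \<omega> (t - s) * x s) has_vector_derivative csn \<omega> (t - s) * q s) (at s within {min 0 t..max 0 t})"
        by (simp add: has_real_derivative_iff_has_vector_derivative has_vector_derivative_at_within)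
    qed
    then show "y t = - (\<omega>\<^sup>2) * snn \<omega> t * x0 + csn \<omega> t * y0 + lint (\<lambda>s. csn \<omega> (t - s) * q s) t" using ode by simp
  qed
qed

text \<open>Changing the frequency is absorbed in the forcing term; this is how the mass of the Klein-Gordon
  equation is traded for the constant potential.\<close>
lemma duhform_shift:
  assumes q: "continuous_on UNIV q" and x: "continuous_on UNIV x"
  shows "duhform \<omega> x0 y0 q x y \<longleftrightarrow> duhform \<omega>' x0 y0 (\<lambda>t. q t + (\<omega>'\<^sup>2 - \<omega>\<^sup>2) * x t) x y"
proof -
  have q': "continuous_on UNIV (\<lambda>t. q t + (\<omega>'\<^sup>2 - \<omega>\<^sup>2) * x t)" by (intro continuous_intros q x)
  have "- (\<omega>'\<^sup>2) * x t + (q t + (\<omega>'\<^sup>2 - \<omega>\<^sup>2) * x t) = - (\<omega>\<^sup>2) * x t + q t" for t by (simp add: algebra_simps)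
  then show ?thesis unfolding duhform_iff_ode[OF q] duhform_iff_ode[OF q'] by (simp only:)
qed

section \<open>The wave group\<close>

definition wc :: "real \<Rightarrow> nat \<Rightarrow> real" where "wc t n = csn (sqrt (real n)) t"
definition ws :: "real \<Rightarrow> nat \<Rightarrow> real" where "ws t n = snn (sqrt (real n)) t"
text \<open>Off-diagonal entry of the wave group in the coordinates (v, y). Conjugation by
  \<open>J\<close> divides this entry by \<open>jsym\<close> and multiplies the other one,
  \<open>wb\<close>, by it; both become bounded in n.\<close>

definition wa :: "real \<Rightarrow> nat \<Rightarrow> real" where "wa t n = ws t n / jsym n"
definition wb :: "real \<Rightarrow> nat \<Rightarrow> real" where "wb t n = - (real n * ws t n * jsym n)"

lemma wc_le: "\<bar>wc t n\<bar> \<le> 1" by (simp add: wc_def csn_abs_le)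
lemma ws_le: "\<bar>ws t n\<bar> \<le> \<bar>t\<bar>" by (simp add: ws_def snn_abs_le)
lemma sqrt_ws_le: "sqrt (real n) * \<bar>ws t n\<bar> \<le> 1"
  using omega_snn_le[of "sqrt (real n)" t] by (simp add: ws_def abs_mult)

lemma wa_le: "\<bar>wa t n\<bar> \<le> \<bar>t\<bar> + 1"
proof -
  have "sqrt (1 + real n) \<le> 1 + sqrt (real n)"
    by (rule real_le_lsqrt) (auto simp: power2_sum)
  then have "\<bar>ws t n\<bar> * sqrt (1 + real n) \<le> \<bar>ws t n\<bar> * (1 + sqrt (real n))" by (intro mult_left_mono) auto
  also have "\<dots> \<le> \<bar>t\<bar> + 1" using ws_le[of t n] sqrt_ws_le[of n t] by (simp add: algebra_simps)
  finally show ?thesis by (simp add: wa_def jsym_def abs_mult)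
qed

lemma wb_le: "\<bar>wb t n\<bar> \<le> 1"
proof -
  have "sqrt (real n) * jsym n \<le> 1" by (simp add: jsym_def)
  then have "(sqrt (real n) * \<bar>ws t n\<bar>) * (sqrt (real n) * jsym n) \<le> 1 * 1"
    using sqrt_ws_le jsym_pos[of n] by (intro mult_mono) auto
  moreover have "(sqrt (real n) * \<bar>ws t n\<bar>) * (sqrt (real n) * jsym n) = \<bar>wb t n\<bar>"
    using jsym_pos[of n] by (simp add: wb_def abs_mult mult_ac)
  ultimately show ?thesis by simp
qed

lemma bdd_w [simp]: "bdd_fun (wc t)" "bdd_fun (ws t)" "bdd_fun (wa t)" "bdd_fun (wb t)"
  by (rule bdd_funI[OF wc_le] bdd_funI[OF ws_le] bdd_funI[OF wa_le] bdd_funI[OF wb_le])+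

lemma w_cont: "continuous_on UNIV (\<lambda>t. wc t n)" "continuous_on UNIV (\<lambda>t. ws t n)"
  "continuous_on UNIV (\<lambda>t. wa t n)" "continuous_on UNIV (\<lambda>t. wb t n)"
  unfolding wa_def wb_def wc_def ws_def using jsym_pos[of n]
  by (auto intro!: continuous_intros csn_cont snn_cont)

definition wgrp :: "real \<Rightarrow> 'd::finite l2 \<times> 'd l2 \<Rightarrow> 'd l2 \<times> 'd l2" where
  "wgrp t z = (cal (wc t) (fst z) + cal (wa t) (snd z), cal (wb t) (fst z) + cal (wc t) (snd z))"

lemma cal_continuous:
  fixes x :: "'d::finite l2"
  assumes c: "\<And>n. continuous_on UNIV (\<lambda>t::real. c t n)" and b: "\<And>t n. \<bar>c t n\<bar> \<le> \<bar>t\<bar> + 1"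
  shows "continuous_on UNIV (\<lambda>t. cal (c t) x)"
proof -
  have "((\<lambda>t. cal (c t) x) \<longlongrightarrow> cal (c t0) x) (at t0)" for t0
  proof (rule sp.cal_tendsto[where K="\<bar>t0\<bar> + 2"])
    have "\<forall>\<^sub>F t in at t0. dist t t0 < 1" by (auto simp: eventually_at intro!: exI[of _ 1])
    then show "\<forall>\<^sub>F t in at t0. \<forall>n. \<bar>c t n\<bar> \<le> \<bar>t0\<bar> + 2"
    proof (rule eventually_mono, intro allI)
      fix t n assume "dist t t0 < 1"
      then show "\<bar>c t n\<bar> \<le> \<bar>t0\<bar> + 2" using b[of t n] by (simp add: dist_real_def)
    qed
    show "bdd_fun (c t0)" using b by (rule bdd_funI)
    show "((\<lambda>t. c t n) \<longlongrightarrow> c t0 n) (at t0)" for n using c[of n] by (simp add: continuous_on_def)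
  qed
  then show ?thesis by (simp add: continuous_on_def)
qed

global_interpretation wave: evo "wgrp :: real \<Rightarrow> 'd::finite l2 \<times> 'd l2 \<Rightarrow> 'd l2 \<times> 'd l2" 5
proof (rule evo.intro)
  fix t :: real and x :: "'d l2 \<times> 'd l2"
  have "bounded_linear (\<lambda>z :: 'd l2 \<times> 'd l2. cal c (fst z))" "bounded_linear (\<lambda>z :: 'd l2 \<times> 'd l2. cal c (snd z))"
    if "bdd_fun c" for c
    using bounded_linear_compose[OF sp.bounded_linear_cal[OF that] bounded_linear_fst]
      bounded_linear_compose[OF sp.bounded_linear_cal[OF that] bounded_linear_snd] by auto
  then show "bounded_linear (wgrp t :: 'd l2 \<times> 'd l2 \<Rightarrow> _)"
    unfolding wgrp_def[abs_def] by (intro bounded_linear_Pair bounded_linear_add) simp_all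
  have "\<bar>wc t n\<bar> \<le> \<bar>t\<bar> + 1" "\<bar>wb t n\<bar> \<le> \<bar>t\<bar> + 1" for t n using wc_le[of t n] wb_le[of t n] by linarith+
  then show "continuous_on UNIV (\<lambda>t. wgrp t x)"
    unfolding wgrp_def by (intro continuous_intros cal_continuous w_cont wa_le)
  have f: "norm (fst x) \<le> norm x" and s: "norm (snd x) \<le> norm x" using norm_fst_le[of "fst x" "snd x"] norm_snd_le[of "snd x" "fst x"] by simp_all
  have c: "norm (cal (wc t) (fst x)) \<le> norm x" "norm (cal (wc t) (snd x)) \<le> norm x" "norm (cal (wb t) (fst x)) \<le> norm x"
    using sp.cal_norm_le[of "wc t" 1, OF wc_le] sp.cal_norm_le[of "wb t" 1, OF wb_le] f s order_trans by (metis mult_1)+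
  have a: "norm (cal (wa t) (snd x)) \<le> (\<bar>t\<bar> + 1) * norm x"
    using sp.cal_norm_le[of "wa t" "\<bar>t\<bar> + 1" "snd x", OF wa_le] s by (meson abs_ge_zero add_nonneg_nonneg mult_left_mono order_trans zero_le_one)
  have "norm (wgrp t x) \<le> norm (cal (wc t) (fst x) + cal (wa t) (snd x)) + norm (cal (wb t) (fst x) + cal (wc t) (snd x))"
    unfolding wgrp_def by (rule norm_Pair_le)
  also have "\<dots> \<le> (norm x + (\<bar>t\<bar> + 1) * norm x) + (norm x + norm x)"
    using a c by (intro add_mono norm_triangle_le) auto
  also have "\<dots> = (\<bar>t\<bar> + 4) * norm x" by (simp add: algebra_simps)
  \<comment> \<open>exp r is at least 1 + r, so 5 exp |t| dominates |t| + 4.\<close>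
  also have "\<dots> \<le> 5 * exp \<bar>t\<bar> * norm x"
    by (rule mult_right_mono) (use exp_ge_add_one_self[of "\<bar>t\<bar>"] abs_ge_zero[of t] in linarith, simp)
  finally show "norm (wgrp t x) \<le> 5 * exp \<bar>t\<bar> * norm x" .
  have "wc 0 = (\<lambda>n. 1)" "wa 0 = (\<lambda>n. 0)" "wb 0 = (\<lambda>n. 0)" by (simp_all add: wc_def wa_def wb_def ws_def fun_eq_iff)
  then show "wgrp 0 x = x" by (simp add: wgrp_def)
qed

definition Lq :: "(real^'d::finite \<Rightarrow> real) \<Rightarrow> 'd l2 \<times> 'd l2 \<Rightarrow> 'd l2 \<times> 'd l2" where
  "Lq q z = (0, mult q (J (fst z)))"

lemma evo_pert_Lq:
  fixes q :: "real^'d::finite \<Rightarrow> real"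
  assumes q: "bmp q" and K: "\<And>x. \<bar>q x\<bar> \<le> K"
  shows "evo_pert wgrp 5 (Lq q) K"
proof (intro evo_pert.intro wave.evo_axioms evo_pert_axioms.intro)
  show K0: "K \<ge> 0" using K[of 0] by linarith
  have "bounded_linear (\<lambda>z :: 'd l2 \<times> 'd l2. mult q (J (fst z)))"
    using bounded_linear_compose[OF bounded_linear_mult[OF q] bounded_linear_compose[OF bounded_linear_J bounded_linear_fst]] by simp
  then show "bounded_linear (Lq q)"
    unfolding Lq_def[abs_def] by (intro bounded_linear_Pair bounded_linear_zero)
  fix z :: "'d l2 \<times> 'd l2"
  have "norm (mult q (J (fst z))) \<le> K * norm (J (fst z))" by (rule mult_norm_le[OF q K])
  also have "\<dots> \<le> K * norm z"
    using K0 norm_fst_le[of "fst z" "snd z"] by (intro mult_left_mono order_trans[OF J_norm_le]) auto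
  finally show "norm (Lq q z) \<le> K * norm z" by (simp add: Lq_def)
qed simp

text \<open>Version of \<open>mildsol\<close> outside the locale, whose interpretation asks for an
  explicit bound of each potential; \<open>Phi\<close> plays the same role for
  \<open>propg\<close>.\<close>

definition wsol :: "(real^'d::finite \<Rightarrow> real) \<Rightarrow> 'd l2 \<times> 'd l2 \<Rightarrow> (real \<Rightarrow> 'd l2 \<times> 'd l2) \<Rightarrow> bool" where
  "wsol q z U \<longleftrightarrow> continuous_on UNIV U \<and> (\<forall>t. U t = wgrp t z + duh wgrp (Lq q) U t)"

definition Phi :: "(real^'d::finite \<Rightarrow> real) \<Rightarrow> real \<Rightarrow> 'd l2 \<times> 'd l2 \<Rightarrow> 'd l2 \<times> 'd l2" where
  "Phi q t z = (SOME U. wsol q z U) t"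

lemma
  fixes q :: "real^'d::finite \<Rightarrow> real"
  assumes q: "bmp q"
  shows wsol_Phi: "wsol q z (\<lambda>t. Phi q t z)"
    and Phi_eqI: "wsol q z U \<Longrightarrow> U t = Phi q t z"
    and bounded_linear_Phi: "bounded_linear (Phi q t)"
proof -
  obtain K where K: "\<And>x. \<bar>q x\<bar> \<le> K" using q by (auto simp: bmp_def)
  interpret evo_pert "wgrp :: real \<Rightarrow> 'd l2 \<times> 'd l2 \<Rightarrow> _" 5 "Lq q" K by (rule evo_pert_Lq[OF q K])
  have e: "wsol q = mildsol" by (simp add: fun_eq_iff wsol_def mildsol_def)
  have p: "Phi q = propg" by (simp add: fun_eq_iff Phi_def propg_def e)
  show "wsol q z (\<lambda>t. Phi q t z)" unfolding e p by (rule mildsol_propg)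
  show "wsol q z U \<Longrightarrow> U t = Phi q t z" unfolding e p by (rule propg_eqI)
  show "bounded_linear (Phi q t)" unfolding p by (rule bounded_linear_propg)
qed

subsection \<open>Fourier modes of mild solutions\<close>

definition modev :: "nat \<Rightarrow> 'd::finite l2 \<Rightarrow> bool" where
  "modev n m \<longleftrightarrow> (\<forall>c x. bdd_fun c \<longrightarrow> inner (cal c x) m = c n * inner x m)"

lemma modev_trig: "k \<in> shell n \<Longrightarrow> modev n (cosk k)" "k \<in> shell n \<Longrightarrow> modev n (sink k)"
  by (simp_all add: modev_def cal_modes)

definition fX :: "'d::finite l2 \<Rightarrow> 'd l2 \<times> 'd l2 \<Rightarrow> real" where "fX m z = inner (J (fst z)) m"
definition fY :: "'d::finite l2 \<Rightarrow> 'd l2 \<times> 'd l2 \<Rightarrow> real" where "fY m z = inner (snd z) m"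

lemma bounded_linear_fX: "bounded_linear (fX m)"
  using bounded_linear_compose[OF bounded_linear_inner_left bounded_linear_compose[OF bounded_linear_J bounded_linear_fst]]
  by (simp add: fX_def[abs_def])
lemma bounded_linear_fY: "bounded_linear (fY m)"
  using bounded_linear_compose[OF bounded_linear_inner_left bounded_linear_snd] by (simp add: fY_def[abs_def])

lemma J_wgrp: "J (fst (wgrp t z)) = cal (wc t) (J (fst z)) + cal (ws t) (snd z)"
proof -
  have "J (cal (wc t) x) = cal (wc t) (J x)" for x :: "'a l2"
    unfolding J_def by (simp add: sp.cal_cal mult.commute)
  moreover have "J (cal (wa t) x) = cal (ws t) x" for x :: "'a l2"
  proof -
    have "(\<lambda>n. jsym n * wa t n) = ws t" using jsym_pos by (simp add: wa_def fun_eq_iff) (metis less_irrefl)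
    then show ?thesis unfolding J_def by (simp add: sp.cal_cal)
  qed
  ultimately show ?thesis by (simp add: wgrp_def J_add)
qed

lemma modes_wgrp:
  assumes "modev n m"
  shows "fX m (wgrp t z) = csn (sqrt (real n)) t * fX m z + snn (sqrt (real n)) t * fY m z"
    and "fY m (wgrp t z) = - ((sqrt (real n))\<^sup>2) * snn (sqrt (real n)) t * fX m z + csn (sqrt (real n)) t * fY m z"
proof -
  show "fX m (wgrp t z) = csn (sqrt (real n)) t * fX m z + snn (sqrt (real n)) t * fY m z"
    using assms by (simp add: fX_def fY_def J_wgrp inner_add_left modev_def wc_def ws_def)
  have "fX m z = jsym n * inner (fst z) m"
    using assms by (simp add: fX_def J_def modev_def)
  then show "fY m (wgrp t z) = - ((sqrt (real n))\<^sup>2) * snn (sqrt (real n)) t * fX m z + csn (sqrt (real n)) t * fY m z"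
    using assms by (simp add: fY_def wgrp_def inner_add_left modev_def wb_def wc_def ws_def)
qed

lemma modes_separate:
  fixes a b :: "'d::finite l2 \<times> 'd l2"
  assumes "\<And>n k e. k \<in> shell n \<Longrightarrow> e \<in> {cosk, sink} \<Longrightarrow> fX (e k) a = fX (e k) b \<and> fY (e k) a = fY (e k) b"
  shows "a = b"
proof -
  have "J (fst a) - J (fst b) = 0"
  proof (rule modes_total)
    fix k :: "real^'d" assume "lattice k"
    then obtain n where "k \<in> shell n" by (rule lattice_shell)
    then show "inner (J (fst a) - J (fst b)) (cosk k) = 0" "inner (J (fst a) - J (fst b)) (sink k) = 0"
      using assms[of k n cosk] assms[of k n sink] by (simp_all add: fX_def inner_diff_left)
  qed
  moreover have "snd a - snd b = 0"
  proof (rule modes_total)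
    fix k :: "real^'d" assume "lattice k"
    then obtain n where "k \<in> shell n" by (rule lattice_shell)
    then show "inner (snd a - snd b) (cosk k) = 0" "inner (snd a - snd b) (sink k) = 0"
      using assms[of k n cosk] assms[of k n sink] by (simp_all add: fY_def inner_diff_left)
  qed
  ultimately show ?thesis using J_inj[of "fst a" "fst b"] by (simp add: prod_eq_iff)
qed

text \<open>The functionals \<open>fX\<close> and \<open>fY\<close> are continuous, hence commute
  with the Duhamel integral, and over all modes they separate points; so the equation splits into
  scalar oscillators.\<close>

lemma wsol_iff_modes:
  fixes q :: "real^'d::finite \<Rightarrow> real"
  assumes q: "bmp q" and U: "continuous_on UNIV U"
  shows "wsol q z U \<longleftrightarrow> (\<forall>n k e. k \<in> shell n \<longrightarrow> e \<in> {cosk, sink} \<longrightarrow>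
     duhform (sqrt (real n)) (fX (e k) z) (fY (e k) z) (\<lambda>t. inner (mult q (J (fst (U t)))) (e k)) (\<lambda>t. fX (e k) (U t)) (\<lambda>t. fY (e k) (U t)))"
proof -
  obtain K where K: "\<And>x. \<bar>q x\<bar> \<le> K" using q by (auto simp: bmp_def)
  interpret evo_pert "wgrp :: real \<Rightarrow> 'd l2 \<times> 'd l2 \<Rightarrow> _" 5 "Lq q" K by (rule evo_pert_Lq[OF q K])
  have fd: "f (duh wgrp (Lq q) U t) = t * integral {0..1} (\<lambda>\<sigma>. f (wgrp (t * (1 - \<sigma>)) (Lq q (U (t * \<sigma>)))))"
    if f: "bounded_linear f" for f :: "'d l2 \<times> 'd l2 \<Rightarrow> real" and t
  proof -
    have "f (integral {0..1} (\<lambda>\<sigma>. wgrp (t * (1 - \<sigma>)) (Lq q (U (t * \<sigma>))))) = integral {0..1} (f \<circ> (\<lambda>\<sigma>. wgrp (t * (1 - \<sigma>)) (Lq q (U (t * \<sigma>)))))"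
      by (rule integral_linear[symmetric, OF integrand_integrable[OF U] f])
    then show ?thesis unfolding duh_def using f by (simp add: bounded_linear.linear linear_scale o_def)
  qed
  have modes: "fX m (wgrp t z + duh wgrp (Lq q) U t) = csn (sqrt (real n)) t * fX m z + snn (sqrt (real n)) t * fY m z
       + lint (\<lambda>s. snn (sqrt (real n)) (t - s) * inner (mult q (J (fst (U s)))) m) t \<and>
     fY m (wgrp t z + duh wgrp (Lq q) U t) = - ((sqrt (real n))\<^sup>2) * snn (sqrt (real n)) t * fX m z + csn (sqrt (real n)) t * fY m z
       + lint (\<lambda>s. csn (sqrt (real n)) (t - s) * inner (mult q (J (fst (U s)))) m) t"
    if m: "modev n m" for n m t
  proof -
    have l: "fX m (Lq q y) = 0" "fY m (Lq q y) = inner (mult q (J (fst y))) m" for y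
      by (simp_all add: fX_def fY_def Lq_def)
    have t: "t * (1 - \<sigma>) = t - t * \<sigma>" for \<sigma> by (simp add: algebra_simps)
    show ?thesis
      unfolding linear_add[OF bounded_linear.linear[OF bounded_linear_fX]] linear_add[OF bounded_linear.linear[OF bounded_linear_fY]]
        fd[OF bounded_linear_fX] fd[OF bounded_linear_fY] modes_wgrp[OF m] l lint_def t by simp
  qed
  show ?thesis
  proof
    assume s: "wsol q z U"
    show "\<forall>n k e. k \<in> shell n \<longrightarrow> e \<in> {cosk, sink} \<longrightarrow>
     duhform (sqrt (real n)) (fX (e k) z) (fY (e k) z) (\<lambda>t. inner (mult q (J (fst (U t)))) (e k)) (\<lambda>t. fX (e k) (U t)) (\<lambda>t. fY (e k) (U t))"
      unfolding duhform_def
    proof (intro allI impI)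
      fix n t and k :: "real^'d" and e :: "real^'d \<Rightarrow> 'd l2" assume "k \<in> shell n" "e \<in> {cosk, sink}"
      then have "modev n (e k)" using modev_trig by auto
      from modes[OF this, of t] s show "fX (e k) (U t) = csn (sqrt (real n)) t * fX (e k) z + snn (sqrt (real n)) t * fY (e k) z
       + lint (\<lambda>s. snn (sqrt (real n)) (t - s) * inner (mult q (J (fst (U s)))) (e k)) t \<and>
       fY (e k) (U t) = - ((sqrt (real n))\<^sup>2) * snn (sqrt (real n)) t * fX (e k) z + csn (sqrt (real n)) t * fY (e k) z
       + lint (\<lambda>s. csn (sqrt (real n)) (t - s) * inner (mult q (J (fst (U s)))) (e k)) t"
        unfolding wsol_def by metis
    qed
  next
    assume d: "\<forall>n k e. k \<in> shell n \<longrightarrow> e \<in> {cosk, sink} \<longrightarrow>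
     duhform (sqrt (real n)) (fX (e k) z) (fY (e k) z) (\<lambda>t. inner (mult q (J (fst (U t)))) (e k)) (\<lambda>t. fX (e k) (U t)) (\<lambda>t. fY (e k) (U t))"
    have "U t = wgrp t z + duh wgrp (Lq q) U t" for t
    proof (rule modes_separate)
      fix n and k :: "real^'d" and e :: "real^'d \<Rightarrow> 'd l2" assume k: "k \<in> shell n" and e: "e \<in> {cosk, sink}"
      then have "modev n (e k)" using modev_trig by auto
      note M = modes[OF this, of t]
      have "duhform (sqrt (real n)) (fX (e k) z) (fY (e k) z) (\<lambda>t. inner (mult q (J (fst (U t)))) (e k)) (\<lambda>t. fX (e k) (U t)) (\<lambda>t. fY (e k) (U t))"
        using d k e by blast
      then show "fX (e k) (U t) = fX (e k) (wgrp t z + duh wgrp (Lq q) U t) \<and> fY (e k) (U t) = fY (e k) (wgrp t z + duh wgrp (Lq q) U t)"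
        unfolding duhform_def M[THEN conjunct1] M[THEN conjunct2] by blast
    qed
    then show "wsol q z U" using U by (simp add: wsol_def)
  qed
qed

subsection \<open>Agreement with the mild solutions of the Klein-Gordon equation\<close>

lemma freq_shell: "k \<in> shell n \<Longrightarrow> freq k = sqrt (1 + real n)"
  by (simp add: freq_def shell_def dot_square_norm)

lemma fco_st:
  assumes "st W z" "lattice k"
  shows "fco cos (fst W) k = fX (cosk k) z" "fco sin (fst W) k = fX (sink k) z"
    "fco cos (snd W) k = fY (cosk k) z" "fco sin (snd W) k = fY (sink k) z"
  using assms by (simp_all add: st_def fco_cos fco_sin fX_def fY_def)

text \<open>\<open>egroup\<close> is defined by choice, so a witness is required: in the coordinates
  (v, y) the Klein-Gordon group rotates shell n by the angle sqrt(1 + n) t.\<close>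

lemma egroup_exists:
  fixes z :: "'d::finite l2 \<times> 'd l2"
  assumes W: "st W z"
  shows "\<exists>W'. W' \<in> Hsp \<and> (\<forall>k e. lattice k \<and> e \<in> {cos, sin} \<longrightarrow>
        fco e (fst W') k = cos (freq k * t) * fco e (fst W) k + sin (freq k * t) / freq k * fco e (snd W) k
      \<and> fco e (snd W') k = - freq k * sin (freq k * t) * fco e (fst W) k + cos (freq k * t) * fco e (snd W) k)"
proof -
  define c where "c n = cos (sqrt (1 + real n) * t)" for n
  define s where "s n = sin (sqrt (1 + real n) * t)" for n
  have b: "bdd_fun c" "bdd_fun s" "bdd_fun (\<lambda>n. - s n)"
    by (auto intro!: bdd_funI[where K=1] simp: c_def s_def)
  define z' where "z' = (cal c (fst z) + cal s (snd z), cal (\<lambda>n. - s n) (fst z) + cal c (snd z))"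
  have *: "fX m z' = c n * fX m z + s n * jsym n * fY m z \<and> fY m z' = - s n / jsym n * fX m z + c n * fY m z"
    if m: "modev n m" for m n
  proof -
    have J: "inner (J x) m = jsym n * inner x m" for x using m by (simp add: J_def modev_def)
    show ?thesis
      using m b jsym_pos[of n] by (simp add: fX_def fY_def J z'_def inner_add_left modev_def algebra_simps)
  qed
  let ?W = "(rep (J (fst z')), rep (snd z'))"
  have st': "st ?W z'" by (rule st_rep)
  show ?thesis
  proof (intro exI[of _ ?W] conjI allI impI)
    show "?W \<in> Hsp" by (rule st_Hsp[OF st'])
  next
    fix k :: "real^'d" and e :: "real \<Rightarrow> real" assume ke: "lattice k \<and> e \<in> {cos, sin}"
    then obtain n where n: "k \<in> shell n" using lattice_shell by blast
    have j: "jsym n = 1 / freq k" "c n = cos (freq k * t)" "s n = sin (freq k * t)"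
      by (simp_all add: freq_shell[OF n] jsym_def c_def s_def)
    have f: "freq k > 0" unfolding freq_shell[OF n] by simp
    have "fco e (fst ?W) k = cos (freq k * t) * fco e (fst W) k + sin (freq k * t) / freq k * fco e (snd W) k
      \<and> fco e (snd ?W) k = - freq k * sin (freq k * t) * fco e (fst W) k + cos (freq k * t) * fco e (snd W) k"
      using ke *[OF modev_trig(1)[OF n]] *[OF modev_trig(2)[OF n]] f
      by (auto simp only: fco_st[OF st'] fco_st[OF W] j insert_iff empty_iff) (auto simp: field_simps)
    then show "fco e (fst ?W) k = cos (freq k * t) * fco e (fst W) k + sin (freq k * t) / freq k * fco e (snd W) k"
      "fco e (snd ?W) k = - freq k * sin (freq k * t) * fco e (fst W) k + cos (freq k * t) * fco e (snd W) k" by blast+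
  qed
qed

lemma fco_egroup:
  fixes z :: "'d::finite l2 \<times> 'd l2"
  assumes W: "st W z" and k: "lattice k" "e \<in> {cos, sin}"
  shows "fco e (fst (egroup t W)) k = cos (freq k * t) * fco e (fst W) k + sin (freq k * t) / freq k * fco e (snd W) k"
    "fco e (snd (egroup t W)) k = - freq k * sin (freq k * t) * fco e (fst W) k + cos (freq k * t) * fco e (snd W) k"
  using someI_ex[OF egroup_exists[OF W, of t]] k unfolding egroup_def by blast+

lemma Hcont_iff:
  assumes "\<And>t. st (W t) (U t)" shows "Hcont W \<longleftrightarrow> continuous_on UNIV U"
proof -
  have "Hnorm (Hdiff (W s) (W t)) = norm (U s - U t)" for s t
    by (rule Hnorm_st[OF st_Hdiff[OF assms assms]])
  then show ?thesis
    by (simp add: Hcont_def continuous_on_def tendsto_norm_zero_iff LIM_zero_iff)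
qed

lemma bmp_minus_1: "bmp p \<Longrightarrow> bmp (\<lambda>x. p x - 1)"
proof -
  assume p: "bmp p"
  then obtain K where K: "\<And>x. \<bar>p x\<bar> \<le> K" by (auto simp: bmp_def)
  have "\<bar>p x - 1\<bar> \<le> K + 1" for x using K[of x] by linarith
  then show ?thesis using p by (auto simp: bmp_def periodic_fun_def)
qed

text \<open>Both formulations reduce to scalar oscillators, of frequency sqrt(1 + n) on one side and
  sqrt n on the other. \<open>duhform_shift\<close> moves the difference 1 of the squared
  frequencies into the forcing, where it becomes the -1 in the potential.\<close>

lemma mild_iff_wsol:
  fixes p :: "real^'d::finite \<Rightarrow> real"
  assumes p: "bmp p" and W0: "st W0 z" and W: "\<And>t. st (W t) (U t)"
  shows "mild p W0 W \<longleftrightarrow> wsol (\<lambda>x. p x - 1) z U"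
proof (cases "continuous_on UNIV U")
  case False
  then show ?thesis using Hcont_iff[OF W] by (auto simp: mild_def wsol_def)
next
  case U: True
  have q: "bmp (\<lambda>x. p x - 1)" by (rule bmp_minus_1[OF p])
  have md: "mult (\<lambda>x. p x - 1) y = mult p y - y" for y
    using mult_fun_diff[OF p bmp_const[of 1] q, of y] by simp
  have Lst: "st (Lop p (W s)) (0, mult p (J (fst (U s))))" for s
    using W[of s] L2_mult_bmp[OF p] by (auto simp: st_def Lop_def L2_const mult_cls[OF p, symmetric])
  have Pc: "continuous_on UNIV (\<lambda>t. inner (mult p (J (fst (U t)))) m)" for m
    by (intro continuous_intros continuous_on_compose2[OF linear_continuous_on[OF bounded_linear_mult[OF p], of UNIV]]
       continuous_on_compose2[OF linear_continuous_on[OF bounded_linear_J, of UNIV]] U) auto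
  have Xc: "continuous_on UNIV (\<lambda>t. fX m (U t))" for m
    by (intro continuous_on_compose2[OF linear_continuous_on[OF bounded_linear_fX, of UNIV]] U) auto
  have key: "(\<forall>t. fco e (fst (W t)) k = fco e (fst (egroup t W0)) k
           + (LBINT s=0..ereal t. fco e (fst (egroup (t - s) (Lop p (W s)))) k)
      \<and> fco e (snd (W t)) k = fco e (snd (egroup t W0)) k
           + (LBINT s=0..ereal t. fco e (snd (egroup (t - s) (Lop p (W s)))) k)) \<longleftrightarrow>
      duhform (sqrt (real n)) (fX (e' k) z) (fY (e' k) z) (\<lambda>t. inner (mult (\<lambda>x. p x - 1) (J (fst (U t)))) (e' k)) (\<lambda>t. fX (e' k) (U t)) (\<lambda>t. fY (e' k) (U t))"
    if n: "k \<in> shell n" and e: "(e = cos \<and> e' = cosk) \<or> (e = sin \<and> e' = sink)" for n k e and e' :: "real^'d \<Rightarrow> 'd l2"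
  proof -
    have k: "lattice k" using n by (simp add: shell_def)
    have ee: "e \<in> {cos, sin}" using e by auto
    let ?w = "sqrt (1 + real n)"
    have w: "?w \<noteq> 0" by simp
    have F: "fco e (fst V) k = fX (e' k) y" "fco e (snd V) k = fY (e' k) y" if "st V y" for V y
      using e fco_st[OF that k] by auto
    have s1: "sin (?w * r) / ?w = snn ?w r" for r using w by (simp add: snn_def)
    have s2: "- ?w * sin (?w * r) = - (?w\<^sup>2) * snn ?w r" for r
      by (simp only: omega_snn[symmetric] power2_eq_square mult_minus_left mult.assoc)
    have c1: "cos (?w * r) = csn ?w r" for r by (simp add: csn_def)
    have L0: "fX (e' k) (0, y) = 0" "fY (e' k) (0, y) = inner y (e' k)" for y by (simp_all add: fX_def fY_def)
    have "fco e (fst (egroup (t - s) (Lop p (W s)))) k = snn ?w (t - s) * inner (mult p (J (fst (U s)))) (e' k)"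
      "fco e (snd (egroup (t - s) (Lop p (W s)))) k = csn ?w (t - s) * inner (mult p (J (fst (U s)))) (e' k)" for t s
      unfolding fco_egroup[OF Lst k ee] F[OF Lst] freq_shell[OF n] L0 s1 c1 by simp_all
    moreover have "(LBINT s=0..ereal t. snn ?w (t - s) * inner (mult p (J (fst (U s)))) (e' k)) = lint (\<lambda>s. snn ?w (t - s) * inner (mult p (J (fst (U s)))) (e' k)) t"
      "(LBINT s=0..ereal t. csn ?w (t - s) * inner (mult p (J (fst (U s)))) (e' k)) = lint (\<lambda>s. csn ?w (t - s) * inner (mult p (J (fst (U s)))) (e' k)) t" for t
      by (intro lint_eq_LBINT continuous_intros snn_cont csn_cont Pc)+
    ultimately have "(\<forall>t. fco e (fst (W t)) k = fco e (fst (egroup t W0)) k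
           + (LBINT s=0..ereal t. fco e (fst (egroup (t - s) (Lop p (W s)))) k)
      \<and> fco e (snd (W t)) k = fco e (snd (egroup t W0)) k
           + (LBINT s=0..ereal t. fco e (snd (egroup (t - s) (Lop p (W s)))) k)) \<longleftrightarrow>
       duhform ?w (fX (e' k) z) (fY (e' k) z) (\<lambda>t. inner (mult p (J (fst (U t)))) (e' k)) (\<lambda>t. fX (e' k) (U t)) (\<lambda>t. fY (e' k) (U t))"
      unfolding fco_egroup[OF W0 k ee] F[OF W] F[OF W0] freq_shell[OF n] s1 s2 c1 duhform_def by simp
    also have "\<dots> \<longleftrightarrow> duhform (sqrt (real n)) (fX (e' k) z) (fY (e' k) z)
       (\<lambda>t. inner (mult p (J (fst (U t)))) (e' k) + ((sqrt (real n))\<^sup>2 - ?w\<^sup>2) * fX (e' k) (U t)) (\<lambda>t. fX (e' k) (U t)) (\<lambda>t. fY (e' k) (U t))"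
      by (rule duhform_shift[OF Pc Xc])
    also have "(\<lambda>t. inner (mult p (J (fst (U t)))) (e' k) + ((sqrt (real n))\<^sup>2 - ?w\<^sup>2) * fX (e' k) (U t)) =
       (\<lambda>t. inner (mult (\<lambda>x. p x - 1) (J (fst (U t)))) (e' k))"
      by (simp add: md inner_diff_left fX_def)
    finally show ?thesis .
  qed
  have "mild p W0 W \<longleftrightarrow> (\<forall>k e. lattice k \<and> e \<in> {cos, sin} \<longrightarrow> (\<forall>t. fco e (fst (W t)) k = fco e (fst (egroup t W0)) k
           + (LBINT s=0..ereal t. fco e (fst (egroup (t - s) (Lop p (W s)))) k)
      \<and> fco e (snd (W t)) k = fco e (snd (egroup t W0)) k
           + (LBINT s=0..ereal t. fco e (snd (egroup (t - s) (Lop p (W s)))) k)))"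
  proof -
    have "Hcont W" using Hcont_iff[of W U, OF W] U by simp
    moreover have "\<forall>t. W t \<in> Hsp" using st_Hsp[OF W] by simp
    ultimately show ?thesis
      unfolding mild_def by (simp only: simp_thms) (intro iffI allI impI; blast)
  qed
  also have "\<dots> \<longleftrightarrow> wsol (\<lambda>x. p x - 1) z U"
    unfolding wsol_iff_modes[OF q U]
  proof (intro iffI allI impI)
    fix n and k :: "real^'d" and e' :: "real^'d \<Rightarrow> 'd l2" assume H: "\<forall>k e. lattice k \<and> e \<in> {cos, sin} \<longrightarrow> (\<forall>t. fco e (fst (W t)) k = fco e (fst (egroup t W0)) k
           + (LBINT s=0..ereal t. fco e (fst (egroup (t - s) (Lop p (W s)))) k)
      \<and> fco e (snd (W t)) k = fco e (snd (egroup t W0)) k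
           + (LBINT s=0..ereal t. fco e (snd (egroup (t - s) (Lop p (W s)))) k))"
      and n: "k \<in> shell n" and e': "e' \<in> {cosk, sink}"
    obtain e :: "real \<Rightarrow> real" where e: "(e = cos \<and> e' = cosk) \<or> (e = sin \<and> e' = sink)" using e' by blast
    have "lattice k \<and> e \<in> {cos, sin}" using n e by (auto simp: shell_def)
    then show "duhform (sqrt (real n)) (fX (e' k) z) (fY (e' k) z) (\<lambda>t. inner (mult (\<lambda>x. p x - 1) (J (fst (U t)))) (e' k)) (\<lambda>t. fX (e' k) (U t)) (\<lambda>t. fY (e' k) (U t))"
      using H unfolding key[OF n e, symmetric] by blast
  next
    fix k :: "real^'d" and e :: "real \<Rightarrow> real"
    assume H: "\<forall>n k e'. k \<in> shell n \<longrightarrow> e' \<in> {cosk, sink} \<longrightarrow>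
      duhform (sqrt (real n)) (fX (e' k) z) (fY (e' k) z) (\<lambda>t. inner (mult (\<lambda>x. p x - 1) (J (fst (U t)))) (e' k)) (\<lambda>t. fX (e' k) (U t)) (\<lambda>t. fY (e' k) (U t))"
      and ke: "lattice k \<and> e \<in> {cos, sin}"
    obtain n where n: "k \<in> shell n" using ke lattice_shell by blast
    obtain e' :: "real^'d \<Rightarrow> 'd l2" where e: "(e = cos \<and> e' = cosk) \<or> (e = sin \<and> e' = sink)" using ke by blast
    then have "e' \<in> {cosk, sink}" by blast
    then have "duhform (sqrt (real n)) (fX (e' k) z) (fY (e' k) z) (\<lambda>t. inner (mult (\<lambda>x. p x - 1) (J (fst (U t)))) (e' k)) (\<lambda>t. fX (e' k) (U t)) (\<lambda>t. fY (e' k) (U t))"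
      using H n by blast
    then show "fco e (fst (W t)) k = fco e (fst (egroup t W0)) k
           + (LBINT s=0..ereal t. fco e (fst (egroup (t - s) (Lop p (W s)))) k)
      \<and> fco e (snd (W t)) k = fco e (snd (egroup t W0)) k
           + (LBINT s=0..ereal t. fco e (snd (egroup (t - s) (Lop p (W s)))) k)" for t
      unfolding key[OF n e, symmetric] by blast
  qed
  finally show ?thesis .
qed

text \<open>\<open>expAL\<close> picks some mild solution; the coordinates of any mild solution
  solve the perturbed wave equation, whose solution is unique, so the pick is immaterial up to null
  sets.\<close>

theorem expAL_st:
  assumes p: "bmp p" and W0: "st W0 z"
  shows "st (expAL t p W0) (Phi (\<lambda>x. p x - 1) t z)"
proof -
  define U where "U t = Phi (\<lambda>x. p x - 1) t z" for t
  have U: "wsol (\<lambda>x. p x - 1) z U" unfolding U_def by (rule wsol_Phi[OF bmp_minus_1[OF p]])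
  have "mild p W0 (\<lambda>t. (rep (J (fst (U t))), rep (snd (U t))))"
    using mild_iff_wsol[OF p W0 st_rep] U by blast
  then have m: "mild p W0 (SOME W. mild p W0 W)" by (rule someI[of "mild p W0"])
  define W where "W = (SOME W. mild p W0 W)"
  define V where "V t = (SOME y. st (W t) y)" for t
  have V: "st (W t) (V t)" for t
  proof -
    have "W t \<in> Hsp" using m by (simp add: W_def mild_def)
    then have "\<exists>y. st (W t) y" by (rule Hsp_st) blast
    then show ?thesis unfolding V_def by (rule someI_ex)
  qed
  have "wsol (\<lambda>x. p x - 1) z V" using mild_iff_wsol[OF p W0 V] m by (simp add: W_def)
  then have "V t = Phi (\<lambda>x. p x - 1) t z" by (rule Phi_eqI[OF bmp_minus_1[OF p]])
  then show ?thesis using V[of t] by (simp add: expAL_def W_def)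
qed

section \<open>Positive kernels of the wave equation in dimensions one and two\<close>

lemma snn_minus: "snn \<omega> (- t) = - snn \<omega> t" and snn_abs: "snn \<bar>\<omega>\<bar> t = snn \<omega> t"
  by (auto simp: snn_def abs_if)

text \<open>Half the indicator of (-t, t) is d'Alembert's kernel; \<open>snn\<close> is an
  antiderivative of the cosine for all frequencies including 0.\<close>

lemma half_cos_integral:
  assumes t: "t > 0"
  shows "integrable lborel (\<lambda>a. cos (\<rho> * a) * (indicator {-t<..<t} a / 2))"
    and "(\<integral>a. cos (\<rho> * a) * (indicator {-t<..<t} a / 2) \<partial>lborel) = snn \<rho> t"
proof -
  have "has_bochner_integral lborel (\<lambda>a. (csn \<rho> a / 2) * indicator {-t..t} a) (snn \<rho> t / 2 - snn \<rho> (- t) / 2)"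
    by (rule has_bochner_integral_FTC_Icc_real[where F="\<lambda>a. snn \<rho> a / 2"])
       (use t in \<open>auto intro!: derivative_eq_intros snn_deriv continuous_intros simp: csn_def\<close>)
  moreover have "AE a in lborel. (csn \<rho> a / 2) * indicator {-t..t} a = cos (\<rho> * a) * (indicator {-t<..<t} a / 2)"
    using AE_lborel_singleton[of t] AE_lborel_singleton[of "-t"]
    by eventually_elim (auto simp: csn_def indicator_def)
  ultimately have "has_bochner_integral lborel (\<lambda>a. cos (\<rho> * a) * (indicator {-t<..<t} a / 2)) (snn \<rho> t / 2 - snn \<rho> (- t) / 2)"
    by (subst (asm) has_bochner_integral_cong_AE) (auto simp: csn_def)
  then show "integrable lborel (\<lambda>a. cos (\<rho> * a) * (indicator {-t<..<t} a / 2))"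
    "(\<integral>a. cos (\<rho> * a) * (indicator {-t<..<t} a / 2) \<partial>lborel) = snn \<rho> t"
    by (simp_all add: has_bochner_integral_iff snn_minus)
qed

text \<open>The integrand blows up at both ends; its antiderivative, a multiple of arcsin(b / c),
  extends continuously, and arcsin has the boundary values -pi/2 and pi/2.\<close>

lemma arcsin_integral:
  assumes c: "c > 0"
  shows "(\<integral>\<^sup>+b. ennreal (indicator {-c<..<c} b / (2 * pi * sqrt (c\<^sup>2 - b\<^sup>2))) \<partial>lborel) = ennreal (1 / 2)"
proof -
  let ?f = "\<lambda>b. 1 / sqrt (c\<^sup>2 - b\<^sup>2)"
  let ?F = "\<lambda>b. arcsin (b / c)"
  have pos: "c\<^sup>2 - b\<^sup>2 > 0" if "- c < b" "b < c" for b
  proof -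
    have "(c - b) * (c + b) > 0" using that by (intro mult_pos_pos) auto
    then show ?thesis by (simp add: power2_eq_square algebra_simps)
  qed
  have lim: "(?F \<longlongrightarrow> ?F x) (at x within {-c..c})" if "x \<in> {-c..c}" for x
  proof -
    have "continuous_on {-c..c} ?F"
      using c by (intro continuous_on_arcsin continuous_intros) (auto simp: field_simps)
    then show ?thesis using that by (simp add: continuous_on_def)
  qed
  have A: "(?F \<longlongrightarrow> - (pi / 2)) (at_right (- c))"
    using lim[of "- c"] c by (simp add: at_within_Icc_at_right)
  have B: "(?F \<longlongrightarrow> pi / 2) (at_left c)"
    using lim[of c] c by (simp add: at_within_Icc_at_left)
  note FTC = interval_integral_FTC_nonneg[of "ereal (- c)" "ereal c" ?F ?f "- (pi / 2)" "pi / 2"]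
  have prem: "ereal (- c) < ereal c" "\<And>x. ereal (- c) < ereal x \<Longrightarrow> ereal x < ereal c \<Longrightarrow> DERIV ?F x :> ?f x"
    "\<And>x. ereal (- c) < ereal x \<Longrightarrow> ereal x < ereal c \<Longrightarrow> isCont ?f x"
    "AE x in lborel. ereal (- c) < ereal x \<longrightarrow> ereal x < ereal c \<longrightarrow> 0 \<le> ?f x"
    "((?F \<circ> real_of_ereal) \<longlongrightarrow> - (pi / 2)) (at_right (ereal (- c)))"
    "((?F \<circ> real_of_ereal) \<longlongrightarrow> pi / 2) (at_left (ereal c))"
  proof -
    show "ereal (- c) < ereal c" using c by simp
    fix x assume x: "ereal (- c) < ereal x" "ereal x < ereal c"
    then have x1: "- 1 < x / c" "x / c < 1" using c by (auto simp: field_simps)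
    have "1 - (x / c)\<^sup>2 = (c\<^sup>2 - x\<^sup>2) / c\<^sup>2" using c by (simp add: field_simps)
    then have "sqrt (1 - (x / c)\<^sup>2) = sqrt (c\<^sup>2 - x\<^sup>2) / c" using c by (simp add: real_sqrt_divide)
    then have "inverse (sqrt (1 - (x / c)\<^sup>2)) * (1 / c) = ?f x" using c by (simp add: field_simps)
    moreover have "DERIV ?F x :> inverse (sqrt (1 - (x / c)\<^sup>2)) * (1 / c)"
      by (rule DERIV_chain2[where f=arcsin and g="\<lambda>b. b / c", OF DERIV_arcsin[OF x1]]) (use c in \<open>auto intro!: derivative_eq_intros\<close>)
    ultimately show "DERIV ?F x :> ?f x" by simp
    show "isCont ?f x" using pos[of x] x by (intro continuous_intros) auto
  next
    show "AE x in lborel. ereal (- c) < ereal x \<longrightarrow> ereal x < ereal c \<longrightarrow> 0 \<le> ?f x"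
      using pos by (intro AE_I2) (auto intro: less_imp_le)
    show "((?F \<circ> real_of_ereal) \<longlongrightarrow> - (pi / 2)) (at_right (ereal (- c)))"
      using A by (simp add: ereal_tendsto_simps1)
    show "((?F \<circ> real_of_ereal) \<longlongrightarrow> pi / 2) (at_left (ereal c))"
      using B by (simp add: ereal_tendsto_simps1)
  qed
  from FTC[OF prem] have i: "set_integrable lborel {-c<..<c} ?f" and v: "(LBINT b=ereal (- c)..ereal c. ?f b) = pi"
    by simp_all
  have v': "(\<integral>b. indicator {-c<..<c} b * ?f b \<partial>lborel) = pi"
    using v c by (simp add: interval_lebesgue_integral_def set_lebesgue_integral_def)
  have i': "integrable lborel (\<lambda>b. indicator {-c<..<c} b * ?f b)" using i by (simp add: set_integrable_def)
  have e: "indicator {-c<..<c} b / (2 * pi * sqrt (c\<^sup>2 - b\<^sup>2)) = (1 / (2 * pi)) * (indicator {-c<..<c} b * ?f b)" for b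
    by simp
  have "(\<integral>\<^sup>+b. ennreal (indicator {-c<..<c} b / (2 * pi * sqrt (c\<^sup>2 - b\<^sup>2))) \<partial>lborel)
     = ennreal (\<integral>b. indicator {-c<..<c} b / (2 * pi * sqrt (c\<^sup>2 - b\<^sup>2)) \<partial>lborel)"
    unfolding e
  proof (rule nn_integral_eq_integral)
    show "integrable lborel (\<lambda>b. 1 / (2 * pi) * (indicator {-c<..<c} b * ?f b))"
      by (rule integrable_mult_right[OF i'])
    have "0 \<le> 1 / (2 * pi) * (indicator {-c<..<c} b * ?f b)" for b
      using pos[of b] by (cases "b \<in> {-c<..<c}") (auto intro: less_imp_le)
    then show "AE b in lborel. 0 \<le> 1 / (2 * pi) * (indicator {-c<..<c} b * ?f b)" by simp
  qed
  also have "(\<integral>b. indicator {-c<..<c} b / (2 * pi * sqrt (c\<^sup>2 - b\<^sup>2)) \<partial>lborel) = 1 / 2"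
    unfolding e integral_mult_right_zero v' by simp
  finally show ?thesis .
qed

text \<open>Poisson's kernel of the wave equation in the plane.\<close>

definition kap2 :: "real \<Rightarrow> real \<times> real \<Rightarrow> real" where
  "kap2 t p = indicator {p. norm p < t} p / (2 * pi * sqrt (t\<^sup>2 - (norm p)\<^sup>2))"

lemma kap2_measurable [measurable]: "kap2 t \<in> borel_measurable borel"
  unfolding kap2_def[abs_def] by measurable

lemma kap2_nonneg: "kap2 t p \<ge> 0"
proof (cases "norm p < t")
  case True
  then have "(norm p)\<^sup>2 \<le> t\<^sup>2" by (intro power_mono) auto
  then show ?thesis by (simp add: kap2_def)
qed (simp add: kap2_def)

text \<open>Method of descent: the chord of the disc at abscissa a has half-length \<open>c\<close>,
  and the arcsine integral over it does not depend on \<open>c\<close>, which leaves the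
  one-dimensional kernel.\<close>

lemma kap2_marginal:
  assumes t: "t > 0"
  shows "(\<integral>\<^sup>+b. ennreal (kap2 t (a, b)) \<partial>lborel) = ennreal (indicator {-t<..<t} a / 2)"
proof (cases "\<bar>a\<bar> < t")
  case True
  define c where "c = sqrt (t\<^sup>2 - a\<^sup>2)"
  have a2: "a\<^sup>2 < t\<^sup>2" using True by (metis abs_ge_zero power2_abs power_strict_mono pos2)
  then have c: "c > 0" and c2: "c\<^sup>2 = t\<^sup>2 - a\<^sup>2" by (simp_all add: c_def)
  have "kap2 t (a, b) = indicator {-c<..<c} b / (2 * pi * sqrt (c\<^sup>2 - b\<^sup>2))" for b
  proof -
    have "norm (a, b) < t \<longleftrightarrow> a\<^sup>2 + b\<^sup>2 < t\<^sup>2"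
      using t by (simp add: norm_Pair real_sqrt_less_iff flip: real_sqrt_abs) (metis abs_of_pos real_sqrt_abs real_sqrt_less_iff)
    also have "\<dots> \<longleftrightarrow> b\<^sup>2 < c\<^sup>2" by (simp add: c2 algebra_simps)
    also have "\<dots> \<longleftrightarrow> \<bar>b\<bar> < c" using c by (metis abs_of_pos abs_le_square_iff linorder_not_less)
    finally have "norm (a, b) < t \<longleftrightarrow> b \<in> {-c<..<c}" by auto
    then show ?thesis by (simp add: kap2_def c2 norm_Pair indicator_def algebra_simps)
  qed
  then show ?thesis using arcsin_integral[OF c] True by (simp add: indicator_def abs_less_iff)
next
  case False
  have "kap2 t (a, b) = 0" for b
  proof -
    have "\<bar>a\<bar> \<le> norm (a, b)" using norm_fst_le[of a b] by simp
    then show ?thesis using False by (simp add: kap2_def)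
  qed
  then show ?thesis using False by (auto simp: indicator_def)
qed

lemma kap2_integrable:
  assumes t: "t > 0" shows "integrable lborel (kap2 t)"
proof (rule integrableI_nonneg)
  show "kap2 t \<in> borel_measurable lborel" by simp
  show "AE p in lborel. 0 \<le> kap2 t p" using kap2_nonneg by simp
  have "(\<integral>\<^sup>+p. ennreal (kap2 t p) \<partial>lborel) = (\<integral>\<^sup>+a. \<integral>\<^sup>+b. ennreal (kap2 t (a, b)) \<partial>lborel \<partial>lborel)"
    unfolding lborel_prod[symmetric] by (rule lborel.nn_integral_fst[symmetric]) (simp add: lborel_prod)
  also have "\<dots> = (\<integral>\<^sup>+a. ennreal (indicator {-t<..<t} a / 2) \<partial>lborel)" by (simp add: kap2_marginal[OF t])
  also have "\<dots> = ennreal (\<integral>a. indicator {-t<..<t} a / 2 \<partial>lborel)"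
    by (rule nn_integral_eq_integral) (use half_cos_integral(1)[OF t, of 0] in auto)
  finally show "(\<integral>\<^sup>+p. ennreal (kap2 t p) \<partial>lborel) < \<infinity>" by simp
qed

lemma kap2_cos_fst:
  assumes t: "t > 0"
  shows "(\<integral>p. kap2 t p * cos (\<rho> * fst p) \<partial>lborel) = snn \<rho> t"
proof -
  have m: "(\<lambda>p. cos (\<rho> * fst p)) \<in> borel_measurable (lborel :: (real \<times> real) measure)"
    by (simp add: borel_measurable_continuous_onI continuous_intros)
  have i: "integrable (lborel \<Otimes>\<^sub>M lborel) (\<lambda>p. kap2 t p * cos (\<rho> * fst p))"
    unfolding lborel_prod
    by (rule integrable_mult_bounded[OF kap2_integrable[OF t] m, where K=1]) simp
  have marg: "(\<integral>b. kap2 t (a, b) \<partial>lborel) = indicator {-t<..<t} a / 2" for a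
    by (subst integral_eq_nn_integral)
       (auto simp: kap2_nonneg kap2_marginal[OF t] borel_measurable_continuous_onI)
  have "(\<integral>p. kap2 t p * cos (\<rho> * fst p) \<partial>lborel) = (\<integral>a. (\<integral>b. kap2 t (a, b) * cos (\<rho> * fst (a, b)) \<partial>lborel) \<partial>lborel)"
    using lborel_pair.integral_fst'[OF i] by (simp add: lborel_prod)
  also have "\<dots> = (\<integral>a. cos (\<rho> * a) * (indicator {-t<..<t} a / 2) \<partial>lborel)"
    by (simp add: marg mult.commute)
  also have "\<dots> = snn \<rho> t" by (rule half_cos_integral(2)[OF t])
  finally show ?thesis .
qed

definition rot :: "real \<Rightarrow> real \<Rightarrow> real \<times> real \<Rightarrow> real \<times> real" where
  "rot \<alpha> \<beta> p = (\<alpha> * fst p - \<beta> * snd p, \<beta> * fst p + \<alpha> * snd p)"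

lemma rot_measurable [measurable]: "rot \<alpha> \<beta> \<in> borel_measurable borel"
  unfolding rot_def[abs_def] by (intro borel_measurable_continuous_onI continuous_intros)

lemma norm_rot: assumes "\<alpha>\<^sup>2 + \<beta>\<^sup>2 = 1" shows "norm (rot \<alpha> \<beta> p) = norm p"
proof -
  have "(\<alpha> * fst p - \<beta> * snd p)\<^sup>2 + (\<beta> * fst p + \<alpha> * snd p)\<^sup>2 = (\<alpha>\<^sup>2 + \<beta>\<^sup>2) * ((fst p)\<^sup>2 + (snd p)\<^sup>2)"
    by (simp add: power2_eq_square algebra_simps)
  then show ?thesis using assms by (simp add: rot_def norm_prod_def)
qed

text \<open>A rotation is a product of two shears and a scaling, each handled by Tonelli and the
  one-dimensional substitution rule.\<close>
lemma nn_integral_rot: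
  fixes f :: "real \<times> real \<Rightarrow> ennreal"
  assumes ab: "\<alpha>\<^sup>2 + \<beta>\<^sup>2 = 1" and f [measurable]: "f \<in> borel_measurable borel"
  shows "(\<integral>\<^sup>+p. f (rot \<alpha> \<beta> p) \<partial>lborel) = (\<integral>\<^sup>+p. f p \<partial>lborel)"
proof -
  have T1: "(\<integral>\<^sup>+p. g p \<partial>lborel) = (\<integral>\<^sup>+x. \<integral>\<^sup>+y. g (x, y) \<partial>lborel \<partial>lborel)"
    and T2: "(\<integral>\<^sup>+p. g p \<partial>lborel) = (\<integral>\<^sup>+y. \<integral>\<^sup>+x. g (x, y) \<partial>lborel \<partial>lborel)"
    if g: "g \<in> borel_measurable borel" for g :: "real \<times> real \<Rightarrow> ennreal"
  proof -
    have g': "g \<in> borel_measurable (lborel \<Otimes>\<^sub>M lborel)" using g by (simp add: lborel_prod)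
    show "(\<integral>\<^sup>+p. g p \<partial>lborel) = (\<integral>\<^sup>+x. \<integral>\<^sup>+y. g (x, y) \<partial>lborel \<partial>lborel)"
      using lborel.nn_integral_fst[OF g'] by (simp add: lborel_prod)
    show "(\<integral>\<^sup>+p. g p \<partial>lborel) = (\<integral>\<^sup>+y. \<integral>\<^sup>+x. g (x, y) \<partial>lborel \<partial>lborel)"
      using lborel_pair.nn_integral_snd[OF g'] by (simp add: lborel_prod)
  qed
  have fb: "(\<lambda>p. f (h p)) \<in> borel_measurable borel" if "continuous_on UNIV h" for h :: "real \<times> real \<Rightarrow> real \<times> real"
    using measurable_compose[OF borel_measurable_continuous_onI[OF that] f] .
  have fb1: "(\<lambda>x. f (h x)) \<in> borel_measurable borel" if "continuous_on UNIV h" for h :: "real \<Rightarrow> real \<times> real"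
    using measurable_compose[OF borel_measurable_continuous_onI[OF that] f] .
  have rotb: "(\<lambda>p. f (rot \<alpha> \<beta> p)) \<in> borel_measurable borel" by measurable
  show ?thesis
  \<comment> \<open>The shear decomposition divides by \<alpha>; for \<alpha> = 0 the rotation
    exchanges the coordinates up to a sign.\<close>
  proof (cases "\<alpha> = 0")
    case True
    then have b: "\<beta> = 1 \<or> \<beta> = - 1" using ab by (simp add: power2_eq_1_iff)
    then have b0: "\<beta> \<noteq> 0" "\<bar>\<beta>\<bar> = 1" "- \<beta> \<noteq> 0" "\<bar>- \<beta>\<bar> = 1" by auto
    have "(\<integral>\<^sup>+p. f (rot \<alpha> \<beta> p) \<partial>lborel) = (\<integral>\<^sup>+y. \<integral>\<^sup>+x. f (- \<beta> * y, \<beta> * x) \<partial>lborel \<partial>lborel)"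
      unfolding T2[OF rotb] by (simp add: rot_def True)
    also have "\<dots> = (\<integral>\<^sup>+y. \<integral>\<^sup>+x. f (- \<beta> * y, x) \<partial>lborel \<partial>lborel)"
    proof (rule nn_integral_cong)
      fix y :: real
      have "(\<lambda>x. f (- \<beta> * y, x)) \<in> borel_measurable borel" by (rule fb1) (intro continuous_intros)
      from nn_integral_real_affine[OF this b0(1), of 0] b0 show "(\<integral>\<^sup>+x. f (- \<beta> * y, \<beta> * x) \<partial>lborel) = (\<integral>\<^sup>+x. f (- \<beta> * y, x) \<partial>lborel)"
        by simp
    qed
    also have "\<dots> = (\<integral>\<^sup>+y. \<integral>\<^sup>+x. f (y, x) \<partial>lborel \<partial>lborel)"
    proof -
      have "(\<lambda>y. \<integral>\<^sup>+x. f (y, x) \<partial>lborel) \<in> borel_measurable borel"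
        using lborel.borel_measurable_nn_integral_fst[of f lborel] by (simp add: lborel_prod)
      from nn_integral_real_affine[OF this b0(3), of 0] b0 show ?thesis by simp
    qed
    also have "\<dots> = (\<integral>\<^sup>+p. f p \<partial>lborel)" by (rule T1[OF f, symmetric])
    finally show ?thesis .
  next
    case a0: False
    define K where "K = ennreal \<bar>1 / \<alpha>\<bar>"
    have c0: "1 / \<alpha> \<noteq> 0" using a0 by simp
    have id: "\<beta> * ((\<beta> * y + x) / \<alpha>) + \<alpha> * y = (y + \<beta> * x) / \<alpha>" for x y
    proof -
      have "\<beta> * ((\<beta> * y + x) / \<alpha>) + \<alpha> * y = ((\<alpha>\<^sup>2 + \<beta>\<^sup>2) * y + \<beta> * x) / \<alpha>"
        using a0 by (simp add: field_simps power2_eq_square)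
      then show ?thesis using ab by simp
    qed
    have gb: "(\<lambda>p. f (fst p, (snd p + \<beta> * fst p) / \<alpha>)) \<in> borel_measurable borel"
      by (rule fb) (intro continuous_intros, use a0 in auto)
    have gb': "(\<lambda>p. f (snd p, (fst p + \<beta> * snd p) / \<alpha>)) \<in> borel_measurable borel"
      by (rule fb) (intro continuous_intros, use a0 in auto)
    have "(\<integral>\<^sup>+p. f (rot \<alpha> \<beta> p) \<partial>lborel) = (\<integral>\<^sup>+y. \<integral>\<^sup>+x. f (\<alpha> * x - \<beta> * y, \<beta> * x + \<alpha> * y) \<partial>lborel \<partial>lborel)"
      unfolding T2[OF rotb] by (simp add: rot_def)
    also have "\<dots> = (\<integral>\<^sup>+y. K * (\<integral>\<^sup>+x. f (x, (y + \<beta> * x) / \<alpha>) \<partial>lborel) \<partial>lborel)"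
    proof (rule nn_integral_cong)
      fix y :: real
      have b: "(\<lambda>x. f (\<alpha> * x - \<beta> * y, \<beta> * x + \<alpha> * y)) \<in> borel_measurable borel"
        by (rule fb1) (intro continuous_intros)
      have s: "\<alpha> * (\<beta> * y / \<alpha> + 1 / \<alpha> * x) - \<beta> * y = x" "\<beta> * (\<beta> * y / \<alpha> + 1 / \<alpha> * x) + \<alpha> * y = (y + \<beta> * x) / \<alpha>" for x
        using a0 id[of y x] by (simp_all add: field_simps)
      show "(\<integral>\<^sup>+x. f (\<alpha> * x - \<beta> * y, \<beta> * x + \<alpha> * y) \<partial>lborel) = K * (\<integral>\<^sup>+x. f (x, (y + \<beta> * x) / \<alpha>) \<partial>lborel)"
        using nn_integral_real_affine[OF b c0, of "\<beta> * y / \<alpha>"] unfolding s K_def .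
    qed
    also have "\<dots> = K * (\<integral>\<^sup>+y. \<integral>\<^sup>+x. f (x, (y + \<beta> * x) / \<alpha>) \<partial>lborel \<partial>lborel)"
    proof (rule nn_integral_cmult)
      show "(\<lambda>y. \<integral>\<^sup>+x. f (x, (y + \<beta> * x) / \<alpha>) \<partial>lborel) \<in> borel_measurable lborel"
        using lborel.borel_measurable_nn_integral[of "\<lambda>y x. f (x, (y + \<beta> * x) / \<alpha>)" lborel] gb'
        by (simp add: lborel_prod case_prod_beta')
    qed
    also have "(\<integral>\<^sup>+y. \<integral>\<^sup>+x. f (x, (y + \<beta> * x) / \<alpha>) \<partial>lborel \<partial>lborel) = (\<integral>\<^sup>+x. \<integral>\<^sup>+y. f (x, (y + \<beta> * x) / \<alpha>) \<partial>lborel \<partial>lborel)"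
      using T1[OF gb] T2[OF gb] by simp
    also have "K * \<dots> = (\<integral>\<^sup>+x. K * (\<integral>\<^sup>+y. f (x, (y + \<beta> * x) / \<alpha>) \<partial>lborel) \<partial>lborel)"
    proof (rule nn_integral_cmult[symmetric])
      show "(\<lambda>x. \<integral>\<^sup>+y. f (x, (y + \<beta> * x) / \<alpha>) \<partial>lborel) \<in> borel_measurable lborel"
        using lborel.borel_measurable_nn_integral_fst[of "\<lambda>p. f (fst p, (snd p + \<beta> * fst p) / \<alpha>)" lborel] gb
        by (simp add: lborel_prod)
    qed
    also have "\<dots> = (\<integral>\<^sup>+x. \<integral>\<^sup>+y. f (x, y) \<partial>lborel \<partial>lborel)"
    proof (rule nn_integral_cong)
      fix x :: real
      have b: "(\<lambda>y. f (x, y)) \<in> borel_measurable borel" by (rule fb1) (intro continuous_intros)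
      have s: "\<beta> * x / \<alpha> + 1 / \<alpha> * y = (y + \<beta> * x) / \<alpha>" for y by (simp add: add_divide_distrib)
      show "K * (\<integral>\<^sup>+y. f (x, (y + \<beta> * x) / \<alpha>) \<partial>lborel) = (\<integral>\<^sup>+y. f (x, y) \<partial>lborel)"
        using nn_integral_real_affine[OF b c0, of "\<beta> * x / \<alpha>"] unfolding s K_def by simp
    qed
    also have "\<dots> = (\<integral>\<^sup>+p. f p \<partial>lborel)" by (rule T1[OF f, symmetric])
    finally show ?thesis .
  qed
qed

lemma lborel_rot:
  assumes ab: "\<alpha>\<^sup>2 + \<beta>\<^sup>2 = 1" shows "distr lborel borel (rot \<alpha> \<beta>) = lborel"
proof (rule measure_eqI)
  fix A assume "A \<in> sets (distr lborel borel (rot \<alpha> \<beta>))"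
  then have A [measurable]: "A \<in> sets borel" by simp
  have "emeasure (distr lborel borel (rot \<alpha> \<beta>)) A = (\<integral>\<^sup>+p. indicator A p \<partial>distr lborel borel (rot \<alpha> \<beta>))"
    by simp
  also have "\<dots> = (\<integral>\<^sup>+p. indicator A (rot \<alpha> \<beta> p) \<partial>lborel)"
    by (rule nn_integral_distr) measurable
  also have "\<dots> = (\<integral>\<^sup>+p. indicator A p \<partial>lborel)" by (rule nn_integral_rot[OF ab]) measurable
  finally show "emeasure (distr lborel borel (rot \<alpha> \<beta>)) A = emeasure lborel A" by simp
qed simp

text \<open>The kernel is radial, so a rotation aligning (k1, k2) with the first axis reduces the
  transform to \<open>kap2_cos_fst\<close>.\<close>

lemma kap2_cos:
  assumes t: "t > 0"
  shows "(\<integral>p. kap2 t p * cos (k1 * fst p + k2 * snd p) \<partial>lborel) = snn (sqrt (k1\<^sup>2 + k2\<^sup>2)) t"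
proof -
  define \<rho> where "\<rho> = sqrt (k1\<^sup>2 + k2\<^sup>2)"
  obtain \<alpha> \<beta> where ab: "\<alpha>\<^sup>2 + \<beta>\<^sup>2 = 1" "k1 = \<rho> * \<alpha>" "k2 = \<rho> * \<beta>"
  proof (cases "\<rho> = 0")
    case True
    then have "k1\<^sup>2 + k2\<^sup>2 = 0" by (simp add: \<rho>_def)
    then have "k1 = 0" "k2 = 0" by (simp_all add: sum_power2_eq_zero_iff)
    with True that[of 1 0] show ?thesis by simp
  next
    case False
    have r2: "\<rho>\<^sup>2 = k1\<^sup>2 + k2\<^sup>2" by (simp add: \<rho>_def)
    have "(k1 / \<rho>)\<^sup>2 + (k2 / \<rho>)\<^sup>2 = 1" using False by (simp add: power_divide add_divide_distrib[symmetric] r2[symmetric])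
    with False that[of "k1 / \<rho>" "k2 / \<rho>"] show ?thesis by simp
  qed
  have m: "(\<lambda>p :: real \<times> real. kap2 t p * cos (k1 * fst p + k2 * snd p)) \<in> borel_measurable borel"
    by (intro borel_measurable_times kap2_measurable borel_measurable_continuous_onI continuous_intros)
  have k: "kap2 t (rot \<alpha> \<beta> p) = kap2 t p" for p by (simp add: kap2_def norm_rot[OF ab(1)] indicator_def)
  have c: "k1 * fst (rot \<alpha> \<beta> p) + k2 * snd (rot \<alpha> \<beta> p) = \<rho> * fst p" for p
  proof -
    have "k1 * fst (rot \<alpha> \<beta> p) + k2 * snd (rot \<alpha> \<beta> p) = \<rho> * (\<alpha>\<^sup>2 + \<beta>\<^sup>2) * fst p"
      unfolding rot_def ab(2,3) by (simp add: power2_eq_square algebra_simps)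
    then show ?thesis by (simp add: ab)
  qed
  have "(\<integral>p. kap2 t p * cos (k1 * fst p + k2 * snd p) \<partial>lborel) =
      (\<integral>p. kap2 t p * cos (k1 * fst p + k2 * snd p) \<partial>(distr lborel borel (rot \<alpha> \<beta>)))"
    by (simp add: lborel_rot[OF ab(1)])
  also have "\<dots> = (\<integral>p. kap2 t (rot \<alpha> \<beta> p) * cos (k1 * fst (rot \<alpha> \<beta> p) + k2 * snd (rot \<alpha> \<beta> p)) \<partial>lborel)"
    by (rule integral_distr) (use m in auto)
  also have "\<dots> = snn \<rho> t" unfolding k c by (rule kap2_cos_fst[OF t])
  finally show ?thesis by (simp add: \<rho>_def)
qed

text \<open>A function kernel of sin(t sqrt(-Laplacian)) / sqrt(-Laplacian), identified by its
  cosine transform. The exact positivity set serves both directions: nothing outside the ball gives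
  finite speed, and strict positivity inside spreads a nonnegative velocity.\<close>

definition wave_kernel :: "real \<Rightarrow> (real^'d::finite \<Rightarrow> real) \<Rightarrow> bool" where
  "wave_kernel t \<kappa> \<longleftrightarrow> \<kappa> \<in> borel_measurable borel \<and> (\<forall>y. \<kappa> y \<ge> 0) \<and> (\<forall>y. \<kappa> y > 0 \<longleftrightarrow> norm y < t) \<and>
     (\<forall>y. \<kappa> (- y) = \<kappa> y) \<and> integrable lborel \<kappa> \<and> (\<forall>k. (\<integral>y. \<kappa> y * cos (k \<bullet> y) \<partial>lborel) = snn (norm k) t)"

text \<open>The single coordinate identifies R^d with the line; the Lebesgue measures agree because
  boxes correspond to intervals, and the kernel is d'Alembert's.\<close>

lemma wave_kernel_1:
  assumes d: "CARD('d::finite) = 1" and t: "t > 0"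
  shows "\<exists>\<kappa> :: real^'d \<Rightarrow> real. wave_kernel t \<kappa>"
proof -
  obtain i :: 'd where i: "UNIV = {i}" using d by (metis card_1_singletonE)
  have all: "j = i" for j :: 'd using i by blast
  define T where "T a = (a *\<^sub>R axis i 1 :: real^'d)" for a :: real
  define \<kappa> where "\<kappa> y = (indicator (ball 0 t) y :: real) / 2" for y :: "real^'d"
  have Tm [measurable]: "T \<in> borel_measurable borel"
    unfolding T_def by (intro borel_measurable_continuous_onI continuous_intros)
  have Ti: "T a $ j = a" for a j using all[of j] by (simp add: T_def)
  have B: "(Basis :: (real^'d) set) = {axis i 1}" by (simp add: Basis_vec_def i)
  have lb: "lborel = distr lborel borel T"
  proof (rule lborel_eqI)
    fix l u :: "real^'d" assume "\<And>b. b \<in> Basis \<Longrightarrow> l \<bullet> b \<le> u \<bullet> b"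
    then have lu: "l $ i \<le> u $ i" by (simp add: B inner_axis)
    have "T -` box l u = {l $ i<..<u $ i}"
    proof (intro set_eqI)
      fix a
      have "a \<in> T -` box l u \<longleftrightarrow> (\<forall>m\<in>UNIV. l $ m < T a $ m \<and> T a $ m < u $ m)"
        by (simp add: mem_box_cart)
      also have "\<dots> \<longleftrightarrow> a \<in> {l $ i<..<u $ i}" unfolding i by (simp add: Ti)
      finally show "a \<in> T -` box l u \<longleftrightarrow> a \<in> {l $ i<..<u $ i}" .
    qed
    then show "emeasure (distr lborel borel T) (box l u) = (\<Prod>b\<in>Basis. (u - l) \<bullet> b)"
      using lu by (simp add: emeasure_distr B inner_axis)
  qed simp
  have nT: "norm (T a) = \<bar>a\<bar>" for a by (simp add: T_def)
  have kT: "\<kappa> (T a) = indicator {-t<..<t} a / 2" for a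
    by (simp add: \<kappa>_def indicator_def nT abs_less_iff) linarith
  have km: "\<kappa> \<in> borel_measurable borel"
    unfolding \<kappa>_def by (intro borel_measurable_divide borel_measurable_indicator borel_measurable_const) simp
  have nk: "\<bar>k $ i\<bar> = norm k" for k :: "real^'d" by (simp add: norm_vec_def L2_set_def i)
  have "wave_kernel t \<kappa>"
    unfolding wave_kernel_def
  proof (intro conjI allI)
    show "\<kappa> \<in> borel_measurable borel" by (rule km)
    show "\<kappa> y \<ge> 0" "\<kappa> y > 0 \<longleftrightarrow> norm y < t" "\<kappa> (- y) = \<kappa> y" for y by (auto simp: \<kappa>_def indicator_def)
    have "integrable (distr lborel borel T) \<kappa>"
      by (subst integrable_distr_eq) (use km half_cos_integral(1)[OF t, of 0] in \<open>auto simp: kT\<close>)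
    then show "integrable lborel \<kappa>" using lb by simp
    fix k :: "real^'d"
    have m: "(\<lambda>y. \<kappa> y * cos (k \<bullet> y)) \<in> borel_measurable borel"
      by (intro borel_measurable_times km borel_measurable_continuous_onI continuous_intros)
    have kd: "k \<bullet> T a = k $ i * a" for a by (simp add: T_def inner_axis mult.commute)
    have "(\<integral>y. \<kappa> y * cos (k \<bullet> y) \<partial>lborel) = (\<integral>y. \<kappa> y * cos (k \<bullet> y) \<partial>(distr lborel borel T))"
      by (rule arg_cong[where f="\<lambda>M. integral\<^sup>L M _"]) (rule lb)
    also have "\<dots> = (\<integral>a. \<kappa> (T a) * cos (k \<bullet> T a) \<partial>lborel)"
      by (rule integral_distr) (use m in auto)
    also have "\<dots> = snn (k $ i) t" unfolding kT kd using half_cos_integral(2)[OF t, of "k $ i"] by (simp add: mult.commute)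
    also have "\<dots> = snn (norm k) t" using snn_abs[of "k $ i" t] by (simp add: nk)
    finally show "(\<integral>y. \<kappa> y * cos (k \<bullet> y) \<partial>lborel) = snn (norm k) t" .
  qed
  then show ?thesis by blast
qed

text \<open>The two coordinates carry \<open>kap2\<close> over to R^d; the identification is an
  isometry, so the kernel remains radial.\<close>

lemma wave_kernel_2:
  assumes d: "CARD('d::finite) = 2" and t: "t > 0"
  shows "\<exists>\<kappa> :: real^'d \<Rightarrow> real. wave_kernel t \<kappa>"
proof -
  obtain i j :: 'd where i: "UNIV = {i, j}" and ij: "i \<noteq> j" using d by (metis card_2_iff)
  have all: "l = i \<or> l = j" for l :: 'd using i by blast
  define T where "T p = (fst p *\<^sub>R axis i 1 + snd p *\<^sub>R axis j 1 :: real^'d)" for p :: "real \<times> real"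
  define S where "S y = (y $ i, y $ j)" for y :: "real^'d"
  define \<kappa> where "\<kappa> y = kap2 t (S y)" for y :: "real^'d"
  have Tm [measurable]: "T \<in> borel_measurable borel"
    unfolding T_def by (intro borel_measurable_continuous_onI continuous_intros)
  have Sm: "S \<in> borel_measurable borel"
    unfolding S_def by (intro borel_measurable_continuous_onI continuous_intros)
  have Ti: "T p $ i = fst p" "T p $ j = snd p" for p using ij by (simp_all add: T_def axis_def)
  have ST: "S (T p) = p" for p by (simp add: S_def Ti)
  have nS: "norm (S y) = norm y" for y :: "real^'d"
    using ij by (simp add: S_def norm_vec_def L2_set_def i norm_Pair)
  have B: "(Basis :: (real^'d) set) = {axis i 1, axis j 1}" by (auto simp: Basis_vec_def i)
  have aij: "axis i (1::real) \<noteq> (axis j 1 :: real^'d)" using ij by (simp add: axis_eq_axis)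
  have lb: "lborel = distr lborel borel T"
  proof (rule lborel_eqI)
    fix l u :: "real^'d" assume le: "\<And>b. b \<in> Basis \<Longrightarrow> l \<bullet> b \<le> u \<bullet> b"
    then have lu: "l $ i \<le> u $ i" "l $ j \<le> u $ j"
      using le[of "axis i 1"] le[of "axis j 1"] by (simp_all add: B inner_axis)
    have "T -` box l u = box (l $ i, l $ j) (u $ i, u $ j)"
    proof (intro set_eqI)
      fix p :: "real \<times> real"
      have "p \<in> T -` box l u \<longleftrightarrow> (\<forall>m\<in>UNIV. l $ m < T p $ m \<and> T p $ m < u $ m)"
        by (simp add: mem_box_cart)
      also have "\<dots> \<longleftrightarrow> (l $ i < fst p \<and> fst p < u $ i) \<and> (l $ j < snd p \<and> snd p < u $ j)"
        unfolding i by (simp add: Ti)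
      also have "\<dots> \<longleftrightarrow> p \<in> box (l $ i, l $ j) (u $ i, u $ j)"
        by (cases p) (auto simp: mem_box Basis_prod_def)
      finally show "p \<in> T -` box l u \<longleftrightarrow> p \<in> box (l $ i, l $ j) (u $ i, u $ j)" .
    qed
    then have "emeasure (distr lborel borel T) (box l u) = emeasure lborel (box (l $ i, l $ j) (u $ i, u $ j))"
      by (simp add: emeasure_distr)
    also have "\<dots> = (\<Prod>b\<in>Basis. ((u $ i, u $ j) - (l $ i, l $ j)) \<bullet> b)"
      by (rule emeasure_lborel_box) (use lu in \<open>auto simp: Basis_prod_def\<close>)
    also have "\<dots> = (u $ i - l $ i) * (u $ j - l $ j)"
      by (simp add: Basis_prod_def mult.commute)
    also have "\<dots> = (\<Prod>b\<in>Basis. (u - l) \<bullet> b)"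
      using aij by (simp add: B inner_axis)
    finally show "emeasure (distr lborel borel T) (box l u) = (\<Prod>b\<in>Basis. (u - l) \<bullet> b)" .
  qed simp
  have km: "\<kappa> \<in> borel_measurable borel"
    unfolding \<kappa>_def using measurable_compose[OF Sm kap2_measurable] .
  have kT: "\<kappa> (T p) = kap2 t p" for p by (simp add: \<kappa>_def ST)
  have k2: "\<kappa> y = indicator (ball 0 t) y / (2 * pi * sqrt (t\<^sup>2 - (norm y)\<^sup>2))" for y
    by (simp add: \<kappa>_def kap2_def nS indicator_def)
  have "wave_kernel t \<kappa>"
    unfolding wave_kernel_def
  proof (intro conjI allI)
    show "\<kappa> \<in> borel_measurable borel" by (rule km)
    show "\<kappa> y \<ge> 0" for y by (simp add: \<kappa>_def kap2_nonneg)
    show "\<kappa> y > 0 \<longleftrightarrow> norm y < t" for y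
    proof (cases "norm y < t")
      case True
      then have "(norm y)\<^sup>2 < t\<^sup>2" by (intro power_strict_mono) auto
      then show ?thesis using True by (simp add: k2)
    qed (simp add: k2)
    show "\<kappa> (- y) = \<kappa> y" for y by (simp add: k2 indicator_def)
    have "integrable (distr lborel borel T) \<kappa>"
      by (subst integrable_distr_eq) (use km kap2_integrable[OF t] in \<open>auto simp: kT\<close>)
    then show "integrable lborel \<kappa>" using lb by simp
    fix k :: "real^'d"
    have m: "(\<lambda>y. \<kappa> y * cos (k \<bullet> y)) \<in> borel_measurable borel"
      by (intro borel_measurable_times km borel_measurable_continuous_onI continuous_intros)
    have kd: "k \<bullet> T p = k $ i * fst p + k $ j * snd p" for p
      by (simp add: T_def inner_axis inner_add_right mult.commute)
    have "(\<integral>y. \<kappa> y * cos (k \<bullet> y) \<partial>lborel) = (\<integral>y. \<kappa> y * cos (k \<bullet> y) \<partial>(distr lborel borel T))"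
      by (rule arg_cong[where f="\<lambda>M. integral\<^sup>L M _"]) (rule lb)
    also have "\<dots> = (\<integral>p. \<kappa> (T p) * cos (k \<bullet> T p) \<partial>lborel)"
      by (rule integral_distr) (use m in auto)
    also have "\<dots> = snn (sqrt ((k $ i)\<^sup>2 + (k $ j)\<^sup>2)) t" unfolding kT kd by (rule kap2_cos[OF t])
    also have "sqrt ((k $ i)\<^sup>2 + (k $ j)\<^sup>2) = norm k" using nS[of k] by (simp add: S_def norm_Pair)
    finally show "(\<integral>y. \<kappa> y * cos (k \<bullet> y) \<partial>lborel) = snn (norm k) t" .
  qed
  then show ?thesis by blast
qed

section \<open>Kernel representation of the wave propagator\<close>

lemma lborel_reflect:
  fixes x :: "'a::euclidean_space"
  shows "lborel = distr lborel borel (\<lambda>y. x - y)"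
proof -
  have T: "(\<lambda>y::'a. x + (\<Sum>j\<in>Basis. ((- 1) * (y \<bullet> j)) *\<^sub>R j)) = (\<lambda>y. x - y)"
  proof
    fix y :: 'a
    have "(\<Sum>j\<in>Basis. ((- 1) * (y \<bullet> j)) *\<^sub>R j) = - (\<Sum>j\<in>Basis. (y \<bullet> j) *\<^sub>R j)"
      by (simp add: sum_negf)
    then show "x + (\<Sum>j\<in>Basis. ((- 1) * (y \<bullet> j)) *\<^sub>R j) = x - y" by (simp add: euclidean_representation)
  qed
  show ?thesis
    using lborel_affine_euclidean[of "\<lambda>_. - 1" x] unfolding T by (simp add: density_1)
qed

text \<open>Joint measurability of g(x - y) calls for a Borel function, while \<open>f\<close> is
  only Lebesgue measurable. Trigonometric polynomials approximate the bounded function arctan f, and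
  the tangent of their pointwise limit is Borel and periodic.\<close>

lemma borel_periodic_representative:
  fixes f :: "real^'d::finite \<Rightarrow> real"
  assumes f: "L2 f"
  obtains g where "g \<in> borel_measurable borel" "periodic_fun g" "AE x in lebesgue. g x = f x"
proof -
  have fm [measurable]: "f \<in> borel_measurable tmeas" by (rule L2_measurable[OF f])
  have "(\<lambda>x. arctan (f x)) \<in> borel_measurable tmeas" by measurable
  moreover have "\<bar>arctan (f x)\<bar> \<le> pi / 2" for x using arctan_bounded[of "f x"] by linarith
  ultimately obtain p where p: "\<And>n::nat. trigpoly (p n)" "AE x in tmeas. (\<lambda>n. p n x) \<longlonglongrightarrow> arctan (f x)"
    by (rule trigpoly_approx_bounded_measurable) blast
  define g where "g x = tan (lim (\<lambda>n. p n x))" for x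
  have pm [measurable]: "p n \<in> borel_measurable borel" for n
    by (rule borel_measurable_continuous_onI[OF trigpoly_continuous[OF p(1)]])
  have lm [measurable]: "(\<lambda>x. lim (\<lambda>n. p n x)) \<in> borel_measurable borel" by measurable
  have gm: "g \<in> borel_measurable borel"
    unfolding g_def tan_def by measurable
  have gp: "periodic_fun g" using trigpoly_periodic[OF p(1)] by (simp add: g_def periodic_fun_def)
  have "AE x in tmeas. g x = f x"
    using p(2) by eventually_elim (simp add: g_def limI tan_arctan)
  then have "AE x in lebesgue. g x = f x"
    by (rule AE_periodic) (use gp L2_periodic[OF f] in \<open>simp add: periodic_fun_def\<close>)
  then show ?thesis using gm gp that by blast
qed

lemma
  fixes u :: "real^'d::finite \<Rightarrow> real"
  assumes u: "u \<in> borel_measurable borel"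
  shows integrable_tmeas_lborel: "integrable tmeas u \<longleftrightarrow> integrable lborel (\<lambda>x. indicator tcube x * u x)"
    and integral_tmeas_lborel: "(\<integral>x. u x \<partial>tmeas) = (\<integral>x. indicator tcube x * u x \<partial>lborel)"
proof -
  have m: "(\<lambda>x. indicator tcube x * u x) \<in> borel_measurable lborel" using u by simp
  show "integrable tmeas u \<longleftrightarrow> integrable lborel (\<lambda>x. indicator tcube x * u x)"
    unfolding tmeas_def by (subst integrable_restrict_space) (use m in \<open>simp_all add: integrable_completion\<close>)
  show "(\<integral>x. u x \<partial>tmeas) = (\<integral>x. indicator tcube x * u x \<partial>lborel)"
    unfolding tmeas_def by (subst integral_restrict_space) (use m in \<open>simp_all add: integral_completion\<close>)
qed

locale wave_conv =
  fixes t :: real and \<kappa> g :: "real^'d::finite \<Rightarrow> real"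
  assumes ker: "wave_kernel t \<kappa>" and gm [measurable]: "g \<in> borel_measurable borel"
    and gper: "periodic_fun g" and gint: "integrable tmeas g"
begin

lemma km [measurable]: "\<kappa> \<in> borel_measurable borel" and k0: "\<kappa> y \<ge> 0"
  and kpos: "\<kappa> y > 0 \<longleftrightarrow> norm y < t" and keven: "\<kappa> (- y) = \<kappa> y" and kint: "integrable lborel \<kappa>"
  and kcos: "(\<integral>y. \<kappa> y * cos (k \<bullet> y) \<partial>lborel) = snn (norm k) t"
  using ker by (auto simp: wave_kernel_def)

text \<open>The integral runs over R^d and not over the torus, so times t for which the ball wraps
  around are covered as well.\<close>

definition conv where "conv x = (\<integral>y. \<kappa> y * g (x - y) \<partial>lborel)"

definition F where "F y x = \<kappa> y * (indicator tcube x * g (x - y))"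

lemma shift_int: "integrable tmeas (\<lambda>x. g (x - y))" "(\<integral>x. \<bar>g (x - y)\<bar> \<partial>tmeas) = (\<integral>x. \<bar>g x\<bar> \<partial>tmeas)"
proof -
  show "integrable tmeas (\<lambda>x. g (x - y))"
    using integrable_periodic_translation[OF gper gint, of "- y"] by simp
  have "periodic_fun (\<lambda>x. \<bar>g x\<bar>)" using gper by (simp add: periodic_fun_def)
  from integral_periodic_translation[OF this, of "- y"] show "(\<integral>x. \<bar>g (x - y)\<bar> \<partial>tmeas) = (\<integral>x. \<bar>g x\<bar> \<partial>tmeas)"
    using gint by simp
qed

lemma gsub [measurable]: "(\<lambda>p. g (snd p - fst p)) \<in> borel_measurable (borel \<Otimes>\<^sub>M borel)"
  by measurable

lemma gshift [measurable]: "(\<lambda>x. g (x - y)) \<in> borel_measurable borel"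
  by measurable

lemma F_measurable: "(\<lambda>(y, x). F y x) \<in> borel_measurable (lborel \<Otimes>\<^sub>M lborel)"
proof -
  have "(\<lambda>p. \<kappa> (fst p) * (indicator tcube (snd p) * g (snd p - fst p))) \<in> borel_measurable (borel \<Otimes>\<^sub>M borel)"
    by measurable
  then show ?thesis by (simp add: F_def case_prod_beta' cong: measurable_cong_sets)
qed

text \<open>Translation invariance of the L^1 norm of \<open>g\<close> makes the iterated integral
  of absolute values the product of two L^1 norms.\<close>

lemma F_integrable: "integrable (lborel \<Otimes>\<^sub>M lborel) (\<lambda>(y, x). F y x)"
proof (rule lborel_pair.Fubini_integrable)
  show "(\<lambda>(y, x). F y x) \<in> borel_measurable (lborel \<Otimes>\<^sub>M lborel)" by (rule F_measurable)
  have "(\<integral>x. norm (F y x) \<partial>lborel) = \<kappa> y * (\<integral>x. \<bar>g x\<bar> \<partial>tmeas)" for y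
  proof -
    have "(\<integral>x. norm (F y x) \<partial>lborel) = (\<integral>x. \<kappa> y * (indicator tcube x * \<bar>g (x - y)\<bar>) \<partial>lborel)"
      by (simp add: F_def abs_mult k0)
    also have "\<dots> = \<kappa> y * (\<integral>x. \<bar>g (x - y)\<bar> \<partial>tmeas)"
      by (subst integral_tmeas_lborel) simp_all
    finally show ?thesis by (simp add: shift_int)
  qed
  then show "integrable lborel (\<lambda>y. \<integral>x. norm (case (y, x) of (y, x) \<Rightarrow> F y x) \<partial>lborel)"
    using kint by simp
  have "integrable lborel (\<lambda>x. F y x)" for y
    unfolding F_def using shift_int(1)[of y] by (subst (asm) integrable_tmeas_lborel) auto
  then show "AE y in lborel. integrable lborel (\<lambda>x. case (y, x) of (y, x) \<Rightarrow> F y x)" by simp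
qed

lemma conv_eq: "indicator tcube x * conv x = (\<integral>y. F y x \<partial>lborel)"
  unfolding conv_def F_def
  by (simp add: mult.left_commute[of "\<kappa> _"] flip: integral_mult_right_zero)

lemma conv_measurable [measurable]: "conv \<in> borel_measurable borel"
proof -
  have "(\<lambda>(x, y). \<kappa> y * g (x - y)) \<in> borel_measurable (borel \<Otimes>\<^sub>M lborel)"
  proof -
    have "(\<lambda>p. \<kappa> (snd p) * g (fst p - snd p)) \<in> borel_measurable (borel \<Otimes>\<^sub>M borel)" by measurable
    then show ?thesis by (simp add: case_prod_beta' cong: measurable_cong_sets)
  qed
  from lborel.borel_measurable_lebesgue_integral[OF this] show ?thesis unfolding conv_def[abs_def] by simp
qed

lemma conv_integrable: "integrable tmeas conv"
  unfolding integrable_tmeas_lborel[OF conv_measurable] conv_eq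
  using lborel_pair.integrable_snd[OF F_integrable] by simp

lemma conv_section_integrable: "AE x in tmeas. integrable lborel (\<lambda>y. \<kappa> y * g (x - y))"
proof -
  have "AE x in lborel. integrable lborel (\<lambda>y. F y x)"
    using lborel_pair.AE_integrable_snd[OF F_integrable] .
  then have "AE x in lborel. x \<in> tcube \<longrightarrow> integrable lborel (\<lambda>y. \<kappa> y * g (x - y))"
    by eventually_elim (auto simp: F_def)
  then show ?thesis unfolding AE_tmeas by (rule AE_completion)
qed

lemma conv_periodic: "periodic_fun conv"
proof -
  have "g (x + (2 * pi) *\<^sub>R axis i 1 - y) = g (x - y)" for x y i
    using gper[unfolded periodic_fun_def, rule_format, of "x - y" i] by (simp add: algebra_simps)
  then show ?thesis by (simp add: periodic_fun_def conv_def)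
qed

lemma kappa_sin: "(\<integral>y. \<kappa> y * sin (k \<bullet> y) \<partial>lborel) = 0"
proof -
  have m: "(\<lambda>y. \<kappa> y * sin (k \<bullet> y)) \<in> borel_measurable borel"
    by (intro borel_measurable_times km borel_measurable_continuous_onI continuous_intros)
  have "(\<integral>y. \<kappa> y * sin (k \<bullet> y) \<partial>lborel) = (\<integral>y. \<kappa> y * sin (k \<bullet> y) \<partial>(distr lborel borel (\<lambda>y. 0 - y)))"
    by (rule arg_cong[where f="\<lambda>M. integral\<^sup>L M _"]) (rule lborel_reflect)
  also have "\<dots> = (\<integral>y. \<kappa> (0 - y) * sin (k \<bullet> (0 - y)) \<partial>lborel)"
    by (rule integral_distr) (use m in auto)
  also have "\<dots> = - (\<integral>y. \<kappa> y * sin (k \<bullet> y) \<partial>lborel)" by (simp add: keven)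
  finally show ?thesis by simp
qed

lemma conv_swap:
  assumes e: "continuous_on UNIV e" "\<And>x. \<bar>e x\<bar> \<le> 1"
  shows "(\<integral>x. conv x * e x \<partial>tmeas) = (\<integral>y. \<kappa> y * (\<integral>x. g (x - y) * e x \<partial>tmeas) \<partial>lborel)"
proof -
  have em [measurable]: "e \<in> borel_measurable borel" by (rule borel_measurable_continuous_onI[OF e(1)])
  have Fi: "integrable (lborel \<Otimes>\<^sub>M lborel) (\<lambda>(y, x). F y x * e x)"
  proof -
    have "(\<lambda>p :: (real^'d) \<times> (real^'d). e (snd p)) \<in> borel_measurable (lborel \<Otimes>\<^sub>M lborel)"
      by measurable
    from integrable_mult_bounded[OF F_integrable this, of 1] show ?thesis
      using e(2) by (simp add: case_prod_beta')
  qed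
  have "(\<integral>x. conv x * e x \<partial>tmeas) = (\<integral>x. indicator tcube x * (conv x * e x) \<partial>lborel)"
    by (rule integral_tmeas_lborel) measurable
  also have "\<dots> = (\<integral>x. (\<integral>y. F y x * e x \<partial>lborel) \<partial>lborel)"
    by (simp add: conv_eq mult.assoc[symmetric])
  also have "\<dots> = (\<integral>y. (\<integral>x. F y x * e x \<partial>lborel) \<partial>lborel)"
    by (rule lborel_pair.Fubini_integral[OF Fi])
  also have "\<dots> = (\<integral>y. \<kappa> y * (\<integral>x. g (x - y) * e x \<partial>tmeas) \<partial>lborel)"
  proof (rule arg_cong[where f="integral\<^sup>L lborel"], rule ext)
    fix y
    have "(\<integral>x. F y x * e x \<partial>lborel) = (\<integral>x. \<kappa> y * (indicator tcube x * (g (x - y) * e x)) \<partial>lborel)"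
      by (simp add: F_def mult.assoc)
    also have "\<dots> = \<kappa> y * (\<integral>x. g (x - y) * e x \<partial>tmeas)"
      by (subst integral_tmeas_lborel) simp_all
    finally show "(\<integral>x. F y x * e x \<partial>lborel) = \<kappa> y * (\<integral>x. g (x - y) * e x \<partial>tmeas)" .
  qed
  finally show ?thesis .
qed

text \<open>Translating the modes by y with the addition formulas leaves the cosine and sine
  transforms of the kernel; the sine transform vanishes by evenness.\<close>

lemma fco_conv:
  assumes k: "lattice k"
  shows "fco cos conv k = snn (norm k) t * fco cos g k" "fco sin conv k = snn (norm k) t * fco sin g k"
proof -
  have ic: "integrable tmeas (\<lambda>x. g x * cos (k \<bullet> x))" and isn: "integrable tmeas (\<lambda>x. g x * sin (k \<bullet> x))"
    using integrable_trigpoly[OF gint] trigpoly.cos[OF k] trigpoly.sin[OF k] by blast+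
  have pc: "periodic_fun (\<lambda>x. cos (k \<bullet> x))" and ps: "periodic_fun (\<lambda>x. sin (k \<bullet> x))"
    using trigpoly_periodic[OF trigpoly.cos[OF k]] trigpoly_periodic[OF trigpoly.sin[OF k]] .
  have sh1: "(\<integral>x. g (x - y) * cos (k \<bullet> x) \<partial>tmeas) = cos (k \<bullet> y) * fco cos g k - sin (k \<bullet> y) * fco sin g k"
    and sh2: "(\<integral>x. g (x - y) * sin (k \<bullet> x) \<partial>tmeas) = cos (k \<bullet> y) * fco sin g k + sin (k \<bullet> y) * fco cos g k" for y
  proof -
    have e1: "g x * cos (k \<bullet> (x + y)) = cos (k \<bullet> y) * (g x * cos (k \<bullet> x)) - sin (k \<bullet> y) * (g x * sin (k \<bullet> x))" for x
      by (simp add: inner_add_right cos_add algebra_simps)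
    have e2: "g x * sin (k \<bullet> (x + y)) = cos (k \<bullet> y) * (g x * sin (k \<bullet> x)) + sin (k \<bullet> y) * (g x * cos (k \<bullet> x))" for x
      by (simp add: inner_add_right sin_add algebra_simps)
    have p1: "periodic_fun (\<lambda>x. g x * cos (k \<bullet> (x + y)))" and p2: "periodic_fun (\<lambda>x. g x * sin (k \<bullet> (x + y)))"
      using periodic_comp2[OF gper periodic_translation[OF pc, of y]] periodic_comp2[OF gper periodic_translation[OF ps, of y]] .
    have i1: "integrable tmeas (\<lambda>x. g x * cos (k \<bullet> (x + y)))" and i2: "integrable tmeas (\<lambda>x. g x * sin (k \<bullet> (x + y)))"
      unfolding e1 e2 using ic isn by auto
    have "(\<integral>x. g (x - y) * cos (k \<bullet> x) \<partial>tmeas) = (\<integral>x. g x * cos (k \<bullet> (x + y)) \<partial>tmeas)"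
      using integral_periodic_translation[OF p1 i1, of "- y"] by simp
    also have "\<dots> = cos (k \<bullet> y) * fco cos g k - sin (k \<bullet> y) * fco sin g k"
      unfolding e1 using ic isn by (simp add: fco_def)
    finally show "(\<integral>x. g (x - y) * cos (k \<bullet> x) \<partial>tmeas) = cos (k \<bullet> y) * fco cos g k - sin (k \<bullet> y) * fco sin g k" .
    have "(\<integral>x. g (x - y) * sin (k \<bullet> x) \<partial>tmeas) = (\<integral>x. g x * sin (k \<bullet> (x + y)) \<partial>tmeas)"
      using integral_periodic_translation[OF p2 i2, of "- y"] by simp
    also have "\<dots> = cos (k \<bullet> y) * fco sin g k + sin (k \<bullet> y) * fco cos g k"
      unfolding e2 using ic isn by (simp add: fco_def)
    finally show "(\<integral>x. g (x - y) * sin (k \<bullet> x) \<partial>tmeas) = cos (k \<bullet> y) * fco sin g k + sin (k \<bullet> y) * fco cos g k" .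
  qed
  have cm: "(\<lambda>y. cos (k \<bullet> y)) \<in> borel_measurable lborel" and sm: "(\<lambda>y. sin (k \<bullet> y)) \<in> borel_measurable lborel"
    by (simp_all add: borel_measurable_continuous_onI continuous_intros)
  have kc: "integrable lborel (\<lambda>y. \<kappa> y * cos (k \<bullet> y))" and ks: "integrable lborel (\<lambda>y. \<kappa> y * sin (k \<bullet> y))"
    using integrable_mult_bounded[OF kint cm, of 1] integrable_mult_bounded[OF kint sm, of 1] by simp_all
  have cc: "continuous_on UNIV (\<lambda>x. cos (k \<bullet> x))" and cs: "continuous_on UNIV (\<lambda>x. sin (k \<bullet> x))"
    by (intro continuous_intros)+
  have "fco cos conv k = (\<integral>y. \<kappa> y * (cos (k \<bullet> y) * fco cos g k - sin (k \<bullet> y) * fco sin g k) \<partial>lborel)"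
    unfolding fco_def[of cos conv k] by (subst conv_swap[OF cc]) (simp_all add: sh1)
  also have "\<dots> = (\<integral>y. fco cos g k * (\<kappa> y * cos (k \<bullet> y)) - fco sin g k * (\<kappa> y * sin (k \<bullet> y)) \<partial>lborel)"
    by (simp add: algebra_simps)
  also have "\<dots> = snn (norm k) t * fco cos g k"
    using kc ks by (simp add: kcos kappa_sin)
  finally show "fco cos conv k = snn (norm k) t * fco cos g k" .
  have "fco sin conv k = (\<integral>y. \<kappa> y * (cos (k \<bullet> y) * fco sin g k + sin (k \<bullet> y) * fco cos g k) \<partial>lborel)"
    unfolding fco_def[of sin conv k] by (subst conv_swap[OF cs]) (simp_all add: sh2)
  also have "\<dots> = (\<integral>y. fco sin g k * (\<kappa> y * cos (k \<bullet> y)) + fco cos g k * (\<kappa> y * sin (k \<bullet> y)) \<partial>lborel)"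
    by (simp add: algebra_simps)
  also have "\<dots> = snn (norm k) t * fco sin g k"
    using kc ks by (simp add: kcos kappa_sin)
  finally show "fco sin conv k = snn (norm k) t * fco sin g k" .
qed

text \<open>Both sides are integrable and have the Fourier coefficients of \<open>f\<close>
  multiplied by \<open>snn (norm k) t\<close>, so \<open>fourier_unique\<close> applies to the
  difference.\<close>

lemma conv_eq_cal:
  assumes f: "L2 f" and fg: "AE x in tmeas. g x = f x"
  shows "AE x in tmeas. rep (cal (ws t) (cls f)) x = conv x"
proof -
  let ?r = "rep (cal (ws t) (cls f))"
  have fm: "f \<in> borel_measurable tmeas" by (rule L2_measurable[OF f])
  have gmt: "g \<in> borel_measurable tmeas" using gint by auto
  have fgc: "fco e g k = fco e f k" if "(\<lambda>x. e (k \<bullet> x)) \<in> borel_measurable tmeas" for e k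
    unfolding fco_def
  proof (rule integral_cong_AE)
    show "AE x in tmeas. g x * e (k \<bullet> x) = f x * e (k \<bullet> x)" using fg by eventually_elim simp
  qed (use fm gmt that in \<open>auto intro: borel_measurable_times\<close>)
  have ri: "integrable tmeas ?r" by (rule L2_integrable[OF L2_rep])
  have "AE x in tmeas. ?r x - conv x = 0"
  proof (rule fourier_unique)
    show "integrable tmeas (\<lambda>x. ?r x - conv x)" using ri conv_integrable by simp
    fix k :: "real^'d" assume k: "lattice k"
    then obtain n where n: "k \<in> shell n" by (rule lattice_shell)
    have nk: "norm k = sqrt (real n)" using n by (simp add: shell_def norm_eq_sqrt_inner)
    have tc: "trigpoly (\<lambda>x. cos (k \<bullet> x))" "trigpoly (\<lambda>x. sin (k \<bullet> x))" using k by (auto intro: trigpoly.intros)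
    have rc: "fco cos ?r k = snn (norm k) t * fco cos f k" "fco sin ?r k = snn (norm k) t * fco sin f k"
      using cal_modes[OF bdd_w(2) n, of t "cls f"] fco_cos[OF k L2_rep] fco_sin[OF k L2_rep] fco_cos[OF k f] fco_sin[OF k f]
      by (simp_all add: ws_def nk)
    have "fco cos (\<lambda>x. ?r x - conv x) k = fco cos ?r k - fco cos conv k"
      unfolding fco_def left_diff_distrib using integrable_trigpoly[OF ri tc(1)] integrable_trigpoly[OF conv_integrable tc(1)] by simp
    then show "fco cos (\<lambda>x. ?r x - conv x) k = 0"
      using rc fco_conv[OF k] fgc[of cos k] trigpoly_measurable[OF tc(1)] by simp
    have "fco sin (\<lambda>x. ?r x - conv x) k = fco sin ?r k - fco sin conv k"
      unfolding fco_def left_diff_distrib using integrable_trigpoly[OF ri tc(2)] integrable_trigpoly[OF conv_integrable tc(2)] by simp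
    then show "fco sin (\<lambda>x. ?r x - conv x) k = 0"
      using rc fco_conv[OF k] fgc[of sin k] trigpoly_measurable[OF tc(2)] by simp
  qed
  then show ?thesis by eventually_elim simp
qed

lemma pred_vanish: "Measurable.pred borel (\<lambda>x. x \<in> ball c \<rho> \<longrightarrow> g x = 0)"
proof -
  have "{x. x \<in> ball c \<rho> \<longrightarrow> g x = 0} = - ball c \<rho> \<union> (g -` {0} \<inter> space borel)" by auto
  also have "\<dots> \<in> sets borel" by (rule sets.Un[OF borel_comp[OF borel_open[OF open_ball]] measurable_sets[OF gm]]) simp
  finally show ?thesis by (simp add: pred_def)
qed

lemma AE_reflect:
  assumes "AE z in lborel. z \<in> ball c \<rho> \<longrightarrow> g z = 0"
  shows "AE y in lborel. x - y \<in> ball c \<rho> \<longrightarrow> g (x - y) = 0"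
proof -
  have "AE z in distr lborel borel (\<lambda>y. x - y). z \<in> ball c \<rho> \<longrightarrow> g z = 0"
    using assms by (simp only: lborel_reflect[of x, symmetric])
  then show ?thesis by (subst (asm) AE_distr_iff) (use pred_vanish in \<open>auto simp: pred_def\<close>)
qed

lemma conv_vanish:
  assumes z: "AE z in lborel. z \<in> ball c \<rho> \<longrightarrow> g z = 0" and x: "x \<in> ball c (\<rho> - t)"
  shows "conv x = 0"
  unfolding conv_def
proof (rule integral_eq_zero_AE)
  show "AE y in lborel. \<kappa> y * g (x - y) = 0"
    using AE_reflect[OF z, of x]
  proof eventually_elim
    case (elim y)
    show ?case
    proof (cases "norm y < t")
      case True
      have "dist c (x - y) \<le> dist c x + norm y" using norm_triangle_ineq[of "c - x" y] by (simp add: dist_norm algebra_simps)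
      then have "x - y \<in> ball c \<rho>" using x True by simp
      then show ?thesis using elim by simp
    next
      case False
      then have "\<kappa> y = 0" using kpos[of y] k0[of y] by linarith
      then show ?thesis by simp
    qed
  qed
qed

text \<open>If the integral vanished, so would its nonnegative integrand, and the strictly positive
  kernel would leave \<open>g\<close> zero on the ball. The integrability hypothesis excludes the
  default value 0 of a divergent integral.\<close>

lemma conv_pos:
  assumes g0: "AE z in lborel. g z \<ge> 0" and nz: "\<not> (AE z in lborel. z \<in> ball x t \<longrightarrow> g z = 0)"
    and i: "integrable lborel (\<lambda>y. \<kappa> y * g (x - y))"
  shows "conv x > 0"
proof -
  have "AE z in distr lborel borel (\<lambda>y. x - y). g z \<ge> 0"
    using g0 by (simp only: lborel_reflect[of x, symmetric])
  then have g0': "AE y in lborel. g (x - y) \<ge> 0" by (subst (asm) AE_distr_iff) measurable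
  then have nn: "AE y in lborel. \<kappa> y * g (x - y) \<ge> 0" by eventually_elim (simp add: k0)
  have "conv x \<noteq> 0"
  proof
    assume "conv x = 0"
    then have "AE y in lborel. \<kappa> y * g (x - y) = 0"
      using integral_nonneg_eq_0_iff_AE[OF i nn] by (simp add: conv_def)
    then have "AE y in lborel. norm y < t \<longrightarrow> g (x - y) = 0"
    proof eventually_elim
      case (elim y)
      then show ?case using kpos[of y] by auto
    qed
    then have "AE y in distr lborel borel (\<lambda>y. x - y). norm y < t \<longrightarrow> g (x - y) = 0"
      by (simp only: lborel_reflect[of x, symmetric])
    then have "AE y in lborel. norm (x - y) < t \<longrightarrow> g (x - (x - y)) = 0" by (subst (asm) AE_distr_iff) measurable
    then have "AE z in lborel. z \<in> ball x t \<longrightarrow> g z = 0" by eventually_elim (simp add: dist_norm)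
    with nz show False by blast
  qed
  moreover have "conv x \<ge> 0" unfolding conv_def by (rule integral_nonneg_AE[OF nn])
  ultimately show ?thesis by linarith
qed

end

text \<open>For \<rho> at most 0 the ball is empty and the condition is void, so radii can be
  decreased by elapsed time without case distinctions.\<close>

definition vanish :: "(real^'d::finite \<Rightarrow> real) \<Rightarrow> real^'d \<Rightarrow> real \<Rightarrow> bool" where
  "vanish f c \<rho> \<longleftrightarrow> (AE x in lebesgue. x \<in> ball c \<rho> \<longrightarrow> f x = 0)"

text \<open>The dimension enters through this lemma alone; all later results receive support and
  positivity of the kernel from here.\<close>

lemma low_dim_wave_conv:
  fixes f :: "real^'d::finite \<Rightarrow> real"
  assumes dim: "CARD('d) = 1 \<or> CARD('d) = 2" and t: "t > 0" and f: "L2 f"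
  obtains \<kappa> g where "wave_conv t \<kappa> g" "AE x in lebesgue. g x = f x"
proof -
  obtain \<kappa> :: "real^'d \<Rightarrow> real" where k: "wave_kernel t \<kappa>"
    using wave_kernel_1[OF _ t, where 'd='d] wave_kernel_2[OF _ t, where 'd='d] dim by blast
  obtain g where g: "g \<in> borel_measurable borel" "periodic_fun g" "AE x in lebesgue. g x = f x"
    by (rule borel_periodic_representative[OF f])
  have "AE x in tmeas. f x = g x" using AE_tmeas_lebesgue[OF g(3)] by eventually_elim simp
  moreover have "g \<in> borel_measurable tmeas" by (intro measurable_lebesgue_tmeas measurable_completion) (simp add: g(1))
  ultimately have "integrable tmeas g"
    using L2_integrable[OF f] integrable_cong_AE[of f tmeas g] L2_measurable[OF f] by simp
  with k g have "wave_conv t \<kappa> g" by (simp add: wave_conv_def)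
  then show ?thesis using g(3) by (rule that)
qed

lemma AE_lborel_of_lebesgue:
  "Measurable.pred borel P \<Longrightarrow> AE x in lebesgue. P x \<Longrightarrow> AE x in lborel. P x"
  by (simp add: AE_completion_iff)

lemma ws_propagation:
  fixes f :: "real^'d::finite \<Rightarrow> real"
  assumes dim: "CARD('d) = 1 \<or> CARD('d) = 2" and t: "t > 0" and f: "L2 f" and z: "vanish f c \<rho>"
  shows "vanish (rep (cal (ws t) (cls f))) c (\<rho> - t)"
proof -
  obtain \<kappa> g where w: "wave_conv t \<kappa> g" and fg: "AE x in lebesgue. g x = f x"
    by (rule low_dim_wave_conv[OF dim t f])
  interpret wave_conv t \<kappa> g by (rule w)
  have "AE x in lebesgue. x \<in> ball c \<rho> \<longrightarrow> g x = 0"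
    using fg z unfolding vanish_def by eventually_elim simp
  then have gz: "AE x in lborel. x \<in> ball c \<rho> \<longrightarrow> g x = 0"
    by (rule AE_lborel_of_lebesgue[OF pred_vanish])
  have "AE x in tmeas. rep (cal (ws t) (cls f)) x = conv x"
    by (rule conv_eq_cal[OF f AE_tmeas_lebesgue[OF fg]])
  then have "AE x in lebesgue. rep (cal (ws t) (cls f)) x = conv x"
    by (rule AE_periodic) (rule periodic_comp2[where g="(=)", OF L2_periodic[OF L2_rep] conv_periodic])
  then show ?thesis unfolding vanish_def
    by eventually_elim (use conv_vanish[OF gz] in simp)
qed

text \<open>At each point the kernel averages \<open>f\<close> over the ball of radius t with
  strictly positive weight, so only a ball of zeros of that radius could prevent positivity.\<close>

lemma ws_positive:
  fixes f :: "real^'d::finite \<Rightarrow> real"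
  assumes dim: "CARD('d) = 1 \<or> CARD('d) = 2" and t: "t > 0" and f: "L2 f" and f0: "AE x in tmeas. f x \<ge> 0"
    and nz: "\<And>c. \<not> vanish f c t"
  shows "AE x in tmeas. rep (cal (ws t) (cls f)) x > 0"
proof -
  obtain \<kappa> g where w: "wave_conv t \<kappa> g" and fg: "AE x in lebesgue. g x = f x"
    by (rule low_dim_wave_conv[OF dim t f])
  interpret wave_conv t \<kappa> g by (rule w)
  have "AE x in lebesgue. f x \<ge> 0"
    by (rule AE_periodic[OF f0]) (use L2_periodic[OF f] in \<open>simp add: periodic_fun_def\<close>)
  then have "AE x in lebesgue. g x \<ge> 0" using fg by eventually_elim simp
  then have g0: "AE x in lborel. g x \<ge> 0" by (rule AE_lborel_of_lebesgue[rotated]) measurable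
  have nz': "\<not> (AE z in lborel. z \<in> ball x t \<longrightarrow> g z = 0)" for x
  proof
    assume "AE z in lborel. z \<in> ball x t \<longrightarrow> g z = 0"
    then have "AE z in lebesgue. z \<in> ball x t \<longrightarrow> g z = 0" by (rule AE_completion)
    then have "vanish f x t" unfolding vanish_def using fg by eventually_elim simp
    with nz show False by blast
  qed
  show ?thesis
    using conv_eq_cal[OF f AE_tmeas_lebesgue[OF fg]] conv_section_integrable
    by eventually_elim (simp add: conv_pos[OF g0 nz'])
qed

section \<open>Finite speed of propagation\<close>

lemma vanish_translate:
  fixes f :: "real^'d::finite \<Rightarrow> real"
  assumes f: "periodic_fun f" and v: "vanish f c \<rho>"
  shows "AE x in lebesgue. \<forall>m. x - tlat m \<in> ball c \<rho> \<longrightarrow> f x = 0"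
proof -
  have N: "negligible {x. \<not> (x \<in> ball c \<rho> \<longrightarrow> f x = 0)}"
    using v by (simp only: vanish_def AE_lebesgue_iff)
  have "{x. \<not> (\<forall>m. x - tlat m \<in> ball c \<rho> \<longrightarrow> f x = 0)} \<subseteq> (\<Union>m. (+) (tlat m) ` {x. \<not> (x \<in> ball c \<rho> \<longrightarrow> f x = 0)})"
  proof
    fix x assume "x \<in> {x. \<not> (\<forall>m. x - tlat m \<in> ball c \<rho> \<longrightarrow> f x = 0)}"
    then obtain m where "x - tlat m \<in> ball c \<rho>" "f x \<noteq> 0" by blast
    then have "x - tlat m \<in> {x. \<not> (x \<in> ball c \<rho> \<longrightarrow> f x = 0)}"
      using periodic_fun_tlat_diff[OF f, of x m] by simp
    then show "x \<in> (\<Union>m. (+) (tlat m) ` {x. \<not> (x \<in> ball c \<rho> \<longrightarrow> f x = 0)})"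
      by (intro UN_I[of m] image_eqI[of _ _ "x - tlat m"]) auto
  qed
  moreover have "negligible (\<Union>m. (+) (tlat m) ` {x. \<not> (x \<in> ball c \<rho> \<longrightarrow> f x = 0)})"
    by (rule negligible_countable_Union) (use negligible_translation[OF N] in auto)
  ultimately show ?thesis unfolding AE_lebesgue_iff by (rule negligible_subset[rotated])
qed

definition chi :: "real^'d::finite \<Rightarrow> real \<Rightarrow> real^'d \<Rightarrow> real" where
  "chi c \<rho> x = (if \<exists>m. x - tlat m \<in> ball c \<rho> then 1 else 0)"

lemma bmp_chi: "bmp (chi c \<rho> :: real^'d::finite \<Rightarrow> real)"
proof -
  have tl: "tlat (m + n) = tlat m + tlat n" for m n :: "int^'d"
    by (simp add: tlat_def vec_eq_iff algebra_simps)
  have ax: "tlat (axis i 1 :: int^'d) = (2 * pi) *\<^sub>R axis i 1" for i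
    by (simp add: tlat_def vec_eq_iff axis_def)
  have "(\<exists>m. x + (2 * pi) *\<^sub>R axis i 1 - tlat m \<in> ball c \<rho>) \<longleftrightarrow> (\<exists>m. x - tlat m \<in> ball c \<rho>)" for x i
  proof
    assume "\<exists>m. x + (2 * pi) *\<^sub>R axis i 1 - tlat m \<in> ball c \<rho>"
    then obtain m where m: "x + (2 * pi) *\<^sub>R axis i 1 - tlat m \<in> ball c \<rho>" by blast
    have "x - tlat (m + (- axis i 1)) = x + (2 * pi) *\<^sub>R axis i 1 - tlat m"
      unfolding tl tlat_uminus ax by simp
    then show "\<exists>m. x - tlat m \<in> ball c \<rho>" using m by metis
  next
    assume "\<exists>m. x - tlat m \<in> ball c \<rho>"
    then obtain m where m: "x - tlat m \<in> ball c \<rho>" by blast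
    have "x + (2 * pi) *\<^sub>R axis i 1 - tlat (m + axis i 1) = x - tlat m"
      unfolding tl ax by simp
    then show "\<exists>m. x + (2 * pi) *\<^sub>R axis i 1 - tlat m \<in> ball c \<rho>" using m by metis
  qed
  then have p: "periodic_fun (chi c \<rho> :: real^'d \<Rightarrow> real)" by (simp add: periodic_fun_def chi_def)
  have "open {x. \<exists>m. x - tlat m \<in> ball c \<rho>}"
  proof -
    have "{x. \<exists>m. x - tlat m \<in> ball c \<rho>} = (\<Union>m. (\<lambda>x. x - tlat m) -` ball c \<rho>)" by auto
    moreover have "open ((\<lambda>x. x - tlat m) -` ball c \<rho>)" for m
      by (rule open_vimage) (auto intro: continuous_intros)
    ultimately show ?thesis by auto
  qed
  then have "{x. \<exists>m. x - tlat m \<in> ball c \<rho>} \<in> sets borel" by simp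
  then have "(\<lambda>x. if x \<in> {x. \<exists>m. x - tlat m \<in> ball c \<rho>} then 1 else 0 :: real) \<in> borel_measurable borel"
    by (intro measurable_If_set) auto
  then have "(chi c \<rho> :: real^'d \<Rightarrow> real) \<in> borel_measurable borel" by (simp add: chi_def[abs_def])
  then have "(chi c \<rho> :: real^'d \<Rightarrow> real) \<in> borel_measurable tmeas"
    by (intro measurable_lebesgue_tmeas measurable_completion) simp
  moreover have "\<bar>chi c \<rho> x\<bar> \<le> 1" for x by (simp add: chi_def)
  ultimately show ?thesis using p unfolding bmp_def by blast
qed

definition vn :: "real^'d::finite \<Rightarrow> real \<Rightarrow> 'd l2 \<Rightarrow> bool" where
  "vn c \<rho> x \<longleftrightarrow> vanish (rep x) c \<rho>"

text \<open>As the kernel of a bounded multiplication operator, vanishing on a ball is a closed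
  linear condition, which is the form of invariant family that \<open>mildsol_exists\<close>
  accepts. The indicator is periodised because it has to act on functions on the torus.\<close>

lemma vn_chi: "vn c \<rho> x \<longleftrightarrow> mult (chi c \<rho>) x = 0"
proof -
  have l: "L2 (\<lambda>z. chi c \<rho> z * rep x z)" by (rule L2_mult_bmp[OF bmp_chi L2_rep])
  have p: "periodic_fun (\<lambda>z. chi c \<rho> z * rep x z = 0)"
    by (rule periodic_comp[OF L2_periodic[OF l]])
  have "mult (chi c \<rho>) x = 0 \<longleftrightarrow> (AE z in lebesgue. chi c \<rho> z * rep x z = 0)"
    unfolding mult_def cls_eq_0_iff[OF l] AE_periodic_iff[OF p] ..
  also have "\<dots> \<longleftrightarrow> vanish (rep x) c \<rho>"
  proof
    assume a: "AE z in lebesgue. chi c \<rho> z * rep x z = 0"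
    show "vanish (rep x) c \<rho>" unfolding vanish_def using a
    proof eventually_elim
      case (elim z)
      have "tlat 0 = (0 :: real^'a)" by (simp add: tlat_def vec_eq_iff)
      then have "z \<in> ball c \<rho> \<Longrightarrow> chi c \<rho> z = 1" unfolding chi_def by (auto intro: exI[of _ 0])
      then show ?case using elim by auto
    qed
  next
    assume "vanish (rep x) c \<rho>"
    from vanish_translate[OF L2_periodic[OF L2_rep] this]
    show "AE z in lebesgue. chi c \<rho> z * rep x z = 0"
      by eventually_elim (auto simp: chi_def)
  qed
  finally show ?thesis by (simp add: vn_def)
qed

lemma vn_cls:
  assumes f: "L2 f" shows "vn c \<rho> (cls f) \<longleftrightarrow> vanish f c \<rho>"
proof -
  have "AE x in lebesgue. rep (cls f) x = f x"
    by (rule AE_periodic[OF rep_cls[OF f]])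
       (rule periodic_comp2[where g="(=)", OF L2_periodic[OF L2_rep] L2_periodic[OF f]])
  then have "AE x in lebesgue. (x \<in> ball c \<rho> \<longrightarrow> rep (cls f) x = 0) \<longleftrightarrow> (x \<in> ball c \<rho> \<longrightarrow> f x = 0)"
    by eventually_elim simp
  then show ?thesis unfolding vn_def vanish_def by (auto elim: eventually_elim2)
qed

lemma vn_mono: "vn c \<rho> x \<Longrightarrow> \<sigma> \<le> \<rho> \<Longrightarrow> vn c \<sigma> x"
  unfolding vn_def vanish_def by (erule eventually_mono) auto

lemma vn_0: "vn c \<rho> 0" by (simp add: vn_chi linear_0[OF linear_mult[OF bmp_chi]])
lemma vn_add: "vn c \<rho> x \<Longrightarrow> vn c \<rho> y \<Longrightarrow> vn c \<rho> (x + y)" by (simp add: vn_chi mult_add[OF bmp_chi])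
lemma vn_scaleR: "vn c \<rho> x \<Longrightarrow> vn c \<rho> (r *\<^sub>R x)" by (simp add: vn_chi mult_scaleR[OF bmp_chi])
lemma vn_diff: "vn c \<rho> x \<Longrightarrow> vn c \<rho> y \<Longrightarrow> vn c \<rho> (x - y)"
  using vn_add[of c \<rho> x "- 1 *\<^sub>R y"] vn_scaleR[of c \<rho> y "- 1"] by simp
lemma vn_mult: "bmp q \<Longrightarrow> vn c \<rho> x \<Longrightarrow> vn c \<rho> (mult q x)"
  unfolding vn_chi by (subst mult_commute[OF bmp_chi]) (simp_all add: linear_0[OF linear_mult])

text \<open>For each smaller radius the condition is closed by \<open>vn_chi\<close>; the ball of
  radius r is the union of countably many such balls.\<close>

lemma vn_tendsto:
  fixes x :: "real \<Rightarrow> 'd::finite l2"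
  assumes lim: "(x \<longlongrightarrow> y) (at_right 0)" and v: "\<And>h. h > 0 \<Longrightarrow> vn c (r - h) (x h)"
  shows "vn c r y"
proof -
  have *: "vn c (r - d) y" if d: "d > 0" for d
  proof -
    have "((\<lambda>h. mult (chi c (r - d)) (x h)) \<longlongrightarrow> mult (chi c (r - d)) y) (at_right 0)"
      by (rule bounded_linear.tendsto[OF bounded_linear_mult[OF bmp_chi] lim])
    moreover have "\<forall>\<^sub>F h in at_right 0. mult (chi c (r - d)) (x h) = 0"
    proof -
      have "\<forall>\<^sub>F h in at_right (0::real). h \<in> {0<..<d}" by (rule eventually_at_right_real[OF d])
      then show ?thesis
      proof eventually_elim
        case (elim h)
        then have "vn c (r - d) (x h)" by (intro vn_mono[OF v[of h]]) auto
        then show ?case by (simp add: vn_chi)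
      qed
    qed
    ultimately have "((\<lambda>h. 0) \<longlongrightarrow> mult (chi c (r - d)) y) (at_right (0::real))"
      by (rule Lim_transform_eventually)
    then have "mult (chi c (r - d)) y = 0" by (rule tendsto_unique[rotated, OF tendsto_const, symmetric]) simp
    then show ?thesis by (simp add: vn_chi)
  qed
  have "AE x in lebesgue. \<forall>n. x \<in> ball c (r - inverse (real (Suc n))) \<longrightarrow> rep y x = 0"
    unfolding AE_all_countable using *[unfolded vn_def vanish_def] by simp
  then show ?thesis unfolding vn_def vanish_def
  proof eventually_elim
    case (elim x)
    show ?case
    proof
      assume "x \<in> ball c r"
      then have "r - dist c x > 0" by simp
      then obtain n where "inverse (real (Suc n)) < r - dist c x" using reals_Archimedean by blast
      then have "x \<in> ball c (r - inverse (real (Suc n)))" by simp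
      with elim show "rep y x = 0" by blast
    qed
  qed
qed

section \<open>Time derivatives of the sine propagator and their supports\<close>

lemma cal_difference_quotient:
  fixes x :: "'d::finite l2"
  assumes der: "\<And>t n. ((\<lambda>t. c t n) has_real_derivative d t n) (at t)" and d: "\<And>t n. \<bar>d t n\<bar> \<le> 1"
    and b: "\<And>t. bdd_fun (c t)"
  shows "((\<lambda>h. (1 / h) *\<^sub>R (cal (c (t + h)) x - cal (c t) x)) \<longlongrightarrow> cal (d t) x) (at_right 0)"
proof -
  have "((\<lambda>h. cal (\<lambda>n. (c (t + h) n - c t n) / h) x) \<longlongrightarrow> cal (d t) x) (at_right 0)"
  proof (rule sp.cal_tendsto[where K=1])
    have "\<bar>(c (t + h) n - c t n) / h\<bar> \<le> 1" if "h > 0" for h n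
    proof -
      obtain z where "c (t + h) n - c t n = (t + h - t) * d z n"
        using MVT2[of t "t + h" "\<lambda>s. c s n" "\<lambda>s. d s n"] der \<open>h > 0\<close> by auto
      then show ?thesis using d[of z n] \<open>h > 0\<close> by simp
    qed
    then show "\<forall>\<^sub>F h in at_right 0. \<forall>n. \<bar>(c (t + h) n - c t n) / h\<bar> \<le> 1"
      using eventually_at_right_less[of 0] by (auto elim: eventually_mono)
    show "bdd_fun (d t)" by (rule bdd_funI[OF d])
    show "((\<lambda>h. (c (t + h) n - c t n) / h) \<longlongrightarrow> d t n) (at_right 0)" for n
      using der[of n t] unfolding DERIV_def by (rule filterlim_mono) (auto simp: at_le)
  qed
  moreover have "cal (\<lambda>n. (c (t + h) n - c t n) / h) x = (1 / h) *\<^sub>R (cal (c (t + h)) x - cal (c t) x)" for h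
    by (rule sp.cal_eqI)
       (use bdd_fun_mult[OF bdd_funI[of "\<lambda>_. 1 / h" "\<bar>1 / h\<bar>"] bdd_fun_diff[OF b b]] in
        \<open>auto simp: sp.E_scale sp.E_diff sp.E_cal[OF b] scaleR_diff_left[symmetric]\<close>)
  ultimately show ?thesis by simp
qed

lemma ws_deriv: "((\<lambda>t. ws t n) has_real_derivative wc t n) (at t)"
  unfolding ws_def wc_def by (rule snn_deriv)

lemma wc_deriv: "((\<lambda>t. wc t n) has_real_derivative - (real n * ws t n)) (at t)"
  using csn_deriv[of "sqrt (real n)" t] by (simp add: ws_def wc_def)

lemma wc_quotient: "((\<lambda>h. (1 / h) *\<^sub>R (cal (ws (t + h)) x - cal (ws t) x)) \<longlongrightarrow> cal (wc t) x) (at_right 0)"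
  by (rule cal_difference_quotient[OF ws_deriv wc_le]) simp

lemma wb_quotient: "((\<lambda>h. (1 / h) *\<^sub>R (cal (wc (t + h)) (J x) - cal (wc t) (J x))) \<longlongrightarrow> cal (wb t) x) (at_right 0)"
proof -
  have "((\<lambda>t. wc t n * jsym n) has_real_derivative wb t n) (at t)" for t n
    using DERIV_cmult_right[OF wc_deriv[of n t], of "jsym n"] by (simp add: wb_def)
  moreover have b: "bdd_fun (\<lambda>n. wc t n * jsym n)" for t by (intro bdd_fun_mult) simp_all
  ultimately have "((\<lambda>h. (1 / h) *\<^sub>R (cal (\<lambda>n. wc (t + h) n * jsym n) x - cal (\<lambda>n. wc t n * jsym n) x)) \<longlongrightarrow> cal (wb t) x) (at_right 0)"
    by (rule cal_difference_quotient[OF _ wb_le])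
  moreover have "cal (\<lambda>n. wc t n * jsym n) x = cal (wc t) (J x)" for t
    unfolding J_def by (rule sp.cal_cal[symmetric]) simp_all
  ultimately show ?thesis by simp
qed

lemma w_minus: "ws (- t) n = - ws t n" "wc (- t) n = wc t n" "wb (- t) n = - wb t n"
  by (simp_all add: ws_def wc_def wb_def snn_def csn_def)

lemma cal_uminus: "bdd_fun c \<Longrightarrow> cal (\<lambda>n. - c n) x = - cal c x"
  using sp.cal_fun_diff[OF bdd_funI[of "\<lambda>n. 0" 0], of c x] by simp

context
  assumes dim: "CARD('d::finite) = 1 \<or> CARD('d) = 2"
begin

lemma vn_ws: assumes v: "vn c \<rho> (x :: 'd l2)" and t: "t \<ge> 0" shows "vn c (\<rho> - t) (cal (ws t) x)"
proof (cases "t = 0")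
  case True
  have "ws 0 = (\<lambda>n. 0)" by (simp add: fun_eq_iff ws_def)
  then show ?thesis using True by (simp add: vn_0)
next
  case False
  obtain f where f: "L2 f" "x = cls f" by (rule l2_cases)
  show ?thesis using ws_propagation[OF dim _ f(1), of t c \<rho>] v False t unfolding f(2) vn_cls[OF f(1)] by (simp add: vn_def)
qed

text \<open>The cosine propagator is the time derivative of the sine propagator. Its own kernel is a
  distribution, but the difference quotients reach only h further, and \<open>vn_tendsto\<close>
  absorbs that. One more derivative gives \<open>vn_wb\<close>.\<close>

lemma vn_wc: assumes v: "vn c \<rho> (x :: 'd l2)" and t: "t \<ge> 0" shows "vn c (\<rho> - t) (cal (wc t) x)"
proof (rule vn_tendsto[OF wc_quotient])
  fix h :: real assume h: "h > 0"
  have "vn c (\<rho> - t - h) (cal (ws (t + h)) x)" using vn_ws[OF v, of "t + h"] t h by (simp add: algebra_simps)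
  moreover have "vn c (\<rho> - t - h) (cal (ws t) x)" using vn_ws[OF v t] h by (intro vn_mono[OF vn_ws[OF v t]]) simp
  ultimately show "vn c (\<rho> - t - h) ((1 / h) *\<^sub>R (cal (ws (t + h)) x - cal (ws t) x))" by (intro vn_scaleR vn_diff)
qed

lemma vn_wb: assumes v: "vn c \<rho> (J x :: 'd l2)" and t: "t \<ge> 0" shows "vn c (\<rho> - t) (cal (wb t) x)"
proof (rule vn_tendsto[OF wb_quotient])
  fix h :: real assume h: "h > 0"
  have "vn c (\<rho> - t - h) (cal (wc (t + h)) (J x))" using vn_wc[OF v, of "t + h"] t h by (simp add: algebra_simps)
  moreover have "vn c (\<rho> - t - h) (cal (wc t) (J x))" using h by (intro vn_mono[OF vn_wc[OF v t]]) simp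
  ultimately show "vn c (\<rho> - t - h) ((1 / h) *\<^sub>R (cal (wc (t + h)) (J x) - cal (wc t) (J x)))" by (intro vn_scaleR vn_diff)
qed

definition pvn :: "real^'d \<Rightarrow> real \<Rightarrow> 'd l2 \<times> 'd l2 \<Rightarrow> bool" where
  "pvn c \<rho> z \<longleftrightarrow> vn c \<rho> (J (fst z)) \<and> vn c \<rho> (snd z)"

text \<open>Time reversal only flips the signs of \<open>ws\<close> and \<open>wb\<close>, so
  negative times reduce to positive ones.\<close>

lemma pvn_wgrp:
  assumes z: "pvn c \<rho> z" shows "pvn c (\<rho> - \<bar>t\<bar>) (wgrp t z)"
proof (cases "t \<ge> 0")
  case True
  then show ?thesis using z unfolding pvn_def J_wgrp
    by (auto simp: wgrp_def intro!: vn_add vn_ws vn_wc vn_wb)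
next
  case False
  define s where "s = - t"
  have s: "s \<ge> 0" "t = - s" "\<bar>t\<bar> = s" using False by (auto simp: s_def)
  have e: "ws (- s) = (\<lambda>n. - ws s n)" "wc (- s) = wc s" "wb (- s) = (\<lambda>n. - wb s n)" by (auto simp: w_minus)
  show ?thesis using z s(1) unfolding pvn_def J_wgrp s(3) unfolding s(2)
    by (auto simp: wgrp_def e cal_uminus intro!: vn_diff vn_ws vn_wc vn_wb)
qed

text \<open>The maps \<open>P t\<close> cut out the states vanishing on the ball of radius \<rho> -
  |t|. Free evolution and multiplication by \<open>q\<close> respect this shrinking family, so a
  solution exists inside it, and uniqueness makes it \<open>Phi\<close>.\<close>

lemma pvn_Phi:
  assumes q: "bmp q" and z: "pvn c \<rho> z" shows "pvn c (\<rho> - \<bar>t\<bar>) (Phi q t z)"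
proof -
  define P :: "real \<Rightarrow> 'd l2 \<times> 'd l2 \<Rightarrow> 'd l2 \<times> 'd l2" where
    "P t y = (mult (chi c (\<rho> - \<bar>t\<bar>)) (J (fst y)), mult (chi c (\<rho> - \<bar>t\<bar>)) (snd y))" for t y
  have P: "P t y = 0 \<longleftrightarrow> pvn c (\<rho> - \<bar>t\<bar>) y" for t y
    by (simp add: P_def pvn_def vn_chi zero_prod_def)
  obtain K where K: "\<And>x. \<bar>q x\<bar> \<le> K" using q by (auto simp: bmp_def)
  interpret evo_pert "wgrp :: real \<Rightarrow> 'd l2 \<times> 'd l2 \<Rightarrow> _" 5 "Lq q" K by (rule evo_pert_Lq[OF q K])
  obtain U where U: "mildsol z U" "\<And>t. P t (U t) = 0"
  proof (rule mildsol_exists[of P z])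
    show "bounded_linear (P t)" for t unfolding P_def[abs_def]
      by (intro bounded_linear_Pair bounded_linear_compose[OF bounded_linear_mult[OF bmp_chi]]
        bounded_linear_compose[OF bounded_linear_J] bounded_linear_fst bounded_linear_snd)
    show "P t (wgrp t z) = 0" for t unfolding P by (rule pvn_wgrp[OF z])
    show "P t (wgrp (t * (1 - \<sigma>)) (Lq q y)) = 0" if s: "\<sigma> \<in> {0..1}" and y: "P (t * \<sigma>) y = 0" for t \<sigma> y
    proof -
      have "pvn c (\<rho> - \<bar>t * \<sigma>\<bar>) (Lq q y)"
        using y unfolding P by (auto simp: pvn_def Lq_def vn_0 intro: vn_mult[OF q])
      from pvn_wgrp[OF this, of "t * (1 - \<sigma>)"]
      have "pvn c (\<rho> - \<bar>t * \<sigma>\<bar> - \<bar>t * (1 - \<sigma>)\<bar>) (wgrp (t * (1 - \<sigma>)) (Lq q y))" .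
      moreover have "\<bar>t * \<sigma>\<bar> + \<bar>t * (1 - \<sigma>)\<bar> = \<bar>t\<bar>"
        using s by (simp add: abs_mult) (simp add: algebra_simps)
      ultimately show ?thesis unfolding P by (simp add: algebra_simps)
    qed
  qed blast
  have "wsol q z U" using U(1) unfolding wsol_def mildsol_def .
  then have "U t = Phi q t z" by (rule Phi_eqI[OF q])
  then show ?thesis using U(2)[of t] P by simp
qed

end

section \<open>Piecewise constant controls in the coordinates (v, y)\<close>

lemma trigpoly_potential: "trigpoly (potential u :: real^'d::finite \<Rightarrow> real)"
proof -
  have s: "trigpoly (\<lambda>x::real^'d. sin (x $ j))" and c: "trigpoly (\<lambda>x::real^'d. cos (x $ j))" for j
    using trigpoly.sin[OF lattice_axis[of j]] trigpoly.cos[OF lattice_axis[of j]] by (simp_all add: inner_axis')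
  have "trigpoly (\<lambda>x::real^'d. fst u + 1 * (\<Sum>j\<in>UNIV. fst (snd u) $ j * sin (x $ j) + snd (snd u) $ j * cos (x $ j)))"
    by (intro trigpoly.add trigpoly.scale trigpoly_const trigpoly_sum s c) simp
  then show ?thesis by (simp add: potential_def[abs_def])
qed

text \<open>The constant control absorbs the mass term, so the perturbation of the wave group is
  the potential minus one.\<close>
fun zflow :: "(real \<times> ('d::finite) ctrl) list \<Rightarrow> 'd l2 \<times> 'd l2 \<Rightarrow> 'd l2 \<times> 'd l2" where
  "zflow [] z = z"
| "zflow (pc # ps) z = zflow ps (Phi (\<lambda>x. potential (snd pc) x - 1) (fst pc) z)"

lemma bmp_potential: "bmp (\<lambda>x. potential u x - 1 :: real)"
  by (intro bmp_minus_1 bmp_trigpoly trigpoly_potential)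

lemma flow_st: "st W z \<Longrightarrow> st (flow ps W) (zflow ps z)"
proof (induction ps arbitrary: W z)
  case (Cons pc ps)
  show ?case
    using Cons.IH[OF expAL_st[OF bmp_trigpoly[OF trigpoly_potential] Cons.prems]] by simp
qed simp

lemma pvn_zflow:
  fixes c :: "real^'d::finite"
  assumes dim: "CARD('d) = 1 \<or> CARD('d) = 2"
  shows "(\<forall>pc\<in>set ps. fst pc \<ge> 0) \<Longrightarrow> pvn c \<rho> z \<Longrightarrow> pvn c (\<rho> - sum_list (map fst ps)) (zflow ps z)"
proof (induction ps arbitrary: z \<rho>)
  case (Cons pc ps)
  have "pvn c (\<rho> - \<bar>fst pc\<bar>) (Phi (\<lambda>x. potential (snd pc) x - 1) (fst pc) z)"
    by (rule pvn_Phi[OF dim bmp_potential Cons.prems(2)])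
  then have "pvn c (\<rho> - \<bar>fst pc\<bar> - sum_list (map fst ps)) (zflow ps (Phi (\<lambda>x. potential (snd pc) x - 1) (fst pc) z))"
    by (rule Cons.IH[rotated]) (use Cons.prems(1) in auto)
  then show ?case using Cons.prems(1) by (simp add: algebra_simps)
qed simp

text \<open>The constant velocity 1 is an unreachable target as long as every reachable state still
  vanishes on a ball of fixed radius.\<close>

theorem controllable_lower_bound:
  fixes W0 :: "'d::finite state"
  assumes dim: "CARD('d) = 1 \<or> CARD('d) = 2" and H: "W0 \<in> Hsp"
    and T: "approx_controllable W0 T"
    and van: "AE x in lebesgue. x \<in> ball c \<rho> \<longrightarrow> fst W0 x = 0 \<and> snd W0 x = 0"
  shows "\<rho> \<le> T"
proof (rule ccontr)
  assume "\<not> \<rho> \<le> T"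
  \<comment> \<open>Half of the gap: an overshoot of at most \<eta> in time leaves a ball of radius
    \<eta> on which the state still vanishes.\<close>
  define \<eta> where "\<eta> = (\<rho> - T) / 2"
  have e: "\<eta> > 0" using \<open>\<not> \<rho> \<le> T\<close> by (simp add: \<eta>_def)
  define one :: "'d l2" where "one = cls (\<lambda>x. 1)"
  have "\<not> vn c \<eta> one"
  proof
    assume "vn c \<eta> one"
    then have "negligible (ball c \<eta>)"
      by (simp add: one_def vn_cls[OF L2_const] vanish_def AE_lebesgue_iff ball_def)
    then show False using e open_not_negligible[of "ball c \<eta>"] by auto
  qed
  then have k: "norm (mult (chi c \<eta>) one) > 0" by (simp add: vn_chi)
  obtain z where z: "st W0 z" by (rule Hsp_st[OF H])
  have W: "L2 (fst W0)" "L2 (snd W0)" "cls (fst W0) = J (fst z)" "cls (snd W0) = snd z" using z by (auto simp: st_def)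
  have "pvn c \<rho> z"
    unfolding pvn_def[OF dim] W(3,4)[symmetric] vn_cls[OF W(1)] vn_cls[OF W(2)] vanish_def
    using van by (auto elim: eventually_mono)
  define V :: "'d state" where "V = ((\<lambda>x. 0), (\<lambda>x. 1))"
  have V: "st V (0, one)" by (simp add: V_def st_def L2_const one_def)
  \<comment> \<open>Bounds the overshoot and the error at once; the error is at least the norm of
    the target on the ball, which gives the contradiction.\<close>
  define \<epsilon> where "\<epsilon> = min \<eta> (norm (mult (chi c \<eta>) one))"
  have "\<epsilon> > 0" using e k by (simp add: \<epsilon>_def)
  moreover have "approx_reachable W0 T V" using T st_Hsp[OF V] by (simp add: approx_controllable_def)
  ultimately obtain T1 ps where p: "T1 \<le> T + \<epsilon>" "\<forall>pc\<in>set ps. fst pc \<ge> 0" "sum_list (map fst ps) = T1"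
      "Hnorm (Hdiff (flow ps W0) V) < \<epsilon>"
    unfolding approx_reachable_def by blast
  let ?y = "zflow ps z"
  have "pvn c (\<rho> - T1) ?y" using pvn_zflow[OF dim p(2) \<open>pvn c \<rho> z\<close>] p(3) by simp
  then have "vn c (\<rho> - T1) (snd ?y)" by (simp add: pvn_def[OF dim])
  moreover have "\<eta> \<le> \<rho> - T1" proof -
    have "\<epsilon> \<le> \<eta>" by (simp add: \<epsilon>_def)
    moreover have "2 * \<eta> = \<rho> - T" by (simp add: \<eta>_def)
    ultimately show ?thesis using p(1) by linarith
  qed
  ultimately have y: "mult (chi c \<eta>) (snd ?y) = 0" using vn_mono vn_chi by blast
  have "norm (mult (chi c \<eta>) one) = norm (mult (chi c \<eta>) (one - snd ?y))"
    by (simp add: linear_diff[OF linear_mult[OF bmp_chi]] y)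
  also have "\<dots> \<le> 1 * norm (one - snd ?y)" by (rule mult_norm_le[OF bmp_chi]) (simp add: chi_def)
  also have "\<dots> \<le> norm (?y - (0, one))"
    using norm_snd_le[of "snd (?y - (0, one))" "fst (?y - (0, one))"] unfolding prod.collapse
    by (simp only: mult_1 snd_diff snd_conv norm_minus_commute[of one])
  also have "\<dots> < \<epsilon>" using p(4) Hnorm_st[OF st_Hdiff[OF flow_st[OF z] V]] by simp
  finally show False by (simp add: \<epsilon>_def)
qed

section \<open>Approximate reachability\<close>

text \<open>Time is controlled only up to an error of either sign, so that the relation survives
  limits; \<open>approx_controllableI\<close> recovers durations of at least T by aiming slightly
  later.\<close>

definition areach :: "real \<Rightarrow> 'd::finite l2 \<times> 'd l2 \<Rightarrow> 'd l2 \<times> 'd l2 \<Rightarrow> bool" where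
  "areach \<tau> x y \<longleftrightarrow> (\<forall>\<epsilon>>0. \<exists>ps. (\<forall>pc\<in>set ps. fst pc \<ge> 0) \<and> \<bar>sum_list (map fst ps) - \<tau>\<bar> < \<epsilon>
     \<and> norm (zflow ps x - y) < \<epsilon>)"

lemma zflow_append: "zflow (ps @ qs) z = zflow qs (zflow ps z)"
  by (induction ps arbitrary: z) auto

lemma bounded_linear_zflow: "bounded_linear (zflow ps)"
proof (induction ps)
  case Nil
  have "zflow [] = (\<lambda>z. z)" by (rule ext) simp
  then show ?case by (simp add: bounded_linear_ident)
next
  case (Cons pc ps)
  have "zflow (pc # ps) = (\<lambda>z. zflow ps (Phi (\<lambda>x. potential (snd pc) x - 1) (fst pc) z))" by (rule ext) simp
  then show ?case
    by (simp only: bounded_linear_compose[OF Cons.IH bounded_linear_Phi[OF bmp_potential]])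
qed

lemma areach_step: "t \<ge> 0 \<Longrightarrow> areach t x (Phi (\<lambda>x. potential u x - 1) t x)"
  unfolding areach_def by (auto intro!: exI[of _ "[(t, u)]"])

lemma areach_trans:
  assumes xy: "areach a x y" and yz: "areach b y z" shows "areach (a + b) x z"
  unfolding areach_def
proof (intro allI impI)
  fix \<epsilon> :: real assume e: "\<epsilon> > 0"
  then obtain qs where q: "\<forall>pc\<in>set qs. fst pc \<ge> 0" "\<bar>sum_list (map fst qs) - b\<bar> < \<epsilon> / 2" "norm (zflow qs y - z) < \<epsilon> / 2"
    using yz unfolding areach_def by (metis half_gt_zero)
  obtain K where K: "K > 0" "\<And>u. norm (zflow qs u) \<le> norm u * K"
    using bounded_linear.pos_bounded[OF bounded_linear_zflow[of qs]] by blast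
  \<comment> \<open>The second control list is already fixed, so its operator bound \<open>K\<close>
    dictates the accuracy required of the first.\<close>
  define \<delta> where "\<delta> = min (\<epsilon> / 2) (\<epsilon> / (2 * K))"
  have "\<delta> > 0" using e K(1) by (simp add: \<delta>_def)
  then obtain ps where p: "\<forall>pc\<in>set ps. fst pc \<ge> 0" "\<bar>sum_list (map fst ps) - a\<bar> < \<delta>" "norm (zflow ps x - y) < \<delta>"
    using xy unfolding areach_def by blast
  have "norm (zflow (ps @ qs) x - z) = norm (zflow qs (zflow ps x - y) + (zflow qs y - z))"
    by (simp add: zflow_append linear_diff[OF bounded_linear.linear[OF bounded_linear_zflow]])
  also have "\<dots> \<le> norm (zflow ps x - y) * K + norm (zflow qs y - z)"
    by (rule norm_triangle_le[OF add_mono[OF K(2) order_refl]])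
  also have "\<dots> < \<delta> * K + \<epsilon> / 2" using p(3) q(3) K(1) by (intro add_strict_mono mult_strict_right_mono)
  also have "\<dots> \<le> \<epsilon> / (2 * K) * K + \<epsilon> / 2" using K(1) by (intro add_mono mult_right_mono) (auto simp: \<delta>_def)
  also have "\<dots> = \<epsilon>" using K(1) by simp
  finally have "norm (zflow (ps @ qs) x - z) < \<epsilon>" .
  moreover have "\<delta> \<le> \<epsilon> / 2" by (simp add: \<delta>_def)
  then have "\<bar>sum_list (map fst (ps @ qs)) - (a + b)\<bar> < \<epsilon>"
    unfolding map_append sum_list_append using p(2) q(2) by linarith
  moreover have "\<forall>pc\<in>set (ps @ qs). fst pc \<ge> 0" using p(1) q(1) by auto
  ultimately show "\<exists>ps. (\<forall>pc\<in>set ps. fst pc \<ge> 0) \<and> \<bar>sum_list (map fst ps) - (a + b)\<bar> < \<epsilon> \<and> norm (zflow ps x - z) < \<epsilon>"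
    by blast
qed

lemma areach_trans0: "areach a x y \<Longrightarrow> areach 0 y z \<Longrightarrow> areach a x z"
  using areach_trans[of a x y 0 z] by simp

lemma areach_0trans: "areach 0 x y \<Longrightarrow> areach b y z \<Longrightarrow> areach b x z"
  using areach_trans[of 0 x y b z] by simp

lemma areach_limit:
  fixes f :: "'b \<Rightarrow> 'd::finite l2 \<times> 'd l2"
  assumes F: "F \<noteq> bot" and ev: "\<forall>\<^sub>F h in F. areach (\<tau> h) x (f h)"
    and t: "(\<tau> \<longlongrightarrow> a) F" and f: "(f \<longlongrightarrow> y) F"
  shows "areach a x y"
  unfolding areach_def
proof (intro allI impI)
  fix \<epsilon> :: real assume e: "\<epsilon> > 0"
  then have e2: "\<epsilon> / 2 > 0" by simp
  have "\<forall>\<^sub>F h in F. areach (\<tau> h) x (f h) \<and> dist (\<tau> h) a < \<epsilon> / 2 \<and> dist (f h) y < \<epsilon> / 2"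
    using ev tendstoD[OF t e2] tendstoD[OF f e2] by eventually_elim simp
  then obtain h where h: "areach (\<tau> h) x (f h)" "dist (\<tau> h) a < \<epsilon> / 2" "dist (f h) y < \<epsilon> / 2"
    using eventually_happens'[OF F] by blast
  obtain ps where p: "\<forall>pc\<in>set ps. fst pc \<ge> 0" "\<bar>sum_list (map fst ps) - \<tau> h\<bar> < \<epsilon> / 2" "norm (zflow ps x - f h) < \<epsilon> / 2"
    using h(1) e2 unfolding areach_def by blast
  have "\<bar>sum_list (map fst ps) - a\<bar> < \<epsilon>" using p(2) h(2) unfolding dist_real_def by linarith
  moreover have "norm (zflow ps x - y) < \<epsilon>"
    using norm_triangle_ineq[of "zflow ps x - f h" "f h - y"] p(3) h(3) unfolding dist_norm by simp
  ultimately show "\<exists>ps. (\<forall>pc\<in>set ps. fst pc \<ge> 0) \<and> \<bar>sum_list (map fst ps) - a\<bar> < \<epsilon> \<and> norm (zflow ps x - y) < \<epsilon>"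
    using p(1) by blast
qed

lemma areach_limit_0:
  assumes "\<And>h. h > 0 \<Longrightarrow> areach h x (f h)" and "(f \<longlongrightarrow> y) (at_right 0)"
  shows "areach 0 x y"
proof (rule areach_limit[where F="at_right 0" and \<tau>="\<lambda>h. h" and f=f])
  show "\<forall>\<^sub>F h in at_right 0. areach h x (f h)"
    using eventually_at_right_less[of 0] assms(1) by (auto elim: eventually_mono)
qed (use assms(2) in \<open>auto intro: tendsto_ident_at\<close>)

lemma Phi_0: "Phi (\<lambda>x. 0) t z = wgrp t z"
proof -
  have "Lq (\<lambda>x. 0) = (\<lambda>z :: 'a l2 \<times> 'a l2. 0)" by (auto simp: Lq_def fun_eq_iff zero_prod_def)
  then have "duh wgrp (Lq (\<lambda>x. 0)) (\<lambda>t. wgrp t z) t = 0" for t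
    by (simp add: duh_def linear_0[OF bounded_linear.linear[OF wave.G_bl]])
  then have "wsol (\<lambda>x. 0) z (\<lambda>t. wgrp t z)" by (simp add: wsol_def wave.G_cont1)
  from Phi_eqI[OF bmp_const this, of t] show ?thesis by simp
qed

lemma areach_wgrp: assumes "t \<ge> 0" shows "areach t x (wgrp t x)"
proof -
  have "(\<lambda>x. potential (1, 0, 0) x - 1) = (\<lambda>x :: real^'a. 0)" by (simp add: potential_def fun_eq_iff)
  then show ?thesis using areach_step[OF assms, of x "(1, 0, 0)"] by (simp add: Phi_0)
qed

section \<open>Impulsive controls\<close>

text \<open>Comparison of the solution on [0, h] with the affine path z + (s / h) L z; since L L = 0, the path is
  exact up to the defect of the free group on short times.\<close>
lemma Phi_impulse:
  fixes z :: "'d::finite l2 \<times> 'd l2"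
  assumes q: "bmp q"
  shows "((\<lambda>h. Phi (\<lambda>x. q x / h) h z) \<longlongrightarrow> z + Lq q z) (at_right 0)"
proof -
  obtain K0 where "\<And>x. \<bar>q x\<bar> \<le> K0" using q by (auto simp: bmp_def)
  then obtain K where K: "\<And>x. \<bar>q x\<bar> \<le> K" by blast
  have K0: "K \<ge> 0" using K[of 0] by linarith
  define a where "a = Lq q z"
  have "\<forall>\<^sub>F h in at_right 0. dist (Phi (\<lambda>x. q x / h) h z) (z + a) < \<epsilon>" if e: "\<epsilon> > 0" for \<epsilon>
  proof -
    \<comment> \<open>For Kg = 5 and B = K / h the weight exponent satisfies M h = 3 h + 10 K, which
      stays bounded although M does not. The 4 comes from the factor 2 of
      \<open>volterra_bound\<close> and the two defects of size \<eta>.\<close>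
    define C where "C = 4 * exp (3 + 10 * K)"
    have C: "C > 0" by (simp add: C_def)
    define \<eta> where "\<eta> = \<epsilon> / (2 * C)"
    have eta: "\<eta> > 0" using e C by (simp add: \<eta>_def)
    have cz: "((\<lambda>r. wgrp r x) \<longlongrightarrow> x) (at 0)" for x :: "'d l2 \<times> 'd l2"
    proof -
      have "((\<lambda>r. wgrp r x) \<longlongrightarrow> wgrp 0 x) (at 0)" using wave.G_cont1[of x] by (simp add: continuous_on_def)
      then show ?thesis by (simp add: wave.G_0)
    qed
    have "\<forall>\<^sub>F r in at 0. dist (wgrp r z) z < \<eta> \<and> dist (wgrp r a) a < \<eta>"
      using tendstoD[OF cz[of z] eta] tendstoD[OF cz[of a] eta] by eventually_elim simp
    then obtain d where d: "d > 0" "\<forall>r. r \<noteq> 0 \<and> dist r 0 < d \<longrightarrow> dist (wgrp r z) z < \<eta> \<and> dist (wgrp r a) a < \<eta>"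
      by (auto simp: eventually_at)
    have small: "norm (wgrp r z - z) \<le> \<eta>" "norm (wgrp r a - a) \<le> \<eta>" if r: "\<bar>r\<bar> < d" for r
    proof -
      have "norm (wgrp r z - z) \<le> \<eta> \<and> norm (wgrp r a - a) \<le> \<eta>"
      proof (cases "r = 0")
        case True
        then show ?thesis using eta by (simp add: wave.G_0)
      next
        case False
        then show ?thesis using d(2)[rule_format, of r] r by (simp add: dist_norm)
      qed
      then show "norm (wgrp r z - z) \<le> \<eta>" "norm (wgrp r a - a) \<le> \<eta>" by blast+
    qed
    have main: "dist (Phi (\<lambda>x. q x / h) h z) (z + a) < \<epsilon>" if h: "0 < h" "h < min d 1" for h
    proof -
      let ?q = "\<lambda>x. q x / h"
      have qh: "bmp ?q" using bmp_mult[OF bmp_const[of "1 / h"] q] by simp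
      have Kh: "\<bar>?q x\<bar> \<le> K / h" for x using K[of x] h by (simp add: divide_right_mono)
      interpret evo_pert "wgrp :: real \<Rightarrow> 'd l2 \<times> 'd l2 \<Rightarrow> _" 5 "Lq ?q" "K / h" by (rule evo_pert_Lq[OF qh Kh])
      define U where "U s = Phi ?q s z" for s
      have "wsol ?q z U" unfolding U_def by (rule wsol_Phi[OF qh])
      then have U: "continuous_on UNIV U" "\<And>s. U s = wgrp s z + duh wgrp (Lq ?q) U s"
        unfolding wsol_def by blast+
      define Z where "Z s = z + (s / h) *\<^sub>R a" for s
      have Zc: "continuous_on UNIV Z" unfolding Z_def by (intro continuous_intros) (use h in auto)
      have LZ: "Lq ?q (Z s) = (1 / h) *\<^sub>R a" for s
      proof -
        have "fst (Z s) = fst z" by (simp add: Z_def a_def Lq_def)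
        moreover have "mult ?q (J (fst z)) = (1 / h) *\<^sub>R mult q (J (fst z))"
          using mult_fun_scale[OF q, of "1 / h"] by simp
        ultimately show ?thesis by (simp add: Lq_def a_def)
      qed
      define D where "D s = U s - Z s" for s
      have Dc: "continuous_on UNIV D" unfolding D_def by (intro continuous_intros U Zc)
      have dZ: "norm (duh wgrp (Lq ?q) Z s - (s / h) *\<^sub>R a) \<le> \<eta>" if s: "0 \<le> s" "s \<le> h" for s
      proof -
        have gc: "(\<lambda>\<sigma>. wgrp (s * (1 - \<sigma>)) a) integrable_on {0..1}"
          by (intro integrable_continuous_real continuous_on_compose2[OF wave.G_cont1, of _ _ a] continuous_intros) auto
        have "duh wgrp (Lq ?q) Z s = s *\<^sub>R integral {0..1} (\<lambda>\<sigma>. (1 / h) *\<^sub>R wgrp (s * (1 - \<sigma>)) a)"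
          unfolding duh_def LZ by (simp only: linear_scale[OF bounded_linear.linear[OF wave.G_bl]])
        also have "\<dots> = (s / h) *\<^sub>R integral {0..1} (\<lambda>\<sigma>. wgrp (s * (1 - \<sigma>)) a)" by simp
        finally have "duh wgrp (Lq ?q) Z s - (s / h) *\<^sub>R a = (s / h) *\<^sub>R (integral {0..1} (\<lambda>\<sigma>. wgrp (s * (1 - \<sigma>)) a) - integral {0..1::real} (\<lambda>\<sigma>. a))"
          by (simp add: scaleR_diff_right)
        also have "\<dots> = (s / h) *\<^sub>R integral {0..1} (\<lambda>\<sigma>. wgrp (s * (1 - \<sigma>)) a - a)"
          by (subst Henstock_Kurzweil_Integration.integral_diff[OF gc]) auto
        finally have e: "duh wgrp (Lq ?q) Z s - (s / h) *\<^sub>R a = (s / h) *\<^sub>R integral {0..1} (\<lambda>\<sigma>. wgrp (s * (1 - \<sigma>)) a - a)" .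
        have "norm (integral {0..1} (\<lambda>\<sigma>. wgrp (s * (1 - \<sigma>)) a - a)) \<le> \<eta> * (1 - 0)"
        proof (rule integral_bound)
          show "continuous_on {0..1} (\<lambda>\<sigma>. wgrp (s * (1 - \<sigma>)) a - a)"
            by (intro continuous_on_compose2[OF wave.G_cont1, of _ _ a] continuous_intros) auto
          fix \<sigma> :: real assume t: "\<sigma> \<in> {0..1}"
          have "s * (1 - \<sigma>) \<le> s * 1" using s t by (intro mult_left_mono) auto
          moreover have "0 \<le> s * (1 - \<sigma>)" using s t by (intro mult_nonneg_nonneg) auto
          ultimately have "\<bar>s * (1 - \<sigma>)\<bar> < d" using s h by simp
          then show "norm (wgrp (s * (1 - \<sigma>)) a - a) \<le> \<eta>" by (rule small)
        qed simp
        then have "\<bar>s / h\<bar> * norm (integral {0..1} (\<lambda>\<sigma>. wgrp (s * (1 - \<sigma>)) a - a)) \<le> 1 * \<eta>"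
          using s h by (intro mult_mono) auto
        then show ?thesis unfolding e by simp
      qed
      have est: "norm (D s) \<le> (2 * \<eta>) * exp (M * \<bar>s\<bar>) + norm (duh wgrp (Lq ?q) D s)" if s: "\<bar>s\<bar> \<le> \<bar>h\<bar>" "s * h \<ge> 0" for s
      proof -
        have s': "0 \<le> s" "s \<le> h" using s h by (auto simp: zero_le_mult_iff)
        have De: "D s = (wgrp s z - z) + (duh wgrp (Lq ?q) Z s - (s / h) *\<^sub>R a) + duh wgrp (Lq ?q) D s"
          unfolding D_def duh_diff[OF U(1) Zc] U(2)[of s] Z_def[of s] by simp
        have "norm (D s) \<le> norm (wgrp s z - z) + norm (duh wgrp (Lq ?q) Z s - (s / h) *\<^sub>R a) + norm (duh wgrp (Lq ?q) D s)"
          using arg_cong[OF De, of norm] norm_triangle_ineq[of "(wgrp s z - z) + (duh wgrp (Lq ?q) Z s - (s / h) *\<^sub>R a)" "duh wgrp (Lq ?q) D s"]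
            norm_triangle_ineq[of "wgrp s z - z" "duh wgrp (Lq ?q) Z s - (s / h) *\<^sub>R a"] by linarith
        moreover have "norm (wgrp s z - z) \<le> \<eta>" using s' h by (intro small) auto
        moreover have "2 * \<eta> * 1 \<le> 2 * \<eta> * exp (M * \<bar>s\<bar>)" using eta M_gt_1 by (intro mult_left_mono) auto
        ultimately show ?thesis using dZ[OF s'] by linarith
      qed
      have "norm (D h) \<le> 2 * (2 * \<eta>) * exp (M * \<bar>h\<bar>)"
        by (rule volterra_bound[OF Dc]) (use eta est in auto)
      also have "M * \<bar>h\<bar> = 3 * h + 10 * K" using h by (simp add: M_def field_simps)
      also have "2 * (2 * \<eta>) * exp (3 * h + 10 * K) \<le> 2 * (2 * \<eta>) * exp (3 + 10 * K)"
        using h eta by (intro mult_left_mono) auto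
      also have "\<dots> = \<epsilon> / 2" using C by (simp add: \<eta>_def C_def)
      finally have "norm (D h) < \<epsilon>" using e by simp
      then show ?thesis using h by (simp add: D_def U_def Z_def dist_norm)
    qed
    have "\<forall>\<^sub>F h in at_right 0. h \<in> {0<..<min d 1}" by (rule eventually_at_right_real) (use d in auto)
    then show ?thesis by eventually_elim (use main in auto)
  qed
  then show ?thesis unfolding a_def by (rule tendstoI)
qed

definition kick :: "(real^'d::finite \<Rightarrow> real) \<Rightarrow> bool" where
  "kick q \<longleftrightarrow> bmp q \<and> (\<forall>z. areach 0 z (z + Lq q z))"

text \<open>All real multiples are demanded: \<open>kick_square\<close> takes multiples of both
  signs as input but produces squares with a negative sign only.\<close>

definition kicks :: "(real^'d::finite \<Rightarrow> real) \<Rightarrow> bool" where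
  "kicks q \<longleftrightarrow> (\<forall>a. kick (\<lambda>x. a * q x))"

lemma kick_reach: "kick q \<Longrightarrow> areach 0 (v, y) (v, y + mult q (J v))"
  by (auto simp: kick_def Lq_def dest: spec[of _ "(v, y)"])

lemma kick_potential: "kick (potential u :: real^'d::finite \<Rightarrow> real)"
  unfolding kick_def
proof (intro conjI allI)
  show b: "bmp (potential u :: real^'d \<Rightarrow> real)" by (intro bmp_trigpoly trigpoly_potential)
  fix z :: "'d l2 \<times> 'd l2"
  show "areach 0 z (z + Lq (potential u) z)"
  proof (rule areach_limit_0[OF _ Phi_impulse[OF b]])
    fix h :: real assume h: "h > 0"
    \<comment> \<open>The summand 1 in the constant control compensates the mass; the rest is the
      impulse amplitude 1 / h.\<close>
    have "potential (1 + fst u / h, (1 / h) *\<^sub>R fst (snd u), (1 / h) *\<^sub>R snd (snd u)) x - 1 = potential u x / h" for x :: "real^'d"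
      by (simp add: potential_def add_divide_distrib sum_divide_distrib)
    then show "areach h z (Phi (\<lambda>x. potential u x / h) h z)"
      using areach_step[of h z "(1 + fst u / h, (1 / h) *\<^sub>R fst (snd u), (1 / h) *\<^sub>R snd (snd u))"] h by simp
  qed
qed

text \<open>An impulse leaves the position unchanged, so two impulses in succession add up.\<close>

lemma kick_add:
  assumes p: "kick p" and q: "kick q" shows "kick (\<lambda>x. p x + q x)"
proof -
  have b: "bmp p" "bmp q" using p q by (auto simp: kick_def)
  have bs: "bmp (\<lambda>x. p x + q x)"
  proof -
    obtain K L where *: "\<And>x. \<bar>p x\<bar> \<le> K" "\<And>x. \<bar>q x\<bar> \<le> L" using b by (auto simp: bmp_def)
    have "\<bar>p x + q x\<bar> \<le> K + L" for x using *(1)[of x] *(2)[of x] by linarith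
    then show ?thesis using b unfolding bmp_def by (auto intro: periodic_comp2 borel_measurable_add)
  qed
  have "areach 0 (v, y) (v, y + mult (\<lambda>x. p x + q x) (J v))" for v y
    using areach_trans0[OF kick_reach[OF p, of v y] kick_reach[OF q]]
    by (simp add: mult_fun_add[OF b bs] add.assoc)
  then show ?thesis using bs by (auto simp: kick_def Lq_def)
qed

lemma kicks_scale: "kicks q \<Longrightarrow> kicks (\<lambda>x. c * q x)"
  by (simp add: kicks_def mult.assoc[symmetric])

lemma kicks_add: "kicks p \<Longrightarrow> kicks q \<Longrightarrow> kicks (\<lambda>x. p x + q x)"
  unfolding kicks_def distrib_left using kick_add by blast

lemma kicks_const: "kicks (\<lambda>x. c)"
proof -
  have "kick (\<lambda>x :: real^'a. a * c)" for a
    using kick_potential[of "(a * c, 0, 0)"] by (simp add: potential_def[abs_def])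
  then show ?thesis by (simp add: kicks_def)
qed

lemma kicks_coordinate:
  fixes j :: "'d::finite"
  shows "kicks (\<lambda>x::real^'d. cos (x $ j))" "kicks (\<lambda>x::real^'d. sin (x $ j))"
proof -
  have "(\<Sum>i\<in>UNIV. a * axis j (1::real) $ i * g i) = a * g j" for a and g :: "'d \<Rightarrow> real"
  proof -
    have "(\<Sum>i\<in>UNIV. a * axis j (1::real) $ i * g i) = (\<Sum>i\<in>UNIV. if i = j then a * g i else 0)"
      by (rule sum.cong) (simp_all add: axis_def)
    also have "\<dots> = a * g j" by simp
    finally show ?thesis .
  qed
  then have "potential (0, 0, a *\<^sub>R axis j 1) = (\<lambda>x :: real^'d. a * cos (x $ j))"
    "potential (0, a *\<^sub>R axis j 1, 0) = (\<lambda>x :: real^'d. a * sin (x $ j))" for a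
    by (simp_all add: potential_def fun_eq_iff)
  then show "kicks (\<lambda>x::real^'d. cos (x $ j))" "kicks (\<lambda>x::real^'d. sin (x $ j))"
    using kick_potential[of "(0, 0, a *\<^sub>R axis j 1) :: 'd ctrl" for a] kick_potential[of "(0, a *\<^sub>R axis j 1, 0) :: 'd ctrl" for a]
    unfolding kicks_def by simp_all
qed

section \<open>Short-time asymptotics of the wave group\<close>

text \<open>Rescaled short-time evolution and its defects: for h > 0, ws = h qs, wc jsym = jsym + h
  qc and qs jsym = jsym + h qt. The factor \<open>jsym\<close> bounds the defects uniformly in n;
  they tend to 0 only for each fixed n.\<close>

definition qs :: "real \<Rightarrow> nat \<Rightarrow> real" where "qs h n = ws h n / h"
definition qc :: "real \<Rightarrow> nat \<Rightarrow> real" where "qc h n = (wc h n - 1) / h * jsym n"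
definition qt :: "real \<Rightarrow> nat \<Rightarrow> real" where "qt h n = (ws h n / h - 1) / h * jsym n"

lemma sqrt_jsym_le: "sqrt (real n) * jsym n \<le> 1" by (simp add: jsym_def)

lemma n_ws_le: "\<bar>real n * ws z n\<bar> \<le> sqrt (real n)" "\<bar>real n * ws z n\<bar> \<le> real n * \<bar>z\<bar>"
proof -
  have "\<bar>real n * ws z n\<bar> = sqrt (real n) * (sqrt (real n) * \<bar>ws z n\<bar>)"
    by (simp add: abs_mult mult.assoc[symmetric])
  also have "\<dots> \<le> sqrt (real n) * 1" by (intro mult_left_mono sqrt_ws_le) simp
  finally show "\<bar>real n * ws z n\<bar> \<le> sqrt (real n)" by simp
  show "\<bar>real n * ws z n\<bar> \<le> real n * \<bar>z\<bar>" unfolding abs_mult by (simp add: mult_left_mono ws_le)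
qed

text \<open>Two estimates from one mean value: the first becomes uniform in n after division by h
  and multiplication by \<open>jsym\<close>, the second yields decay for fixed n.
  \<open>sp.cal_tendsto\<close> asks for both.\<close>

lemma wc_minus_1_le:
  assumes h: "h > 0" shows "\<bar>wc h n - 1\<bar> \<le> h * sqrt (real n)" "\<bar>wc h n - 1\<bar> \<le> h * (real n * h)"
proof -
  obtain z where z: "0 < z" "z < h" "wc h n - wc 0 n = (h - 0) * (- (real n * ws z n))"
    using MVT2[of 0 h "\<lambda>s. wc s n" "\<lambda>s. - (real n * ws s n)"] wc_deriv h by blast
  have "wc 0 n = 1" by (simp add: wc_def)
  then have e: "\<bar>wc h n - 1\<bar> = h * \<bar>real n * ws z n\<bar>" using z(3) h by (simp add: abs_mult)
  show "\<bar>wc h n - 1\<bar> \<le> h * sqrt (real n)" unfolding e using h n_ws_le(1) by (intro mult_left_mono) auto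
  have "real n * \<bar>z\<bar> \<le> real n * h" using z by (intro mult_left_mono) auto
  then show "\<bar>wc h n - 1\<bar> \<le> h * (real n * h)" unfolding e using h n_ws_le(2)[of n z] by (intro mult_left_mono) auto
qed

lemma ws_minus_le:
  assumes h: "h > 0" shows "\<bar>ws h n - h\<bar> \<le> h * (h * sqrt (real n))" "\<bar>ws h n - h\<bar> \<le> h * (h * (real n * h))"
proof -
  have "((\<lambda>s. ws s n - s) has_real_derivative (wc s n - 1)) (at s)" for s
    by (rule DERIV_diff[OF ws_deriv DERIV_ident])
  then obtain z where z: "0 < z" "z < h" "(ws h n - h) - (ws 0 n - 0) = (h - 0) * (wc z n - 1)"
    using MVT2[of 0 h "\<lambda>s. ws s n - s" "\<lambda>s. wc s n - 1"] h by blast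
  have "ws 0 n = 0" by (simp add: ws_def)
  then have e: "\<bar>ws h n - h\<bar> = h * \<bar>wc z n - 1\<bar>" using z(3) h by (simp add: abs_mult)
  have "z * sqrt (real n) \<le> h * sqrt (real n)" using z by (intro mult_right_mono) auto
  then have "\<bar>wc z n - 1\<bar> \<le> h * sqrt (real n)" using wc_minus_1_le(1)[OF z(1), of n] by linarith
  then show "\<bar>ws h n - h\<bar> \<le> h * (h * sqrt (real n))" unfolding e using h by (intro mult_left_mono) auto
  have "z * (real n * z) \<le> h * (real n * h)" using z by (intro mult_mono) auto
  then have "\<bar>wc z n - 1\<bar> \<le> h * (real n * h)" using wc_minus_1_le(2)[OF z(1), of n] by linarith
  then show "\<bar>ws h n - h\<bar> \<le> h * (h * (real n * h))" unfolding e using h by (intro mult_left_mono) auto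
qed

lemma quotient_symbol_le:
  assumes r1: "\<bar>r\<bar> \<le> sqrt (real n)" and r2: "\<bar>r\<bar> \<le> real n * h"
  shows "\<bar>r * jsym n\<bar> \<le> 1" "\<bar>r * jsym n\<bar> \<le> real n * h"
proof -
  have "\<bar>r * jsym n\<bar> = \<bar>r\<bar> * jsym n" using jsym_pos[of n] by (simp add: abs_mult)
  moreover have "\<bar>r\<bar> * jsym n \<le> sqrt (real n) * jsym n" using r1 jsym_pos[of n] by (intro mult_right_mono) auto
  moreover have "\<bar>r\<bar> * jsym n \<le> \<bar>r\<bar> * 1" using jsym_le_1[of n] by (intro mult_left_mono) auto
  ultimately show "\<bar>r * jsym n\<bar> \<le> 1" "\<bar>r * jsym n\<bar> \<le> real n * h" using sqrt_jsym_le[of n] r2 by auto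
qed

lemma qs_le: "h > 0 \<Longrightarrow> \<bar>qs h n\<bar> \<le> 1"
  using ws_le[of h n] by (simp add: qs_def)

lemma qc_le: assumes h: "h > 0" shows "\<bar>qc h n\<bar> \<le> 1" "\<bar>qc h n\<bar> \<le> real n * h"
proof -
  have "\<bar>(wc h n - 1) / h\<bar> \<le> sqrt (real n)" "\<bar>(wc h n - 1) / h\<bar> \<le> real n * h"
    using wc_minus_1_le[OF h, of n] h by (simp_all add: field_simps)
  from quotient_symbol_le[OF this] show "\<bar>qc h n\<bar> \<le> 1" "\<bar>qc h n\<bar> \<le> real n * h" by (simp_all add: qc_def)
qed

lemma qt_le: assumes h: "h > 0" shows "\<bar>qt h n\<bar> \<le> 1" "\<bar>qt h n\<bar> \<le> real n * h"
proof -
  have "(ws h n / h - 1) / h = (ws h n - h) / (h * h)" using h by (simp add: field_simps)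
  then have "\<bar>(ws h n / h - 1) / h\<bar> \<le> sqrt (real n)" "\<bar>(ws h n / h - 1) / h\<bar> \<le> real n * h"
    using ws_minus_le[OF h, of n] h by (simp_all add: abs_divide abs_mult pos_divide_le_eq mult_ac)
  from quotient_symbol_le[OF this] show "\<bar>qt h n\<bar> \<le> 1" "\<bar>qt h n\<bar> \<le> real n * h" by (simp_all add: qt_def)
qed

lemma bdd_q: "h > 0 \<Longrightarrow> bdd_fun (qs h)" "h > 0 \<Longrightarrow> bdd_fun (qc h)" "h > 0 \<Longrightarrow> bdd_fun (qt h)"
  by (rule bdd_funI[where K=1], simp add: qs_le qc_le qt_le)+

lemma tendsto_n_h: "((\<lambda>h. real n * h) \<longlongrightarrow> 0) (at_right 0)"
  by (rule tendsto_mult_right_zero) (rule tendsto_ident_at)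

lemma eventually_pos: "(\<And>h::real. h > 0 \<Longrightarrow> P h) \<Longrightarrow> \<forall>\<^sub>F h in at_right 0. P h"
  using eventually_at_right_less[of 0] by (auto elim: eventually_mono)

lemma QS_lim: "((\<lambda>h. cal (qs h) x) \<longlongrightarrow> x) (at_right 0)"
proof -
  have "((\<lambda>h. cal (qs h) x) \<longlongrightarrow> cal (\<lambda>n. 1) x) (at_right 0)"
  proof (rule sp.cal_tendsto[where K=1])
    show "\<forall>\<^sub>F h in at_right 0. \<forall>n. \<bar>qs h n\<bar> \<le> 1" by (rule eventually_pos) (simp add: qs_le)
    show "bdd_fun (\<lambda>n. 1)" by (rule bdd_funI[of _ 1]) simp
    fix n
    have "((\<lambda>h. (ws (0 + h) n - ws 0 n) / h) \<longlongrightarrow> wc 0 n) (at_right 0)"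
      using ws_deriv[of n 0] unfolding DERIV_def by (rule filterlim_mono) (auto simp: at_le)
    then show "((\<lambda>h. qs h n) \<longlongrightarrow> 1) (at_right 0)" by (simp add: ws_def wc_def qs_def)
  qed
  then show ?thesis by simp
qed

lemma QC_lim: "((\<lambda>h. cal (qc h) x) \<longlongrightarrow> 0) (at_right 0)"
  and QT_lim: "((\<lambda>h. cal (qt h) x) \<longlongrightarrow> 0) (at_right 0)"
proof -
  have b: "bdd_fun (\<lambda>n. 0)" by (rule bdd_funI[of _ 0]) simp
  have "((\<lambda>h. cal (qc h) x) \<longlongrightarrow> cal (\<lambda>n. 0) x) (at_right 0)"
  proof (rule sp.cal_tendsto[where K=1, OF _ b])
    show "\<forall>\<^sub>F h in at_right 0. \<forall>n. \<bar>qc h n\<bar> \<le> 1" by (rule eventually_pos) (simp add: qc_le)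
    show "((\<lambda>h. qc h n) \<longlongrightarrow> 0) (at_right 0)" for n
      by (rule Lim_null_comparison[OF _ tendsto_n_h[of n]]) (rule eventually_pos, simp add: qc_le)
  qed
  then show "((\<lambda>h. cal (qc h) x) \<longlongrightarrow> 0) (at_right 0)" by simp
  have "((\<lambda>h. cal (qt h) x) \<longlongrightarrow> cal (\<lambda>n. 0) x) (at_right 0)"
  proof (rule sp.cal_tendsto[where K=1, OF _ b])
    show "\<forall>\<^sub>F h in at_right 0. \<forall>n. \<bar>qt h n\<bar> \<le> 1" by (rule eventually_pos) (simp add: qt_le)
    show "((\<lambda>h. qt h n) \<longlongrightarrow> 0) (at_right 0)" for n
      by (rule Lim_null_comparison[OF _ tendsto_n_h[of n]]) (rule eventually_pos, simp add: qt_le)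
  qed
  then show "((\<lambda>h. cal (qt h) x) \<longlongrightarrow> 0) (at_right 0)" by simp
qed

lemma w_lim_0:
  fixes x :: "'d::finite l2"
  shows "((\<lambda>h. cal (wc h) x) \<longlongrightarrow> x) (at_right 0)" "((\<lambda>h. cal (wa h) x) \<longlongrightarrow> 0) (at_right 0)"
    "((\<lambda>h. cal (wb h) x) \<longlongrightarrow> 0) (at_right 0)"
proof -
  have G: "((\<lambda>h. wgrp h z) \<longlongrightarrow> z) (at_right 0)" for z :: "'d l2 \<times> 'd l2"
  proof -
    have "((\<lambda>h. wgrp h z) \<longlongrightarrow> wgrp 0 z) (at 0)" using wave.G_cont1[of z] by (simp add: continuous_on_def)
    then have "((\<lambda>h. wgrp h z) \<longlongrightarrow> z) (at 0)" by (simp only: wave.G_0)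
    then show ?thesis by (rule filterlim_mono) (auto simp: at_le)
  qed
  show "((\<lambda>h. cal (wc h) x) \<longlongrightarrow> x) (at_right 0)" using tendsto_fst[OF G[of "(x, 0)"]] by (simp add: wgrp_def)
  show "((\<lambda>h. cal (wa h) x) \<longlongrightarrow> 0) (at_right 0)" using tendsto_fst[OF G[of "(0, x)"]] by (simp add: wgrp_def)
  show "((\<lambda>h. cal (wb h) x) \<longlongrightarrow> 0) (at_right 0)" using tendsto_snd[OF G[of "(x, 0)"]] by (simp add: wgrp_def)
qed

lemma w_q:
  fixes x :: "'d::finite l2"
  assumes h: "h > 0"
  shows "cal (ws h) x = h *\<^sub>R cal (qs h) x" "cal (wa h) (J x) = h *\<^sub>R cal (qs h) x"
    "cal (wc h) (J x) = J x + h *\<^sub>R cal (qc h) x" "cal (qs h) (J x) = J x + h *\<^sub>R cal (qt h) x"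
proof -
  have j: "jsym n \<noteq> 0" for n using jsym_pos[of n] by simp
  have e: "ws h n = h * qs h n" "wa h n * jsym n = h * qs h n" "wc h n * jsym n = jsym n + h * qc h n"
    "qs h n * jsym n = jsym n + h * qt h n" for n
    using h j[of n] by (simp_all add: qs_def qc_def qt_def wa_def) (simp_all add: algebra_simps)
  note E = sp.E_add sp.E_scale sp.E_cal[OF bdd_q(1)[OF h]] sp.E_cal[OF bdd_q(2)[OF h]] sp.E_cal[OF bdd_q(3)[OF h]] E_J
  show "cal (ws h) x = h *\<^sub>R cal (qs h) x"
    by (rule sp.cal_eqI) (simp_all add: E e(1))
  show "cal (wa h) (J x) = h *\<^sub>R cal (qs h) x"
    by (rule sp.cal_eqI) (simp_all add: E e(2))
  show "cal (wc h) (J x) = J x + h *\<^sub>R cal (qc h) x"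
    by (rule sp.cal_eqI) (simp_all add: E e(3) scaleR_add_left)
  show "cal (qs h) (J x) = J x + h *\<^sub>R cal (qt h) x"
    by (rule sp.cal_eqI) (simp_all add: E e(4) bdd_q[OF h] scaleR_add_left)
qed

lemma sqrt_lim_0: "((\<lambda>h. sqrt h) \<longlongrightarrow> 0) (at_right 0)"
  using tendsto_real_sqrt[OF tendsto_ident_at[of 0 "{0<..}"]] by simp

section \<open>Saturation of the impulsive directions\<close>

text \<open>The impulses f / sqrt h and - f / sqrt h, separated by free evolution during time h, leave the
  impulse - f * f.\<close>
lemma kick_square:
  fixes f :: "real^'d::finite \<Rightarrow> real"
  assumes T: "kicks f" and f: "trigpoly f"
  shows "kick (\<lambda>x. - (f x)\<^sup>2)"
proof -
  have b: "bmp f" by (rule bmp_trigpoly[OF f])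
  have b2: "bmp (\<lambda>x. - (f x)\<^sup>2)"
    using bmp_mult[OF bmp_const[of "- 1"] bmp_mult[OF b b]] by (simp add: power2_eq_square)
  have "areach 0 (v, y) (v, y - mult f (mult f (J v)))" for v y :: "'d l2"
  proof -
    obtain v' where v': "mult f (J v) = J v'" by (rule mult_trigpoly_J[OF f])
    \<comment> \<open>State after impulse, free evolution and opposite impulse, with the terms of
      order 1 / sqrt h already cancelled.\<close>
    define g where "g h = (cal (wc h) v + cal (wa h) y + sqrt h *\<^sub>R cal (qs h) v',
      cal (wb h) v + cal (wc h) y + sqrt h *\<^sub>R (cal (qc h) v' - mult f (cal (qc h) v)) - sqrt h *\<^sub>R mult f (cal (qs h) y)
       - mult f (cal (qs h) (J v')))" for h
    show ?thesis
    proof (rule areach_limit_0[where f=g])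
      fix h :: real assume h: "h > 0"
      \<comment> \<open>An impulse of amplitude 1 / s displaces the position by order s during time
        h; the opposite impulse of amplitude 1 / s turns this displacement into a velocity of order
        one.\<close>
      define s where "s = sqrt h"
      have s: "s > 0" and sh: "h / s = s" using h by (auto simp: s_def real_div_sqrt)
      define p where "p = cal (wc h) v + cal (wa h) (y + (1 / s) *\<^sub>R J v')"
      define r where "r = cal (wb h) v + cal (wc h) (y + (1 / s) *\<^sub>R J v')"
      have k: "kick (\<lambda>x. (1 / s) * f x)" "kick (\<lambda>x. (- 1 / s) * f x)" using T unfolding kicks_def by blast+
      have 1: "areach 0 (v, y) (v, y + (1 / s) *\<^sub>R J v')"
        using kick_reach[OF k(1), of v y] by (simp only: mult_fun_scale[OF b] v')
      have 2: "areach h (v, y + (1 / s) *\<^sub>R J v') (p, r)"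
        using areach_wgrp[of h "(v, y + (1 / s) *\<^sub>R J v')"] h by (simp add: wgrp_def p_def r_def)
      have 3: "areach 0 (p, r) (p, r + (- 1 / s) *\<^sub>R mult f (J p))"
        using kick_reach[OF k(2), of p r] by (simp only: mult_fun_scale[OF b])
      have p: "p = cal (wc h) v + cal (wa h) y + s *\<^sub>R cal (qs h) v'"
        by (simp add: p_def sp.cal_add sp.cal_scale w_q(2)[OF h] sh)
      have r: "r = cal (wb h) v + cal (wc h) y + (1 / s) *\<^sub>R J v' + s *\<^sub>R cal (qc h) v'"
        by (simp add: r_def sp.cal_add sp.cal_scale w_q(3)[OF h] scaleR_add_right sh)
      have "J p = cal (wc h) (J v) + cal (ws h) (y + (1 / s) *\<^sub>R J v')"
        using J_wgrp[of h "(v, y + (1 / s) *\<^sub>R J v')"] by (simp add: wgrp_def p_def)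
      then have Jp: "J p = J v + h *\<^sub>R cal (qc h) v + h *\<^sub>R cal (qs h) y + s *\<^sub>R cal (qs h) (J v')"
        by (simp add: w_q(1,3)[OF h] sp.cal_add bdd_q[OF h] sp.cal_scale scaleR_add_right sh)
      \<comment> \<open>The singular parts \<open>(1 / s) *\<^sub>R J v'\<close> and
        \<open>(- 1 / s) *\<^sub>R mult f (J v)\<close> cancel because
        \<open>mult f (J v) = J v'\<close>.\<close>
      have "r + (- 1 / s) *\<^sub>R mult f (J p) = snd (g h)"
        using s unfolding r Jp g_def s_def[symmetric]
        by (simp add: mult_add[OF b] mult_scaleR[OF b] v' scaleR_add_right scaleR_diff_right sh)
      then have "g h = (p, r + (- 1 / s) *\<^sub>R mult f (J p))"
        by (simp add: prod_eq_iff) (simp add: g_def p s_def)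
      then show "areach h (v, y) (g h)"
        using areach_trans0[OF areach_0trans[OF 1 2] 3] by simp
    next
      have "(g \<longlongrightarrow> (v + 0 + 0 *\<^sub>R v', 0 + y + 0 *\<^sub>R (0 - mult f 0) - 0 *\<^sub>R mult f y - mult f (J v'))) (at_right 0)"
        unfolding g_def
        by (intro tendsto_intros w_lim_0 sqrt_lim_0 QS_lim QC_lim bounded_linear.tendsto[OF bounded_linear_mult[OF b]])
      then show "(g \<longlongrightarrow> (v, y - mult f (mult f (J v)))) (at_right 0)"
        by (simp add: v')
    qed
  qed
  moreover have "mult (\<lambda>x. - (f x)\<^sup>2) z = - mult f (mult f z)" for z
    using mult_fun_scale[OF bmp_mult[OF b b], of "- 1" z] by (simp add: mult_mult[OF b b] power2_eq_square)
  ultimately show ?thesis using b2 by (auto simp: kick_def Lq_def)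
qed

lemma kick_two_squares:
  assumes "kicks f" "trigpoly f" "kicks g" "trigpoly g" and b: "b \<ge> 0"
  shows "kick (\<lambda>x. c - b * ((f x)\<^sup>2 + (g x)\<^sup>2))"
proof -
  have "kick (\<lambda>x. - (sqrt b * f x)\<^sup>2)" "kick (\<lambda>x. - (sqrt b * g x)\<^sup>2)"
    using assms by (auto intro!: kick_square kicks_scale trigpoly.scale)
  moreover have "kick (\<lambda>x. 1 * c)" using kicks_const[of c] unfolding kicks_def by blast
  ultimately have "kick (\<lambda>x. 1 * c + (- (sqrt b * f x)\<^sup>2 + - (sqrt b * g x)\<^sup>2))" by (intro kick_add)
  moreover have "1 * c + (- (sqrt b * f x)\<^sup>2 + - (sqrt b * g x)\<^sup>2) = c - b * ((f x)\<^sup>2 + (g x)\<^sup>2)" for x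
    using b by (simp add: power_mult_distrib algebra_simps)
  ultimately show ?thesis by simp
qed

text \<open>Squares can be subtracted but not added, so multiples of \<open>u\<close> of either sign
  have to be constants minus sums of squares; \<open>e2\<close> serves the nonnegative multiples and
  \<open>e1\<close> the negative ones.\<close>

lemma kicks_two_squares:
  assumes f: "kicks f1" "trigpoly f1" "kicks f2" "trigpoly f2" and g: "kicks g1" "trigpoly g1" "kicks g2" "trigpoly g2"
    and e1: "\<And>x. (f1 x)\<^sup>2 + (f2 x)\<^sup>2 = 2 + 2 * u x" and e2: "\<And>x. (g1 x)\<^sup>2 + (g2 x)\<^sup>2 = 2 - 2 * u x"
  shows "kicks u"
  unfolding kicks_def
proof
  fix a :: real
  show "kick (\<lambda>x. a * u x)"
  proof (cases "a \<ge> 0")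
    case True
    have "kick (\<lambda>x. a - a / 2 * ((g1 x)\<^sup>2 + (g2 x)\<^sup>2))" by (rule kick_two_squares[OF g]) (use True in simp)
    then show ?thesis unfolding e2 by (simp add: algebra_simps)
  next
    case False
    have "kick (\<lambda>x. - a - (- a / 2) * ((f1 x)\<^sup>2 + (f2 x)\<^sup>2))" by (rule kick_two_squares[OF f]) (use False in simp)
    then show ?thesis unfolding e1 by (simp add: algebra_simps)
  qed
qed

text \<open>Squared moduli of e^(iA) + e^(-iB), e^(iA) - e^(-iB), e^(iA) + i e^(-iB) and e^(iA) - i
  e^(-iB).\<close>

lemma trig_squares:
  fixes A B :: real
  shows "(cos A + cos B)\<^sup>2 + (sin A - sin B)\<^sup>2 = 2 + 2 * cos (A + B)"
    "(cos A - cos B)\<^sup>2 + (sin A + sin B)\<^sup>2 = 2 - 2 * cos (A + B)"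
    "(sin A + cos B)\<^sup>2 + (cos A + sin B)\<^sup>2 = 2 + 2 * sin (A + B)"
    "(sin A - cos B)\<^sup>2 + (cos A - sin B)\<^sup>2 = 2 - 2 * sin (A + B)"
  by (simp_all add: power2_sum power2_diff cos_add sin_add cos_squared_eq algebra_simps)

definition good_freq :: "real^'d::finite \<Rightarrow> bool" where
  "good_freq k \<longleftrightarrow> lattice k \<and> kicks (\<lambda>x. cos (k \<bullet> x)) \<and> kicks (\<lambda>x. sin (k \<bullet> x))"

text \<open>Sums of squares of combinations of the modes k and l are, up to constants, multiples of
  the modes of frequency k + l. Unit vectors and negation then generate the whole lattice.\<close>

lemma good_freq_add:
  assumes k: "good_freq k" and l: "good_freq l" shows "good_freq (k + l)"
proof -
  note g = k[unfolded good_freq_def] l[unfolded good_freq_def]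
  have T: "trigpoly (\<lambda>x. cos (k \<bullet> x))" "trigpoly (\<lambda>x. sin (k \<bullet> x))" "trigpoly (\<lambda>x. cos (l \<bullet> x))" "trigpoly (\<lambda>x. sin (l \<bullet> x))"
    using g by (auto intro: trigpoly.intros)
  have P: "kicks (\<lambda>x. p x + q x)" "trigpoly (\<lambda>x. p x + q x)" "kicks (\<lambda>x. p x - q x)" "trigpoly (\<lambda>x. p x - q x)"
    if "kicks p" "trigpoly p" "kicks q" "trigpoly q" for p q :: "real^'a \<Rightarrow> real"
    using kicks_add[OF that(1,3)] trigpoly.add[OF that(2,4)] kicks_add[OF that(1) kicks_scale[OF that(3), of "- 1"]]
      trigpoly.add[OF that(2) trigpoly.scale[OF that(4), of "- 1"]] by simp_all
  have "kicks (\<lambda>x. cos (k \<bullet> x + l \<bullet> x))"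
    by (rule kicks_two_squares[where ?f1.0="\<lambda>x. cos (k \<bullet> x) + cos (l \<bullet> x)" and ?f2.0="\<lambda>x. sin (k \<bullet> x) - sin (l \<bullet> x)"
        and ?g1.0="\<lambda>x. cos (k \<bullet> x) - cos (l \<bullet> x)" and ?g2.0="\<lambda>x. sin (k \<bullet> x) + sin (l \<bullet> x)"])
       (use g T in \<open>simp_all add: P trig_squares\<close>)
  moreover have "kicks (\<lambda>x. sin (k \<bullet> x + l \<bullet> x))"
    by (rule kicks_two_squares[where ?f1.0="\<lambda>x. sin (k \<bullet> x) + cos (l \<bullet> x)" and ?f2.0="\<lambda>x. cos (k \<bullet> x) + sin (l \<bullet> x)"
        and ?g1.0="\<lambda>x. sin (k \<bullet> x) - cos (l \<bullet> x)" and ?g2.0="\<lambda>x. cos (k \<bullet> x) - sin (l \<bullet> x)"])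
       (use g T in \<open>simp_all add: P trig_squares\<close>)
  ultimately show ?thesis using g by (simp add: good_freq_def lattice_add inner_add_left)
qed

lemma good_freq_0: "good_freq 0"
  by (simp add: good_freq_def kicks_const)

lemma good_freq_uminus: "good_freq k \<Longrightarrow> good_freq (- k)"
  using kicks_scale[of "\<lambda>x. sin (k \<bullet> x)" "- 1"] by (simp add: good_freq_def lattice_uminus)

lemma good_freq_axis: "good_freq (axis j 1 :: real^'d::finite)"
  using kicks_coordinate[of j] by (simp add: good_freq_def lattice_axis inner_axis')

lemma good_freq_lattice:
  fixes k :: "real^'d::finite"
  assumes k: "lattice k" shows "good_freq k"
proof -
  obtain m where m: "\<And>i. k $ i = of_int (m i)" using lattice_of_int[OF k] by blast
  have n: "good_freq (real n *\<^sub>R axis j 1 :: real^'d)" for n j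
    by (induction n) (auto simp: good_freq_0 scaleR_add_left intro: good_freq_add good_freq_axis)
  have i: "good_freq (of_int i *\<^sub>R axis j 1 :: real^'d)" for i j
  proof (cases "i \<ge> 0")
    case True
    then show ?thesis using n[of "nat i" j] by simp
  next
    case False
    then show ?thesis using good_freq_uminus[OF n[of "nat (- i)" j]] by simp
  qed
  have "good_freq (\<Sum>j\<in>S. of_int (m j) *\<^sub>R axis j 1 :: real^'d)" if "finite S" for S
    using that by (induction S rule: finite_induct) (auto simp: good_freq_0 intro: good_freq_add i)
  moreover have "k = (\<Sum>j\<in>UNIV. of_int (m j) *\<^sub>R axis j 1)"
    using basis_expansion[of k] by (simp add: m scalar_mult_eq_scaleR)
  ultimately show ?thesis by simp
qed

lemma kicks_trigpoly: "trigpoly p \<Longrightarrow> kicks p"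
  by (induction rule: trigpoly.induct)
     (use good_freq_lattice in \<open>auto simp: good_freq_def intro: kicks_add kicks_scale\<close>)

lemma kick_trigpoly: "trigpoly p \<Longrightarrow> kick p"
  using kicks_trigpoly[of p] unfolding kicks_def by (auto dest: spec[of _ 1])

lemma cls_tendsto:
  fixes f :: "nat \<Rightarrow> real^'d::finite \<Rightarrow> real"
  assumes f: "\<And>n. L2 (f n)" and g: "L2 g" and D: "L2 D"
    and dom: "\<And>n. AE x in tmeas. \<bar>f n x - g x\<bar> \<le> \<bar>D x\<bar>" and lim: "AE x in tmeas. (\<lambda>n. f n x) \<longlonglongrightarrow> g x"
  shows "(\<lambda>n. cls (f n)) \<longlonglongrightarrow> cls g"
proof -
  have fg: "L2 (\<lambda>x. f n x - g x)" for n by (rule L2_diff[OF f g])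
  have "(\<lambda>n. \<integral>x. (f n x - g x)\<^sup>2 \<partial>tmeas) \<longlonglongrightarrow> (\<integral>x. 0 \<partial>(tmeas :: (real^'d) measure))"
  proof (rule integral_dominated_convergence[where w="\<lambda>x. (D x)\<^sup>2"])
    show "(\<lambda>x. (f n x - g x)\<^sup>2) \<in> borel_measurable tmeas" for n using L2_measurable[OF fg] by simp
    show "integrable tmeas (\<lambda>x. (D x)\<^sup>2)" by (rule L2_square_integrable[OF D])
    show "AE x in tmeas. (\<lambda>n. (f n x - g x)\<^sup>2) \<longlonglongrightarrow> 0"
      using lim
    proof eventually_elim
      case (elim x)
      have "(\<lambda>n. (f n x - g x)\<^sup>2) \<longlonglongrightarrow> (g x - g x)\<^sup>2" by (intro tendsto_intros elim)
      then show ?case by simp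
    qed
    show "AE x in tmeas. norm ((f n x - g x)\<^sup>2) \<le> (D x)\<^sup>2" for n
      using dom[of n] by eventually_elim (simp add: abs_le_square_iff)
  qed simp
  then have "(\<lambda>n. (norm (cls (f n) - cls g))\<^sup>2) \<longlonglongrightarrow> 0"
    by (simp add: cls_diff[OF f g, symmetric] norm_cls[OF fg])
  then have "(\<lambda>n. sqrt ((norm (cls (f n) - cls g))\<^sup>2)) \<longlonglongrightarrow> sqrt 0" by (rule tendsto_real_sqrt)
  then show ?thesis by (simp add: tendsto_norm_zero_iff LIM_zero_iff)
qed

text \<open>Bounded a.e. approximation of \<open>q\<close> by trigonometric polynomials makes the
  products with a fixed position converge in L^2; the limit is taken separately for each
  state.\<close>

lemma kick_bmp:
  fixes q :: "real^'d::finite \<Rightarrow> real"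
  assumes q: "bmp q" shows "kick q"
proof -
  obtain M where M: "\<And>x. \<bar>q x\<bar> \<le> M" and qm: "q \<in> borel_measurable tmeas" using q by (auto simp: bmp_def)
  obtain p where p: "\<And>n::nat. trigpoly (p n)" "\<And>n x. x \<in> tcube \<Longrightarrow> \<bar>p n x\<bar> \<le> M + 1"
    "AE x in tmeas. (\<lambda>n. p n x) \<longlonglongrightarrow> q x"
    by (rule trigpoly_approx_bounded_measurable[OF qm M]) blast
  have "areach 0 (v, y) (v, y + mult q (J v))" for v y :: "'d l2"
  proof (rule areach_limit[where F=sequentially and \<tau>="\<lambda>n. 0" and f="\<lambda>n. (v, y + mult (p n) (J v))"])
    show "\<forall>\<^sub>F n in sequentially. areach 0 (v, y) (v, y + mult (p n) (J v))"
      by (intro always_eventually allI kick_reach kick_trigpoly p(1))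
    let ?w = "rep (J v)"
    have "(\<lambda>n. cls (\<lambda>x. p n x * ?w x)) \<longlonglongrightarrow> cls (\<lambda>x. q x * ?w x)"
    proof (rule cls_tendsto[where D="\<lambda>x. (2 * M + 1) * ?w x"])
      show "AE x in tmeas. \<bar>p n x * ?w x - q x * ?w x\<bar> \<le> \<bar>(2 * M + 1) * ?w x\<bar>" for n
      proof (rule AE_I2)
        fix x :: "real^'d" assume "x \<in> space tmeas"
        then have "\<bar>p n x - q x\<bar> \<le> \<bar>2 * M + 1\<bar>" using p(2)[of x n] M[of x] by auto
        then have "\<bar>p n x - q x\<bar> * \<bar>?w x\<bar> \<le> \<bar>2 * M + 1\<bar> * \<bar>?w x\<bar>" by (rule mult_right_mono) simp
        then show "\<bar>p n x * ?w x - q x * ?w x\<bar> \<le> \<bar>(2 * M + 1) * ?w x\<bar>"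
          by (simp add: abs_mult[symmetric] left_diff_distrib)
      qed
      show "AE x in tmeas. (\<lambda>n. p n x * ?w x) \<longlonglongrightarrow> q x * ?w x"
        using p(3) by eventually_elim (intro tendsto_intros)
    qed (intro L2_mult_bmp bmp_trigpoly p(1) q L2_scale L2_rep)+
    then show "(\<lambda>n. (v, y + mult (p n) (J v))) \<longlonglongrightarrow> (v, y + mult q (J v))"
      unfolding mult_def by (intro tendsto_intros)
  qed auto
  then show ?thesis using q by (auto simp: kick_def Lq_def)
qed

text \<open>The ideal multiplier (y' - y) / w is unbounded, so bounded truncations are used; their
  products with w converge to y' - y in L^2, the error being dominated by |y' - y|.\<close>

lemma reach_velocity:
  fixes v y y' :: "'d::finite l2"
  assumes z: "AE x in tmeas. rep (J v) x = 0 \<longrightarrow> rep y x = rep y' x"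
  shows "areach 0 (v, y) (v, y')"
proof -
  let ?k = "rep (J v)" and ?g = "rep (y' - y)"
  \<comment> \<open>The truncation bounds the multiplier by n; at zeros of the position its value is
    0.\<close>
  define q where "q n x = (if \<bar>?g x\<bar> \<le> real n * \<bar>?k x\<bar> then ?g x / ?k x else 0)" for n x
  have km: "?k \<in> borel_measurable tmeas" and gm: "?g \<in> borel_measurable tmeas" by (rule L2_measurable[OF L2_rep])+
  have qb: "bmp (q n)" for n
    unfolding bmp_def
  proof (intro conjI exI[of _ "real n"] allI)
    show "periodic_fun (q n)" unfolding q_def
      by (rule periodic_comp2[where g="\<lambda>a b. if \<bar>a\<bar> \<le> real n * \<bar>b\<bar> then a / b else 0", OF L2_periodic[OF L2_rep] L2_periodic[OF L2_rep]])
    show "q n \<in> borel_measurable tmeas" unfolding q_def using km gm by measurable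
    show "\<bar>q n x\<bar> \<le> real n" for x
      by (cases "?k x = 0") (auto simp: q_def abs_divide pos_divide_le_eq)
  qed
  have "AE x in tmeas. ?g x = rep (1 *\<^sub>R y' + (- 1) *\<^sub>R y) x" by simp
  then have g0: "AE x in tmeas. ?k x = 0 \<longrightarrow> ?g x = 0"
    using z rep_add[of "1 *\<^sub>R y'" "(- 1) *\<^sub>R y"] rep_scaleR[of "- 1" y] by eventually_elim simp
  have "(\<lambda>n. cls (\<lambda>x. q n x * ?k x)) \<longlonglongrightarrow> cls ?g"
  proof (rule cls_tendsto[where D="?g"])
    show "AE x in tmeas. \<bar>q n x * ?k x - ?g x\<bar> \<le> \<bar>?g x\<bar>" for n
      by (rule AE_I2) (auto simp: q_def)
    show "AE x in tmeas. (\<lambda>n. q n x * ?k x) \<longlonglongrightarrow> ?g x"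
      using g0
    proof eventually_elim
      case (elim x)
      show ?case
      proof (cases "?k x = 0")
        case True
        then show ?thesis using elim by simp
      next
        case False
        obtain N :: nat where N: "\<bar>?g x\<bar> / \<bar>?k x\<bar> \<le> real N" using real_arch_simple by blast
        have "q n x * ?k x = ?g x" if "n \<ge> N" for n
        proof -
          have "\<bar>?g x\<bar> / \<bar>?k x\<bar> \<le> real n" using N that by simp
          then have "\<bar>?g x\<bar> \<le> real n * \<bar>?k x\<bar>" using False by (simp add: pos_divide_le_eq)
          then show ?thesis using False by (simp add: q_def)
        qed
        then show ?thesis by (intro tendsto_eventually eventually_sequentiallyI[of N])
      qed
    qed
  qed (intro L2_mult_bmp qb L2_rep)+
  then have "(\<lambda>n. (v, y + mult (q n) (J v))) \<longlonglongrightarrow> (v, y + (y' - y))"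
    unfolding mult_def cls_rep by (intro tendsto_intros)
  then have l: "(\<lambda>n. (v, y + mult (q n) (J v))) \<longlonglongrightarrow> (v, y')" by simp
  show ?thesis
    by (rule areach_limit[where F=sequentially and \<tau>="\<lambda>n. 0", OF _ _ _ l])
       (auto intro!: always_eventually kick_reach kick_bmp qb)
qed

section \<open>Scaling and shear\<close>

lemma kick_const: "kick (\<lambda>x. c)"
  using kicks_const[of c] unfolding kicks_def by (auto dest: spec[of _ 1])

text \<open>The impulse s / h followed by free evolution during time h moves v to (1 + s) v and
  leaves the velocity y + (s / h) J v. The second impulse -\<sigma> / h acts on the new position:
  \<sigma> (1 + s) = s makes it cancel the singular velocity, and its action on the displacement h y
  leaves (1 - \<sigma>) y = y / (1 + s).\<close>

lemma areach_scale:
  fixes v y :: "'d::finite l2"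
  assumes s: "s > - 1"
  shows "areach 0 (v, y) ((1 + s) *\<^sub>R v, (1 / (1 + s)) *\<^sub>R y)"
proof -
  define \<sigma> where "\<sigma> = s / (1 + s)"
  have sg: "\<sigma> * (1 + s) = s" "1 - \<sigma> = 1 / (1 + s)" using s by (simp_all add: \<sigma>_def field_simps)
  define g where "g h = (cal (wc h) v + cal (wa h) y + s *\<^sub>R cal (qs h) v,
     cal (wb h) v + cal (wc h) y + s *\<^sub>R cal (qc h) v - \<sigma> *\<^sub>R cal (qc h) v - \<sigma> *\<^sub>R cal (qs h) y - (\<sigma> * s) *\<^sub>R cal (qt h) v)" for h
  have "areach 0 (v, y) (v + 0 + s *\<^sub>R v, 0 + y + s *\<^sub>R 0 - \<sigma> *\<^sub>R 0 - \<sigma> *\<^sub>R y - (\<sigma> * s) *\<^sub>R 0)"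
  proof (rule areach_limit_0[where f=g])
    fix h :: real assume h: "h > 0"
    define p where "p = cal (wc h) v + cal (wa h) (y + (s / h) *\<^sub>R J v)"
    define r where "r = cal (wb h) v + cal (wc h) (y + (s / h) *\<^sub>R J v)"
    have 1: "areach 0 (v, y) (v, y + (s / h) *\<^sub>R J v)" using kick_reach[OF kick_const, of v y "s / h"] by simp
    have 2: "areach h (v, y + (s / h) *\<^sub>R J v) (p, r)"
      using areach_wgrp[of h "(v, y + (s / h) *\<^sub>R J v)"] h by (simp add: wgrp_def p_def r_def)
    have 3: "areach 0 (p, r) (p, r + (- \<sigma> / h) *\<^sub>R J p)" using kick_reach[OF kick_const, of p r "- \<sigma> / h"] by simp
    have p: "p = cal (wc h) v + cal (wa h) y + s *\<^sub>R cal (qs h) v"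
      using h by (simp add: p_def sp.cal_add sp.cal_scale w_q(2)[OF h])
    have r: "r = cal (wb h) v + cal (wc h) y + (s / h) *\<^sub>R J v + s *\<^sub>R cal (qc h) v"
      using h by (simp add: r_def sp.cal_add sp.cal_scale w_q(3)[OF h] scaleR_add_right)
    have "J p = cal (wc h) (J v) + cal (ws h) (y + (s / h) *\<^sub>R J v)"
      using J_wgrp[of h "(v, y + (s / h) *\<^sub>R J v)"] by (simp add: wgrp_def p_def)
    then have Jp: "J p = J v + h *\<^sub>R cal (qc h) v + h *\<^sub>R cal (qs h) y + s *\<^sub>R (J v + h *\<^sub>R cal (qt h) v)"
      using h by (simp add: w_q(1,3,4)[OF h] sp.cal_add bdd_q[OF h] sp.cal_scale scaleR_add_right)
    have c: "(s / h) *\<^sub>R J v - (\<sigma> / h) *\<^sub>R J v - (\<sigma> * s / h) *\<^sub>R J v = 0"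
    proof -
      have "s / h - \<sigma> / h - \<sigma> * s / h = (s - \<sigma> * (1 + s)) / h"
        by (simp add: diff_divide_distrib add_divide_distrib distrib_left)
      then show ?thesis by (simp only: scaleR_diff_left[symmetric] sg) simp
    qed
    have "r + (- \<sigma> / h) *\<^sub>R J p = snd (g h) + ((s / h) *\<^sub>R J v - (\<sigma> / h) *\<^sub>R J v - (\<sigma> * s / h) *\<^sub>R J v)"
      using h unfolding r Jp g_def by (simp add: scaleR_add_right)
    then have "g h = (p, r + (- \<sigma> / h) *\<^sub>R J p)"
      unfolding c by (simp add: prod_eq_iff) (simp add: g_def p)
    then show "areach h (v, y) (g h)" using areach_trans0[OF areach_0trans[OF 1 2] 3] by simp
  next
    show "(g \<longlongrightarrow> (v + 0 + s *\<^sub>R v, 0 + y + s *\<^sub>R 0 - \<sigma> *\<^sub>R 0 - \<sigma> *\<^sub>R y - (\<sigma> * s) *\<^sub>R 0)) (at_right 0)"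
      unfolding g_def by (intro tendsto_intros w_lim_0 QS_lim QC_lim QT_lim)
  qed
  moreover have "y - \<sigma> *\<^sub>R y = (1 - \<sigma>) *\<^sub>R y" by (simp add: scaleR_diff_left)
  ultimately show ?thesis by (simp add: sg(2) scaleR_add_left)
qed

text \<open>Conjugating the free evolution during time h by the scaling with factor sqrt (h / b) slows the
  propagation down but keeps the displacement b y.\<close>
lemma areach_shear:
  fixes v y :: "'d::finite l2"
  assumes b: "b > 0" shows "areach 0 (v, J y) (v + b *\<^sub>R y, J y)"
proof -
  define g where "g h = (cal (wc h) v + b *\<^sub>R cal (qs h) y, (h / b) *\<^sub>R cal (wb h) v + cal (wc h) (J y))" for h
  have "areach 0 (v, J y) (v + b *\<^sub>R y, (0 / b) *\<^sub>R 0 + J y)"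
  proof (rule areach_limit_0[where f=g])
    fix h :: real assume h: "h > 0"
    \<comment> \<open>In scaled variables the velocity is y / l and displaces the position by h y /
      l; undoing the scaling gives (h / l^2) y = b y.\<close>
    define l where "l = sqrt (h / b)"
    have l: "l > 0" "l * l = h / b" using h b by (auto simp: l_def)
    have 1: "areach 0 (v, J y) (l *\<^sub>R v, (1 / l) *\<^sub>R J y)" using areach_scale[of "l - 1" v "J y"] l by simp
    have 2: "areach h (l *\<^sub>R v, (1 / l) *\<^sub>R J y) (wgrp h (l *\<^sub>R v, (1 / l) *\<^sub>R J y))" using h by (intro areach_wgrp) simp
    define p where "p = fst (wgrp h (l *\<^sub>R v, (1 / l) *\<^sub>R J y))"
    define r where "r = snd (wgrp h (l *\<^sub>R v, (1 / l) *\<^sub>R J y))"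
    have 3: "areach 0 (p, r) ((1 / l) *\<^sub>R p, l *\<^sub>R r)" using areach_scale[of "1 / l - 1" p r] l by simp
    have i: "h / (l * l) = b" using h b by (simp add: l)
    have "(1 / l) *\<^sub>R p = fst (g h)"
      using l(1) i by (simp add: p_def g_def wgrp_def sp.cal_scale w_q(2)[OF h] scaleR_add_right)
    moreover have "l *\<^sub>R r = snd (g h)"
      using l by (simp add: r_def g_def wgrp_def sp.cal_scale scaleR_add_right)
    ultimately have "((1 / l) *\<^sub>R p, l *\<^sub>R r) = g h" by (simp add: prod_eq_iff)
    moreover have "areach h (v, J y) (p, r)" using areach_0trans[OF 1 2] by (simp add: p_def r_def)
    ultimately show "areach h (v, J y) (g h)" using areach_trans0[OF _ 3] by metis
  next
    show "(g \<longlongrightarrow> (v + b *\<^sub>R y, (0 / b) *\<^sub>R 0 + J y)) (at_right 0)"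
      unfolding g_def by (intro tendsto_intros w_lim_0 QS_lim) (use b in auto)
  qed
  then show ?thesis by simp
qed

section \<open>States with almost everywhere nonzero position\<close>

text \<open>The values c to be avoided are the atoms of the distribution of -f / s on the finite
  measure space; there are only countably many of them, so an open interval contains other
  values.\<close>

lemma generic_coefficient:
  fixes f s :: "real^'d::finite \<Rightarrow> real"
  assumes f: "f \<in> borel_measurable tmeas" and s: "s \<in> borel_measurable tmeas" and ab: "a < b"
  obtains c where "a < c" "c < b" "AE x in tmeas. s x \<noteq> 0 \<longrightarrow> f x + c * s x \<noteq> 0"
proof -
  define g where "g x = - f x / s x" for x
  have g: "g \<in> borel_measurable tmeas" unfolding g_def using f s by measurable
  interpret N: finite_measure "distr tmeas borel g"
    by (rule finite_measure.finite_measure_distr[OF finite_measure_tmeas g])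
  have "\<not> {a<..<b} \<subseteq> {x. measure (distr tmeas borel g) {x} \<noteq> 0}"
    using N.countable_support countable_subset uncountable_open_interval[of a b] ab by blast
  then obtain c where c: "a < c" "c < b" "measure (distr tmeas borel g) {c} = 0" by auto
  have "{c} \<in> null_sets (distr tmeas borel g)"
    using c(3) by (intro null_setsI) (simp_all add: N.emeasure_eq_measure)
  then have "AE z in distr tmeas borel g. z \<notin> {c}" by (rule AE_not_in)
  then have "AE x in tmeas. g x \<notin> {c}" by (subst (asm) AE_distr_iff[OF g]) auto
  then have "AE x in tmeas. s x \<noteq> 0 \<longrightarrow> f x + c * s x \<noteq> 0"
    by eventually_elim (auto simp: g_def field_simps add_eq_0_iff)
  then show ?thesis using c that by blast
qed

lemma rep_lincomb: "AE z in tmeas. rep (x + c *\<^sub>R y) z = rep x z + c * rep y z"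
  using rep_add[of x "c *\<^sub>R y"] rep_scaleR[of c y] by eventually_elim simp

definition full :: "'d::finite l2 \<Rightarrow> bool" where
  "full v \<longleftrightarrow> (AE x in tmeas. rep (J v) x \<noteq> 0)"

lemma full_reach_velocity: "full v \<Longrightarrow> areach 0 (v, y) (v, y')"
  by (rule reach_velocity) (auto simp: full_def elim: eventually_mono)

lemma J_wa: "J (cal (wa h) x) = cal (ws h) x"
  using J_wgrp[of h "(0, x)"] by (simp add: wgrp_def)

context
  assumes dim: "CARD('d::finite) = 1 \<or> CARD('d) = 2"
begin

text \<open>The velocity (1 / h) J (vf - v) moves the position by nearly vf - v during time h. A
  small spatially constant velocity with generic factor is added to make the new position nonzero
  a.e. again, so that the velocity can be reset to \<open>yf\<close>.\<close>

lemma full_reach_all: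
  fixes v :: "'d l2"
  assumes v: "full v" shows "areach 0 (v, y) (vf, yf)"
proof -
  define one :: "'d l2" where "one = cls (\<lambda>x. 1)"
  define base where "base h = cal (wc h) v + cal (qs h) (vf - v)" for h
  have "\<exists>c. \<bar>c\<bar> * norm (cal (wa h) one) \<le> h \<and> full (base h + c *\<^sub>R cal (wa h) one)" if h: "h > 0" for h
  proof -
    let ?S = "cal (ws h) one"
    have "AE x in tmeas. rep ?S x > 0"
      unfolding one_def
    proof (rule ws_positive[OF dim h L2_const])
      show "\<not> vanish (\<lambda>x. 1) c h" for c :: "real^'d"
        using h open_not_negligible[of "ball c h"] by (auto simp: vanish_def AE_lebesgue_iff ball_def[symmetric])
    qed auto
    then have S: "AE x in tmeas. rep ?S x \<noteq> 0" by eventually_elim simp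
    \<comment> \<open>A factor below \<open>B\<close> keeps the correction of the position below h
      in norm, so it disappears in the limit.\<close>
    define B where "B = h / (1 + norm (cal (wa h) one))"
    have B: "B > 0" using h by (simp add: B_def add_pos_nonneg)
    obtain c where c: "0 < c" "c < B" "AE x in tmeas. rep ?S x \<noteq> 0 \<longrightarrow> rep (J (base h)) x + c * rep ?S x \<noteq> 0"
      by (rule generic_coefficient[OF L2_measurable[OF L2_rep] L2_measurable[OF L2_rep] B])
    have "J (base h + c *\<^sub>R cal (wa h) one) = J (base h) + c *\<^sub>R ?S" by (simp add: J_add J_scale J_wa)
    moreover have "AE x in tmeas. rep (J (base h) + c *\<^sub>R ?S) x \<noteq> 0"
      using c(3) S rep_lincomb[of "J (base h)" c ?S] by eventually_elim simp
    moreover have "c * norm (cal (wa h) one) \<le> h"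
    proof -
      have "c * norm (cal (wa h) one) \<le> B * (1 + norm (cal (wa h) one))" using c B by (intro mult_mono) auto
      also have "\<dots> = h"
        using norm_ge_zero[of "cal (wa h) one"] unfolding B_def by (intro nonzero_eq_divide_eq[THEN iffD1, OF _ refl]) linarith
      finally show ?thesis .
    qed
    ultimately show ?thesis using c(1) by (intro exI[of _ c]) (simp add: full_def)
  qed
  then obtain c where c: "\<And>h. h > 0 \<Longrightarrow> \<bar>c h\<bar> * norm (cal (wa h) one) \<le> h"
    "\<And>h. h > 0 \<Longrightarrow> full (base h + c h *\<^sub>R cal (wa h) one)" by metis
  have "areach 0 (v, y) (v + (vf - v) + 0, yf)"
  proof (rule areach_limit_0[where f="\<lambda>h. (base h + c h *\<^sub>R cal (wa h) one, yf)"])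
    fix h :: real assume h: "h > 0"
    define y1 where "y1 = (1 / h) *\<^sub>R J (vf - v) + c h *\<^sub>R one"
    have 1: "areach 0 (v, y) (v, y1)" by (rule full_reach_velocity[OF v])
    have 2: "areach h (v, y1) (wgrp h (v, y1))" using h by (intro areach_wgrp) simp
    have f: "fst (wgrp h (v, y1)) = base h + c h *\<^sub>R cal (wa h) one"
      using h by (simp add: wgrp_def y1_def base_def sp.cal_add sp.cal_scale w_q(2)[OF h])
    have 3: "areach 0 (wgrp h (v, y1)) (fst (wgrp h (v, y1)), yf)"
      using full_reach_velocity[OF c(2)[OF h], of "snd (wgrp h (v, y1))" yf] unfolding f[symmetric] by simp
    show "areach h (v, y) (base h + c h *\<^sub>R cal (wa h) one, yf)"
      using areach_trans0[OF areach_0trans[OF 1 2] 3] unfolding f .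
  next
    have "((\<lambda>h. c h *\<^sub>R cal (wa h) one) \<longlongrightarrow> 0) (at_right 0)"
      by (rule Lim_null_comparison[OF eventually_pos tendsto_ident_at]) (simp add: c(1))
    then show "((\<lambda>h. (base h + c h *\<^sub>R cal (wa h) one, yf)) \<longlongrightarrow> (v + (vf - v) + 0, yf)) (at_right 0)"
      unfolding base_def by (intro tendsto_intros w_lim_0 QS_lim)
  qed
  then show ?thesis by simp
qed

lemma AE_rep_lebesgue:
  fixes x y :: "'d l2"
  assumes "AE z in tmeas. P (rep x z) (rep y z)" shows "AE z in lebesgue. P (rep x z) (rep y z)"
  by (rule AE_periodic[OF assms]) (rule periodic_comp2[where g=P, OF L2_periodic[OF L2_rep] L2_periodic[OF L2_rep]])

text \<open>As the velocity vanishes wherever the position does, it can be replaced in time 0 by c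
  times the indicator \<open>u\<close> of the nonzero set of the position. A ball of zeros of
  \<open>u\<close> would consist of common zeros, so \<open>u\<close> spreads to a positive
  function, and a generic c prevents cancellation with the evolved position.\<close>

lemma reach_full_of_zeros:
  fixes v y :: "'d l2"
  assumes t: "t > 0" and z: "AE x in tmeas. rep (J v) x = 0 \<longrightarrow> rep y x = 0"
    and nz: "\<And>c. \<not> (vn c t (J v) \<and> vn c t y)"
  shows "\<exists>v' y'. areach t (v, y) (v', y') \<and> full v'"
proof -
  define u where "u x = (if rep (J v) x \<noteq> 0 then 1 else 0 :: real)" for x
  have wm: "rep (J v) \<in> borel_measurable tmeas" by (rule L2_measurable[OF L2_rep])
  have u: "L2 u"
  proof (rule L2_bounded)
    show "periodic_fun u" unfolding u_def by (rule periodic_comp[OF L2_periodic[OF L2_rep]])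
    show "u \<in> borel_measurable tmeas" unfolding u_def using wm by measurable
    show "\<bar>u x\<bar> \<le> 1" for x by (simp add: u_def)
  qed
  have "AE x in tmeas. rep (cal (ws t) (cls u)) x > 0"
  proof (rule ws_positive[OF dim t u])
    show "AE x in tmeas. u x \<ge> 0" by (simp add: u_def)
    fix c show "\<not> vanish u c t"
    proof
      assume "vanish u c t"
      then have a: "AE x in lebesgue. x \<in> ball c t \<longrightarrow> rep (J v) x = 0"
        unfolding vanish_def by eventually_elim (auto simp: u_def split: if_splits)
      moreover have "AE x in lebesgue. x \<in> ball c t \<longrightarrow> rep y x = 0"
        using a AE_rep_lebesgue[where P="\<lambda>a b. a = 0 \<longrightarrow> b = 0", OF z] by eventually_elim auto
      ultimately show False using nz[of c] by (simp add: vn_def vanish_def)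
    qed
  qed
  then have S: "AE x in tmeas. rep (cal (ws t) (cls u)) x \<noteq> 0" by eventually_elim simp
  let ?b = "cal (wc t) (J v)" and ?S = "cal (ws t) (cls u)"
  obtain c :: real where c: "0 < c" "AE x in tmeas. rep ?S x \<noteq> 0 \<longrightarrow> rep ?b x + c * rep ?S x \<noteq> 0"
    by (rule generic_coefficient[OF L2_measurable[OF L2_rep] L2_measurable[OF L2_rep], of 0 1]) auto
  have "areach 0 (v, y) (v, c *\<^sub>R cls u)"
  proof (rule reach_velocity)
    show "AE x in tmeas. rep (J v) x = 0 \<longrightarrow> rep y x = rep (c *\<^sub>R cls u) x"
      using z rep_scaleR[of c "cls u"] rep_cls[OF u] by eventually_elim (simp add: u_def)
  qed
  moreover have "areach t (v, c *\<^sub>R cls u) (wgrp t (v, c *\<^sub>R cls u))" using t by (intro areach_wgrp) simp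
  ultimately have "areach t (v, y) (wgrp t (v, c *\<^sub>R cls u))" by (rule areach_0trans)
  moreover have "J (fst (wgrp t (v, c *\<^sub>R cls u))) = ?b + c *\<^sub>R ?S" by (simp add: J_wgrp sp.cal_scale)
  then have "full (fst (wgrp t (v, c *\<^sub>R cls u)))"
    unfolding full_def using c(2) S rep_lincomb[of ?b c ?S] by (auto elim: eventually_elim2)
  ultimately show ?thesis by (metis prod.collapse)
qed

text \<open>Having the velocity in the range of \<open>J\<close> allows the shear to add b y to v.
  For generic b the new position vanishes only where the velocity does, and a ball of zeros of both
  would also be one for the old position.\<close>

lemma reach_full_of_H1:
  fixes v y :: "'d l2"
  assumes t: "t > 0" and nz: "\<And>c. \<not> (vn c t (J v) \<and> vn c t (J y))"
  shows "\<exists>v' y'. areach t (v, J y) (v', y') \<and> full v'"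
proof -
  obtain b :: real where b: "0 < b" "AE x in tmeas. rep (J y) x \<noteq> 0 \<longrightarrow> rep (J v) x + b * rep (J y) x \<noteq> 0"
    by (rule generic_coefficient[OF L2_measurable[OF L2_rep] L2_measurable[OF L2_rep], of 0 1]) auto
  let ?v = "v + b *\<^sub>R y"
  have Jv: "J ?v = J v + b *\<^sub>R J y" by (simp add: J_add J_scale)
  have z: "AE x in tmeas. rep (J ?v) x = 0 \<longrightarrow> rep (J y) x = 0"
    unfolding Jv using b(2) rep_lincomb[of "J v" b "J y"] by eventually_elim auto
  have "\<not> (vn c t (J ?v) \<and> vn c t (J y))" for c
  proof
    assume a: "vn c t (J ?v) \<and> vn c t (J y)"
    then have "vn c t (J ?v - b *\<^sub>R J y)" by (intro vn_diff vn_scaleR) auto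
    then show False using nz[of c] a by (simp add: Jv)
  qed
  from reach_full_of_zeros[OF t z this] show ?thesis using areach_0trans[OF areach_shear[OF b(1)]] by blast
qed

text \<open>At zero position impulses have no effect, but a velocity of one sign turns into an a.e.
  nonzero position by free evolution alone; the nonpositive case follows by linearity.\<close>

lemma reach_full_of_sign:
  fixes f :: "real^'d \<Rightarrow> real"
  assumes t: "t > 0" and f: "L2 f" and sg: "(AE x in tmeas. f x \<ge> 0) \<or> (AE x in tmeas. f x \<le> 0)"
    and nz: "\<And>c. \<not> vn c t (cls f)"
  shows "\<exists>v' y'. areach t (0, cls f) (v', y') \<and> full v'"
proof -
  have nv: "\<not> vanish f c t" for c using nz[of c] by (simp add: vn_cls[OF f])
  have "AE x in tmeas. rep (cal (ws t) (cls f)) x \<noteq> 0"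
    using sg
  proof
    assume "AE x in tmeas. f x \<ge> 0"
    from ws_positive[OF dim t f this nv] show ?thesis by eventually_elim simp
  next
    assume "AE x in tmeas. f x \<le> 0"
    then have n: "AE x in tmeas. - f x \<ge> 0" by eventually_elim simp
    have "\<not> vanish (\<lambda>x. - f x) c t" for c using nv[of c] by (simp add: vanish_def)
    from ws_positive[OF dim t L2_uminus[OF f] n this]
    have p: "AE x in tmeas. rep (cal (ws t) (cls (\<lambda>x. - f x))) x > 0" .
    have "cls (\<lambda>x. - f x) = (- 1) *\<^sub>R cls f" using cls_scaleR[OF f, of "- 1"] by simp
    then have "cal (ws t) (cls (\<lambda>x. - f x)) = (- 1) *\<^sub>R cal (ws t) (cls f)" by (simp only: sp.cal_scale[OF bdd_w(2)])
    with p have "AE x in tmeas. rep ((- 1) *\<^sub>R cal (ws t) (cls f)) x > 0" by simp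
    then show ?thesis using rep_scaleR[of "- 1" "cal (ws t) (cls f)"] by eventually_elim auto
  qed
  then have "full (fst (wgrp t (0, cls f)))" by (simp add: full_def J_wgrp)
  moreover have "areach t (0, cls f) (wgrp t (0, cls f))" using t by (intro areach_wgrp) simp
  ultimately show ?thesis by (metis prod.collapse)
qed

end

text \<open>Aiming at time T + \<epsilon>/2 with tolerance \<epsilon>/2 places the actual duration
  in the interval [T, T + \<epsilon>].\<close>

lemma approx_controllableI:
  fixes W0 :: "'d::finite state"
  assumes z: "st W0 z" and r: "\<And>T' zf. T' > T \<Longrightarrow> areach T' z zf"
  shows "approx_controllable W0 T"
  unfolding approx_controllable_def approx_reachable_def
proof (intro ballI allI impI)
  fix Wf :: "'d state" and \<epsilon> :: real assume "Wf \<in> Hsp" and e: "\<epsilon> > 0"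
  obtain zf where zf: "st Wf zf" by (rule Hsp_st[OF \<open>Wf \<in> Hsp\<close>])
  have "areach (T + \<epsilon> / 2) z zf" using e by (intro r) simp
  moreover have "\<epsilon> / 2 > 0" using e by simp
  ultimately obtain ps where p: "\<forall>pc\<in>set ps. fst pc \<ge> 0" "\<bar>sum_list (map fst ps) - (T + \<epsilon> / 2)\<bar> < \<epsilon> / 2"
    "norm (zflow ps z - zf) < \<epsilon> / 2"
    unfolding areach_def by blast
  have "Hnorm (Hdiff (flow ps W0) Wf) = norm (zflow ps z - zf)"
    by (rule Hnorm_st[OF st_Hdiff[OF flow_st[OF z] zf]])
  then show "\<exists>T1 ps. T \<le> T1 \<and> T1 \<le> T + \<epsilon> \<and> (\<forall>pc\<in>set ps. fst pc \<ge> 0) \<and> sum_list (map fst ps) = T1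
      \<and> Hnorm (Hdiff (flow ps W0) Wf) < \<epsilon>"
    using p e by (intro exI[of _ "sum_list (map fst ps)"] exI[of _ ps]) (auto simp: abs_less_iff field_simps)
qed

theorem mainTheorem4:
  fixes W0 :: "'d::finite state"
  assumes dim: "CARD('d) = 1 \<or> CARD('d) = 2"
    and H: "W0 \<in> Hsp"
    and nonzero: "\<not> (AE x in tmeas. fst W0 x = 0 \<and> snd W0 x = 0)"
    and cases:
      "((AE x in tmeas. fst W0 x = 0) \<and>
          ((AE x in tmeas. snd W0 x \<ge> 0) \<or> (AE x in tmeas. snd W0 x \<le> 0)))
       \<or> ae_eq_set (Zset (\<lambda>x. fst W0 x = 0)) (Zset (\<lambda>x. fst W0 x = 0 \<and> snd W0 x = 0))
       \<or> (H1 (fst W0) \<and> H1 (snd W0))"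
  shows "Tmin W0 = rW W0"
proof (rule antisym)
  show "rW W0 \<le> Tmin W0"
    unfolding rW_def Tmin_def
    by (rule Sup_least, rule Inf_greatest) (use controllable_lower_bound[OF dim H] in auto)
  obtain v0 y0 where z: "st W0 (v0, y0)" using Hsp_st[OF H] by (metis prod.collapse)
  then have W: "L2 (fst W0)" "L2 (snd W0)" "cls (fst W0) = J v0" "cls (snd W0) = y0" by (auto simp: st_def)
  \<comment> \<open>The radius 0 is admissible because its ball is empty.\<close>
  have r0: "0 \<le> rW W0" unfolding rW_def by (rule Sup_upper) (auto intro!: exI[of _ 0])
  \<comment> \<open>A time above the radius admits no ball of that radius of common zeros; each
    hypothesis then leads to a state with a.e. nonzero position.\<close>
  have full: "\<exists>v y. areach t (v0, y0) (v, y) \<and> full v" if t: "rW W0 < ereal t" for t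
  proof -
    have t0: "t > 0" using le_less_trans[OF r0 t] by simp
    have nz: "\<not> (vn c t (J v0) \<and> vn c t y0)" for c
    proof
      assume "vn c t (J v0) \<and> vn c t y0"
      then have a: "AE x in lebesgue. x \<in> ball c t \<longrightarrow> fst W0 x = 0" "AE x in lebesgue. x \<in> ball c t \<longrightarrow> snd W0 x = 0"
        unfolding W(3,4)[symmetric] vn_cls[OF W(1)] vn_cls[OF W(2)] vanish_def by auto
      then have "AE x in lebesgue. x \<in> ball c t \<longrightarrow> fst W0 x = 0 \<and> snd W0 x = 0" by eventually_elim simp
      then have "ereal t \<le> rW W0" unfolding rW_def using t0 by (intro Sup_upper) auto
      with t show False by simp
    qed
    consider (i) "AE x in tmeas. fst W0 x = 0" "(AE x in tmeas. snd W0 x \<ge> 0) \<or> (AE x in tmeas. snd W0 x \<le> 0)"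
      | (ii) "ae_eq_set (Zset (\<lambda>x. fst W0 x = 0)) (Zset (\<lambda>x. fst W0 x = 0 \<and> snd W0 x = 0))"
      | (iii) "H1 (snd W0)"
      using cases by blast
    then show ?thesis
    proof cases
      case i
      then have "J v0 = 0" using cls_eq_0_iff[OF W(1)] W(3) by simp
      then have v0: "v0 = 0" using J_inj[of v0 0] by simp
      have "\<not> vn c t (cls (snd W0))" for c using nz[of c] by (simp add: W(4) v0 vn_0)
      from reach_full_of_sign[OF dim t0 W(2) i(2) this] show ?thesis by (simp add: W(4) v0)
    next
      case ii
      then have "AE x in lebesgue. fst W0 x = 0 \<longrightarrow> snd W0 x = 0"
        unfolding ae_eq_set_def Zset_def by eventually_elim blast
      then have "AE x in tmeas. fst W0 x = 0 \<longrightarrow> snd W0 x = 0" by (rule AE_tmeas_lebesgue)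
      then have "AE x in tmeas. rep (J v0) x = 0 \<longrightarrow> rep y0 x = 0"
        unfolding W(3,4)[symmetric] using rep_cls[OF W(1)] rep_cls[OF W(2)] by eventually_elim simp
      from reach_full_of_zeros[OF dim t0 this nz] show ?thesis .
    next
      case iii
      then obtain y where "y0 = J y" using W(4) by (auto simp: H1_iff)
      then show ?thesis using reach_full_of_H1[OF dim t0, of v0 y] nz by simp
    qed
  qed
  show "Tmin W0 \<le> rW W0"
  \<comment> \<open>Controllability is established for times strictly above the radius, which
    determines the infimum.\<close>
  proof (rule dense_ge)
    fix x assume x: "rW W0 < x"
    show "Tmin W0 \<le> x"
    proof (cases x)
      case (real T)
      have "approx_controllable W0 T"
      proof (rule approx_controllableI[OF z])
        fix T' and zf :: "'d l2 \<times> 'd l2" assume "T < T'"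
        then have "rW W0 < ereal T'" using x real by (metis ereal_less_eq(3) less_imp_le less_le_trans)
        then obtain v y where "areach T' (v0, y0) (v, y)" "full v" using full by blast
        then show "areach T' (v0, y0) zf"
          using areach_trans0[OF _ full_reach_all[OF dim]] by (metis prod.collapse)
      qed
      moreover have "T \<ge> 0" using le_less_trans[OF r0 x] real by simp
      ultimately show ?thesis unfolding Tmin_def real by (intro Inf_lower) auto
    qed (use x r0 in auto)
  qed
qed

end
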